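(* Let $X$ be any r.i. space on $(-1,1)$ such that $0<\underline{\alpha}_X\le\overline{\alpha}_X<1$, and let $T_X\colon X\to X$ be the finite Hilbert transform on $X$. (a) Let $p_X>2$ (attained or not) or let $p_X=2$ with $p_X$ not attained. Then $\sigma_{\mathrm{pt}}(T_X)=\emptyset$. (b) Let $p_X\le2$ with $p_X$ attained. Then $\sigma_{\mathrm{pt}}(T_X)=\mathcal{R}_{p_X}\setminus\{\pm1\}$. (c) Let $p_X<2$ with $p_X$ not attained. Then $\sigma_{\mathrm{pt}}(T_X)=\mathrm{int}(\mathcal{R}_{p_X})$.
   Context: The interval $(-1,1)$ carries Lebesgue measure; $L^0$ is the space of (equivalence classes of) complex-valued measurable functions on $(-1,1)$, and $L^p=L^p(-1,1)$. For $f\in L^0$, $f^*\colon[0,2]\to[0,\infty]$ denotes its decreasing rearrangement. A rearrangement invariant (r.i.) space $X$ on $(-1,1)$ is a (nonzero) Banach space $X\subseteq L^0$ such that if $g\in L^0$, $f\in X$ and $g^*\le f^*$, then $g\in X$ and $\|g\|_X\le\|f\|_X$; all r.i. spaces are assumed to satisfy the Fatou property: if $(f_n)\subseteq X$, $0\le f_n\uparrow f$ a.e. and $\sup_n\|f_n\|_X<\infty$, then $f\in X$ and $\|f_n\|_X\to\|f\|_X$. For $t>0$ the dilation operator $E_t\colon X\to X$ is $E_t(f)(s):=f(st)$ if $-1\le st\le1$ and $0$ otherwise. The lower and upper Boyd indices of $X$ are $\underline{\alpha}_X:=\sup_{0<t<1}\frac{\log\|E_{1/t}\|_{X\to X}}{\log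 t}$ and $\overline{\alpha}_X:=\inf_{1<t<\infty}\frac{\log\|E_{1/t}\|_{X\to X}}{\log t}$. The finite Hilbert transform of $f\in L^1(-1,1)$ is $(T(f))(t)=\lim_{\varepsilon\to0^+}\frac{1}{\pi i}\left(\int_{-1}^{t-\varepsilon}+\int_{t+\varepsilon}^1\right)\frac{f(x)}{x-t}\,dx$, which exists for a.e. $t\in(-1,1)$. If $0<\underline{\alpha}_X\le\overline{\alpha}_X<1$, then $T$ maps $X$ boundedly into $X$ (Boyd); this operator is denoted $T_X$. $\sigma_{\mathrm{pt}}(T_X)$ is the set of eigenvalues of $T_X$. For $1<p<\infty$, $L^{p,\infty}$ is the space of $f\in L^0$ with $f^*(t)\le M t^{-1/p}$, $0<t\le2$, for some constant $M$. The index $p_X\in(1,\infty)$ is $p_X:=\inf\{p\in(1,\infty):|x|^{-1/p}\in X\}=\inf\{p\in(1,\infty):L^{p,\infty}\subseteq X\}$. It is attained if this infimum is attained, i.e. if $L^{p_X,\infty}\subseteq X$. For $1<p<\infty$, $\mathcal{R}_p:=\{\pm1\}\cup\left\{\lambda\in\mathbb{C}:\frac1{2\pi}\left|\arg\left(\frac{1+\lambda}{1-\lambda}\right)\right|\le\left|\frac12-\frac1p\right|\right\}$, with $\arg$ the principal argument (so $|\arg|\le\pi$). $\mathrm{int}$ denotes interior in $\mathbb{C}$. *)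

theory Defs
  imports "HOL-Analysis.Analysis"
begin

text \<open>Elements of \<open>L\<^sup>0\<close> are represented by measurable functions; values outside \<open>(-1,1)\<close> are
  irrelevant, and equality of classes is equality almost everywhere.\<close>

abbreviation leb :: "real measure" where
  "leb \<equiv> lebesgue_on {-1<..<1}"

definition L0 :: "(real \<Rightarrow> complex) set" where
  "L0 = borel_measurable leb"

definition decr_rearr :: "(real \<Rightarrow> complex) \<Rightarrow> real \<Rightarrow> ennreal" where
  "decr_rearr f t =
     Inf {s :: ennreal. emeasure leb {x \<in> space leb. s < ennreal (norm (f x))} \<le> ennreal t}"

text \<open>A space is given by the set \<open>X\<close> of all representatives of its members together with a
  norm, whose values outside \<open>X\<close> play no role. That \<open>X\<close> and the norm respect almost everywhere
  equality is a consequence of \<open>rearr\<close>.\<close>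

locale ri_space =
  fixes X :: "(real \<Rightarrow> complex) set"
    and nrm :: "(real \<Rightarrow> complex) \<Rightarrow> real"
  assumes sub_L0: "X \<subseteq> L0"
    and nonzero: "\<exists>f\<in>X. \<not> (AE x in leb. f x = 0)"
    and add_mem: "\<lbrakk>f \<in> X; g \<in> X\<rbrakk> \<Longrightarrow> (\<lambda>x. f x + g x) \<in> X"
    and scale_mem: "f \<in> X \<Longrightarrow> (\<lambda>x. c * f x) \<in> X"
    and nrm_nonneg: "f \<in> X \<Longrightarrow> 0 \<le> nrm f"
    and nrm_eq_0_iff: "f \<in> X \<Longrightarrow> nrm f = 0 \<longleftrightarrow> (AE x in leb. f x = 0)"
    and nrm_triangle: "\<lbrakk>f \<in> X; g \<in> X\<rbrakk> \<Longrightarrow> nrm (\<lambda>x. f x + g x) \<le> nrm f + nrm g"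
    and nrm_scale: "f \<in> X \<Longrightarrow> nrm (\<lambda>x. c * f x) = norm c * nrm f"
    and complete:
      "\<lbrakk>\<And>n. u n \<in> X;
        \<And>e. e > 0 \<Longrightarrow> \<exists>N. \<forall>m\<ge>N. \<forall>n\<ge>N. nrm (\<lambda>x. u m x - u n x) < e\<rbrakk>
       \<Longrightarrow> \<exists>f\<in>X. (\<lambda>n. nrm (\<lambda>x. u n x - f x)) \<longlonglongrightarrow> 0"
    and rearr:
      "\<lbrakk>g \<in> L0; f \<in> X; \<And>t. t \<in> {0..2} \<Longrightarrow> decr_rearr g t \<le> decr_rearr f t\<rbrakk>
       \<Longrightarrow> g \<in> X \<and> nrm g \<le> nrm f"
    and fatou:
      "\<And>v :: nat \<Rightarrow> real \<Rightarrow> real. \<And>w :: real \<Rightarrow> real.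
       \<lbrakk>\<And>n. (\<lambda>x. complex_of_real (v n x)) \<in> X;
        (\<lambda>x. complex_of_real (w x)) \<in> L0;
        AE x in leb. (\<forall>n. 0 \<le> v n x) \<and> incseq (\<lambda>n. v n x) \<and> (\<lambda>n. v n x) \<longlonglongrightarrow> w x;
        bdd_above (range (\<lambda>n. nrm (\<lambda>x. complex_of_real (v n x))))\<rbrakk>
       \<Longrightarrow> (\<lambda>x. complex_of_real (w x)) \<in> X \<and>
           (\<lambda>n. nrm (\<lambda>x. complex_of_real (v n x))) \<longlonglongrightarrow> nrm (\<lambda>x. complex_of_real (w x))"

definition dilation :: "real \<Rightarrow> (real \<Rightarrow> complex) \<Rightarrow> (real \<Rightarrow> complex)" where
  "dilation t f = (\<lambda>s. if -1 \<le> s * t \<and> s * t \<le> 1 then f (s * t) else 0)"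

text \<open>The supremum below and those in the Boyd indices are taken in \<open>real\<close>. On an r.i. space the
  dilation with parameter \<open>1 / t\<close> is bounded with norm at most \<open>max t 1\<close> and at least \<open>min t 1\<close>,
  so the operator norm is a supremum of a bounded set and the quotients lie in \<open>[0,1]\<close>.\<close>

definition op_norm ::
    "(real \<Rightarrow> complex) set \<Rightarrow> ((real \<Rightarrow> complex) \<Rightarrow> real)
      \<Rightarrow> ((real \<Rightarrow> complex) \<Rightarrow> (real \<Rightarrow> complex)) \<Rightarrow> real" where
  "op_norm X nrm A = (SUP f\<in>{f \<in> X. nrm f \<le> 1}. nrm (A f))"

definition lower_boyd :: "(real \<Rightarrow> complex) set \<Rightarrow> ((real \<Rightarrow> complex) \<Rightarrow> real) \<Rightarrow> real" where
  "lower_boyd X nrm = (SUP t\<in>{0<..<1}. ln (op_norm X nrm (dilation (1 / t))) / ln t)"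

definition upper_boyd :: "(real \<Rightarrow> complex) set \<Rightarrow> ((real \<Rightarrow> complex) \<Rightarrow> real) \<Rightarrow> real" where
  "upper_boyd X nrm = (INF t\<in>{1<..}. ln (op_norm X nrm (dilation (1 / t))) / ln t)"

definition finite_hilbert :: "(real \<Rightarrow> complex) \<Rightarrow> (real \<Rightarrow> complex)" where
  "finite_hilbert f = (\<lambda>t. Lim (at_right 0) (\<lambda>\<epsilon>. 1 / (complex_of_real pi * \<i>) *
     ((LINT x:{-1<..<t - \<epsilon>}|lebesgue. f x / complex_of_real (x - t)) +
      (LINT x:{t + \<epsilon><..<1}|lebesgue. f x / complex_of_real (x - t)))))"

definition point_spectrum ::
    "(real \<Rightarrow> complex) set \<Rightarrow> ((real \<Rightarrow> complex) \<Rightarrow> (real \<Rightarrow> complex)) \<Rightarrow> complex set" where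
  "point_spectrum X A =
     {z. \<exists>f\<in>X. \<not> (AE x in leb. f x = 0) \<and> (AE x in leb. A f x = z * f x)}"

definition weak_Lp :: "real \<Rightarrow> (real \<Rightarrow> complex) set" where
  "weak_Lp p = {f \<in> L0. \<exists>M::real. \<forall>t\<in>{0<..2}. decr_rearr f t \<le> ennreal (M * t powr (-1 / p))}"

definition p_index :: "(real \<Rightarrow> complex) set \<Rightarrow> real" where
  "p_index X = Inf {p. 1 < p \<and> (\<lambda>x. complex_of_real (\<bar>x\<bar> powr (-1 / p))) \<in> X}"

definition p_index_attained :: "(real \<Rightarrow> complex) set \<Rightarrow> bool" where
  "p_index_attained X \<longleftrightarrow> weak_Lp (p_index X) \<subseteq> X"

definition R_set :: "real \<Rightarrow> complex set" where
  "R_set p = {1, -1} \<union>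
     {z. 1 / (2 * pi) * \<bar>Arg ((1 + z) / (1 - z))\<bar> \<le> \<bar>1 / 2 - 1 / p\<bar>}"

end

theory Submission
  imports Defs "HOL-Probability.Probability" "HOL-Complex_Analysis.Complex_Analysis" "HOL-Real_Asymp.Real_Asymp"
begin

text \<open>An r.i. space whose upper Boyd index is below 1 satisfies a weak-type estimate that places it inside
  \<open>L\<^sup>q\<close> for some \<open>1 < q < 2\<close>. Hence M. Riesz' theorem applies to its members: conjugate Poisson
  integrals converge in \<open>L\<^sup>1(-1,1)\<close> to the Hilbert transform. Put
  \<open>F s = \<integral> f x ((1 - x) / (1 + x))\<^bsup>i s\<^esup> dx\<close>. For an eigenfunction \<open>f\<close> with eigenvalue \<open>\<lambda>\<close> this pairing gives
  \<open>(cosh (\<pi> s) - \<lambda> sinh (\<pi> s)) F s = F 0\<close>. As \<open>F\<close> determines \<open>f\<close>, the eigenspace is at most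
  one-dimensional, and \<open>\<lambda> \<noteq> \<plusminus>1\<close> with \<open>w = (1 + \<lambda>) / (1 - \<lambda>)\<close> off the nonpositive reals. For such \<open>\<lambda>\<close>
  a contour computation shows that \<open>(1 - x)\<^bsup>c\<^esup> (1 + x)\<^bsup>-1-c\<^esup>\<close> with \<open>c = -1/2 + Ln w / (2 \<pi> i)\<close> solves the
  eigenvalue equation. So \<open>\<lambda>\<close> is an eigenvalue on \<open>X\<close> iff this function lies in \<open>X\<close>, which by rearrangement
  means \<open>|x|\<^bsup>-\<alpha>\<^esup> \<in> X\<close> for \<open>\<alpha> = 1/2 + |Arg w| / (2 \<pi>)\<close>; the index \<open>p_index X\<close> decides that.\<close>

section \<open>Boundary values of Poisson integrals\<close>

text \<open>Under u = ln ((1 - x) / (1 + x)) the interval becomes the line, F a Fourier transform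
  and the operator a convolution plus a rank-one term; that term is the F 0 on the right of the
  relation. It stems from Cauchy transforms of Jacobi functions whose exponents sum to 0: these are
  explicit powers only after a constant is added. Exponents summing to -1, as in the eigenfunctions,
  call for no constant. The obstacle is to integrate the eigenvalue equation against bounded
  functions. For a density merely in L^1 the principal value exists almost everywhere but may fail
  to be integrable. An integrability exponent above 1 repairs this, since conjugate Poisson
  integrals then converge in L^1, and it is kept below 2 because the inequality behind the Riesz
  bound asks for 1 < r < 2. For lambda other than 1 and -1 the symbol cosh - lambda sinh has a real
  zero exactly when w is negative, and F then vanishes off that zero. For lambda = 1 or -1 the
  relation makes F an exponential, against its boundedness. The positive lower Boyd index puts some
  |x|^(-a) with 0 < a < 1 into X, so that the infimum defining \<open>p_index X\<close> is over a
  nonempty set.\<close>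

definition lebesgue_point :: "(real \<Rightarrow> complex) \<Rightarrow> real \<Rightarrow> bool" where
  "lebesgue_point f t \<longleftrightarrow>
     (\<forall>e>0. \<exists>d0>0. \<forall>d. 0 < d \<and> d < d0 \<longrightarrow> (LBINT x:{t-d..t+d}. norm (f x - f t)) \<le> e * d)"

text \<open>The differentiation theorem \<open>integrable_ccontinuous_explicit\<close> averages over
  cubes with their lowest corner at the point. In dimension one these are the right-hand intervals;
  reflection supplies the left-hand ones.\<close>

lemma AE_right_average:
  fixes g :: "real \<Rightarrow> real"
  assumes "\<And>a b. set_integrable lborel {a..b} g"
  shows "AE t in lborel. \<forall>e>0. \<exists>d0>0. \<forall>d. 0 < d \<and> d < d0 \<longrightarrow>
           (LBINT x:{t..t+d}. g x) \<le> (g t + e) * d"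
proof -
  have int: "g integrable_on cbox a b" for a b
    using set_borel_integral_eq_integral(1)[OF assms[of a b]] by simp
  obtain N where N: "negligible N"
    "\<And>x e. \<lbrakk>x \<notin> N; 0 < e\<rbrakk> \<Longrightarrow> \<exists>d>0. \<forall>h. 0 < h \<and> h < d \<longrightarrow>
        norm (integral (cbox x (x + h *\<^sub>R One)) g /\<^sub>R h ^ DIM(real) - g x) < e"
    using integrable_ccontinuous_explicit[of g] int by blast
  have "AE t in lebesgue. t \<notin> N"
    using N(1) by (simp add: negligible_iff_null_sets AE_not_in)
  hence "AE t in lborel. t \<notin> N"
    by (simp add: AE_completion_iff)
  thus ?thesis
  proof eventually_elim
    case (elim t)
    show ?case
    proof (intro allI impI)
      fix e :: real assume "e > 0"
      then obtain d0 where d0: "d0 > 0" "\<And>h. 0 < h \<Longrightarrow> h < d0 \<Longrightarrow>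
        norm (integral {t..t+h} g / h - g t) < e"
        using N(2)[OF elim, of e] by (auto simp: divide_inverse mult.commute)
      have "(LBINT x:{t..t+d}. g x) \<le> (g t + e) * d" if "0 < d" "d < d0" for d
      proof -
        have "(LBINT x:{t..t+d}. g x) = integral {t..t+d} g"
          using set_borel_integral_eq_integral(2)[OF assms] .
        moreover have "integral {t..t+d} g / d < g t + e"
          using d0(2)[OF that] by (simp add: abs_less_iff)
        ultimately show ?thesis using that by (simp add: pos_divide_less_eq less_imp_le)
      qed
      thus "\<exists>d0>0. \<forall>d. 0 < d \<and> d < d0 \<longrightarrow> (LBINT x:{t..t+d}. g x) \<le> (g t + e) * d"
        using d0(1) by blast
    qed
  qed
qed

lemma AE_left_average:
  fixes g :: "real \<Rightarrow> real"
  assumes int: "\<And>a b. set_integrable lborel {a..b} g"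
  shows "AE t in lborel. \<forall>e>0. \<exists>d0>0. \<forall>d. 0 < d \<and> d < d0 \<longrightarrow>
           (LBINT x:{t-d..t}. g x) \<le> (g t + e) * d"
proof -
  have ind: "indicator {a..b} (- x) = (indicator {-b..-a} x :: real)" for a b x :: real
    by (auto simp: indicator_def)
  have "set_integrable lborel {a..b} (\<lambda>x. g (-x))" for a b
    using lborel_integrable_real_affine_iff[of "-1" "\<lambda>x. indicator {-b..-a} x *\<^sub>R g x" 0] int[of "-b" "-a"]
    unfolding set_integrable_def by (simp add: ind)
  from AE_right_average[OF this]
  have "AE t in lborel. \<forall>e>0. \<exists>d0>0. \<forall>d. 0 < d \<and> d < d0 \<longrightarrow>
           (LBINT x:{t..t+d}. g (-x)) \<le> (g (-t) + e) * d" .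
  hence "AE t in distr lborel borel uminus. \<forall>e>0. \<exists>d0>0. \<forall>d. 0 < d \<and> d < d0 \<longrightarrow>
           (LBINT x:{t..t+d}. g (-x)) \<le> (g (-t) + e) * d"
    by (subst lborel_distr_uminus)
  hence "AE t in lborel. \<forall>e>0. \<exists>d0>0. \<forall>d. 0 < d \<and> d < d0 \<longrightarrow>
           (LBINT x:{-t..-t+d}. g (-x)) \<le> (g t + e) * d"
    using AE_distrD[of uminus lborel borel "\<lambda>t. \<forall>e>0. \<exists>d0>0. \<forall>d. 0 < d \<and> d < d0 \<longrightarrow>
           (LBINT x:{t..t+d}. g (-x)) \<le> (g (-t) + e) * d"] by (simp del: lborel_distr_uminus)
  moreover have "(LBINT x:{-t..-t+d}. g (-x)) = (LBINT x:{t-d..t}. g x)" for t d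
    using lborel_integral_real_affine[of "-1" "\<lambda>x. indicator {t-d..t} x *\<^sub>R g x" 0]
    unfolding set_lebesgue_integral_def by (simp add: ind)
  ultimately show ?thesis by simp
qed

text \<open>The integrand |f x - f t| depends on t, so differentiation cannot be applied to it
  directly. It is applied to |f x - q| for all q in a countable dense set, which costs one null set
  in all, and then q is chosen close to \<open>f t\<close>.\<close>

lemma AE_lebesgue_point:
  fixes f :: "real \<Rightarrow> complex"
  assumes f: "integrable lborel f"
  shows "AE t in lborel. lebesgue_point f t"
proof -
  obtain Q :: "complex set" where Q: "countable Q" "\<And>U. open U \<Longrightarrow> U \<noteq> {} \<Longrightarrow> \<exists>q\<in>Q. q \<in> U"
    using countable_dense_exists[where 'a=complex] by metis
  have [measurable]: "f \<in> borel_measurable borel" using f by auto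
  have int: "set_integrable lborel {a..b} (\<lambda>x. norm (f x - q))" for a b and q
  proof -
    have "set_integrable lborel {a..b} (\<lambda>x. f x - q)"
      by (intro set_integral_diff) 
         (auto simp: set_integrable_def f emeasure_lborel_Icc_eq integrable_mult_indicator)
    thus ?thesis by (rule set_integrable_norm)
  qed
  have A1: "AE t in lborel. \<forall>q\<in>Q. \<forall>e>0. \<exists>d0>0. \<forall>d. 0 < d \<and> d < d0 \<longrightarrow>
           (LBINT x:{t..t+d}. norm (f x - q)) \<le> (norm (f t - q) + e) * d"
    by (rule iffD2[OF AE_ball_countable[OF Q(1)]]) (intro ballI AE_right_average int)
  have A2: "AE t in lborel. \<forall>q\<in>Q. \<forall>e>0. \<exists>d0>0. \<forall>d. 0 < d \<and> d < d0 \<longrightarrow>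
           (LBINT x:{t-d..t}. norm (f x - q)) \<le> (norm (f t - q) + e) * d"
    by (rule iffD2[OF AE_ball_countable[OF Q(1)]]) (intro ballI AE_left_average int)
  from A1 A2 show ?thesis
  proof eventually_elim
    case (elim t)
    show ?case unfolding lebesgue_point_def
    proof (intro allI impI)
      fix e :: real assume e: "e > 0"
      obtain q where q: "q \<in> Q" "q \<in> ball (f t) (e/8)"
        using Q(2)[of "ball (f t) (e/8)"] e by auto
      have ee: "e/8 > 0" using e by simp
      obtain d1 where d1: "d1 > 0" "\<And>d. 0 < d \<Longrightarrow> d < d1 \<Longrightarrow> 
         (LBINT x:{t..t+d}. norm (f x - q)) \<le> (norm (f t - q) + e/8) * d"
        using elim(1)[THEN bspec, OF q(1), rule_format, OF ee] by blast
      obtain d2 where d2: "d2 > 0" "\<And>d. 0 < d \<Longrightarrow> d < d2 \<Longrightarrow> 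
         (LBINT x:{t-d..t}. norm (f x - q)) \<le> (norm (f t - q) + e/8) * d"
        using elim(2)[THEN bspec, OF q(1), rule_format, OF ee] by blast
      have nq: "norm (f t - q) < e/8" using q(2) by (simp add: dist_norm)
      have "(LBINT x:{t-d..t+d}. norm (f x - f t)) \<le> e * d" if d: "0 < d" "d < min d1 d2" for d
      proof -
        have cint: "set_integrable lborel {a..b} (\<lambda>x. e / 8)" for a b :: real
          unfolding set_integrable_def by (simp add: emeasure_lborel_Icc_eq)
        have "(LBINT x:{t-d..t+d}. norm (f x - f t)) \<le> (LBINT x:{t-d..t+d}. norm (f x - q) + e/8)"
          by (rule set_integral_mono[OF int set_integral_add(1)[OF int cint]])
             (use nq norm_triangle_ineq4[of "f _ - q" "f t - q"] in \<open>simp add: order.trans[OF norm_triangle_ineq4[of "f _ - q" "f t - q", simplified]]\<close>)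
        also have "\<dots> = (LBINT x:{t-d..t+d}. norm (f x - q)) + (LBINT x:{t-d..t+d}. e/8)"
          by (rule set_integral_add(2)[OF int cint])
        also have "(LBINT x:{t-d..t+d}. e/8) = 2 * d * (e/8)"
          using d by (simp add: set_lebesgue_integral_def)
        also have "(LBINT x:{t-d..t+d}. norm (f x - q)) = (LBINT x:{t-d..t} \<union> {t<..t+d}. norm (f x - q))"
          using d by (intro arg_cong2[where f="set_lebesgue_integral lborel"]) auto
        also have "\<dots> = (LBINT x:{t-d..t}. norm (f x - q)) + (LBINT x:{t<..t+d}. norm (f x - q))"
          by (rule set_integral_Un) (auto intro: int set_integrable_subset[OF int[of t "t+d"]])
        also have "(LBINT x:{t<..t+d}. norm (f x - q)) = (LBINT x:{t..t+d}. norm (f x - q))"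
          unfolding set_lebesgue_integral_def
        proof (rule integral_cong_AE)
          show "AE x in lborel. indicat_real {t<..t + d} x *\<^sub>R cmod (f x - q) = indicat_real {t..t + d} x *\<^sub>R cmod (f x - q)"
            using AE_lborel_singleton[of t] by eventually_elim (auto simp: indicator_def)
        qed measurable
        also have "(LBINT x:{t-d..t}. norm (f x - q)) + (LBINT x:{t..t+d}. norm (f x - q)) + 2 * d * (e/8)
            \<le> (e/8 + e/8) * d + (e/8 + e/8) * d + 2 * d * (e/8)"
        proof -
          have "(norm (f t - q) + e/8) * d \<le> (e/8 + e/8) * d"
            using nq d by (intro mult_right_mono) auto
          thus ?thesis using d1(2)[of d] d2(2)[of d] d by linarith
        qed
        also have "\<dots> \<le> e * d" using e d by (simp add: field_simps)
        finally show ?thesis .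
      qed
      thus "\<exists>d0>0. \<forall>d. 0 < d \<and> d < d0 \<longrightarrow> (LBINT x:{t-d..t+d}. norm (f x - f t)) \<le> e * d"
        using d1(1) d2(1) by (intro exI[of _ "min d1 d2"]) auto
    qed
  qed
qed

lemma integrable_mult_bounded:
  fixes f g :: "'a \<Rightarrow> 'b::{real_normed_algebra, second_countable_topology, banach}"
  assumes "integrable M f" "g \<in> borel_measurable M" "\<And>x. norm (g x) \<le> B"
  shows "integrable M (\<lambda>x. f x * g x)"
proof (rule Bochner_Integration.integrable_bound)
  show "integrable M (\<lambda>x. B * norm (f x))" using assms(1) by simp
  have "B \<ge> 0" using assms(3)[of undefined] norm_ge_zero order_trans by blast
  thus "AE x in M. norm (f x * g x) \<le> norm (B * norm (f x))"
    using order_trans[OF norm_mult_ineq mult_left_mono[OF assms(3) norm_ge_zero]]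
    by (intro AE_I2) (simp add: mult.commute)
qed (use assms in auto)

section \<open>Poisson averages at Lebesgue points\<close>

definition poisson_kernel :: "real \<Rightarrow> real \<Rightarrow> real" where
  "poisson_kernel e u = e / (e\<^sup>2 + u\<^sup>2)"

lemma poisson_kernel_measurable [measurable]: "poisson_kernel e \<in> borel_measurable borel"
  unfolding poisson_kernel_def by measurable

lemma poisson_kernel_le:
  fixes e u :: real
  assumes "e > 0"
  shows "0 \<le> poisson_kernel e u" "poisson_kernel e u \<le> 1 / e" "\<bar>poisson_kernel e u\<bar> \<le> 1 / e"
  unfolding poisson_kernel_def
proof -
  have "e\<^sup>2 + u\<^sup>2 > 0" using assms by (simp add: add_pos_nonneg)
  thus "0 \<le> e / (e\<^sup>2 + u\<^sup>2)" "e / (e\<^sup>2 + u\<^sup>2) \<le> 1 / e" "\<bar>e / (e\<^sup>2 + u\<^sup>2)\<bar> \<le> 1 / e"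
    using assms by (auto simp: field_simps power2_eq_square)
qed

text \<open>Majorises the kernel by indicators of dyadic windows and a flat tail. The weight 4 /
  (4^k eps) times the half-width 2^k eps is summable in k, so averages over symmetric windows
  control the whole integral; the tail vanishes as eps tends to 0.\<close>

lemma poisson_kernel_dyadic:
  fixes u \<epsilon> d1 :: real
  assumes eps: "\<epsilon> > 0" and n: "d1 < 2^(n+1) * \<epsilon>" and d1: "d1 > 0"
  shows "poisson_kernel \<epsilon> u \<le> (\<Sum>k\<le>n. (4 / (4^k * \<epsilon>)) * of_bool (\<bar>u\<bar> \<le> 2^k * \<epsilon>)) + 4 * \<epsilon> / d1\<^sup>2"
proof (cases "\<bar>u\<bar> \<le> 2^n * \<epsilon>")
  case True
  define k where "k = (LEAST k. \<bar>u\<bar> \<le> 2^k * \<epsilon>)"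
  have k1: "\<bar>u\<bar> \<le> 2^k * \<epsilon>" unfolding k_def using True by (rule LeastI)
  have k2: "k \<le> n" unfolding k_def using True by (rule Least_le)
  have "\<epsilon> / (\<epsilon>\<^sup>2 + u\<^sup>2) \<le> 4 / (4^k * \<epsilon>)"
  proof (cases k)
    case 0
    have "\<epsilon> / (\<epsilon>\<^sup>2 + u\<^sup>2) \<le> 1 / \<epsilon>" using poisson_kernel_le(2)[OF eps] unfolding poisson_kernel_def .
    also have "\<dots> \<le> 4 / \<epsilon>" using eps by (simp add: field_simps)
    finally show ?thesis using 0 by simp
  next
    case (Suc j)
    have "\<not> \<bar>u\<bar> \<le> 2^j * \<epsilon>" using not_less_Least[of j "\<lambda>k. \<bar>u\<bar> \<le> 2^k * \<epsilon>"] Suc unfolding k_def by simp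
    hence "(2^j * \<epsilon>)\<^sup>2 \<le> \<bar>u\<bar>\<^sup>2" using eps by (intro power_mono) auto
    hence u: "4^j * \<epsilon>\<^sup>2 \<le> u\<^sup>2" using power_mult_distrib[of 2 "2::real" j] by (simp add: power2_eq_square mult_ac)
    have "\<epsilon> / (\<epsilon>\<^sup>2 + u\<^sup>2) \<le> \<epsilon> / (4^j * \<epsilon>\<^sup>2)"
      using u eps by (intro divide_left_mono) (auto simp: add_pos_nonneg add_increasing)
    also have "\<dots> = 4 / (4^k * \<epsilon>)" using eps Suc by (simp add: power2_eq_square field_simps)
    finally show ?thesis .
  qed
  also have "\<dots> = (4 / (4^k * \<epsilon>)) * of_bool (\<bar>u\<bar> \<le> 2^k * \<epsilon>)" using k1 by simp
  also have "\<dots> \<le> (\<Sum>k\<le>n. (4 / (4^k * \<epsilon>)) * of_bool (\<bar>u\<bar> \<le> 2^k * \<epsilon>))"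
    using k2 eps by (intro member_le_sum) auto
  also have "\<dots> \<le> \<dots> + 4 * \<epsilon> / d1\<^sup>2" using eps by simp
  finally show ?thesis unfolding poisson_kernel_def .
next
  case False
  hence "\<bar>u\<bar> \<ge> d1 / 2" using n by simp
  hence "(d1/2)\<^sup>2 \<le> \<bar>u\<bar>\<^sup>2" using d1 by (intro power_mono) auto
  hence u: "d1\<^sup>2 / 4 \<le> u\<^sup>2" by (simp add: power_divide)
  have "\<epsilon> / (\<epsilon>\<^sup>2 + u\<^sup>2) \<le> \<epsilon> / (d1\<^sup>2 / 4)"
    using u eps d1 by (intro divide_left_mono) (auto simp: add_pos_nonneg add_increasing)
  also have "\<dots> = 0 + 4 * \<epsilon> / d1\<^sup>2" by simp
  also have "\<dots> \<le> (\<Sum>k\<le>n. (4 / (4^k * \<epsilon>)) * of_bool (\<bar>u\<bar> \<le> 2^k * \<epsilon>)) + 4 * \<epsilon> / d1\<^sup>2"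
    using eps by (intro add_right_mono sum_nonneg) auto
  finally show ?thesis unfolding poisson_kernel_def .
qed

lemma set_integrable_sub_const:
  fixes f :: "real \<Rightarrow> complex"
  assumes "integrable lborel f"
  shows "set_integrable lborel {a..b} (\<lambda>x. f x - c)"
  by (intro set_integral_diff) 
     (auto simp: set_integrable_def assms emeasure_lborel_Icc_eq integrable_mult_indicator)

lemma poisson_lebesgue_point:
  assumes lp: "lebesgue_point f t" and f: "integrable lborel f"
  shows "((\<lambda>\<epsilon>. LBINT x:{t-D..t+D}. norm (f x - f t) * poisson_kernel \<epsilon> (x-t)) \<longlongrightarrow> 0) (at_right 0)"
proof (rule tendstoI)
  fix e :: real assume e: "e > 0"
  have [measurable]: "f \<in> borel_measurable borel" using f by auto
  define M where "M = (LBINT x:{t-D..t+D}. norm (f x - f t))"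
  have int: "set_integrable lborel {a..b} (\<lambda>x. norm (f x - f t))" for a b
    by (intro set_integrable_norm set_integrable_sub_const f)
  have M0: "M \<ge> 0" unfolding M_def set_lebesgue_integral_def by (intro Bochner_Integration.integral_nonneg) auto
  \<comment> \<open>With e/32 the k-th dyadic window contributes e/8 times 2^(-k), hence the windows
    together at most e/4. The tail is pushed below e/2 by the bound imposed on eps.\<close>
  obtain d0 where d0: "d0 > 0" "\<And>d. 0 < d \<Longrightarrow> d < d0 \<Longrightarrow> (LBINT x:{t-d..t+d}. norm (f x - f t)) \<le> e/32 * d"
    using lp e unfolding lebesgue_point_def by (metis divide_pos_pos zero_less_numeral)
  define d1 where "d1 = d0 / 2"
  have d1: "d1 > 0" "d1 < d0" using d0(1) by (auto simp: d1_def)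
  have "eventually (\<lambda>\<epsilon>. \<epsilon> < d1 \<and> \<epsilon> < e * d1\<^sup>2 / (8 * (M+1))) (at_right (0::real))"
    using d1 e M0 by (intro eventually_conj eventually_at_right_less order_tendstoD(2)[OF tendsto_ident_at]) auto
  moreover have "eventually (\<lambda>\<epsilon>. \<epsilon> > 0) (at_right (0::real))" by (rule eventually_at_right_less)
  ultimately show "\<forall>\<^sub>F \<epsilon> in at_right 0. dist (LBINT x:{t-D..t+D}. norm (f x - f t) * poisson_kernel \<epsilon> (x-t)) 0 < e"
  proof eventually_elim
    case (elim \<epsilon>)
    hence eps: "\<epsilon> > 0" "\<epsilon> < d1" "\<epsilon> < e * d1\<^sup>2 / (8 * (M+1))" by auto
    have ex: "\<exists>n::nat. d1 < 2^(n+1) * \<epsilon>"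
    proof -
      obtain n :: nat where "d1 / \<epsilon> < 2^n" using real_arch_pow[of 2] by auto
      also have "(2::real)^n \<le> 2^(n+1)" by simp
      finally show ?thesis using eps by (auto simp: field_simps)
    qed
    \<comment> \<open>The last dyadic scale: 2^n eps <= d1 < d0 keeps every window in the range of
      the Lebesgue point estimate, and 2^(n+1) eps > d1 leaves the rest to the tail.\<close>
    define n where "n = (LEAST n::nat. d1 < 2^(n+1) * \<epsilon>)"
    have n1: "d1 < 2^(n+1) * \<epsilon>" unfolding n_def by (rule LeastI_ex[OF ex])
    have n2: "2^n * \<epsilon> \<le> d1"
    proof (cases n)
      case 0 thus ?thesis using eps by simp
    next
      case (Suc m)
      thus ?thesis using not_less_Least[of m "\<lambda>n. d1 < 2^(n+1) * \<epsilon>"] unfolding n_def by (simp add: not_less)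
    qed
    let ?g = "\<lambda>x. indicator {t-D..t+D} x * norm (f x - f t)"
    let ?S = "\<lambda>k x. indicator {t-2^k*\<epsilon>..t+2^k*\<epsilon>} x * norm (f x - f t)"
    have Si: "integrable lborel (?S k)" for k using int[of "t-2^k*\<epsilon>" "t+2^k*\<epsilon>"] unfolding set_integrable_def by simp
    have gi: "integrable lborel ?g" using int unfolding set_integrable_def by simp
    have ineq: "?g x * poisson_kernel \<epsilon> (x-t) \<le> (\<Sum>k\<le>n. (4 / (4^k * \<epsilon>)) * ?S k x) + 4 * \<epsilon> / d1\<^sup>2 * ?g x" for x
    proof -
      have "?g x * poisson_kernel \<epsilon> (x-t) \<le> ?g x * ((\<Sum>k\<le>n. (4 / (4^k * \<epsilon>)) * of_bool (\<bar>x-t\<bar> \<le> 2^k * \<epsilon>)) + 4 * \<epsilon> / d1\<^sup>2)"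
        by (intro mult_left_mono poisson_kernel_dyadic eps n1 d1) auto
      also have "\<dots> = (\<Sum>k\<le>n. (4 / (4^k * \<epsilon>)) * (of_bool (\<bar>x-t\<bar> \<le> 2^k * \<epsilon>) * ?g x)) + 4 * \<epsilon> / d1\<^sup>2 * ?g x"
        by (simp add: distrib_left sum_distrib_left mult_ac)
      also have "\<dots> \<le> (\<Sum>k\<le>n. (4 / (4^k * \<epsilon>)) * ?S k x) + 4 * \<epsilon> / d1\<^sup>2 * ?g x"
        using eps by (intro add_right_mono sum_mono mult_left_mono) (auto simp: indicator_def)
      finally show ?thesis .
    qed
    have "(LBINT x:{t-D..t+D}. norm (f x - f t) * poisson_kernel \<epsilon> (x-t)) = (LBINT x. ?g x * poisson_kernel \<epsilon> (x-t))"
      unfolding set_lebesgue_integral_def by (simp add: mult.assoc)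
    also have "\<dots> \<le> (LBINT x. (\<Sum>k\<le>n. (4 / (4^k * \<epsilon>)) * ?S k x) + 4 * \<epsilon> / d1\<^sup>2 * ?g x)"
    proof (rule integral_mono)
      show "integrable lborel (\<lambda>x. ?g x * poisson_kernel \<epsilon> (x-t))"
        using poisson_kernel_le(3)[OF eps(1)] by (intro integrable_mult_bounded[where B="1/\<epsilon>" and f="?g"] gi) auto
    qed (use Si gi ineq in auto)
    also have "\<dots> = (\<Sum>k\<le>n. (4 / (4^k * \<epsilon>)) * (LBINT x. ?S k x)) + 4 * \<epsilon> / d1\<^sup>2 * M"
      using Si gi by (simp add: M_def set_lebesgue_integral_def)
    also have "\<dots> \<le> (\<Sum>k\<le>n. (4 / (4^k * \<epsilon>)) * (e/32 * (2^k * \<epsilon>))) + 4 * \<epsilon> / d1\<^sup>2 * M"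
    proof (intro add_right_mono sum_mono mult_left_mono)
      fix k assume "k \<in> {..n}"
      hence "(2::real)^k \<le> 2^n" by (intro power_increasing) auto
      hence "2^k * \<epsilon> \<le> 2^n * \<epsilon>" using eps by simp
      hence "2^k * \<epsilon> < d0" using n2 d1 by linarith
      from d0(2)[OF _ this] show "(LBINT x. ?S k x) \<le> e/32 * (2^k * \<epsilon>)"
        using eps by (simp add: set_lebesgue_integral_def)
    qed (use eps in auto)
    also have "(\<Sum>k\<le>n. (4 / (4^k * \<epsilon>)) * (e/32 * (2^k * \<epsilon>))) = e/8 * (\<Sum>k\<le>n. (1/2)^k)"
      unfolding sum_distrib_left
    proof (intro sum.cong refl)
      fix k :: nat
      have "(4::real)^k = 2^k * 2^k" by (simp flip: power_mult_distrib)
      thus "4 / (4^k * \<epsilon>) * (e/32 * (2^k * \<epsilon>)) = e/8 * (1/2)^k" using eps by (simp add: field_simps power_divide)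
    qed
    also have "(\<Sum>k\<le>n. (1/2)^k) \<le> (2::real)" by (simp add: sum_gp0)
    also have "4 * \<epsilon> / d1\<^sup>2 * M \<le> e / 2"
    proof -
      have "4 * \<epsilon> * M \<le> 4 * (e * d1\<^sup>2 / (8 * (M+1))) * M" using eps M0 by (intro mult_right_mono) auto
      also have "\<dots> = (e/2 * d1\<^sup>2) * (M / (M+1))" using M0 by (simp add: field_simps)
      also have "\<dots> \<le> (e/2 * d1\<^sup>2) * 1" using M0 e by (intro mult_left_mono) auto
      finally show ?thesis using d1 by (simp add: field_simps)
    qed
    finally have "(LBINT x:{t-D..t+D}. norm (f x - f t) * poisson_kernel \<epsilon> (x-t)) \<le> 3/4 * e" using e by simp
    moreover have "0 \<le> (LBINT x:{t-D..t+D}. norm (f x - f t) * poisson_kernel \<epsilon> (x-t))"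
      unfolding set_lebesgue_integral_def using eps by (intro Bochner_Integration.integral_nonneg) (auto simp: poisson_kernel_le)
    ultimately show ?case using e by (simp add: dist_real_def)
  qed
qed

definition supp1 :: "(real \<Rightarrow> complex) \<Rightarrow> bool" where
  "supp1 f \<longleftrightarrow> (\<forall>x. 1 \<le> \<bar>x\<bar> \<longrightarrow> f x = 0)"

lemma odd_integral_zero:
  fixes k :: "real \<Rightarrow> real"
  assumes odd: "\<And>u. k (-u) = - k u"
  shows "(LBINT x:{t-d..t+d}. k (x-t)) = 0"
proof -
  have ind: "indicator {t-d..t+d} (2*t - x) = (indicator {t-d..t+d} x :: real)" for x
    by (auto simp: indicator_def)
  have "k (t - x) = - k (x - t)" for x using odd[of "x-t"] by simp
  hence "(LBINT x:{t-d..t+d}. k (x-t)) = - (LBINT x:{t-d..t+d}. k (x-t))"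
    using lborel_integral_real_affine[of "-1" "\<lambda>x. indicator {t-d..t+d} x *\<^sub>R k (x-t)" "2*t"]
    unfolding set_lebesgue_integral_def by (simp add: ind)
  thus ?thesis by simp
qed

text \<open>An odd kernel integrates to zero over a window centred at t, so the constant
  \<open>f t\<close> can be subtracted at no cost. Half-width 2 makes the window cover (-1,1), and
  with it the support of f, for every |t| < 1.\<close>

lemma odd_kernel_bound:
  fixes k :: "real \<Rightarrow> real"
  assumes f: "integrable lborel f" "supp1 f" and t: "\<bar>t\<bar> < 1" and eps: "\<epsilon> > 0"
    and k[measurable]: "k \<in> borel_measurable borel" and odd: "\<And>u. k (-u) = - k u"
    and bd: "\<And>u. \<bar>k u\<bar> \<le> C * poisson_kernel \<epsilon> u"
  shows "norm (LBINT x. f x * of_real (k (x-t))) \<le> C * (LBINT x:{t-2..t+2}. norm (f x - f t) * poisson_kernel \<epsilon> (x-t))"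
proof -
  have [measurable]: "f \<in> borel_measurable borel" using f by auto
  have C0: "C \<ge> 0" using order_trans[OF abs_ge_zero bd[of 0]] eps by (auto simp: poisson_kernel_def power2_eq_square zero_le_divide_iff)
  have kb: "\<bar>k u\<bar> \<le> C / \<epsilon>" for u
    using order_trans[OF bd[of u] mult_left_mono[OF poisson_kernel_le(2)[OF eps] C0]] by simp
  let ?I = "{t-2..t+2}"
  have "set_integrable lborel ?I (\<lambda>x. (f x - f t) * of_real (k (x-t)))"
    unfolding set_integrable_def
    using integrable_mult_bounded[of lborel "\<lambda>x. indicator ?I x *\<^sub>R (f x - f t)" "\<lambda>x. of_real (k (x-t))" "C/\<epsilon>"]
      set_integrable_sub_const[OF f(1)] kb unfolding set_integrable_def by (simp add: mult.assoc)
  moreover have "set_integrable lborel ?I (\<lambda>x. f t * of_real (k (x-t)))"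
    unfolding set_integrable_def
    using integrable_mult_bounded[of lborel "\<lambda>x. indicator ?I x *\<^sub>R f t" "\<lambda>x. of_real (k (x-t))" "C/\<epsilon>"]
      kb by (simp add: emeasure_lborel_Icc_eq)
  ultimately have "(LBINT x:?I. (f x - f t) * of_real (k (x-t)) + f t * of_real (k (x-t))) = 
     (LBINT x:?I. (f x - f t) * of_real (k (x-t))) + (LBINT x:?I. f t * of_real (k (x-t)))"
    by (rule set_integral_add(2))
  moreover have "(LBINT x:?I. f t * of_real (k (x-t))) = f t * of_real (LBINT x:?I. k (x-t))"
    by (simp add: set_integral_complex_of_real)
  moreover have "(LBINT x. f x * of_real (k (x-t))) = (LBINT x:?I. (f x - f t) * of_real (k (x-t)) + f t * of_real (k (x-t)))"
    unfolding set_lebesgue_integral_def using f(2) t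
    by (intro Bochner_Integration.integral_cong refl) (auto simp: supp1_def indicator_def algebra_simps)
  ultimately have "(LBINT x. f x * of_real (k (x-t))) = (LBINT x:?I. (f x - f t) * of_real (k (x-t)))"
    using odd_integral_zero[of k, OF odd] by simp
  also have "norm \<dots> \<le> (LBINT x. norm (indicator ?I x *\<^sub>R ((f x - f t) * of_real (k (x-t)))))"
    unfolding set_lebesgue_integral_def by (rule integral_norm_bound)
  also have "\<dots> \<le> (LBINT x. C * (indicator ?I x *\<^sub>R (norm (f x - f t) * poisson_kernel \<epsilon> (x-t))))"
  proof (rule integral_mono')
    show "integrable lborel (\<lambda>x. C * (indicator ?I x *\<^sub>R (norm (f x - f t) * poisson_kernel \<epsilon> (x-t))))"
      using integrable_mult_bounded[of lborel "\<lambda>x. indicator ?I x *\<^sub>R norm (f x - f t)" "\<lambda>x. poisson_kernel \<epsilon> (x-t)" "1/\<epsilon>"]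
        poisson_kernel_le(3)[OF eps] set_integrable_norm[OF set_integrable_sub_const[OF f(1)]]
      unfolding set_integrable_def by (simp add: mult.assoc)
  next
    fix x
    show "norm (indicator ?I x *\<^sub>R ((f x - f t) * of_real (k (x-t)))) \<le> C * (indicator ?I x *\<^sub>R (norm (f x - f t) * poisson_kernel \<epsilon> (x-t)))"
      using mult_left_mono[OF bd[of "x-t"], of "norm (f x - f t)"] by (auto simp: indicator_def norm_mult mult_ac)
  qed (use C0 poisson_kernel_le[OF eps] in auto)
  finally show ?thesis unfolding set_lebesgue_integral_def by simp
qed

lemma odd_kernel_lebesgue_point:
  fixes k :: "real \<Rightarrow> real \<Rightarrow> real"
  assumes f: "lebesgue_point f t" "integrable lborel f" "supp1 f" and t: "\<bar>t\<bar> < 1" 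
    and k: "\<And>\<epsilon>. \<epsilon> > 0 \<Longrightarrow> k \<epsilon> \<in> borel_measurable borel" and odd: "\<And>\<epsilon> u. \<epsilon> > 0 \<Longrightarrow> k \<epsilon> (-u) = - k \<epsilon> u"
    and bd: "\<And>\<epsilon> u. \<epsilon> > 0 \<Longrightarrow> \<bar>k \<epsilon> u\<bar> \<le> C * poisson_kernel \<epsilon> u"
  shows "((\<lambda>\<epsilon>. LBINT x. f x * of_real (k \<epsilon> (x-t))) \<longlongrightarrow> 0) (at_right 0)"
proof (rule Lim_null_comparison)
  show "\<forall>\<^sub>F \<epsilon> in at_right 0. norm (LBINT x. f x * of_real (k \<epsilon> (x-t))) \<le> C * (LBINT x:{t-2..t+2}. norm (f x - f t) * poisson_kernel \<epsilon> (x-t))"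
    using eventually_at_right_less[of 0] by eventually_elim (intro odd_kernel_bound f t k odd bd)
  show "((\<lambda>\<epsilon>. C * (LBINT x:{t-2..t+2}. norm (f x - f t) * poisson_kernel \<epsilon> (x-t))) \<longlongrightarrow> 0) (at_right 0)"
    using tendsto_mult_right_zero[OF poisson_lebesgue_point[OF f(1,2)]] .
qed

section \<open>The Cauchy transform and its real and imaginary parts\<close>

definition cauchy_transform :: "(real \<Rightarrow> complex) \<Rightarrow> complex \<Rightarrow> complex" where
  "cauchy_transform f z = (LBINT x. f x / (of_real x - z))"

text \<open>\<open>conj_kernel e u\<close> and \<open>poisson_kernel e u\<close> are the real and
  the imaginary part of 1 / (u - i e). Neither carries the customary factor 1/pi, so that factor
  reappears in the limits.\<close>

definition conj_kernel :: "real \<Rightarrow> real \<Rightarrow> real" where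
  "conj_kernel e u = u / (e\<^sup>2 + u\<^sup>2)"

definition conj_poisson :: "(real \<Rightarrow> complex) \<Rightarrow> real \<Rightarrow> real \<Rightarrow> complex" where
  "conj_poisson f e t = (LBINT x. f x * of_real (conj_kernel e (x - t)))"

definition poisson :: "(real \<Rightarrow> complex) \<Rightarrow> real \<Rightarrow> real \<Rightarrow> complex" where
  "poisson f e t = (LBINT x. f x * of_real (poisson_kernel e (x - t)))"

lemma conj_kernel_measurable [measurable]: "conj_kernel e \<in> borel_measurable borel"
  unfolding conj_kernel_def by measurable

lemma conj_kernel_minus [simp]: "conj_kernel e (-u) = - conj_kernel e u"
  by (simp add: conj_kernel_def)

lemma conj_kernel_le:
  fixes e u :: real
  assumes "e > 0"
  shows "\<bar>conj_kernel e u\<bar> \<le> 1 / e"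
proof -
  have "0 \<le> (e - \<bar>u\<bar>)\<^sup>2" by simp
  also have "(e - \<bar>u\<bar>)\<^sup>2 = e\<^sup>2 + u\<^sup>2 - 2 * (\<bar>u\<bar> * e)" by (simp add: power2_diff)
  finally have "2 * (\<bar>u\<bar> * e) \<le> e\<^sup>2 + u\<^sup>2" by simp
  moreover have "0 \<le> \<bar>u\<bar> * e" using assms by simp
  ultimately have "\<bar>u\<bar> * e \<le> e\<^sup>2 + u\<^sup>2" by linarith
  moreover have "e\<^sup>2 + u\<^sup>2 > 0" using assms by (simp add: add_pos_nonneg)
  ultimately show ?thesis using assms by (simp add: conj_kernel_def field_simps abs_mult abs_divide)
qed

lemma cauchy_kernel_split:
  assumes "e > 0"
  shows "1 / (of_real x - Complex t e) = of_real (conj_kernel e (x-t)) + \<i> * of_real (poisson_kernel e (x-t))"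
    and "1 / (of_real x - Complex t (-e)) = of_real (conj_kernel e (x-t)) - \<i> * of_real (poisson_kernel e (x-t))"
proof -
  have "e\<^sup>2 + (x-t)\<^sup>2 > 0" using assms by (simp add: add_pos_nonneg)
  hence "e\<^sup>2 + (x-t)\<^sup>2 \<noteq> 0" by linarith
  thus "1 / (of_real x - Complex t e) = of_real (conj_kernel e (x-t)) + \<i> * of_real (poisson_kernel e (x-t))"
    and "1 / (of_real x - Complex t (-e)) = of_real (conj_kernel e (x-t)) - \<i> * of_real (poisson_kernel e (x-t))"
    by (simp_all add: complex_eq_iff Re_divide Im_divide conj_kernel_def poisson_kernel_def add.commute[of "(x-t)\<^sup>2"] power2_eq_square[of "e\<^sup>2 + (x-t)\<^sup>2"])
qed

lemma integrable_conj_kernel: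
  assumes "integrable lborel f" "e > 0"
  shows "integrable lborel (\<lambda>x. f x * complex_of_real (conj_kernel e (x-t)))"
  by (rule integrable_mult_bounded[OF assms(1), where B="1/e"]) (use conj_kernel_le[OF assms(2)] in auto)

lemma integrable_poisson_kernel:
  assumes "integrable lborel f" "e > 0"
  shows "integrable lborel (\<lambda>x. f x * complex_of_real (poisson_kernel e (x-t)))"
  by (rule integrable_mult_bounded[OF assms(1), where B="1/e"]) (use poisson_kernel_le(3)[OF assms(2)] in auto)

lemma cauchy_transform_upper:
  assumes "integrable lborel f" "e > 0"
  shows "cauchy_transform f (Complex t e) = conj_poisson f e t + \<i> * poisson f e t"
    and "cauchy_transform f (Complex t (-e)) = conj_poisson f e t - \<i> * poisson f e t"
proof -
  note i = integrable_conj_kernel[OF assms, of t] integrable_poisson_kernel[OF assms, of t]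
  have "f x / (of_real x - Complex t e) = f x * of_real (conj_kernel e (x-t)) + \<i> * (f x * of_real (poisson_kernel e (x-t)))" for x
    using arg_cong[OF cauchy_kernel_split(1)[OF assms(2), of x t], of "(*) (f x)"] by (simp add: algebra_simps)
  thus "cauchy_transform f (Complex t e) = conj_poisson f e t + \<i> * poisson f e t"
    using i unfolding cauchy_transform_def conj_poisson_def poisson_def by simp
  have "f x / (of_real x - Complex t (-e)) = f x * of_real (conj_kernel e (x-t)) - \<i> * (f x * of_real (poisson_kernel e (x-t)))" for x
    using arg_cong[OF cauchy_kernel_split(2)[OF assms(2), of x t], of "(*) (f x)"] by (simp add: algebra_simps)
  thus "cauchy_transform f (Complex t (-e)) = conj_poisson f e t - \<i> * poisson f e t"
    using i unfolding cauchy_transform_def conj_poisson_def poisson_def by simp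
qed

lemma poisson_kernel_integral:
  assumes "e > 0" "d > 0"
  shows "(LBINT x:{t-d..t+d}. poisson_kernel e (x-t)) = 2 * arctan (d/e)"
proof -
  have "(\<integral>x. poisson_kernel e (x-t) * indicator {t-d..t+d} x \<partial>lborel) = arctan ((t+d-t)/e) - arctan ((t-d-t)/e)"
  proof (rule integral_FTC_Icc_real)
    show "((\<lambda>x. arctan ((x-t)/e)) has_real_derivative poisson_kernel e (x-t)) (at x)" for x
      unfolding poisson_kernel_def using assms(1)
      by (auto intro!: derivative_eq_intros simp: field_simps power2_eq_square)
    show "isCont (\<lambda>x. poisson_kernel e (x-t)) x" for x
      unfolding poisson_kernel_def using assms(1)
      by (intro continuous_intros) (auto simp: sum_power2_eq_zero_iff)
  qed (use assms in auto)
  moreover have "arctan ((t-d-t)/e) = - arctan (d/e)" by (simp flip: arctan_minus)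
  ultimately show ?thesis by (simp add: set_lebesgue_integral_def mult.commute)
qed

text \<open>The window carries the kernel mass 2 arctan (2/e), which tends to pi; the deviation of f
  from \<open>f t\<close> is absorbed at a Lebesgue point.\<close>

lemma poisson_tendsto:
  assumes f: "integrable lborel f" "supp1 f" and lp: "lebesgue_point f t" and t: "\<bar>t\<bar> < 1"
  shows "((\<lambda>e. poisson f e t) \<longlongrightarrow> of_real pi * f t) (at_right 0)"
proof -
  have [measurable]: "f \<in> borel_measurable borel" using f by auto
  let ?I = "{t-2..t+2}"
  let ?G = "\<lambda>e. (LBINT x:?I. norm (f x - f t) * poisson_kernel e (x-t))"
  have main: "norm (poisson f e t - f t * of_real (2 * arctan (2/e))) \<le> ?G e" if e: "e > 0" for e
  proof -
    have 1: "set_integrable lborel ?I (\<lambda>x. (f x - f t) * of_real (poisson_kernel e (x-t)))"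
      unfolding set_integrable_def
      using integrable_mult_bounded[of lborel "\<lambda>x. indicator ?I x *\<^sub>R (f x - f t)" "\<lambda>x. of_real (poisson_kernel e (x-t))" "1/e"]
        set_integrable_sub_const[OF f(1)] poisson_kernel_le(3)[OF e] unfolding set_integrable_def by (simp add: mult.assoc)
    have 2: "set_integrable lborel ?I (\<lambda>x. f t * of_real (poisson_kernel e (x-t)))"
      unfolding set_integrable_def
      using integrable_mult_bounded[of lborel "\<lambda>x. indicator ?I x *\<^sub>R f t" "\<lambda>x. of_real (poisson_kernel e (x-t))" "1/e"]
        poisson_kernel_le(3)[OF e] by (simp add: emeasure_lborel_Icc_eq)
    have "(LBINT x:?I. f t * of_real (poisson_kernel e (x-t))) = f t * of_real (2 * arctan (2/e))"
      using poisson_kernel_integral[OF e, of 2 t] by (simp add: set_integral_complex_of_real)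
    moreover have "poisson f e t = (LBINT x:?I. (f x - f t) * of_real (poisson_kernel e (x-t)) + f t * of_real (poisson_kernel e (x-t)))"
      unfolding set_lebesgue_integral_def poisson_def using f(2) t
      by (intro Bochner_Integration.integral_cong refl) (auto simp: supp1_def indicator_def algebra_simps)
    ultimately have "poisson f e t - f t * of_real (2 * arctan (2/e)) = (LBINT x:?I. (f x - f t) * of_real (poisson_kernel e (x-t)))"
      using set_integral_add(2)[OF 1 2] by simp
    also have "norm \<dots> \<le> (LBINT x:?I. norm ((f x - f t) * of_real (poisson_kernel e (x-t))))"
      by (rule set_integral_norm_bound[OF 1])
    also have "\<dots> = ?G e"
      using poisson_kernel_le(1)[OF e] by (simp add: norm_mult)
    finally show ?thesis .
  qed
  have "((\<lambda>e. poisson f e t - f t * of_real (2 * arctan (2/e))) \<longlongrightarrow> 0) (at_right 0)"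
  proof (rule Lim_null_comparison[OF _ poisson_lebesgue_point[OF lp f(1)]])
    show "\<forall>\<^sub>F e in at_right 0. norm (poisson f e t - f t * of_real (2 * arctan (2/e))) \<le> ?G e"
      using eventually_at_right_less[of 0] by eventually_elim (rule main)
  qed
  moreover have "((\<lambda>e. f t * of_real (2 * arctan (2/e))) \<longlongrightarrow> f t * of_real (2 * (pi/2))) (at_right 0)"
    by (intro tendsto_intros filterlim_compose[OF tendsto_arctan_at_top])
       (simp add: divide_inverse, intro filterlim_tendsto_pos_mult_at_top[OF tendsto_const] filterlim_inverse_at_top_right, simp)
  ultimately have "((\<lambda>e. (poisson f e t - f t * of_real (2 * arctan (2/e))) + f t * of_real (2 * arctan (2/e))) \<longlongrightarrow> 0 + f t * of_real (2 * (pi/2))) (at_right 0)"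
    by (rule tendsto_add)
  thus ?thesis by (simp add: mult.commute)
qed

text \<open>For |u| > e the difference equals e/u times the Poisson kernel; for |u| <= e only the
  conjugate kernel is left, and its numerator is at most e.\<close>

lemma trunc_kernel_bound:
  fixes e u :: real
  assumes "e > 0"
  shows "\<bar>of_bool (e < \<bar>u\<bar>) / u - conj_kernel e u\<bar> \<le> poisson_kernel e u"
proof (cases "e < \<bar>u\<bar>")
  case True
  hence u: "u \<noteq> 0" using assms by auto
  have p: "e\<^sup>2 + u\<^sup>2 > 0" using assms by (simp add: add_pos_nonneg)
  have "1 / u - conj_kernel e u = e\<^sup>2 / (u * (e\<^sup>2 + u\<^sup>2))"
    using u p by (simp add: conj_kernel_def field_simps power2_eq_square)
  hence "\<bar>1 / u - conj_kernel e u\<bar> = (e / \<bar>u\<bar>) * poisson_kernel e u"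
    using p assms by (simp add: poisson_kernel_def abs_mult power2_eq_square)
  also have "\<dots> \<le> 1 * poisson_kernel e u"
    using True assms by (intro mult_right_mono poisson_kernel_le) auto
  finally show ?thesis using True by simp
next
  case False
  have p: "e\<^sup>2 + u\<^sup>2 > 0" using assms by (simp add: add_pos_nonneg)
  thus ?thesis using False by (simp add: conj_kernel_def poisson_kernel_def abs_divide divide_right_mono)
qed

definition truncated_hilbert :: "(real \<Rightarrow> complex) \<Rightarrow> real \<Rightarrow> real \<Rightarrow> complex" where
  "truncated_hilbert f e t = (LBINT x. f x * of_real (of_bool (e < \<bar>x - t\<bar>) / (x - t)))"

text \<open>At a Lebesgue point the principal value and the limit of the conjugate Poisson integrals
  therefore exist together and agree, so the smooth kernel can stand in for the truncation.\<close>

lemma trunc_conj_poisson: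
  assumes f: "integrable lborel f" "supp1 f" and lp: "lebesgue_point f t" and t: "\<bar>t\<bar> < 1"
  shows "((\<lambda>e. truncated_hilbert f e t - conj_poisson f e t) \<longlongrightarrow> 0) (at_right 0)"
proof -
  let ?k = "\<lambda>e u::real. of_bool (e < \<bar>u\<bar>) / u - conj_kernel e u"
  have meas: "(\<lambda>u::real. of_bool (e < \<bar>u\<bar>) / u) \<in> borel_measurable borel" for e :: real
    by measurable
  have lim: "((\<lambda>e. LBINT x. f x * of_real (?k e (x-t))) \<longlongrightarrow> 0) (at_right 0)"
  proof (rule odd_kernel_lebesgue_point[OF lp f t, where C=1 and k="?k"])
    show "?k e \<in> borel_measurable borel" for e by (intro borel_measurable_diff meas conj_kernel_measurable)
    show "?k e (-u) = - ?k e u" for e u by (simp add: conj_kernel_def)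
    show "\<bar>?k e u\<bar> \<le> 1 * poisson_kernel e u" if "e > 0" for e u unfolding mult_1 by (rule trunc_kernel_bound[OF that])
  qed
  have "(LBINT x. f x * of_real (?k e (x-t))) = truncated_hilbert f e t - conj_poisson f e t" if e: "e > 0" for e
  proof -
    let ?h = "\<lambda>u::real. of_bool (e < \<bar>u\<bar>) / u"
    have b: "\<bar>?h u\<bar> \<le> 1 / e" for u
      using e by (cases "e < \<bar>u\<bar>") (simp_all add: abs_divide frac_le)
    have m: "(\<lambda>x. complex_of_real (?h (x - t))) \<in> borel_measurable lborel"
      using measurable_compose[OF _ meas, of "\<lambda>x. x - t" lborel e] by measurable
    have i: "integrable lborel (\<lambda>x. f x * complex_of_real (?h (x - t)))"
      by (rule integrable_mult_bounded[OF f(1) m, where B="1/e"]) (unfold norm_of_real, rule b)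
    show ?thesis unfolding truncated_hilbert_def conj_poisson_def of_real_diff right_diff_distrib
      by (rule Bochner_Integration.integral_diff[OF i integrable_conj_kernel[OF f(1) e]])
  qed
  note eq = this
  have "\<forall>\<^sub>F e in at_right 0. (LBINT x. f x * of_real (?k e (x-t))) = truncated_hilbert f e t - conj_poisson f e t"
    using eventually_at_right_less[of 0] by eventually_elim (rule eq)
  from Lim_transform_eventually[OF lim this] show ?thesis .
qed

text \<open>A whole neighbourhood of w keeps the same distance d from [-1,1], which makes the
  estimates for difference quotients uniform.\<close>

lemma cauchy_kernel_gap:
  fixes w :: complex
  assumes "w \<notin> of_real ` {-1..1::real}"
  obtains d where "d > 0" "\<And>z x. dist z w < d \<Longrightarrow> \<bar>x\<bar> \<le> 1 \<Longrightarrow> d \<le> norm (of_real x - z)"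
proof -
  have "closed (of_real ` {-1..1::real} :: complex set)"
    by (intro compact_imp_closed compact_continuous_image continuous_intros) auto
  then obtain d where d: "d > 0" "\<And>y. y \<in> of_real ` {-1..1::real} \<Longrightarrow> d \<le> dist w y"
    using separate_point_closed[OF _ assms] by blast
  have "d/2 \<le> norm (of_real x - z)" if "dist z w < d/2" "\<bar>x\<bar> \<le> 1" for z :: complex and x :: real
  proof -
    have "d \<le> dist w (of_real x)" using that by (intro d(2) imageI) auto
    also have "\<dots> \<le> dist z w + norm (of_real x - z)"
      using dist_triangle2[of w "of_real x" z] by (simp add: dist_norm norm_minus_commute dist_commute)
    finally show ?thesis using that(1) by linarith
  qed
  thus ?thesis using d(1) by (intro that[of "d/2"]) auto
qed

lemma integrable_cauchy_kernel:
  assumes f: "integrable lborel f" "supp1 f" and d: "d > 0" "\<And>x. \<bar>x\<bar> \<le> 1 \<Longrightarrow> d \<le> norm (of_real x - z)"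
    and h: "h \<in> borel_measurable borel" "\<And>x. \<bar>x\<bar> \<le> 1 \<Longrightarrow> norm (h x) \<le> B"
  shows "integrable lborel (\<lambda>x. f x * (h x / (of_real x - z)))"
    and "norm (LBINT x. f x * (h x / (of_real x - z))) \<le> (B / d) * (LBINT x. norm (f x))"
proof -
  have [measurable]: "f \<in> borel_measurable borel" "h \<in> borel_measurable borel" using f h by auto
  have b: "norm (f x * (h x / (of_real x - z))) \<le> (B / d) * norm (f x)" for x
  proof (cases "\<bar>x\<bar> \<le> 1")
    case True
    have "norm (h x) / norm (of_real x - z) \<le> B / d"
      using h(2)[OF True] d(2)[OF True] d(1) order_trans[OF norm_ge_zero h(2)[OF True]] by (intro frac_le) auto
    thus ?thesis using mult_right_mono[of "norm (h x) / norm (of_real x - z)" "B/d" "norm (f x)"]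
      by (simp add: norm_mult norm_divide mult.commute)
  next
    case False
    thus ?thesis using f(2) by (simp add: supp1_def)
  qed
  show i: "integrable lborel (\<lambda>x. f x * (h x / (of_real x - z)))"
    by (rule Bochner_Integration.integrable_bound[where f="\<lambda>x. (B/d) * norm (f x)"])
       (use f in \<open>auto intro!: AE_I2 order_trans[OF b abs_ge_self] simp del: times_divide_eq_left times_divide_eq_right\<close>)
  have "norm (LBINT x. f x * (h x / (of_real x - z))) \<le> (LBINT x. norm (f x * (h x / (of_real x - z))))"
    by (rule integral_norm_bound)
  also have "\<dots> \<le> (LBINT x. (B/d) * norm (f x))"
    using f i b by (intro integral_mono) auto
  finally show "norm (LBINT x. f x * (h x / (of_real x - z))) \<le> (B / d) * (LBINT x. norm (f x))" by simp
qed

text \<open>The resolvent identity, used twice, writes the error of the difference quotient as (z -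
  w) times an integral bounded by d^(-3) times the L^1 norm of f, so the error vanishes
  linearly.\<close>

lemma cauchy_transform_has_derivative:
  assumes f: "integrable lborel f" "supp1 f" and w: "w \<notin> of_real ` {-1..1::real}"
  shows "(cauchy_transform f has_field_derivative (LBINT x. f x / (of_real x - w)\<^sup>2)) (at w)"
proof -
  obtain d where d: "d > 0" "\<And>z x. dist z w < d \<Longrightarrow> \<bar>x\<bar> \<le> 1 \<Longrightarrow> d \<le> norm (of_real x - z)"
    using cauchy_kernel_gap[OF w] by blast
  have dw: "d \<le> norm (of_real x - w)" if "\<bar>x\<bar> \<le> 1" for x using d that by auto
  let ?D = "LBINT x. f x / (of_real x - w)\<^sup>2"
  let ?N = "LBINT x. norm (f x)"
  have bd: "norm ((cauchy_transform f z - cauchy_transform f w) / (z - w) - ?D) \<le> norm (z - w) * (1/d^3 * ?N)"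
    if z: "dist z w < d" "z \<noteq> w" for z
  proof -
    have dz: "d \<le> norm (of_real x - z)" if "\<bar>x\<bar> \<le> 1" for x using d z that by auto
    have p1: "norm (1 / (of_real x - w) ^ n) \<le> 1 / d ^ n" if "\<bar>x\<bar> \<le> 1" for x n
      using dw[OF that] d(1) by (auto simp: norm_divide norm_power intro!: frac_le power_mono)
    have h1: "(\<lambda>x. 1) \<in> borel_measurable borel" by simp
    have h2: "(\<lambda>x. 1 / (of_real x - w) ^ n) \<in> borel_measurable borel" for n by measurable
    note 1 = integrable_cauchy_kernel[OF f d(1) dz h1, of 1, simplified]
    note 2 = integrable_cauchy_kernel[OF f d(1) dw h1, of 1, simplified]
    note 3 = integrable_cauchy_kernel(1)[OF f d(1) dw h2[of 1] p1[of _ 1]]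
    note 4 = integrable_cauchy_kernel[OF f d(1) dz h2[of 2] p1[of _ 2]]
    have resolvent: "F * (1 / a) - F * (1 / b) = (b - a) * (F * (1 / b^1 / b) + (b - a) * (F * (1 / b^2 / a)))"
      if "a \<noteq> 0" "b \<noteq> 0" for a b F :: complex
      using that by (simp add: field_simps power2_eq_square)
    have eq: "f x * (1 / (of_real x - z)) - f x * (1 / (of_real x - w)) = (z - w) * (f x * (1/(of_real x - w)^1 / (of_real x - w)) + (z-w) * (f x * (1 / (of_real x - w)^2 / (of_real x - z))))" for x
    proof (cases "\<bar>x\<bar> < 1")
      case True
      hence "of_real x - z \<noteq> 0" "of_real x - w \<noteq> 0" using dz[of x] dw[of x] d(1) by auto
      thus ?thesis using resolvent[of "of_real x - z" "of_real x - w" "f x"] by simp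
    next
      case False
      thus ?thesis using f(2) by (simp add: supp1_def)
    qed
    have "cauchy_transform f z - cauchy_transform f w = (LBINT x. f x * (1 / (of_real x - z)) - f x * (1 / (of_real x - w)))"
      unfolding cauchy_transform_def using 1(1) 2(1) by (subst Bochner_Integration.integral_diff) auto
    also have "\<dots> = (z - w) * ((LBINT x. f x * (1/(of_real x - w)^1 / (of_real x - w))) + (z-w) * (LBINT x. f x * (1 / (of_real x - w)^2 / (of_real x - z))))"
      unfolding eq using 3 4(1) by (simp del: power_one_right times_divide_eq_right)
    also have "(LBINT x. f x * (1/(of_real x - w)^1 / (of_real x - w))) = ?D"
      by (simp add: power2_eq_square)
    finally have "(cauchy_transform f z - cauchy_transform f w) / (z - w) - ?D = (z-w) * (LBINT x. f x * (1 / (of_real x - w)^2 / (of_real x - z)))"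
      using z(2) by (simp add: field_simps)
    thus ?thesis using mult_left_mono[OF 4(2) norm_ge_zero[of "z-w"]] d(1)
      by (simp add: norm_mult power2_eq_square power3_eq_cube)
  qed
  have "((\<lambda>z. (cauchy_transform f z - cauchy_transform f w) / (z - w) - ?D) \<longlongrightarrow> 0) (at w)"
  proof (rule Lim_null_comparison)
    show "\<forall>\<^sub>F z in at w. norm ((cauchy_transform f z - cauchy_transform f w) / (z - w) - ?D) \<le> norm (z - w) * (1/d^3 * ?N)"
      unfolding eventually_at using d(1) bd by auto
    have "((\<lambda>z. norm (z - w) * (1/d^3 * ?N)) \<longlongrightarrow> norm (w - w) * (1/d^3 * ?N)) (at w)"
      by (intro tendsto_intros)
    thus "((\<lambda>z. norm (z - w) * (1/d^3 * ?N)) \<longlongrightarrow> 0) (at w)" by simp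
  qed
  hence "((\<lambda>z. (cauchy_transform f z - cauchy_transform f w) / (z - w)) \<longlongrightarrow> ?D) (at w)"
    by (simp add: LIM_zero_iff)
  thus ?thesis by (simp add: has_field_derivative_iff)
qed

lemma Im_nonzero_not_real: "Im z \<noteq> 0 \<Longrightarrow> z \<notin> of_real ` A"
  by auto

lemma cauchy_transform_bound:
  assumes f: "integrable lborel f" "supp1 f" and z: "norm z > 1"
  shows "norm (cauchy_transform f z) \<le> (LBINT x. norm (f x)) / (norm z - 1)"
proof -
  have "norm z - 1 \<le> norm (of_real x - z)" if "\<bar>x\<bar> \<le> 1" for x
    using norm_triangle_ineq2[of z "of_real x"] that by (simp add: norm_minus_commute)
  from integrable_cauchy_kernel(2)[OF f _ this, of "\<lambda>_. 1" 1] z show ?thesis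
    by (simp add: cauchy_transform_def mult.commute)
qed

section \<open>M. Riesz' theorem\<close>

text \<open>For 1 < r < 2 the angle r theta passes pi/2 while theta is still below pi/2. Up to the
  cut-off angle s, midway between pi/(2r) and pi/2, the cosine is bounded below and A pays for
  everything; beyond s one has cos (r theta) <= -k < 0, and B = 1/k alone yields 1.\<close>

lemma calderon_angle:
  fixes r :: real
  assumes "1 < r" "r < 2"
  shows "\<exists>A B. A \<ge> 0 \<and> B \<ge> 0 \<and> (\<forall>\<theta>. \<bar>\<theta>\<bar> < pi/2 \<longrightarrow> 1 \<le> A * cos \<theta> powr r - B * cos (r * \<theta>))"
proof -
  define s where "s = (pi/(2 * r) + pi/2) / 2"
  have "pi/(2 * r) < pi/2" using assms by (simp add: field_simps)
  hence s: "pi/(2 * r) < s" "s < pi/2" by (auto simp: s_def)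
  have s0: "s > 0" using s(1) assms by (meson divide_pos_pos less_trans mult_pos_pos pi_gt_zero zero_less_numeral zero_less_one)
  have rs: "pi/2 < r * s" using s(1) assms by (simp add: field_simps)
  have rs2: "r * s < pi" 
    using mult_strict_mono[of r 2 s "pi/2"] assms s s0 by simp
  define k where "k = - cos (r * s)"
  have k: "k > 0" unfolding k_def using cos_monotone_0_pi[of "pi/2" "r * s"] rs rs2 by simp
  define h where "h = cos s"
  have h: "h > 0" unfolding h_def using s s0 by (intro cos_gt_zero) auto
  define B where "B = 1/k"
  define A where "A = (1+B) / h powr r"
  have AB: "A \<ge> 0" "B \<ge> 0" using k h by (auto simp: A_def B_def)
  have "1 \<le> A * cos t powr r - B * cos (r * t)" if t: "0 \<le> t" "t < pi/2" for t
  proof (cases "t < s")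
    case True
    have "h \<le> cos t" unfolding h_def using True t s by (intro cos_monotone_0_pi_le) auto
    hence "h powr r \<le> cos t powr r" using h assms by (intro powr_mono2) auto
    hence "A * h powr r \<le> A * cos t powr r" using AB by (intro mult_left_mono)
    moreover have "A * h powr r = 1 + B" using h by (simp add: A_def)
    moreover have "B * cos (r * t) \<le> B * 1" using AB by (intro mult_left_mono) auto
    ultimately show ?thesis by linarith
  next
    case False
    have "r * t < pi" using mult_strict_mono[of r 2 t "pi/2"] assms t by simp
    hence "cos (r * t) \<le> cos (r * s)" using False rs assms s0 by (intro cos_monotone_0_pi_le) auto
    hence "B * cos (r * t) \<le> B * (-k)" using AB unfolding k_def by (intro mult_left_mono) auto
    also have "\<dots> = -1" using k by (simp add: B_def)
    finally have "B * cos (r * t) \<le> -1" .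
    moreover have "0 \<le> A * cos t powr r" using AB by simp
    ultimately show ?thesis by linarith
  qed
  note pos = this
  have "1 \<le> A * cos t powr r - B * cos (r * t)" if "\<bar>t\<bar> < pi/2" for t
    using that pos[of "\<bar>t\<bar>"] by (cases "t \<ge> 0") auto
  thus ?thesis using AB by blast
qed

text \<open>Splits |w|^r into a power of Re w, which for a Poisson integral is controlled by
  averaging, and the real part of w^r, which is analytic in w and can be integrated by Cauchy's
  theorem.\<close>

lemma calderon_inequality:
  fixes r :: real
  assumes "1 < r" "r < 2"
  obtains A B where "A \<ge> 0" "B \<ge> 0" 
    "\<And>w. Re w > 0 \<Longrightarrow> norm w powr r \<le> A * Re w powr r - B * Re (w powr of_real r)"
proof -
  obtain A B where AB: "A \<ge> 0" "B \<ge> 0" and ineq: "\<And>\<theta>. \<bar>\<theta>\<bar> < pi/2 \<Longrightarrow> 1 \<le> A * cos \<theta> powr r - B * cos (r * \<theta>)"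
    using calderon_angle[OF assms] by blast
  have "norm w powr r \<le> A * Re w powr r - B * Re (w powr of_real r)" if w: "Re w > 0" for w
  proof -
    have w0: "w \<noteq> 0" using w by auto
    define t where "t = Im (Ln w)"
    have t: "\<bar>t\<bar> < pi/2" unfolding t_def using Re_Ln_pos_lt_imp w by simp
    have "Re (exp (Ln w)) = exp (Re (Ln w)) * cos t" by (simp only: Re_exp t_def)
    hence Rw: "Re w = norm w * cos t" using w0 by simp
    have c: "cos t > 0" using t by (intro cos_gt_zero_pi) auto
    have "Re (w powr of_real r) = norm w powr r * cos (r * t)"
      using w0 by (simp add: powr_def Re_exp t_def)
    hence "A * Re w powr r - B * Re (w powr of_real r) = norm w powr r * (A * cos t powr r - B * cos (r * t))"
      using c by (simp add: Rw powr_mult algebra_simps)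
    also have "\<dots> \<ge> norm w powr r * 1" using ineq[OF t] by (intro mult_left_mono) auto
    finally show ?thesis by simp
  qed
  thus ?thesis using that AB by blast
qed

section \<open>L^r bounds for nonnegative densities\<close>

lemma poisson_kernel_total: "e > 0 \<Longrightarrow> d > 0 \<Longrightarrow> (LBINT x:{t-d..t+d}. poisson_kernel e (x-t)) \<le> pi"
  using poisson_kernel_integral[of e d t] arctan_ubound[of "d/e"] by simp

lemma nn_poisson_kernel: "e > 0 \<Longrightarrow> (\<integral>\<^sup>+x\<in>{a..b}. ennreal (poisson_kernel e (x-t)) \<partial>lborel) \<le> ennreal pi"
proof -
  assume e: "e > 0"
  define d where "d = \<bar>a\<bar> + \<bar>b\<bar> + \<bar>t\<bar> + 1"
  have d: "d > 0" unfolding d_def by linarith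
  have sub: "{a..b} \<subseteq> {t-d..t+d}" unfolding d_def by auto
  have "(\<integral>\<^sup>+x\<in>{a..b}. ennreal (poisson_kernel e (x-t)) \<partial>lborel) \<le> (\<integral>\<^sup>+x\<in>{t-d..t+d}. ennreal (poisson_kernel e (x-t)) \<partial>lborel)"
    using sub by (intro nn_integral_mono) (auto simp: indicator_def)
  also have "\<dots> = (\<integral>\<^sup>+x. ennreal (indicator {t-d..t+d} x *\<^sub>R poisson_kernel e (x-t)) \<partial>lborel)"
    by (intro nn_integral_cong) (auto simp: indicator_def)
  also have "\<dots> = ennreal (LBINT x:{t-d..t+d}. poisson_kernel e (x-t))"
  proof -
    have "integrable lborel (\<lambda>x. indicator {t-d..t+d} x * poisson_kernel e (x-t))"
      by (rule integrable_mult_bounded[where B="1/e"]) (use poisson_kernel_le(3)[OF e] in \<open>auto simp: emeasure_lborel_Icc_eq\<close>)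
    thus ?thesis unfolding set_lebesgue_integral_def
      using poisson_kernel_le(1)[OF e] by (intro nn_integral_eq_integral) auto
  qed
  also have "\<dots> \<le> ennreal pi" using poisson_kernel_total[OF e d] by (rule ennreal_leI)
  finally show ?thesis .
qed

text \<open>Plays the part of Hoelder's inequality with a free threshold c: above c the factor
  u^(1-r) is at most c^(1-r). The threshold is chosen at each use to balance the two terms.\<close>

lemma young_split:
  fixes u c r :: real
  assumes "u \<ge> 0" "c > 0" "r > 1"
  shows "u \<le> c + c powr (1 - r) * u powr r"
proof (cases "u \<le> c")
  case True
  thus ?thesis by (simp add: add_increasing2)
next
  case False
  hence u: "u > c" by simp
  have "u = u powr r * u powr (1 - r)" using u assms by (simp flip: powr_add)
  also have "\<dots> \<le> u powr r * c powr (1 - r)" using u assms by (intro mult_left_mono powr_mono2') auto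
  finally show ?thesis using assms by (simp add: mult.commute)
qed

text \<open>The factor -i makes the Poisson integral of f the real part of \<open>W\<close> in the
  upper half plane. It is nonnegative, and positive total mass makes it strictly positive, so the
  principal power of \<open>W\<close> is holomorphic there.\<close>

locale nonneg_density =
  fixes f :: "real \<Rightarrow> real" and F :: "real \<Rightarrow> complex" and W :: "complex \<Rightarrow> complex"
  assumes f: "integrable lborel f" and nonneg: "\<And>x. f x \<ge> 0" and supp: "\<And>x. 1 \<le> \<bar>x\<bar> \<Longrightarrow> f x = 0"
    and pos: "(LBINT x. f x) > 0"
  defines "F \<equiv> \<lambda>x. complex_of_real (f x)"
    and "W \<equiv> \<lambda>z. - \<i> * cauchy_transform F z"
begin

lemma F: "integrable lborel F" "supp1 F"
  using f supp by (auto simp: F_def supp1_def)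

lemma f_measurable [measurable]: "f \<in> borel_measurable borel"
  using f by auto

lemma integrable_poisson_real:
  "e > 0 \<Longrightarrow> integrable lborel (\<lambda>x. f x * poisson_kernel e (x - t))"
  by (rule integrable_mult_bounded[OF f, where B="1/e"]) (use poisson_kernel_le(3) in auto)

lemma Re_W: 
  assumes "e > 0"
  shows "Re (W (Complex t e)) = (LBINT x. f x * poisson_kernel e (x-t))" "Re (W (Complex t e)) > 0"
proof -
  have "poisson F e t = of_real (LBINT x. f x * poisson_kernel e (x-t))"
    unfolding poisson_def F_def by (simp flip: of_real_mult)
  moreover have "conj_poisson F e t = of_real (LBINT x. f x * conj_kernel e (x-t))"
    unfolding conj_poisson_def F_def by (simp flip: of_real_mult)
  ultimately show eq: "Re (W (Complex t e)) = (LBINT x. f x * poisson_kernel e (x-t))"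
    unfolding W_def cauchy_transform_upper[OF F(1) assms] by simp
  have pk: "poisson_kernel e u > 0" for u
    using assms by (simp add: poisson_kernel_def add_pos_nonneg)
  have "(LBINT x. f x * poisson_kernel e (x-t)) \<noteq> 0"
  proof
    assume "(LBINT x. f x * poisson_kernel e (x-t)) = 0"
    hence "AE x in lborel. f x * poisson_kernel e (x-t) = 0"
      using integral_nonneg_eq_0_iff_AE[OF integrable_poisson_real[OF assms]] nonneg pk
      by (simp add: less_imp_le)
    hence "AE x in lborel. f x = 0" by eventually_elim (use pk in \<open>auto simp: less_le\<close>)
    hence "(LBINT x. f x) = 0" using integral_eq_zero_AE by blast
    thus False using pos by simp
  qed
  moreover have "(LBINT x. f x * poisson_kernel e (x-t)) \<ge> 0"
    by (intro Bochner_Integration.integral_nonneg) (use nonneg pk in \<open>auto simp: less_imp_le\<close>)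
  ultimately show "Re (W (Complex t e)) > 0" using eq by simp
qed

lemma W_holomorphic: 
  assumes "Im z > 0"
  shows "W field_differentiable (at z)"
proof -
  have "cauchy_transform F field_differentiable (at z)"
    using cauchy_transform_has_derivative[OF F Im_nonzero_not_real[of z]] assms
    by (auto simp: field_differentiable_def)
  thus ?thesis unfolding W_def by (intro derivative_intros)
qed

lemma W_continuous: "e > 0 \<Longrightarrow> continuous_on UNIV (\<lambda>t. W (Complex t e))"
proof -
  assume e: "e > 0"
  have "isCont (\<lambda>t. W (Complex t e)) t" for t
  proof -
    have "isCont W (Complex t e)" using W_holomorphic[of "Complex t e"] e by (simp add: field_differentiable_imp_continuous_at)
    moreover have "isCont (\<lambda>t. Complex t e) t" unfolding Complex_eq by (intro continuous_intros)
    ultimately show ?thesis by (rule isCont_o2[rotated])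
  qed
  thus ?thesis by (simp add: continuous_at_imp_continuous_on)
qed

text \<open>Cauchy's theorem on a half disc, with the argument of \<open>W\<close> raised by e to
  stay off the real line. On the arc \<open>W\<close> is at most the mass divided by R - 1, so the
  bound has order R^(1-r) and vanishes as R grows once r > 1.\<close>

lemma W_powr_contour:
  assumes R: "R > 2" and e: "e > 0" and r: "r > 0"
  shows "norm (integral {-R..R} (\<lambda>t. W (Complex t e) powr of_real r)) \<le> pi * R * ((LBINT x. f x) / (R-1)) powr r"
proof -
  define g where "g = (\<lambda>z. W (z + \<i> * of_real e) powr of_real r)"
  have g: "g holomorphic_on {z. Im z > -e}"
  proof -
    have "(\<lambda>z. W (z + \<i> * of_real e)) field_differentiable (at z)" if "Im z > -e" for z
    proof -
      have "(\<lambda>z. z + \<i> * of_real e) field_differentiable (at z)" by (intro derivative_intros)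
      from field_differentiable_compose[OF this W_holomorphic] that show ?thesis by (simp add: o_def)
    qed
    moreover have "W (z + \<i> * of_real e) \<notin> \<real>\<^sub>\<le>\<^sub>0" if "Im z > -e" for z
    proof -
      have "z + \<i> * of_real e = Complex (Re z) (Im z + e)" by (simp add: complex_eq_iff)
      thus ?thesis using Re_W(2)[of "Im z + e" "Re z"] that by (auto simp: complex_nonpos_Reals_iff)
    qed
    ultimately show ?thesis unfolding g_def
      by (intro holomorphic_on_powr holomorphic_intros) (auto simp: holomorphic_on_def field_differentiable_at_within)
  qed
  let ?L = "linepath (of_real (-R)) (of_real R) :: real \<Rightarrow> complex"
  let ?C = "part_circlepath 0 R 0 pi"
  have imL: "path_image ?L \<subseteq> {z. Im z > -e}"
  proof -
    have "Im z = 0" if "z \<in> closed_segment (complex_of_real (-R)) (of_real R)" for z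
      using that by (auto simp: in_segment)
    thus ?thesis using e by (auto simp: path_image_linepath)
  qed
  have imC: "z \<in> path_image ?C \<Longrightarrow> Im z \<ge> 0 \<and> norm z = R" for z
  proof -
    assume "z \<in> path_image ?C"
    then obtain y where y': "z = ?C y" and "y \<in> {0..1}" unfolding path_image_def by blast
    hence y: "z = R * exp (\<i> * (of_real y * of_real pi))" "0 \<le> y" "y \<le> 1"
      by (simp_all add: part_circlepath_def linepath_def)
    have "0 \<le> sin (y * pi)" using y by (intro sin_ge_zero) auto
    thus ?thesis using R y by (simp add: Im_exp norm_mult flip: of_real_mult)
  qed
  have ends: "pathstart ?C = pathfinish ?L" "pathfinish ?C = pathstart ?L"
    using R by (auto simp: exp_Euler)
  have "(g has_contour_integral 0) (?L +++ ?C)"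
  proof (rule Cauchy_theorem_convex_simple[OF g])
    show "convex {z. Im z > -e}" by (rule convex_halfspace_Im_gt)
    show "path_image (?L +++ ?C) \<subseteq> {z. Im z > -e}"
      using imL imC e by (subst path_image_join) (force simp: ends)+
  qed (use ends in auto)
  moreover have "g contour_integrable_on ?L"
    by (rule contour_integrable_continuous_linepath)
       (use imL g in \<open>auto intro: holomorphic_on_imp_continuous_on continuous_on_subset simp: path_image_linepath\<close>)
  moreover have C: "g contour_integrable_on ?C"
    using imC e by (intro contour_integrable_continuous_part_circlepath continuous_on_subset[OF holomorphic_on_imp_continuous_on[OF g]]) force
  ultimately have "contour_integral ?L g + contour_integral ?C g = 0"
    using contour_integral_unique[of g 0 "?L +++ ?C"] ends by (simp add: contour_integral_join)
  hence "norm (contour_integral ?L g) = norm (contour_integral ?C g)"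
    by (simp add: add_eq_0_iff)
  also have "\<dots> \<le> ((LBINT x. f x) / (R-1)) powr r * R * \<bar>pi - 0\<bar>"
  proof (rule contour_integral_bound_part_circlepath[OF C])
    fix z assume z: "z \<in> path_image ?C"
    let ?z = "z + \<i> * of_real e"
    have "(norm z)\<^sup>2 \<le> (norm ?z)\<^sup>2" using conjunct1[OF imC[OF z]] e by (simp add: cmod_power2 power2_sum)
    hence n: "norm ?z \<ge> R" using imC[OF z] using power2_le_imp_le[OF _ norm_ge_zero] by auto
    have "norm (W ?z) \<le> (LBINT x. norm (F x)) / (norm ?z - 1)"
      unfolding W_def using cauchy_transform_bound[OF F, of ?z] n R by (simp add: norm_mult)
    also have "(LBINT x. norm (F x)) = (LBINT x. f x)" using nonneg by (simp add: F_def)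
    also have "(LBINT x. f x) / (norm ?z - 1) \<le> (LBINT x. f x) / (R - 1)"
      using n R pos by (intro divide_left_mono) auto
    finally have "norm (W ?z) \<le> (LBINT x. f x) / (R - 1)" .
    thus "norm (g z) \<le> ((LBINT x. f x) / (R-1)) powr r"
      unfolding g_def using r by (subst norm_powr_real_powr') (auto intro: powr_mono2)
  qed (use R in auto)
  also have "contour_integral ?L g = integral {-R..R} (\<lambda>t. g (of_real t))"
    using R by (subst contour_integral_linepath_Reals_eq) auto
  also have "(\<lambda>t. g (of_real t)) = (\<lambda>t. W (Complex t e) powr of_real r)"
    unfolding g_def Complex_eq by simp
  finally show ?thesis by (simp add: mult_ac)
qed

text \<open>Jensen's inequality for a kernel of mass at most pi, up to a factor 2^r; it results from
  \<open>young_split\<close> by optimising the threshold.\<close>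

lemma poisson_powr_le:
  assumes e: "e > 0" and r: "r > 1" and fr: "integrable lborel (\<lambda>x. f x powr r)"
  shows "Re (W (Complex t e)) powr r \<le> (2 * pi) powr r / pi * (LBINT x. f x powr r * poisson_kernel e (x-t))"
proof -
  define u where "u = Re (W (Complex t e))"
  define J where "J = (LBINT x. f x powr r * poisson_kernel e (x-t))"
  have u: "u > 0" "u = (LBINT x. f x * poisson_kernel e (x-t))" using Re_W[OF e] by (auto simp: u_def)
  have Ji: "integrable lborel (\<lambda>x. f x powr r * poisson_kernel e (x-t))"
    by (rule integrable_mult_bounded[OF fr, where B="1/e"]) (use poisson_kernel_le(3)[OF e] in auto)
  have J0: "J \<ge> 0" unfolding J_def using poisson_kernel_le(1)[OF e] 
    by (intro Bochner_Integration.integral_nonneg) auto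
  have key: "u \<le> c * pi + c powr (1 - r) * J" if c: "c > 0" for c
  proof -
    let ?I = "{t-(1+\<bar>t\<bar>)..t+(1+\<bar>t\<bar>)}"
    have Ii: "integrable lborel (\<lambda>x. indicator ?I x * poisson_kernel e (x-t))"
      by (rule integrable_mult_bounded[where B="1/e"]) (use poisson_kernel_le(3)[OF e] in \<open>auto simp: emeasure_lborel_Icc_eq\<close>)
    have "u \<le> (LBINT x. c * (indicator ?I x * poisson_kernel e (x-t)) + c powr (1 - r) * (f x powr r * poisson_kernel e (x-t)))"
      unfolding u(2)
    proof (rule integral_mono[OF integrable_poisson_real[OF e]])
      fix x
      show "f x * poisson_kernel e (x-t) \<le> c * (indicator ?I x * poisson_kernel e (x-t)) + c powr (1 - r) * (f x powr r * poisson_kernel e (x-t))"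
      proof (cases "\<bar>x\<bar> < 1")
        case True
        hence "x \<in> ?I" by auto
        thus ?thesis using mult_right_mono[OF young_split[OF nonneg c r, of x] poisson_kernel_le(1)[OF e, of "x-t"]]
          by (simp add: algebra_simps)
      next
        case False
        thus ?thesis using supp[of x] poisson_kernel_le(1)[OF e] c by (simp add: indicator_def)
      qed
    qed (use Ii Ji in auto)
    also have "\<dots> = c * (LBINT x:?I. poisson_kernel e (x-t)) + c powr (1 - r) * J"
      using Ii Ji by (simp add: J_def set_lebesgue_integral_def)
    also have "\<dots> \<le> c * pi + c powr (1 - r) * J"
      using c by (intro add_right_mono mult_left_mono poisson_kernel_total e) auto
    finally show ?thesis .
  qed
  \<comment> \<open>If J were 0, the threshold u / (2 pi) would give u <= u/2.\<close>
  have Jpos: "J > 0"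
  proof (rule ccontr)
    assume "\<not> J > 0"
    hence "u \<le> u / (2*pi) * pi" using key[of "u / (2*pi)"] u(1) J0 by simp
    thus False using u(1) by simp
  qed
  \<comment> \<open>Balances the two terms of \<open>key\<close>: c^(1-r) J equals c pi.\<close>
  define c where "c = (J/pi) powr (1/r)"
  have c: "c > 0" using Jpos by (simp add: c_def)
  have cr: "c powr r = J / pi" using r Jpos by (simp add: c_def powr_powr)
  have "c powr (1 - r) * J = c * (J / c powr r)" using c by (simp add: powr_diff)
  also have "\<dots> = c * pi" using cr Jpos by simp
  finally have "u \<le> (2 * pi) * c" using key[OF c] by simp
  hence "u powr r \<le> ((2 * pi) * c) powr r" using u r by (intro powr_mono2) auto
  also have "\<dots> = (2*pi) powr r * (J / pi)" using c by (simp add: powr_mult cr)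
  finally show ?thesis by (simp add: u_def J_def)
qed

text \<open>Tonelli's theorem on the pointwise bound: the mass pi of the kernel in its other
  variable cancels the 1/pi, and the result depends on neither e nor R.\<close>

lemma poisson_powr_integral:
  assumes e: "e > 0" and r: "r > 1" and fr: "integrable lborel (\<lambda>x. f x powr r)"
  shows "(\<integral>\<^sup>+t\<in>{-R..R}. ennreal (Re (W (Complex t e)) powr r) \<partial>lborel) \<le> ennreal ((2 * pi) powr r * (LBINT x. f x powr r))"
proof -
  have "(\<integral>\<^sup>+t\<in>{-R..R}. ennreal (Re (W (Complex t e)) powr r) \<partial>lborel) 
     \<le> (\<integral>\<^sup>+t\<in>{-R..R}. ennreal ((2 * pi) powr r / pi) * (\<integral>\<^sup>+x. ennreal (f x powr r * poisson_kernel e (x-t)) \<partial>lborel) \<partial>lborel)"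
  proof (intro nn_integral_mono mult_right_mono)
    fix t
    have Ji: "integrable lborel (\<lambda>x. f x powr r * poisson_kernel e (x-t))"
      by (rule integrable_mult_bounded[OF fr, where B="1/e"]) (use poisson_kernel_le(3)[OF e] in auto)
    have "ennreal (Re (W (Complex t e)) powr r) \<le> ennreal ((2 * pi) powr r / pi * (LBINT x. f x powr r * poisson_kernel e (x-t)))"
      by (intro ennreal_leI poisson_powr_le e r fr)
    also have "\<dots> = ennreal ((2 * pi) powr r / pi) * ennreal (LBINT x. f x powr r * poisson_kernel e (x-t))"
      by (rule ennreal_mult) (auto intro!: Bochner_Integration.integral_nonneg poisson_kernel_le[OF e] mult_nonneg_nonneg)
    also have "ennreal (LBINT x. f x powr r * poisson_kernel e (x-t)) = (\<integral>\<^sup>+x. ennreal (f x powr r * poisson_kernel e (x-t)) \<partial>lborel)"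
      by (rule nn_integral_eq_integral[symmetric, OF Ji]) (auto intro!: poisson_kernel_le[OF e] mult_nonneg_nonneg)
    finally show "ennreal (Re (W (Complex t e)) powr r) \<le> ennreal ((2 * pi) powr r / pi) * (\<integral>\<^sup>+x. ennreal (f x powr r * poisson_kernel e (x-t)) \<partial>lborel)" .
  qed auto
  also have "\<dots> = ennreal ((2 * pi) powr r / pi) * (\<integral>\<^sup>+t. (\<integral>\<^sup>+x. ennreal (f x powr r) * (ennreal (poisson_kernel e (x-t)) * indicator {-R..R} t) \<partial>lborel) \<partial>lborel)"
    by (simp add: nn_integral_cmult ennreal_mult'' poisson_kernel_le[OF e] nn_integral_multc mult_ac flip: nn_integral_cmult nn_integral_multc)
  also have "(\<integral>\<^sup>+t. (\<integral>\<^sup>+x. ennreal (f x powr r) * (ennreal (poisson_kernel e (x-t)) * indicator {-R..R} t) \<partial>lborel) \<partial>lborel)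
     = (\<integral>\<^sup>+x. (\<integral>\<^sup>+t. ennreal (f x powr r) * (ennreal (poisson_kernel e (x-t)) * indicator {-R..R} t) \<partial>lborel) \<partial>lborel)"
    by (rule lborel_pair.Fubini') measurable
  also have "\<dots> = (\<integral>\<^sup>+x. ennreal (f x powr r) * (\<integral>\<^sup>+t\<in>{-R..R}. ennreal (poisson_kernel e (t-x)) \<partial>lborel) \<partial>lborel)"
    by (intro nn_integral_cong) (simp add: nn_integral_cmult poisson_kernel_def power2_commute)
  also have "\<dots> \<le> (\<integral>\<^sup>+x. ennreal (f x powr r) * ennreal pi \<partial>lborel)"
    by (intro nn_integral_mono mult_left_mono nn_poisson_kernel e) auto
  also have "\<dots> = ennreal (LBINT x. f x powr r) * ennreal pi"
    using fr by (subst nn_integral_multc) (auto simp: nn_integral_eq_integral)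
  finally have "(\<integral>\<^sup>+t\<in>{-R..R}. ennreal (Re (W (Complex t e)) powr r) \<partial>lborel) \<le> ennreal ((2 * pi) powr r / pi) * (ennreal (LBINT x. f x powr r) * ennreal pi)"
    by (simp add: mult_left_mono)
  also have "\<dots> = ennreal ((2 * pi) powr r / pi * ((LBINT x. f x powr r) * pi))"
    by (subst ennreal_mult | simp add: Bochner_Integration.integral_nonneg)+
  finally show ?thesis by simp
qed

text \<open>Calderon's inequality is integrated over [-R,R] and R is sent to infinity. The analytic
  term disappears and the averaged power of the density remains, with a constant free of e.\<close>

lemma powr_cauchy_transform_integral:
  assumes e: "e > 0" and r: "1 < r" "r < 2" and fr: "integrable lborel (\<lambda>x. f x powr r)"
    and AB: "A \<ge> 0" "B \<ge> 0" "\<And>w. Re w > 0 \<Longrightarrow> norm w powr r \<le> A * Re w powr r - B * Re (w powr of_real r)"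
  shows "(LBINT t:{-1..1}. norm (cauchy_transform F (Complex t e)) powr r) \<le> A * (2 * pi) powr r * (LBINT x. f x powr r)"
proof -
  define w where "w t = W (Complex t e)" for t
  have wpos: "Re (w t) > 0" for t unfolding w_def by (rule Re_W(2)[OF e])
  have w0: "w t \<noteq> 0" for t using wpos[of t] by auto
  have wc: "continuous_on S w" for S unfolding w_def
    using W_continuous[OF e] continuous_on_subset by blast
  have c1: "continuous_on S (\<lambda>t. norm (w t) powr r)" for S
    using w0 by (intro continuous_intros wc) auto
  have c2: "continuous_on S (\<lambda>t. Re (w t) powr r)" for S
    using wpos by (intro continuous_intros wc) (auto simp: less_imp_neq less_le)
  have c3: "continuous_on S (\<lambda>t. w t powr of_real r)" for S
    using wpos by (intro continuous_on_powr_complex wc continuous_intros) (use w0 r in \<open>auto simp: complex_nonpos_Reals_iff less_imp_le less_le\<close>)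
  let ?J = "LBINT x. f x powr r"
  have J0: "?J \<ge> 0" by (intro Bochner_Integration.integral_nonneg) auto
  have c2': "set_integrable lborel {a..b} (\<lambda>t. Re (w t) powr r)" for a b
    by (rule borel_integrable_atLeastAtMost'[OF c2])
  have i2: "integral {-R..R} (\<lambda>t. Re (w t) powr r) \<le> (2 * pi) powr r * ?J" for R
  proof -
    have "(LBINT t:{-R..R}. Re (w t) powr r) \<le> (2 * pi) powr r * ?J"
    proof -
      have "ennreal (LBINT t:{-R..R}. Re (w t) powr r) = (\<integral>\<^sup>+t. ennreal (indicator {-R..R} t *\<^sub>R (Re (w t) powr r)) \<partial>lborel)"
        unfolding set_lebesgue_integral_def
        by (rule nn_integral_eq_integral[symmetric]) (use c2' in \<open>auto simp: set_integrable_def\<close>)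
      also have "\<dots> = (\<integral>\<^sup>+t\<in>{-R..R}. ennreal (Re (W (Complex t e)) powr r) \<partial>lborel)"
        unfolding w_def by (intro nn_integral_cong) (auto simp: indicator_def)
      also have "\<dots> \<le> ennreal ((2 * pi) powr r * ?J)" by (rule poisson_powr_integral[OF e r(1) fr])
      finally show ?thesis using J0 by (subst (asm) ennreal_le_iff) auto
    qed
    thus ?thesis using set_borel_integral_eq_integral(2)[OF c2'] by simp
  qed
  have main: "integral {-1..1} (\<lambda>t. norm (w t) powr r) \<le> A * ((2 * pi) powr r * ?J) + B * (pi * R * ((LBINT x. f x) / (R-1)) powr r)"
    if R: "R > 2" for R
  proof -
    have "integral {-1..1} (\<lambda>t. norm (w t) powr r) \<le> integral {-R..R} (\<lambda>t. norm (w t) powr r)"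
      using R by (intro integral_subset_le integrable_continuous_real c1) auto
    also have "\<dots> \<le> integral {-R..R} (\<lambda>t. A * Re (w t) powr r - B * Re (w t powr of_real r))"
      using wpos AB(3) by (intro integral_le integrable_continuous_real continuous_intros c1 c2 c3) auto
    also have "\<dots> = A * integral {-R..R} (\<lambda>t. Re (w t) powr r) - B * integral {-R..R} (\<lambda>t. Re (w t powr of_real r))"
      by (subst Henstock_Kurzweil_Integration.integral_diff)
         (auto intro!: integrable_continuous_real continuous_intros c2 c3)
    also have "integral {-R..R} (\<lambda>t. Re (w t powr of_real r)) = Re (integral {-R..R} (\<lambda>t. w t powr of_real r))"
      using integral_linear[OF integrable_continuous_real[OF c3] bounded_linear_Re] by (simp add: o_def)
    also have "A * integral {-R..R} (\<lambda>t. Re (w t) powr r) \<le> A * ((2 * pi) powr r * ?J)"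
      by (intro mult_left_mono i2 AB)
    finally have "integral {-1..1} (\<lambda>t. norm (w t) powr r) 
       \<le> A * ((2 * pi) powr r * ?J) - B * Re (integral {-R..R} (\<lambda>t. w t powr of_real r))" by simp
    moreover have "- (B * Re (integral {-R..R} (\<lambda>t. w t powr of_real r))) \<le> B * (pi * R * ((LBINT x. f x) / (R-1)) powr r)"
    proof -
      have "- Re (integral {-R..R} (\<lambda>t. w t powr of_real r)) \<le> norm (integral {-R..R} (\<lambda>t. w t powr of_real r))"
        using abs_Re_le_cmod[of "integral {-R..R} (\<lambda>t. w t powr of_real r)"] by linarith
      also have "\<dots> \<le> pi * R * ((LBINT x. f x) / (R-1)) powr r"
        unfolding w_def using R r by (intro W_powr_contour e) auto
      finally show ?thesis using mult_left_mono[OF _ AB(2)] by fastforce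
    qed
    ultimately show ?thesis by linarith
  qed
  have lim: "((\<lambda>R. A * ((2 * pi) powr r * ?J) + B * (pi * R * ((LBINT x. f x) / (R-1)) powr r)) \<longlongrightarrow> A * ((2 * pi) powr r * ?J) + B * 0) at_top"
  proof (intro tendsto_intros)
    have "((\<lambda>R. pi * R * (I / (R-1)) powr r) \<longlongrightarrow> 0) at_top" if "I > 0" for I :: real
      using that r by real_asymp
    thus "((\<lambda>R. pi * R * ((LBINT x. f x) / (R-1)) powr r) \<longlongrightarrow> 0) at_top" using pos by simp
  qed
  have "integral {-1..1} (\<lambda>t. norm (w t) powr r) \<le> A * ((2 * pi) powr r * ?J) + B * 0"
    by (rule tendsto_lowerbound[OF lim]) (auto intro!: eventually_mono[OF eventually_gt_at_top[of 2]] main)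
  moreover have "(LBINT t:{-1..1}. norm (w t) powr r) = integral {-1..1} (\<lambda>t. norm (w t) powr r)"
    by (rule set_borel_integral_eq_integral(2)[OF borel_integrable_atLeastAtMost'[OF c1]])
  ultimately show ?thesis by (simp add: w_def W_def norm_mult)
qed

end

section \<open>Uniform bounds for conjugate Poisson integrals\<close>

lemma conj_poisson_add:
  assumes "integrable lborel f" "integrable lborel g" "e > 0"
  shows "conj_poisson (\<lambda>x. f x + g x) e t = conj_poisson f e t + conj_poisson g e t"
  unfolding conj_poisson_def distrib_right
  by (rule Bochner_Integration.integral_add[OF integrable_conj_kernel integrable_conj_kernel]) fact+

lemma conj_poisson_diff:
  assumes "integrable lborel f" "integrable lborel g" "e > 0"
  shows "conj_poisson (\<lambda>x. f x - g x) e t = conj_poisson f e t - conj_poisson g e t"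
  unfolding conj_poisson_def left_diff_distrib
  by (rule Bochner_Integration.integral_diff[OF integrable_conj_kernel integrable_conj_kernel]) fact+

lemma conj_poisson_cmult:
  "conj_poisson (\<lambda>x. c * f x) e t = c * conj_poisson f e t"
  unfolding conj_poisson_def by (simp add: mult.assoc)

lemma conj_poisson_eq:
  assumes "integrable lborel f" "e > 0"
  shows "conj_poisson f e t = (cauchy_transform f (Complex t e) + cauchy_transform f (Complex t (-e))) / 2"
  unfolding cauchy_transform_upper[OF assms] by simp

lemma cauchy_transform_line_continuous:
  assumes "integrable lborel f" "supp1 f" "e \<noteq> 0"
  shows "continuous_on S (\<lambda>t. cauchy_transform f (Complex t e))"
proof -
  have "isCont (\<lambda>t. cauchy_transform f (Complex t e)) t" for t
  proof -
    have "isCont (cauchy_transform f) (Complex t e)"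
      by (rule DERIV_isCont[OF cauchy_transform_has_derivative[OF assms(1,2) Im_nonzero_not_real]])
         (simp add: assms(3))
    moreover have "isCont (\<lambda>t. Complex t e) t" unfolding Complex_eq by (intro continuous_intros)
    ultimately show ?thesis by (rule isCont_o2[rotated])
  qed
  thus ?thesis by (simp add: continuous_at_imp_continuous_on)
qed

lemma conj_poisson_continuous:
  assumes "integrable lborel f" "supp1 f" "e > 0"
  shows "continuous_on S (\<lambda>t. conj_poisson f e t)"
  unfolding conj_poisson_eq[OF assms(1,3)]
  using assms by (intro continuous_intros cauchy_transform_line_continuous) auto

lemma conj_poisson_measurable:
  assumes "integrable lborel f" "supp1 f" "e > 0"
  shows "(\<lambda>t. conj_poisson f e t) \<in> borel_measurable borel"
  by (rule borel_measurable_continuous_onI[OF conj_poisson_continuous[OF assms]])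

lemma conj_poisson_set_integrable:
  assumes "integrable lborel f" "supp1 f" "e > 0"
  shows "set_integrable lborel {a..b} (\<lambda>t. conj_poisson f e t)"
  by (rule borel_integrable_atLeastAtMost'[OF conj_poisson_continuous[OF assms]])

text \<open>For a real density the conjugate Poisson integral is the real part of the Cauchy
  transform and is dominated by its modulus. The constant A (2 pi)^r depends on r only.\<close>

lemma riesz_nonneg:
  fixes r :: real
  assumes r: "1 < r" "r < 2"
  obtains C where "C \<ge> 0"
    "\<And>f e. \<lbrakk>integrable lborel f; \<And>x. f x \<ge> 0; \<And>x. 1 \<le> \<bar>x\<bar> \<Longrightarrow> f x = 0;
       integrable lborel (\<lambda>x. f x powr r); e > 0\<rbrakk> \<Longrightarrow>
     (LBINT t:{-1..1}. norm (conj_poisson (\<lambda>x. of_real (f x)) e t) powr r) \<le> C * (LBINT x. f x powr r)"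
proof -
  obtain A B where AB: "A \<ge> 0" "B \<ge> 0"
    "\<And>w. Re w > 0 \<Longrightarrow> norm w powr r \<le> A * Re w powr r - B * Re (w powr of_real r)"
    using calderon_inequality[OF r] by blast
  have "(LBINT t:{-1..1}. norm (conj_poisson (\<lambda>x. of_real (f x)) e t) powr r) \<le> (A * (2 * pi) powr r) * (LBINT x. f x powr r)"
    if f: "integrable lborel f" "\<And>x. f x \<ge> 0" "\<And>x. 1 \<le> \<bar>x\<bar> \<Longrightarrow> f x = 0"
       "integrable lborel (\<lambda>x. f x powr r)" "e > 0" for f :: "real \<Rightarrow> real" and e
  proof (cases "(LBINT x. f x) > 0")
    case True
    let ?F = "\<lambda>x. complex_of_real (f x)"
    interpret N: nonneg_density f ?F "\<lambda>z. - \<i> * cauchy_transform ?F z"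
      using f True by unfold_locales auto
    have "norm (conj_poisson ?F e t) powr r \<le> norm (cauchy_transform ?F (Complex t e)) powr r" for t
    proof -
      have "conj_poisson ?F e t = of_real (LBINT x. f x * conj_kernel e (x-t))"
        "poisson ?F e t = of_real (LBINT x. f x * poisson_kernel e (x-t))"
        unfolding poisson_def conj_poisson_def by (simp_all flip: of_real_mult)
      hence "norm (conj_poisson ?F e t) = \<bar>Re (cauchy_transform ?F (Complex t e))\<bar>"
        unfolding cauchy_transform_upper[OF N.F(1) f(5)] by simp
      thus ?thesis using abs_Re_le_cmod r by (intro powr_mono2) auto
    qed
    hence "(LBINT t:{-1..1}. norm (conj_poisson ?F e t) powr r) \<le> (LBINT t:{-1..1}. norm (cauchy_transform ?F (Complex t e)) powr r)"
      using r f(5) by (intro set_integral_mono borel_integrable_atLeastAtMost' continuous_on_powr' continuous_intros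
        conj_poisson_continuous N.F cauchy_transform_line_continuous) auto
    also have "\<dots> \<le> A * (2 * pi) powr r * (LBINT x. f x powr r)"
      by (rule N.powr_cauchy_transform_integral[OF f(5) r f(4) AB])
    finally show ?thesis .
  next
    \<comment> \<open>Zero mass falls outside the locale, where positivity of \<open>W\<close> is
      strict; the density then vanishes almost everywhere.\<close>
    case False
    moreover have "(LBINT x. f x) \<ge> 0" using f(2) by (intro Bochner_Integration.integral_nonneg) auto
    ultimately have "(LBINT x. f x) = 0" by simp
    hence ae: "AE x in lborel. f x = 0"
      using integral_nonneg_eq_0_iff_AE[OF f(1)] f(2) by auto
    have "conj_poisson (\<lambda>x. of_real (f x)) e t = 0" for t
      unfolding conj_poisson_def by (rule integral_eq_zero_AE) (use ae in \<open>eventually_elim, simp\<close>)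
    thus ?thesis using AB r by (simp add: set_lebesgue_integral_def Bochner_Integration.integral_nonneg)
  qed
  thus ?thesis using that[of "A * (2*pi) powr r"] AB by simp
qed

text \<open>Turns the L^r estimate into smallness in L^1, uniformly in e. On [-1,1], of length 2,
  the threshold eta of \<open>young_split\<close> costs 2 eta and the power term at most eta; the
  positive and negative parts of real and imaginary part make four such bounds, 12 eta in all, while
  eta is 1/16 of the target.\<close>

lemma conj_poisson_small:
  fixes r :: real
  assumes r: "1 < r" "r < 2" and eps: "\<epsilon> > 0"
  obtains \<delta> where "\<delta> > 0"
    "\<And>g e. \<lbrakk>integrable lborel g; supp1 g; integrable lborel (\<lambda>x. norm (g x) powr r); 
       (LBINT x. norm (g x) powr r) < \<delta>; e > 0\<rbrakk> \<Longrightarrow> (LBINT t:{-1..1}. norm (conj_poisson g e t)) < \<epsilon>"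
proof -
  obtain C where C: "C \<ge> 0" "\<And>f e. \<lbrakk>integrable lborel f; \<And>x. f x \<ge> 0; \<And>x. 1 \<le> \<bar>x\<bar> \<Longrightarrow> f x = 0;
       integrable lborel (\<lambda>x. f x powr r); e > 0\<rbrakk> \<Longrightarrow>
     (LBINT t:{-1..1}. norm (conj_poisson (\<lambda>x. of_real (f x)) e t) powr r) \<le> C * (LBINT x. f x powr r)"
    using riesz_nonneg[OF r] by blast
  define \<eta> where "\<eta> = \<epsilon> / 16"
  have eta: "\<eta> > 0" using eps by (simp add: \<eta>_def)
  \<comment> \<open>Solves eta^(1-r) (C + 1) delta = eta; C + 1 in place of C avoids a zero
    denominator.\<close>
  define \<delta> where "\<delta> = \<eta> / (\<eta> powr (1-r) * (C + 1))"
  have delta: "\<delta> > 0" using eta C by (simp add: \<delta>_def)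
  have part: "(LBINT t:{-1..1}. norm (conj_poisson (\<lambda>x. of_real (f x)) e t)) \<le> 3 * \<eta>"
    if f: "integrable lborel f" "\<And>x. f x \<ge> 0" "\<And>x. 1 \<le> \<bar>x\<bar> \<Longrightarrow> f x = 0"
       "integrable lborel (\<lambda>x. f x powr r)" "(LBINT x. f x powr r) < \<delta>" "e > 0" for f :: "real \<Rightarrow> real" and e
  proof -
    let ?F = "\<lambda>x. complex_of_real (f x)"
    have F: "integrable lborel ?F" "supp1 ?F" using f by (auto simp: supp1_def)
    have cpi: "set_integrable lborel {-1..1} (\<lambda>t. norm (conj_poisson ?F e t) powr r)"
      using r by (intro borel_integrable_atLeastAtMost' continuous_on_powr' continuous_intros conj_poisson_continuous F f(6)) auto
    have ci: "set_integrable lborel {-1..1::real} (\<lambda>t. \<eta>)"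
      by (intro borel_integrable_atLeastAtMost' continuous_intros)
    have "(LBINT t:{-1..1}. norm (conj_poisson ?F e t)) \<le> (LBINT t:{-1..1}. \<eta> + \<eta> powr (1-r) * norm (conj_poisson ?F e t) powr r)"
      by (intro set_integral_mono set_integrable_norm conj_poisson_set_integrable F f(6) set_integral_add(1) ci 
         set_integrable_mult_right cpi young_split eta r norm_ge_zero)
    also have "\<dots> = (LBINT t:{-1..1::real}. \<eta>) + (LBINT t:{-1..1}. \<eta> powr (1-r) * norm (conj_poisson ?F e t) powr r)"
      by (intro set_integral_add(2) ci set_integrable_mult_right cpi)
    also have "(LBINT t:{-1..1}. \<eta> powr (1-r) * norm (conj_poisson ?F e t) powr r) = \<eta> powr (1-r) * (LBINT t:{-1..1}. norm (conj_poisson ?F e t) powr r)"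
      by simp
    also have "\<dots> \<le> \<eta> powr (1-r) * (C * \<delta>)"
      using C(2)[OF f(1-4,6)] mult_left_mono[OF less_imp_le[OF f(5)] C(1)]
      by (intro mult_left_mono) auto
    also have "\<dots> \<le> \<eta> powr (1-r) * ((C+1) * \<delta>)" using delta by (intro mult_left_mono mult_right_mono) auto
    also have "\<dots> = \<eta>" unfolding \<delta>_def using C(1) eta by simp
    finally show ?thesis by (simp add: set_lebesgue_integral_def)
  qed
  have "(LBINT t:{-1..1}. norm (conj_poisson g e t)) < \<epsilon>"
    if g: "integrable lborel g" "supp1 g" "integrable lborel (\<lambda>x. norm (g x) powr r)" 
       "(LBINT x. norm (g x) powr r) < \<delta>" "e > 0" for g e
  proof -
    have [measurable]: "g \<in> borel_measurable borel" using g(1) by auto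
    have pp: "integrable lborel (\<lambda>x. complex_of_real (p (g x))) \<and> supp1 (\<lambda>x. complex_of_real (p (g x))) \<and>
      (LBINT t:{-1..1}. norm (conj_poisson (\<lambda>x. of_real (p (g x))) e t)) \<le> 3 * \<eta>"
      if p: "p \<in> borel_measurable borel" "\<And>z. 0 \<le> p z" "\<And>z. p z \<le> norm z" for p :: "complex \<Rightarrow> real"
    proof -
      note [measurable] = p(1)
      have z: "1 \<le> \<bar>x\<bar> \<Longrightarrow> p (g x) = 0" for x using g(2) p(2,3)[of 0] by (simp add: supp1_def)
      have i1: "integrable lborel (\<lambda>x. p (g x))"
        by (rule Bochner_Integration.integrable_bound[OF g(1)]) (use p in auto)
      have i2: "integrable lborel (\<lambda>x. p (g x) powr r)"
        by (rule Bochner_Integration.integrable_bound[OF g(3)]) (use p r in \<open>auto intro!: powr_mono2\<close>)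
      have "(LBINT x. p (g x) powr r) \<le> (LBINT x. norm (g x) powr r)"
        by (intro integral_mono i2 g(3) powr_mono2 p) (use r in auto)
      hence "(LBINT x. p (g x) powr r) < \<delta>" using g(4) by linarith
      from part[OF i1 p(2) z i2 this g(5)] i1 z show ?thesis by (auto simp: supp1_def)
    qed
    define g1 where "g1 = (\<lambda>x. complex_of_real (max 0 (Re (g x))))"
    define g2 where "g2 = (\<lambda>x. complex_of_real (max 0 (- Re (g x))))"
    define g3 where "g3 = (\<lambda>x. complex_of_real (max 0 (Im (g x))))"
    define g4 where "g4 = (\<lambda>x. complex_of_real (max 0 (- Im (g x))))"
    have re: "Re z \<le> norm z" "- Re z \<le> norm z" "Im z \<le> norm z" "- Im z \<le> norm z" for z
      using abs_Re_le_cmod[of z] abs_Im_le_cmod[of z] by linarith+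
    have 1: "integrable lborel g1 \<and> supp1 g1 \<and> (LBINT t:{-1..1}. norm (conj_poisson g1 e t)) \<le> 3 * \<eta>"
      unfolding g1_def by (rule pp[of "\<lambda>z. max 0 (Re z)"]) (use re in auto)
    have 2: "integrable lborel g2 \<and> supp1 g2 \<and> (LBINT t:{-1..1}. norm (conj_poisson g2 e t)) \<le> 3 * \<eta>"
      unfolding g2_def by (rule pp[of "\<lambda>z. max 0 (- Re z)"]) (use re in auto)
    have 3: "integrable lborel g3 \<and> supp1 g3 \<and> (LBINT t:{-1..1}. norm (conj_poisson g3 e t)) \<le> 3 * \<eta>"
      unfolding g3_def by (rule pp[of "\<lambda>z. max 0 (Im z)"]) (use re in auto)
    have 4: "integrable lborel g4 \<and> supp1 g4 \<and> (LBINT t:{-1..1}. norm (conj_poisson g4 e t)) \<le> 3 * \<eta>"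
      unfolding g4_def by (rule pp[of "\<lambda>z. max 0 (- Im z)"]) (use re in auto)
    have geq: "g = (\<lambda>x. (g1 x - g2 x) + \<i> * (g3 x - g4 x))"
      by (auto simp: g1_def g2_def g3_def g4_def complex_eq_iff fun_eq_iff)
    have cp: "conj_poisson g e t = (conj_poisson g1 e t - conj_poisson g2 e t) + \<i> * (conj_poisson g3 e t - conj_poisson g4 e t)" for t
      by (subst geq) (use 1 2 3 4 g(5) in \<open>simp add: conj_poisson_add conj_poisson_diff conj_poisson_cmult\<close>)
    have n: "norm (conj_poisson g e t) \<le> (norm (conj_poisson g1 e t) + norm (conj_poisson g2 e t)) + (norm (conj_poisson g3 e t) + norm (conj_poisson g4 e t))" for t
      unfolding cp by (intro order_trans[OF norm_triangle_ineq] add_mono order_trans[OF norm_triangle_ineq4]) 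
        (use norm_triangle_ineq4 in \<open>auto simp: norm_mult\<close>)
    have I: "set_integrable lborel {-1..1} (\<lambda>t. norm (conj_poisson f e t))" if "integrable lborel f" "supp1 f" for f
      by (intro set_integrable_norm conj_poisson_set_integrable that g(5))
    have "(LBINT t:{-1..1}. norm (conj_poisson g e t)) \<le> (LBINT t:{-1..1}. (norm (conj_poisson g1 e t) + norm (conj_poisson g2 e t)) + (norm (conj_poisson g3 e t) + norm (conj_poisson g4 e t)))"
      using 1 2 3 4 g by (intro set_integral_mono set_integral_add(1) I n) auto
    also have "\<dots> = ((LBINT t:{-1..1}. norm (conj_poisson g1 e t)) + (LBINT t:{-1..1}. norm (conj_poisson g2 e t))) + ((LBINT t:{-1..1}. norm (conj_poisson g3 e t)) + (LBINT t:{-1..1}. norm (conj_poisson g4 e t)))"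
      using 1 2 3 4 I by (simp add: set_integral_add)
    also have "\<dots> \<le> 12 * \<eta>" using 1 2 3 4 by linarith
    also have "\<dots> < \<epsilon>" using eps by (simp add: \<eta>_def)
    finally show ?thesis .
  qed
  thus ?thesis using that delta by blast
qed

section \<open>Lipschitz approximation and convergence in L^1\<close>

lemma powr_add3_le:
  fixes a b c r :: real
  assumes "a \<ge> 0" "b \<ge> 0" "c \<ge> 0" "r > 0"
  shows "(a + b + c) powr r \<le> 3 powr r * (a powr r + b powr r + c powr r)"
proof -
  define m where "m = max a (max b c)"
  have "(a + b + c) powr r \<le> (3 * m) powr r" using assms by (intro powr_mono2) (auto simp: m_def)
  also have "\<dots> = 3 powr r * m powr r" using assms by (intro powr_mult)
  also have "m powr r \<le> a powr r + b powr r + c powr r"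
    unfolding m_def max_def by (auto simp: add_increasing add_increasing2)
  finally show ?thesis by simp
qed

text \<open>The factor 1 - x^2 vanishes at both ends, so cutting off outside (-1,1) creates no jump,
  and a bound for the derivative on [-1,1] is a Lipschitz constant on the whole line.\<close>

lemma lipschitz_polynomial_cutoff:
  fixes p :: "real \<Rightarrow> complex"
  assumes "polynomial_function p"
  obtains L where "L \<ge> 0" 
    "\<And>x y. norm (of_bool (\<bar>x\<bar> < 1) * (of_real (1 - x\<^sup>2) * p x) - of_bool (\<bar>y\<bar> < 1) * (of_real (1 - y\<^sup>2) * p y)) \<le> L * \<bar>x - y\<bar>"
proof -
  define q where "q x = (1 - x\<^sup>2) *\<^sub>R p x" for x
  have "real_polynomial_function (\<lambda>x::real. 1 - x\<^sup>2)"
    by (intro real_polynomial_function_diff real_polynomial_function_power) 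
       (auto intro: real_polynomial_function.intros bounded_linear_ident)
  hence "polynomial_function (\<lambda>x::real. 1 - x\<^sup>2)" by (simp add: real_polynomial_function_eq)
  hence "polynomial_function q" unfolding q_def using assms
    by (intro polynomial_function_mult) 
  then obtain q' where q': "polynomial_function q'" "\<And>x. (q has_vector_derivative q' x) (at x)"
    using has_vector_derivative_polynomial_function by metis
  have "compact (q' ` {-1..1})"
    using continuous_on_polymonial_function[OF q'(1)] by (intro compact_continuous_image) auto
  then obtain L where L: "\<And>x. x \<in> {-1..1} \<Longrightarrow> norm (q' x) \<le> L"
    using compact_imp_bounded bounded_iff by (metis imageI)
  have L0: "L \<ge> 0" using order_trans[OF norm_ge_zero L[of 0]] by simp
  have lip: "norm (q x - q y) \<le> L * \<bar>x - y\<bar>" if "x \<in> {-1..1}" "y \<in> {-1..1}" for x y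
  proof -
    have "norm (q x - q y) \<le> L * norm (x - y)"
    proof (rule differentiable_bound[of "{-1..1}" q "\<lambda>x h. h *\<^sub>R q' x"])
      show "(q has_derivative (\<lambda>h. h *\<^sub>R q' z)) (at z within {-1..1})" for z
        using q'(2)[of z] by (simp add: has_vector_derivative_def has_derivative_at_withinI)
      show "onorm (\<lambda>h. h *\<^sub>R q' z) \<le> L" if "z \<in> {-1..1}" for z
        using L[OF that] L0 by (intro onorm_bound) (auto simp: mult.commute[of L] intro!: mult_left_mono)
    qed (use that in auto)
    thus ?thesis by simp
  qed
  \<comment> \<open>Clamping to [-1,1] is 1-Lipschitz, and q after clamping is the cut-off function
    because q is 0 at both ends.\<close>
  define c :: "real \<Rightarrow> real" where "c x = max (-1) (min 1 x)" for x
  have eq: "of_bool (\<bar>x\<bar> < 1) * (of_real (1 - x\<^sup>2) * p x) = q (c x)" for x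
  proof (cases "\<bar>x\<bar> < 1")
    case True thus ?thesis by (auto simp: q_def c_def max_def min_def scaleR_conv_of_real abs_less_iff)
  next
    case False
    hence "c x = 1 \<or> c x = -1" by (auto simp: c_def max_def min_def)
    thus ?thesis using False by (auto simp: q_def)
  qed
  have "norm (q (c x) - q (c y)) \<le> L * \<bar>x - y\<bar>" for x y
  proof -
    have "norm (q (c x) - q (c y)) \<le> L * \<bar>c x - c y\<bar>" by (rule lip) (auto simp: c_def)
    also have "\<dots> \<le> L * \<bar>x - y\<bar>" using L0 by (intro mult_left_mono) (auto simp: c_def max_def min_def)
    finally show ?thesis .
  qed
  thus ?thesis using that L0 unfolding eq by blast
qed

text \<open>The continuous G comes from the description of measurable functions as limits of
  continuous ones, the polynomial from the Weierstrass theorem. The two errors stay separate because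
  they are combined later through \<open>powr_add3_le\<close>.\<close>

lemma bounded_polynomial_approx:
  fixes h :: "real \<Rightarrow> complex"
  assumes h: "h \<in> borel_measurable borel" "\<And>x. norm (h x) \<le> B" and r: "r \<ge> 1" and d: "\<delta> > 0"
  obtains G p where "continuous_on UNIV G" "polynomial_function p"
    "set_integrable lborel {-1..1} (\<lambda>x. norm (h x - G x) powr r)" "(LBINT x:{-1..1}. norm (h x - G x) powr r) < \<delta>"
    "set_integrable lborel {-1..1} (\<lambda>x. norm (G x - p x) powr r)" "(LBINT x:{-1..1}. norm (G x - p x) powr r) < \<delta>"
proof -
  note [measurable] = h(1)
  define b where "b = B + 1"
  have b: "b > 0" "norm (h x) \<le> b" for x using h(2)[of x] order_trans[OF norm_ge_zero h(2)[of 0]] by (auto simp: b_def)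
  have "h \<in> borel_measurable (lebesgue_on UNIV)" using h(1) by (simp add: lebesgue_on_UNIV_eq measurable_completion)
  hence "h measurable_on UNIV" by (simp add: measurable_on_iff_borel_measurable)
  then obtain N G where N: "negligible N" and G: "\<And>n. continuous_on UNIV (G n)" "\<And>x. x \<notin> N \<Longrightarrow> (\<lambda>n. G n x) \<longlonglongrightarrow> h x"
    unfolding measurable_on_def by auto
  \<comment> \<open>Radial retraction onto the ball of radius b. It preserves continuity, gives the
    uniform bound for dominated convergence and leaves the limit \<open>h x\<close> in place, since
    |h x| <= b.\<close>
  define H where "H n x = G n x / of_real (max 1 (norm (G n x) / b))" for n :: nat and x
  have Hc: "continuous_on UNIV (H n)" for n
    unfolding H_def using b by (intro continuous_intros G) (auto simp: max_def)
  have Hb: "norm (H n x) \<le> b" for n x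
    unfolding H_def using b by (auto simp: norm_divide max_def field_simps)
  have [measurable]: "H n \<in> borel_measurable borel" for n by (rule borel_measurable_continuous_onI[OF Hc])
  have "AE x in lebesgue. x \<notin> N" using N by (simp add: negligible_iff_null_sets AE_not_in)
  hence "AE x in lborel. x \<notin> N" by (simp add: AE_completion_iff)
  hence Hlim: "AE x in lborel. (\<lambda>n. norm (h x - H n x) powr r) \<longlonglongrightarrow> 0"
  proof eventually_elim
    case (elim x)
    have "(\<lambda>n. H n x) \<longlonglongrightarrow> h x / of_real (max 1 (norm (h x) / b))"
      unfolding H_def using G(2)[OF elim] b by (intro tendsto_intros) (auto simp: max_def)
    moreover have "norm (h x) / b \<le> 1" using b by simp
    hence "max 1 (norm (h x) / b) = 1" by simp
    ultimately have "(\<lambda>n. H n x) \<longlonglongrightarrow> h x" by simp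
    hence "(\<lambda>n. norm (h x - H n x)) \<longlonglongrightarrow> norm (h x - h x)" by (intro tendsto_intros)
    hence "(\<lambda>n. norm (h x - H n x) powr r) \<longlonglongrightarrow> 0 powr r"
      using r by (intro tendsto_powr') auto
    thus ?case using r by simp
  qed
  have bound: "norm (h x - H n x) powr r \<le> (2 * b) powr r" for n x
  proof (rule powr_mono2)
    show "norm (h x - H n x) \<le> 2 * b"
      using norm_triangle_ineq4[of "h x" "H n x"] b(2)[of x] Hb[of n x] by linarith
  qed (use r in auto)
  have ci: "integrable lborel (\<lambda>x. indicator {-1..1::real} x * c)" for c :: real
    by (simp add: emeasure_lborel_Icc_eq)
  have "(\<lambda>n. LBINT x. indicator {-1..1} x * (norm (h x - H n x) powr r)) \<longlonglongrightarrow> (LBINT (x::real). 0)"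
  proof (rule integral_dominated_convergence[where w="\<lambda>x. indicator {-1..1} x * (2 * b) powr r"])
    show "AE x in lborel. (\<lambda>n. indicator {-1..1} x * (norm (h x - H n x) powr r)) \<longlonglongrightarrow> 0"
      using Hlim by eventually_elim (auto simp: indicator_def)
  qed (use bound ci in \<open>auto simp: indicator_def\<close>)
  hence "eventually (\<lambda>n. (LBINT x. indicator {-1..1} x * (norm (h x - H n x) powr r)) < \<delta>) sequentially"
    using d by (intro order_tendstoD(2)) auto
  then obtain n where n: "(LBINT x. indicator {-1..1} x * (norm (h x - H n x) powr r)) < \<delta>"
    by (auto simp: eventually_sequentially)
  have i1: "set_integrable lborel {-1..1} (\<lambda>x. norm (h x - H n x) powr r)"
    unfolding set_integrable_def 
    by (rule Bochner_Integration.integrable_bound[OF ci[of "(2 * b) powr r"]]) (use bound in \<open>auto simp: indicator_def\<close>)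
  define \<eta> where "\<eta> = (\<delta> / 4) powr (1/r)"
  have eta: "\<eta> > 0" "\<eta> powr r = \<delta> / 4" using d r by (auto simp: \<eta>_def powr_powr)
  obtain p where p: "polynomial_function p" "\<And>x. x \<in> {-1..1} \<Longrightarrow> norm (H n x - p x) < \<eta>"
    using Stone_Weierstrass_polynomial_function[of "{-1..1::real}" "H n" \<eta>] eta(1) continuous_on_subset[OF Hc] by auto
  have pc: "continuous_on UNIV p" using continuous_on_polymonial_function[OF p(1)] .
  have i2: "set_integrable lborel {-1..1} (\<lambda>x. norm (H n x - p x) powr r)"
    using r by (intro borel_integrable_atLeastAtMost' continuous_on_powr' continuous_intros 
       continuous_on_subset[OF Hc] continuous_on_subset[OF pc]) auto
  have ci': "set_integrable lborel {-1..1::real} (\<lambda>x. c)" for c :: real using ci unfolding set_integrable_def by simp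
  have "(LBINT x:{-1..1}. norm (H n x - p x) powr r) \<le> (LBINT x:{-1..1::real}. \<delta> / 4)"
  proof (intro set_integral_mono i2 ci')
    fix x :: real assume "x \<in> {-1..1}"
    thus "norm (H n x - p x) powr r \<le> \<delta> / 4"
      using powr_mono2[of r "norm (H n x - p x)" \<eta>] p(2)[of x] r by (simp add: eta(2))
  qed
  also have "\<dots> < \<delta>" using d by (simp add: set_lebesgue_integral_def)
  finally show ?thesis using that[OF Hc p(1) i1 _ i2] n by (simp add: set_lebesgue_integral_def)
qed

text \<open>The polynomial approximates f / (1 - x^2) rather than f, so that multiplying back by 1 -
  x^2 gives a Lipschitz function. Truncating f in size and to |x| <= 1 - 1/(n+1) keeps the quotient
  bounded, since 1 - x^2 >= 1/(n+1) there; the factor 1 - x^2 <= 1 does not enlarge the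
  errors.\<close>

lemma lipschitz_dense:
  fixes f :: "real \<Rightarrow> complex"
  assumes f: "f \<in> borel_measurable borel" "supp1 f" "integrable lborel (\<lambda>x. norm (f x) powr r)"
    and r: "r \<ge> 1" and d: "\<delta> > 0"
  obtains g L where "integrable lborel g" "supp1 g" "\<And>x y. norm (g x - g y) \<le> L * \<bar>x - y\<bar>"
    "integrable lborel (\<lambda>x. norm (f x - g x) powr r)" "(LBINT x. norm (f x - g x) powr r) < \<delta>"
proof -
  note [measurable] = f(1)
  define d' where "d' = \<delta> / (3 * 3 powr r)"
  have d': "d' > 0" using d by (simp add: d'_def)
  define F where "F n x = (if norm (f x) \<le> real n \<and> \<bar>x\<bar> \<le> 1 - 1 / real (Suc n) then f x else 0)" for n x
  have [measurable]: "F n \<in> borel_measurable borel" for n unfolding F_def by measurable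
  have bound: "norm (f x - F n x) powr r \<le> norm (f x) powr r" for n x
    using r by (auto simp: F_def)
  have Fi: "integrable lborel (\<lambda>x. norm (f x - F n x) powr r)" for n
    by (rule Bochner_Integration.integrable_bound[OF f(3)]) (use bound in auto)
  have "(\<lambda>n. LBINT x. norm (f x - F n x) powr r) \<longlonglongrightarrow> (LBINT (x::real). 0)"
  proof (rule integral_dominated_convergence[OF _ _ f(3)])
    have "(\<lambda>n. norm (f x - F n x) powr r) \<longlonglongrightarrow> 0" for x
    proof (cases "\<bar>x\<bar> < 1")
      case True
      have "eventually (\<lambda>n. norm (f x) < real n) sequentially"
        by (rule filterlim_at_top_dense[THEN iffD1, rule_format, OF filterlim_real_sequentially])
      moreover have "eventually (\<lambda>n. 1 / real (Suc n) < 1 - \<bar>x\<bar>) sequentially"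
        using True by (intro order_tendstoD(2)[OF lim_1_over_n[THEN LIMSEQ_Suc]]) auto
      ultimately have "eventually (\<lambda>n. norm (f x - F n x) powr r = 0) sequentially"
        by eventually_elim (auto simp: F_def)
      thus ?thesis by (rule tendsto_eventually)
    next
      case False
      hence "f x = 0" using f(2) by (simp add: supp1_def)
      hence "f x - F n x = 0" for n by (auto simp: F_def)
      thus ?thesis by simp
    qed
    thus "AE x in lborel. (\<lambda>n. norm (f x - F n x) powr r) \<longlonglongrightarrow> 0" by simp
  qed (use bound in auto)
  hence "eventually (\<lambda>n. (LBINT x. norm (f x - F n x) powr r) < d') sequentially"
    using d' by (intro order_tendstoD(2)) auto
  then obtain n where n: "(LBINT x. norm (f x - F n x) powr r) < d'"
    by (auto simp: eventually_sequentially)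
  define h where "h x = F n x / of_real (1 - x\<^sup>2)" for x
  have hm: "h \<in> borel_measurable borel" unfolding h_def by measurable
  have hb: "norm (h x) \<le> real n * real (Suc n)" for x
  proof (cases "norm (f x) \<le> real n \<and> \<bar>x\<bar> \<le> 1 - 1 / real (Suc n)")
    case True
    have "0 \<le> 1 / real (Suc n)" by simp
    hence "\<bar>x\<bar> \<le> 1" using True by linarith
    hence "\<bar>x\<bar> * \<bar>x\<bar> \<le> \<bar>x\<bar>" by (intro mult_left_le) auto
    hence "x\<^sup>2 \<le> \<bar>x\<bar>" by (simp add: power2_eq_square)
    hence "1 / real (Suc n) \<le> 1 - x\<^sup>2" using True by linarith
    hence "norm (f x) / \<bar>1 - x\<^sup>2\<bar> \<le> real n / (1 / real (Suc n))"
      using True by (intro frac_le) auto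
    moreover have "norm (h x) = norm (f x) / \<bar>1 - x\<^sup>2\<bar>" using True 
      by (simp add: h_def F_def norm_divide del: of_real_diff of_real_power)
    ultimately show ?thesis by simp
  next
    case False
    thus ?thesis by (auto simp: h_def F_def)
  qed
  obtain G p where G: "continuous_on UNIV G" and p: "polynomial_function p" and 
    i: "set_integrable lborel {-1..1} (\<lambda>x. norm (h x - G x) powr r)" "(LBINT x:{-1..1}. norm (h x - G x) powr r) < d'"
    "set_integrable lborel {-1..1} (\<lambda>x. norm (G x - p x) powr r)" "(LBINT x:{-1..1}. norm (G x - p x) powr r) < d'"
    using bounded_polynomial_approx[OF hm hb r d'] by blast
  obtain L where L: "L \<ge> 0" 
    "\<And>x y. norm (of_bool (\<bar>x\<bar> < 1) * (of_real (1 - x\<^sup>2) * p x) - of_bool (\<bar>y\<bar> < 1) * (of_real (1 - y\<^sup>2) * p y)) \<le> L * \<bar>x - y\<bar>"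
    using lipschitz_polynomial_cutoff[OF p] by blast
  define g where "g x = of_bool (\<bar>x\<bar> < 1) * (of_real (1 - x\<^sup>2) * p x)" for x
  have pc: "continuous_on UNIV p" using continuous_on_polymonial_function[OF p] .
  have [measurable]: "p \<in> borel_measurable borel" by (rule borel_measurable_continuous_onI[OF pc])
  have [measurable]: "G \<in> borel_measurable borel" by (rule borel_measurable_continuous_onI[OF G])
  have gm[measurable]: "g \<in> borel_measurable borel" unfolding g_def by measurable
  have gs: "supp1 g" by (auto simp: supp1_def g_def)
  have gi: "integrable lborel g"
  proof -
    have "set_integrable lborel {-1..1} (\<lambda>x. of_real (1 - x\<^sup>2) * p x)"
      by (intro borel_integrable_atLeastAtMost' continuous_intros continuous_on_subset[OF pc]) auto
    thus ?thesis unfolding set_integrable_def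
      by (rule Bochner_Integration.integrable_bound) (auto simp: g_def indicator_def)
  qed
  let ?I = "indicator {-1..1} :: real \<Rightarrow> real"
  have pt: "norm (f x - g x) powr r \<le> 3 powr r * (norm (f x - F n x) powr r + ?I x * norm (h x - G x) powr r + ?I x * norm (G x - p x) powr r)" for x
  proof (cases "\<bar>x\<bar> < 1")
    case True
    hence x2: "0 < 1 - x\<^sup>2" "1 - x\<^sup>2 \<le> 1" by (auto simp: abs_square_less_1)
    have "F n x = of_real (1 - x\<^sup>2) * h x" using x2 by (simp add: h_def del: of_real_diff)
    hence "f x - g x = (f x - F n x) + of_real (1 - x\<^sup>2) * (h x - G x) + of_real (1 - x\<^sup>2) * (G x - p x)"
      using True by (simp add: g_def algebra_simps)
    hence "norm (f x - g x) \<le> norm (f x - F n x) + norm (of_real (1 - x\<^sup>2) * (h x - G x)) + norm (of_real (1 - x\<^sup>2) * (G x - p x))"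
      using norm_triangle_ineq by (metis (no_types) add_right_mono order_trans)
    also have "\<dots> \<le> norm (f x - F n x) + norm (h x - G x) + norm (G x - p x)"
      using x2 by (intro add_mono) (auto simp: norm_mult mult_left_le_one_le simp del: of_real_diff)
    finally have "norm (f x - g x) powr r \<le> (norm (f x - F n x) + norm (h x - G x) + norm (G x - p x)) powr r"
      using r by (intro powr_mono2) auto
    also have "\<dots> \<le> 3 powr r * (norm (f x - F n x) powr r + norm (h x - G x) powr r + norm (G x - p x) powr r)"
      using r by (intro powr_add3_le) auto
    moreover have "x \<in> {-1..1}" using True by auto
    ultimately show ?thesis by simp
  next
    case False
    hence "f x - g x = 0" using f(2) by (simp add: g_def supp1_def)
    thus ?thesis by (auto intro!: add_nonneg_nonneg mult_nonneg_nonneg)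
  qed
  have I: "integrable lborel (\<lambda>x. 3 powr r * (norm (f x - F n x) powr r + ?I x * norm (h x - G x) powr r + ?I x * norm (G x - p x) powr r))"
    using Fi i(1,3) unfolding set_integrable_def by simp
  have fgi: "integrable lborel (\<lambda>x. norm (f x - g x) powr r)"
    by (rule Bochner_Integration.integrable_bound[OF I]) (use pt in \<open>auto intro: order_trans[OF pt abs_ge_self]\<close>)
  have "(LBINT x. norm (f x - g x) powr r) \<le> (LBINT x. 3 powr r * (norm (f x - F n x) powr r + ?I x * norm (h x - G x) powr r + ?I x * norm (G x - p x) powr r))"
    by (rule integral_mono[OF fgi I pt])
  also have "\<dots> = 3 powr r * ((LBINT x. norm (f x - F n x) powr r) + (LBINT x:{-1..1}. norm (h x - G x) powr r) + (LBINT x:{-1..1}. norm (G x - p x) powr r))"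
    using Fi i(1,3) unfolding set_integrable_def set_lebesgue_integral_def by simp
  also have "\<dots> < 3 powr r * (3 * d')" using n i by (intro mult_strict_left_mono) auto
  also have "\<dots> = \<delta>" by (simp add: d'_def)
  finally show ?thesis using that[OF gi gs _ fgi] L(2) unfolding g_def by blast
qed

lemma conj_kernel_diff:
  assumes "e > 0"
  shows "\<bar>u * conj_kernel e u - of_bool (u \<noteq> 0)\<bar> \<le> e * poisson_kernel e u + of_bool (u = 0)"
proof (cases "u = 0")
  case False
  define s where "s = e\<^sup>2 + u\<^sup>2"
  have "s \<noteq> 0" using assms by (simp add: s_def sum_power2_eq_zero_iff)
  hence "u * (u / s) - 1 = (u\<^sup>2 - s) / s" by (simp add: diff_divide_distrib power2_eq_square)
  hence "u * conj_kernel e u - 1 = - (e * poisson_kernel e u)"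
    by (simp add: conj_kernel_def poisson_kernel_def s_def power2_eq_square)
  thus ?thesis using False poisson_kernel_le(1)[OF assms, of u] assms by (simp add: abs_mult)
qed (auto simp: conj_kernel_def poisson_kernel_def)

lemma conj_kernel_diff2:
  assumes "e > 0" "e' > 0"
  shows "\<bar>u\<bar> * \<bar>conj_kernel e u - conj_kernel e' u\<bar> \<le> e * poisson_kernel e u + e' * poisson_kernel e' u"
proof (cases "u = 0")
  case True
  thus ?thesis using poisson_kernel_le(1) assms by simp
next
  case False
  have "\<bar>u\<bar> * \<bar>conj_kernel e u - conj_kernel e' u\<bar> = \<bar>(u * conj_kernel e u - 1) - (u * conj_kernel e' u - 1)\<bar>"
    by (simp add: abs_mult right_diff_distrib flip: abs_mult)
  also have "\<dots> \<le> \<bar>u * conj_kernel e u - 1\<bar> + \<bar>u * conj_kernel e' u - 1\<bar>" by (rule abs_triangle_ineq4)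
  finally show ?thesis using conj_kernel_diff[OF assms(1), of u] conj_kernel_diff[OF assms(2), of u] False by simp
qed

text \<open>A Lipschitz density cancels the singularity: |u| times the difference of the kernels is
  at most e P_e + e' P_e', where both Poisson kernels have mass at most pi on the window.\<close>

lemma conj_poisson_lipschitz_cauchy:
  assumes g: "integrable lborel g" "supp1 g" and L: "\<And>x y. norm (g x - g y) \<le> L * \<bar>x - y\<bar>"
    and e: "e > 0" "e' > 0" and t: "\<bar>t\<bar> \<le> 1"
  shows "norm (conj_poisson g e t - conj_poisson g e' t) \<le> L * pi * (e + e')"
proof -
  have L0: "L \<ge> 0" using order_trans[OF norm_ge_zero L[of 1 0]] by simp
  let ?I = "{t-2..t+2}"
  define k where "k u = conj_kernel e u - conj_kernel e' u" for u
  have [measurable]: "k \<in> borel_measurable borel" unfolding k_def by measurable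
  have kb: "\<bar>k u\<bar> \<le> 1/e + 1/e'" for u
    unfolding k_def using conj_kernel_le[OF e(1), of u] conj_kernel_le[OF e(2), of u] by linarith
  have i1: "set_integrable lborel ?I (\<lambda>x. (g x - g t) * of_real (k (x-t)))"
    unfolding set_integrable_def
    using integrable_mult_bounded[of lborel "\<lambda>x. indicator ?I x *\<^sub>R (g x - g t)" "\<lambda>x. of_real (k (x-t))" "1/e+1/e'"]
      set_integrable_sub_const[OF g(1)] kb unfolding set_integrable_def by (simp add: mult.assoc)
  have i2: "set_integrable lborel ?I (\<lambda>x. g t * of_real (k (x-t)))"
    unfolding set_integrable_def
    using integrable_mult_bounded[of lborel "\<lambda>x. indicator ?I x *\<^sub>R g t" "\<lambda>x. of_real (k (x-t))" "1/e+1/e'"]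
      kb by (simp add: emeasure_lborel_Icc_eq)
  have "conj_poisson g e t - conj_poisson g e' t = (LBINT x. g x * of_real (k (x-t)))"
    unfolding conj_poisson_def k_def of_real_diff right_diff_distrib
    by (rule Bochner_Integration.integral_diff[symmetric, OF integrable_conj_kernel[OF g(1) e(1)] integrable_conj_kernel[OF g(1) e(2)]])
  also have "\<dots> = (LBINT x:?I. (g x - g t) * of_real (k (x-t)) + g t * of_real (k (x-t)))"
    unfolding set_lebesgue_integral_def using g(2) t
    by (intro Bochner_Integration.integral_cong refl) (auto simp: supp1_def indicator_def algebra_simps)
  also have "\<dots> = (LBINT x:?I. (g x - g t) * of_real (k (x-t))) + (LBINT x:?I. g t * of_real (k (x-t)))"
    by (rule set_integral_add(2)[OF i1 i2])
  also have "(LBINT x:?I. g t * of_real (k (x-t))) = g t * of_real (LBINT x:?I. k (x-t))"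
    by (simp add: set_integral_complex_of_real)
  also have "(LBINT x:?I. k (x-t)) = 0" by (rule odd_integral_zero) (simp add: k_def)
  finally have "norm (conj_poisson g e t - conj_poisson g e' t) = norm (LBINT x:?I. (g x - g t) * of_real (k (x-t)))" by simp
  also have "\<dots> \<le> (LBINT x:?I. norm ((g x - g t) * of_real (k (x-t))))"
    by (rule set_integral_norm_bound[OF i1])
  also have "\<dots> \<le> (LBINT x:?I. L * (e * poisson_kernel e (x-t)) + L * (e' * poisson_kernel e' (x-t)))"
  proof (rule set_integral_mono[OF set_integrable_norm[OF i1]])
    have pi: "set_integrable lborel ?I (\<lambda>x. poisson_kernel d (x-t))" if "d > 0" for d
      unfolding set_integrable_def real_scaleR_def
      by (rule integrable_mult_bounded[where B="1/d"]) (use poisson_kernel_le(3)[OF that] in \<open>auto simp: emeasure_lborel_Icc_eq\<close>)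
    show "set_integrable lborel ?I (\<lambda>x. L * (e * poisson_kernel e (x-t)) + L * (e' * poisson_kernel e' (x-t)))"
      by (intro set_integral_add(1) set_integrable_mult_right pi e)
    fix x
    have "norm ((g x - g t) * of_real (k (x-t))) \<le> (L * \<bar>x - t\<bar>) * \<bar>k (x-t)\<bar>"
      using L[of x t] by (auto simp: norm_mult intro!: mult_right_mono)
    also have "\<dots> = L * (\<bar>x - t\<bar> * \<bar>conj_kernel e (x-t) - conj_kernel e' (x-t)\<bar>)" by (simp add: k_def)
    also have "\<dots> \<le> L * (e * poisson_kernel e (x-t) + e' * poisson_kernel e' (x-t))"
      by (intro mult_left_mono conj_kernel_diff2 e L0)
    finally show "norm ((g x - g t) * of_real (k (x-t))) \<le> L * (e * poisson_kernel e (x-t)) + L * (e' * poisson_kernel e' (x-t))"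
      by (simp add: distrib_left)
  qed
  also have "\<dots> = L * (e * (LBINT x:?I. poisson_kernel e (x-t))) + L * (e' * (LBINT x:?I. poisson_kernel e' (x-t)))"
  proof -
    have pi: "set_integrable lborel ?I (\<lambda>x. poisson_kernel d (x-t))" if "d > 0" for d
      unfolding set_integrable_def real_scaleR_def
      by (rule integrable_mult_bounded[where B="1/d"]) (use poisson_kernel_le(3)[OF that] in \<open>auto simp: emeasure_lborel_Icc_eq\<close>)
    show ?thesis by (subst set_integral_add(2)) (auto intro!: set_integrable_mult_right pi e)
  qed
  also have "\<dots> \<le> L * (e * pi) + L * (e' * pi)"
    using L0 e by (intro add_mono mult_left_mono poisson_kernel_total) auto
  finally show ?thesis by (simp add: algebra_simps)
qed

text \<open>A Lipschitz approximation g of f has an explicit rate, and the remainder f - g is small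
  in L^1 for all e at once. The radius d makes the rate contribute at most a quarter of the target,
  as does each of the two remainders.\<close>

lemma conj_poisson_L1_cauchy:
  fixes f :: "real \<Rightarrow> complex"
  assumes f: "integrable lborel f" "supp1 f" "integrable lborel (\<lambda>x. norm (f x) powr r)" and r: "1 < r" "r < 2"
    and eps: "\<epsilon> > 0"
  obtains d where "d > 0" "\<And>e e'. \<lbrakk>0 < e; e < d; 0 < e'; e' < d\<rbrakk> \<Longrightarrow>
    (LBINT t:{-1..1}. norm (conj_poisson f e t - conj_poisson f e' t)) < \<epsilon>"
proof -
  obtain \<delta> where \<delta>: "\<delta> > 0"
    "\<And>g e. \<lbrakk>integrable lborel g; supp1 g; integrable lborel (\<lambda>x. norm (g x) powr r); 
       (LBINT x. norm (g x) powr r) < \<delta>; e > 0\<rbrakk> \<Longrightarrow> (LBINT t:{-1..1}. norm (conj_poisson g e t)) < \<epsilon>/4"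
    using conj_poisson_small[OF r, of "\<epsilon>/4"] eps by auto
  have fm: "f \<in> borel_measurable borel" using f(1) by auto
  obtain g L where g: "integrable lborel g" "supp1 g" "\<And>x y. norm (g x - g y) \<le> L * \<bar>x - y\<bar>"
    "integrable lborel (\<lambda>x. norm (f x - g x) powr r)" "(LBINT x. norm (f x - g x) powr r) < \<delta>"
    using lipschitz_dense[OF fm f(2,3) less_imp_le[OF r(1)] \<delta>(1)] by blast
  have L0: "L \<ge> 0" using order_trans[OF norm_ge_zero g(3)[of 1 0]] by simp
  define d where "d = \<epsilon> / (16 * (L * pi + 1))"
  have d: "d > 0" using eps L0 by (simp add: d_def add_nonneg_pos)
  let ?k = "\<lambda>x. f x - g x"
  have k: "integrable lborel ?k" "supp1 ?k" using f g by (auto simp: supp1_def)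
  have "(LBINT t:{-1..1}. norm (conj_poisson f e t - conj_poisson f e' t)) < \<epsilon>"
    if e: "0 < e" "e < d" "0 < e'" "e' < d" for e e'
  proof -
    have ci: "set_integrable lborel {-1..1::real} (\<lambda>t. c)" for c :: real
      by (intro borel_integrable_atLeastAtMost' continuous_intros)
    have ki: "set_integrable lborel {-1..1} (\<lambda>t. norm (conj_poisson ?k b t))" if "b > 0" for b
      by (intro set_integrable_norm conj_poisson_set_integrable k that)
    have "(LBINT t:{-1..1}. norm (conj_poisson f e t - conj_poisson f e' t)) 
       \<le> (LBINT t:{-1..1}. (norm (conj_poisson ?k e t) + norm (conj_poisson ?k e' t)) + L * pi * (2 * d))"
    proof (intro set_integral_mono set_integrable_norm set_integral_diff(1) conj_poisson_set_integrable f e set_integral_add(1) k ci)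
      fix t :: real assume "t \<in> {-1..1}"
      hence t: "\<bar>t\<bar> \<le> 1" by auto
      have "conj_poisson f e t - conj_poisson f e' t = (conj_poisson ?k e t - conj_poisson ?k e' t) + (conj_poisson g e t - conj_poisson g e' t)"
        using conj_poisson_diff[OF f(1) g(1) e(1)] conj_poisson_diff[OF f(1) g(1) e(3)] by simp
      hence "norm (conj_poisson f e t - conj_poisson f e' t) \<le> (norm (conj_poisson ?k e t) + norm (conj_poisson ?k e' t)) + norm (conj_poisson g e t - conj_poisson g e' t)"
        using norm_triangle_ineq[of "conj_poisson ?k e t - conj_poisson ?k e' t" "conj_poisson g e t - conj_poisson g e' t"]
          norm_triangle_ineq4[of "conj_poisson ?k e t" "conj_poisson ?k e' t"] by simp
      moreover have "norm (conj_poisson g e t - conj_poisson g e' t) \<le> L * pi * (e + e')"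
        by (rule conj_poisson_lipschitz_cauchy[OF g(1-3) e(1,3) t])
      moreover have "L * pi * (e + e') \<le> L * pi * (2 * d)" using e L0 by (intro mult_left_mono) auto
      ultimately show "norm (conj_poisson f e t - conj_poisson f e' t) \<le> (norm (conj_poisson ?k e t) + norm (conj_poisson ?k e' t)) + L * pi * (2 * d)"
        by linarith
    qed
    also have "\<dots> = (LBINT t:{-1..1}. norm (conj_poisson ?k e t)) + (LBINT t:{-1..1}. norm (conj_poisson ?k e' t)) + (LBINT t:{-1..1::real}. L * pi * (2 * d))"
      using ki e ci by (simp add: set_integral_add)
    also have "(LBINT t:{-1..1::real}. L * pi * (2 * d)) = 4 * (L * pi) * d" by (simp add: set_lebesgue_integral_def)
    also have "\<dots> \<le> 4 * (L * pi + 1) * d" using d by (intro mult_right_mono) auto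
    also have "\<dots> = \<epsilon> / 4" 
    proof -
      have "L * pi + 1 > 0" using L0 by (simp add: add_nonneg_pos)
      thus ?thesis by (simp add: d_def divide_simps)
    qed
    also have "(LBINT t:{-1..1}. norm (conj_poisson ?k e t)) < \<epsilon> / 4" by (rule \<delta>(2)[OF k g(4,5) e(1)])
    also have "(LBINT t:{-1..1}. norm (conj_poisson ?k e' t)) < \<epsilon> / 4" by (rule \<delta>(2)[OF k g(4,5) e(3)])
    finally show ?thesis using eps by simp
  qed
  thus ?thesis using that d by blast
qed

text \<open>Completeness of L^1: a subsequence along e = 1/(n+1) converges almost everywhere, and
  Fatou's lemma carries the Cauchy estimate to the limit for every small e, not only along the
  subsequence.\<close>

lemma conj_poisson_L1_limit:
  fixes f :: "real \<Rightarrow> complex"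
  assumes f: "integrable lborel f" "supp1 f" "integrable lborel (\<lambda>x. norm (f x) powr r)" and r: "1 < r" "r < 2"
  obtains h where "integrable lborel h" 
    "((\<lambda>e. LBINT t. norm (indicator {-1..1} t *\<^sub>R conj_poisson f e t - h t)) \<longlongrightarrow> 0) (at_right 0)"
proof -
  define q where "q e t = indicator {-1..1} t *\<^sub>R conj_poisson f e t" for e and t :: real
  have qi: "integrable lborel (q e)" if "e > 0" for e
    using conj_poisson_set_integrable[OF f(1,2) that] unfolding set_integrable_def q_def .
  have cauchy: "\<exists>d>0. \<forall>e e'. 0 < e \<and> e < d \<and> 0 < e' \<and> e' < d \<longrightarrow> (LBINT t. norm (q e t - q e' t)) < \<epsilon>" if "\<epsilon> > 0" for \<epsilon>
  proof -
    obtain d where d: "d > 0" "\<And>e e'. \<lbrakk>0 < e; e < d; 0 < e'; e' < d\<rbrakk> \<Longrightarrow>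
      (LBINT t:{-1..1}. norm (conj_poisson f e t - conj_poisson f e' t)) < \<epsilon>"
      using conj_poisson_L1_cauchy[OF f r \<open>\<epsilon> > 0\<close>] by blast
    have "(LBINT t:{-1..1}. norm (conj_poisson f e t - conj_poisson f e' t)) = (LBINT t. norm (q e t - q e' t))" for e e'
      unfolding set_lebesgue_integral_def q_def
      by (intro Bochner_Integration.integral_cong refl) (auto simp: indicator_def)
    thus ?thesis using d by auto
  qed
  define s where "s n = q (1 / real (Suc n))" for n
  have si: "integrable lborel (s n)" for n unfolding s_def by (rule qi) simp
  have small: "\<exists>N. \<forall>n\<ge>N. 1 / real (Suc n) < d" if "d > 0" for d
  proof -
    have "eventually (\<lambda>n. 1 / real (Suc n) < d) sequentially"
      using that by (intro order_tendstoD(2)[OF lim_1_over_n[THEN LIMSEQ_Suc]]) auto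
    thus ?thesis by (simp add: eventually_sequentially)
  qed
  have "\<exists>N. \<forall>i\<ge>N. \<forall>j\<ge>N. LINT x|lborel. norm (s i x - s j x) < \<epsilon>" if eps: "\<epsilon> > 0" for \<epsilon>
  proof -
    obtain d where d: "d > 0" "\<And>e e'. \<lbrakk>0 < e; e < d; 0 < e'; e' < d\<rbrakk> \<Longrightarrow> (LBINT t. norm (q e t - q e' t)) < \<epsilon>"
      using cauchy[OF eps] by blast
    obtain N where "\<And>n. n \<ge> N \<Longrightarrow> 1 / real (Suc n) < d" using small[OF d(1)] by blast
    thus ?thesis unfolding s_def by (intro exI[of _ N] allI impI d(2)) auto
  qed
  from cauchy_L1_AE_cauchy_subseq[OF si this] obtain \<sigma> where \<sigma>: "strict_mono \<sigma>" "AE x in lborel. Cauchy (\<lambda>i. s (\<sigma> i) x)"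
    by blast
  define h where "h x = lim (\<lambda>i. s (\<sigma> i) x)" for x
  have [measurable]: "s n \<in> borel_measurable borel" for n using si[of n] by auto
  have hm[measurable]: "h \<in> borel_measurable borel" unfolding h_def by measurable
  have hlim: "AE x in lborel. (\<lambda>i. s (\<sigma> i) x) \<longlonglongrightarrow> h x"
    using \<sigma>(2) by eventually_elim (auto simp: h_def Cauchy_convergent_iff convergent_LIMSEQ_iff)
  have main: "integrable lborel (\<lambda>t. q e t - h t) \<and> (LBINT t. norm (q e t - h t)) \<le> \<epsilon>"
    if e: "0 < e" "e < d" and d: "d > 0" "\<And>e e'. \<lbrakk>0 < e; e < d; 0 < e'; e' < d\<rbrakk> \<Longrightarrow> (LBINT t. norm (q e t - q e' t)) < \<epsilon>" for e d \<epsilon>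
  proof -
    have eps: "\<epsilon> > 0" using d(2)[OF e e] by simp
    have [measurable]: "q e \<in> borel_measurable borel" using qi[OF e(1)] by auto
    obtain N where N: "\<And>n. n \<ge> N \<Longrightarrow> 1 / real (Suc n) < d" using small[OF d(1)] by blast
    have "(\<integral>\<^sup>+t. ennreal (norm (q e t - h t)) \<partial>lborel) = (\<integral>\<^sup>+t. liminf (\<lambda>i. ennreal (norm (q e t - s (\<sigma> i) t))) \<partial>lborel)"
    proof (rule nn_integral_cong_AE)
      show "AE x in lborel. ennreal (norm (q e x - h x)) = liminf (\<lambda>i. ennreal (norm (q e x - s (\<sigma> i) x)))"
        using hlim
      proof eventually_elim
        case (elim x)
        have "(\<lambda>i. ennreal (norm (q e x - s (\<sigma> i) x))) \<longlonglongrightarrow> ennreal (norm (q e x - h x))"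
          by (intro tendsto_intros elim)
        thus ?case by (intro lim_imp_Liminf[symmetric]) auto
      qed
    qed
    also have "\<dots> \<le> liminf (\<lambda>i. \<integral>\<^sup>+t. ennreal (norm (q e t - s (\<sigma> i) t)) \<partial>lborel)"
      by (rule nn_integral_liminf) measurable
    also have "\<dots> \<le> ennreal \<epsilon>"
    proof (rule Liminf_le)
      show "\<forall>\<^sub>F i in sequentially. (\<integral>\<^sup>+t. ennreal (norm (q e t - s (\<sigma> i) t)) \<partial>lborel) \<le> ennreal \<epsilon>"
        unfolding eventually_sequentially
      proof (intro exI[of _ N] allI impI)
        fix i assume i: "N \<le> i"
        have "N \<le> \<sigma> i" using i seq_suble[OF \<sigma>(1), of i] by linarith
        hence "(LBINT t. norm (q e t - s (\<sigma> i) t)) < \<epsilon>" unfolding s_def by (intro d(2) e N) auto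
        thus "(\<integral>\<^sup>+t. ennreal (norm (q e t - s (\<sigma> i) t)) \<partial>lborel) \<le> ennreal \<epsilon>"
          using qi[OF e(1)] si by (subst nn_integral_eq_integral) (auto intro!: ennreal_leI)
      qed
    qed simp
    finally have fin: "(\<integral>\<^sup>+t. ennreal (norm (q e t - h t)) \<partial>lborel) \<le> ennreal \<epsilon>" .
    have i: "integrable lborel (\<lambda>t. q e t - h t)"
      by (rule integrableI_bounded) (use fin in \<open>auto intro: le_less_trans\<close>)
    moreover have "(LBINT t. norm (q e t - h t)) \<le> \<epsilon>"
    proof -
      have "ennreal (LBINT t. norm (q e t - h t)) \<le> ennreal \<epsilon>"
        using fin i by (subst (asm) nn_integral_eq_integral) auto
      thus ?thesis using eps by (subst (asm) ennreal_le_iff) auto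
    qed
    ultimately show ?thesis by simp
  qed
  obtain d where d: "d > 0" "\<And>e e'. \<lbrakk>0 < e; e < d; 0 < e'; e' < d\<rbrakk> \<Longrightarrow> (LBINT t. norm (q e t - q e' t)) < 1"
    using cauchy[of 1] by auto
  have "integrable lborel (\<lambda>t. q (d/2) t - (q (d/2) t - h t))"
    using d(1) by (intro Bochner_Integration.integrable_diff qi conjunct1[OF main[OF _ _ d]]) auto
  hence hi: "integrable lborel h" by simp
  have "((\<lambda>e. LBINT t. norm (q e t - h t)) \<longlongrightarrow> 0) (at_right 0)"
  proof (rule tendstoI)
    fix \<epsilon> :: real assume eps: "\<epsilon> > 0"
    obtain d where d: "d > 0" "\<And>e e'. \<lbrakk>0 < e; e < d; 0 < e'; e' < d\<rbrakk> \<Longrightarrow> (LBINT t. norm (q e t - q e' t)) < \<epsilon>/2"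
      using cauchy[of "\<epsilon>/2"] eps by auto
    have "eventually (\<lambda>e. e \<in> {0<..<d}) (at_right 0)" using d(1) by (rule eventually_at_right_real)
    thus "\<forall>\<^sub>F e in at_right 0. dist (LBINT t. norm (q e t - h t)) 0 < \<epsilon>"
    proof eventually_elim
      case (elim e)
      have "(LBINT t. norm (q e t - h t)) \<le> \<epsilon>/2" using main[of e d, OF _ _ d] elim by auto
      moreover have "0 \<le> (LBINT t. norm (q e t - h t))" by (intro Bochner_Integration.integral_nonneg) auto
      ultimately show ?case using eps by (simp add: dist_real_def)
    qed
  qed
  thus ?thesis using that[OF hi] unfolding q_def by blast
qed

section \<open>Identification of the limit with the principal value\<close>

text \<open>An approximate identity that links L^1 limits to pointwise limits. Its support is
  compact, so averages at a point of (-1,1) stay where the L^1 limit is known; it is Lipschitz, so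
  its convolution with the conjugate kernel remains bounded near 0.\<close>

definition tent :: "real \<Rightarrow> real \<Rightarrow> real" where
  "tent e v = max 0 (1 - \<bar>v\<bar> / e) / e"

lemma tent_measurable [measurable]: "tent e \<in> borel_measurable borel"
  unfolding tent_def by measurable

lemma tent_nonneg: "e > 0 \<Longrightarrow> 0 \<le> tent e v"
  by (simp add: tent_def)

lemma tent_minus [simp]: "tent e (- v) = tent e v"
  by (simp add: tent_def)

lemma tent_zero: "e > 0 \<Longrightarrow> e \<le> \<bar>v\<bar> \<Longrightarrow> tent e v = 0"
  by (simp add: tent_def max_def)

lemma tent_le: "e > 0 \<Longrightarrow> \<bar>tent e v\<bar> \<le> 1 / e"
  by (simp add: tent_def max_def field_simps)

lemma tent_lipschitz: 
  assumes "e > 0"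
  shows "\<bar>tent e v - tent e w\<bar> \<le> \<bar>v - w\<bar> / e\<^sup>2"
proof -
  have "\<bar>max 0 (1 - \<bar>v\<bar> / e) - max 0 (1 - \<bar>w\<bar> / e)\<bar> \<le> \<bar>(1 - \<bar>v\<bar> / e) - (1 - \<bar>w\<bar> / e)\<bar>" 
    by (simp add: max_def)
  also have "\<dots> = \<bar>(\<bar>w\<bar> - \<bar>v\<bar>) / e\<bar>" by (simp add: diff_divide_distrib)
  also have "\<dots> = \<bar>\<bar>w\<bar> - \<bar>v\<bar>\<bar> / e" using assms by (simp add: abs_divide)
  also have "\<dots> \<le> \<bar>v - w\<bar> / e" using assms by (intro divide_right_mono) auto
  finally have "\<bar>max 0 (1 - \<bar>v\<bar> / e) - max 0 (1 - \<bar>w\<bar> / e)\<bar> / e \<le> \<bar>v - w\<bar> / e / e"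
    using assms by (intro divide_right_mono) auto
  thus ?thesis using assms by (simp add: tent_def power2_eq_square abs_divide flip: diff_divide_distrib)
qed

lemma integrable_bounded_Icc:
  fixes g :: "real \<Rightarrow> real"
  assumes "g \<in> borel_measurable borel" "\<And>x. \<bar>g x\<bar> \<le> B" "\<And>x. x \<notin> {a..b} \<Longrightarrow> g x = 0"
  shows "integrable lborel g"
proof (rule Bochner_Integration.integrable_bound)
  show "integrable lborel (\<lambda>x. indicator {a..b} x * B)" by (simp add: emeasure_lborel_Icc_eq)
  show "AE x in lborel. norm (g x) \<le> norm (indicator {a..b} x * B)"
    using assms(2,3) order_trans[OF assms(2) abs_ge_self] by (intro AE_I2) (auto simp: indicator_def)
qed (use assms in auto)

lemma integrable_tent: "e > 0 \<Longrightarrow> integrable lborel (\<lambda>x. tent e (x - t))"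
  by (rule integrable_bounded_Icc[where B="1/e" and a="t-e" and b="t+e"]) (auto intro: tent_le tent_zero)

lemma tent_integral:
  assumes "e > 0"
  shows "(LBINT x. tent e (x - t)) = 1"
proof -
  have "(\<integral>x. tent e (x - t) * indicator {t-e..t} x \<partial>lborel) = ((t-t)/e + (t-t)\<^sup>2/(2*e\<^sup>2)) - ((t-e-t)/e + (t-e-t)\<^sup>2/(2*e\<^sup>2))"
  proof (rule integral_FTC_Icc_real)
    fix x assume x: "t - e \<le> x" "x \<le> t"
    have "((\<lambda>x. (x-t)/e + (x-t)\<^sup>2/(2*e\<^sup>2)) has_real_derivative (1/e + (x-t)/e\<^sup>2)) (at x)"
      using assms by (auto intro!: derivative_eq_intros simp: field_simps power2_eq_square)
    moreover have "tent e (x-t) = 1/e + (x-t)/e\<^sup>2"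
      using x assms by (simp add: tent_def max_def field_simps power2_eq_square)
    ultimately show "((\<lambda>x. (x-t)/e + (x-t)\<^sup>2/(2*e\<^sup>2)) has_real_derivative tent e (x-t)) (at x)" by simp
    show "isCont (\<lambda>x. tent e (x-t)) x" unfolding tent_def using assms by (intro continuous_intros) auto
  qed (use assms in auto)
  hence l: "(\<integral>x. tent e (x - t) * indicator {t-e..t} x \<partial>lborel) = 1/2" using assms by (simp add: power2_eq_square field_simps)
  have "(\<integral>x. tent e (x - t) * indicator {t..t+e} x \<partial>lborel) = ((t+e-t)/e - (t+e-t)\<^sup>2/(2*e\<^sup>2)) - ((t-t)/e - (t-t)\<^sup>2/(2*e\<^sup>2))"
  proof (rule integral_FTC_Icc_real)
    fix x assume x: "t \<le> x" "x \<le> t + e"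
    have "((\<lambda>x. (x-t)/e - (x-t)\<^sup>2/(2*e\<^sup>2)) has_real_derivative (1/e - (x-t)/e\<^sup>2)) (at x)"
      using assms by (auto intro!: derivative_eq_intros simp: field_simps power2_eq_square)
    moreover have "tent e (x-t) = 1/e - (x-t)/e\<^sup>2"
      using x assms by (simp add: tent_def max_def field_simps power2_eq_square)
    ultimately show "((\<lambda>x. (x-t)/e - (x-t)\<^sup>2/(2*e\<^sup>2)) has_real_derivative tent e (x-t)) (at x)" by simp
    show "isCont (\<lambda>x. tent e (x-t)) x" unfolding tent_def using assms by (intro continuous_intros) auto
  qed (use assms in auto)
  hence r: "(\<integral>x. tent e (x - t) * indicator {t..t+e} x \<partial>lborel) = 1/2" using assms by (simp add: power2_eq_square field_simps)
  have "(LBINT x. tent e (x - t)) = (\<integral>x. tent e (x - t) * indicator {t-e..t} x + tent e (x - t) * indicator {t..t+e} x \<partial>lborel)"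
  proof (rule integral_cong_AE)
    show "AE x in lborel. tent e (x - t) = tent e (x - t) * indicator {t-e..t} x + tent e (x - t) * indicator {t..t+e} x"
      using AE_lborel_singleton[of t]
    proof eventually_elim
      case (elim x)
      thus ?case using tent_zero[OF assms, of "x - t"] by (cases "e \<le> \<bar>x - t\<bar>") (auto simp: indicator_def)
    qed
  qed measurable
  also have "\<dots> = (\<integral>x. tent e (x - t) * indicator {t-e..t} x \<partial>lborel) + (\<integral>x. tent e (x - t) * indicator {t..t+e} x \<partial>lborel)"
    by (intro Bochner_Integration.integral_add integrable_real_mult_indicator integrable_tent assms) auto
  finally show ?thesis using l r by simp
qed

lemma tent_average_tendsto:
  assumes h: "integrable lborel h" and lp: "lebesgue_point h t"
  shows "((\<lambda>e. LBINT s. h s * of_real (tent e (s - t))) \<longlongrightarrow> h t) (at_right 0)"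
proof (rule tendstoI)
  fix \<epsilon> :: real assume eps: "\<epsilon> > 0"
  obtain d0 where d0: "d0 > 0" "\<And>d. 0 < d \<Longrightarrow> d < d0 \<Longrightarrow> (LBINT x:{t-d..t+d}. norm (h x - h t)) \<le> \<epsilon>/2 * d"
    using lp[unfolded lebesgue_point_def, rule_format, of "\<epsilon>/2"] eps by auto
  have "eventually (\<lambda>e. e \<in> {0<..<d0}) (at_right 0)" using d0(1) by (rule eventually_at_right_real)
  thus "\<forall>\<^sub>F e in at_right 0. dist (LBINT s. h s * of_real (tent e (s - t))) (h t) < \<epsilon>"
  proof eventually_elim
    case (elim e)
    hence e: "e > 0" "e < d0" by auto
    have i1: "integrable lborel (\<lambda>s. h s * of_real (tent e (s - t)))"
      by (rule integrable_mult_bounded[OF h, where B="1/e"]) (use tent_le[OF e(1)] in auto)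
    have i2: "integrable lborel (\<lambda>s. h t * of_real (tent e (s - t)))"
      using integrable_tent[OF e(1)] by simp
    have "(LBINT s. h t * of_real (tent e (s - t))) = h t"
      using tent_integral[OF e(1), of t] by simp
    hence "(LBINT s. h s * of_real (tent e (s - t))) - h t = (LBINT s. h s * of_real (tent e (s - t)) - h t * of_real (tent e (s - t)))"
      using i1 i2 by simp
    also have "norm \<dots> \<le> (LBINT s. norm (h s * of_real (tent e (s - t)) - h t * of_real (tent e (s - t))))"
      by (rule integral_norm_bound)
    also have "\<dots> \<le> (LBINT s. (1/e) * (indicator {t-e..t+e} s *\<^sub>R norm (h s - h t)))"
    proof (rule integral_mono)
      show "integrable lborel (\<lambda>s. (1/e) * (indicator {t-e..t+e} s *\<^sub>R norm (h s - h t)))"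
        using set_integrable_norm[OF set_integrable_sub_const[OF h]] unfolding set_integrable_def by simp
      fix s
      have "norm (h s * of_real (tent e (s - t)) - h t * of_real (tent e (s - t))) = \<bar>tent e (s-t)\<bar> * norm (h s - h t)"
        by (simp add: norm_mult mult.commute flip: left_diff_distrib)
      also have "\<dots> \<le> (1/e) * (indicator {t-e..t+e} s *\<^sub>R norm (h s - h t))"
        using mult_right_mono[OF tent_le[OF e(1), of "s-t"], of "norm (h s - h t)"] tent_zero[OF e(1), of "s-t"] 
        by (cases "s \<in> {t-e..t+e}") auto
      finally show "norm (h s * of_real (tent e (s - t)) - h t * of_real (tent e (s - t))) \<le> (1/e) * (indicator {t-e..t+e} s *\<^sub>R norm (h s - h t))" .
    qed (use i1 i2 in auto)
    also have "\<dots> = (1/e) * (LBINT x:{t-e..t+e}. norm (h x - h t))" by (simp add: set_lebesgue_integral_def)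
    also have "\<dots> \<le> (1/e) * (\<epsilon>/2 * e)" using d0(2)[OF e] e by (intro mult_left_mono) auto
    also have "\<dots> < \<epsilon>" using e eps by simp
    finally show ?case by (simp add: dist_norm)
  qed
qed

text \<open>The kernel that a tent average puts in place of \<open>conj_kernel d\<close>. The aim is
  to compare it with \<open>conj_kernel e\<close>, uniformly in d <= e, at the cost of a multiple of
  \<open>poisson_kernel e\<close>.\<close>

definition tent_conj :: "real \<Rightarrow> real \<Rightarrow> real \<Rightarrow> real" where
  "tent_conj d e u = (LBINT v. conj_kernel d (u - v) * tent e v)"

lemma integrable_conj_tent: "d > 0 \<Longrightarrow> e > 0 \<Longrightarrow> integrable lborel (\<lambda>v. conj_kernel d (u - v) * tent e v)"
proof -
  assume "d > 0" "e > 0"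
  have "integrable lborel (\<lambda>v. tent e v * conj_kernel d (u - v))"
    by (rule integrable_mult_bounded[where B="1/d"]) 
      (use integrable_tent[OF \<open>e > 0\<close>, of 0] conj_kernel_le[OF \<open>d > 0\<close>] in auto)
  thus ?thesis by (simp add: mult.commute)
qed

lemma tent_conj_minus: "tent_conj d e (- u) = - tent_conj d e u"
proof -
  have flip: "conj_kernel d (- u + v) = - conj_kernel d (u - v)" for v
    using conj_kernel_minus[of d "u - v"] by simp
  have "tent_conj d e (- u) = (LBINT v. conj_kernel d (- u + v) * tent e v)"
    unfolding tent_conj_def
    using lborel_integral_real_affine[of "-1" "\<lambda>v. conj_kernel d (- u - v) * tent e v" 0] by simp
  also have "\<dots> = (LBINT v. - (conj_kernel d (u - v) * tent e v))"
    unfolding flip mult_minus_left ..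
  finally show ?thesis by (simp add: tent_conj_def)
qed

text \<open>Averaging the integral with its reflection in w pairs the odd kernel with the difference
  tent (u - w) - tent (u + w). That is at most 2 |w| / e^2, the kernel times |w| is at most 1, and
  everything lives on [-3e,3e]: twice the value is at most 12/e.\<close>

lemma tent_conj_near:
  assumes d: "d > 0" "d \<le> e" and u: "\<bar>u\<bar> \<le> 2 * e"
  shows "\<bar>tent_conj d e u\<bar> \<le> 6 / e"
proof -
  have e: "e > 0" using d by simp
  have a1: "tent_conj d e u = (LBINT w. conj_kernel d w * tent e (u - w))"
    unfolding tent_conj_def
    using lborel_integral_real_affine[of "-1" "\<lambda>v. conj_kernel d (u - v) * tent e v" u] by simp
  have a2: "tent_conj d e u = (LBINT w. - (conj_kernel d w * tent e (u + w)))"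
    unfolding a1
    using lborel_integral_real_affine[of "-1" "\<lambda>w. conj_kernel d w * tent e (u - w)" 0] by simp
  have i: "integrable lborel (\<lambda>w. conj_kernel d w * tent e (u - w))" "integrable lborel (\<lambda>w. conj_kernel d w * tent e (u + w))"
  proof -
    have "integrable lborel (\<lambda>w. tent e (w - u) * conj_kernel d w)" "integrable lborel (\<lambda>w. tent e (w - (-u)) * conj_kernel d w)"
      by (rule integrable_mult_bounded[OF integrable_tent[OF e], where B="1/d"]; use conj_kernel_le[OF d(1)] in simp)+
    moreover have "tent e (u - w) = tent e (w - u)" "tent e (u + w) = tent e (w - (- u))" for w
      using tent_minus[of e "w - u"] by (simp_all add: add.commute)
    ultimately show "integrable lborel (\<lambda>w. conj_kernel d w * tent e (u - w))" "integrable lborel (\<lambda>w. conj_kernel d w * tent e (u + w))"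
      by (simp_all only: mult.commute)
  qed
  have "2 * tent_conj d e u = (LBINT w. conj_kernel d w * tent e (u - w) - conj_kernel d w * tent e (u + w))"
    using a1 a2 i by simp
  hence "\<bar>2 * tent_conj d e u\<bar> = \<bar>LBINT w. conj_kernel d w * tent e (u - w) - conj_kernel d w * tent e (u + w)\<bar>"
    by simp
  also have "\<dots> \<le> (LBINT w. \<bar>conj_kernel d w * tent e (u - w) - conj_kernel d w * tent e (u + w)\<bar>)"
    by (rule integral_abs_bound)
  also have "\<dots> \<le> (LBINT w. indicator {-3*e..3*e} w * (2 / e\<^sup>2))"
  proof (rule integral_mono)
    fix w
    show "\<bar>conj_kernel d w * tent e (u - w) - conj_kernel d w * tent e (u + w)\<bar> \<le> indicator {-3*e..3*e} w * (2 / e\<^sup>2)"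
    proof (cases "w \<in> {-3*e..3*e}")
      case True
      have "\<bar>w * conj_kernel d w\<bar> \<le> 1" 
      proof -
        have "0 \<le> w * w" "0 < d\<^sup>2 + w\<^sup>2" using d by (auto simp: add_pos_nonneg)
        thus ?thesis by (simp add: conj_kernel_def abs_divide abs_mult power2_eq_square)
      qed
      hence k: "\<bar>conj_kernel d w\<bar> * \<bar>w\<bar> \<le> 1" by (simp add: abs_mult mult.commute)
      have "\<bar>conj_kernel d w * tent e (u - w) - conj_kernel d w * tent e (u + w)\<bar> = \<bar>conj_kernel d w\<bar> * \<bar>tent e (u - w) - tent e (u + w)\<bar>"
        by (simp add: abs_mult flip: right_diff_distrib)
      also have "\<dots> \<le> \<bar>conj_kernel d w\<bar> * (\<bar>(u - w) - (u + w)\<bar> / e\<^sup>2)"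
        by (intro mult_left_mono tent_lipschitz e) auto
      also have "\<dots> = (\<bar>conj_kernel d w\<bar> * \<bar>w\<bar>) * (2 / e\<^sup>2)" by (simp add: abs_mult)
      also have "\<dots> \<le> 1 * (2 / e\<^sup>2)" by (intro mult_right_mono k) auto
      finally show ?thesis using True by simp
    next
      case False
      hence "\<bar>u - w\<bar> \<ge> e" "\<bar>u + w\<bar> \<ge> e" using u by auto
      thus ?thesis using False tent_zero[OF e] by simp
    qed
  qed (use i in \<open>auto simp: emeasure_lborel_Icc_eq\<close>)
  also have "\<dots> = 12 / e" using e by (simp add: power2_eq_square field_simps)
  finally show ?thesis by (simp add: abs_mult)
qed

text \<open>For |v| <= e < |u|/2 the distance |u - v| is at least |u|/2. Passing from the kernel at
  u - v to 1/(u - v), then to 1/u, then to the kernel at u costs 4, 2 and 1 times e/u^2; averaging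
  over the tent of mass 1 preserves the sum 7.\<close>

lemma tent_conj_far:
  assumes d: "d > 0" "d \<le> e" and u: "\<bar>u\<bar> > 2 * e"
  shows "\<bar>tent_conj d e u - conj_kernel e u\<bar> \<le> 7 * e / u\<^sup>2"
proof -
  have e: "e > 0" using d by simp
  have u0: "u \<noteq> 0" using u e by auto
  have inv: "\<bar>conj_kernel b a - 1 / a\<bar> \<le> b\<^sup>2 / \<bar>a\<bar>^3" if "b > 0" "a \<noteq> 0" for a b :: real
  proof -
    define s where "s = b\<^sup>2 + a\<^sup>2"
    have s: "s > 0" "s \<ge> a\<^sup>2" using that by (auto simp: s_def add_pos_nonneg)
    have "conj_kernel b a = a / s" by (simp add: conj_kernel_def s_def)
    hence "conj_kernel b a - 1 / a = (a\<^sup>2 - s) / (a * s)"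
      using s that by (simp add: field_simps power2_eq_square)
    also have "\<bar>\<dots>\<bar> = b\<^sup>2 / (\<bar>a\<bar> * s)" using s by (simp add: s_def abs_mult abs_divide)
    also have "\<dots> \<le> b\<^sup>2 / (\<bar>a\<bar> * a\<^sup>2)" using s that by (intro divide_left_mono mult_left_mono) auto
    finally show ?thesis by (simp add: power3_eq_cube power2_eq_square)
  qed
  have key: "\<bar>conj_kernel d (u - v) - conj_kernel e u\<bar> \<le> 7 * e / u\<^sup>2" if v: "\<bar>v\<bar> \<le> e" for v
  proof -
    define a where "a = u - v"
    have a: "\<bar>a\<bar> \<ge> \<bar>u\<bar> / 2" using abs_triangle_ineq[of "u - v" v] v u by (simp_all add: a_def)
    have a0: "a \<noteq> 0" using a u0 by auto
    have u3: "\<bar>u\<bar>^3 = \<bar>u\<bar> * u\<^sup>2" by (simp add: power3_eq_cube power2_eq_square)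
    have "\<bar>conj_kernel d a - 1/a\<bar> \<le> d\<^sup>2 / \<bar>a\<bar>^3" by (rule inv[OF d(1) a0])
    also have "\<dots> \<le> e\<^sup>2 / (\<bar>u\<bar>/2)^3" using a d u0 by (intro frac_le power_mono) auto
    also have "(\<bar>u\<bar>/2)^3 = \<bar>u\<bar> * u\<^sup>2 / 8" by (simp only: power_divide u3) simp
    also have "e\<^sup>2 / (\<bar>u\<bar> * u\<^sup>2 / 8) = (8 * e) * e / (\<bar>u\<bar> * u\<^sup>2)" by (simp add: power2_eq_square[of e])
    also have "\<dots> \<le> (8 * e) * (\<bar>u\<bar> / 2) / (\<bar>u\<bar> * u\<^sup>2)" using u e by (intro divide_right_mono mult_left_mono) auto
    also have "\<dots> = 4 * e / u\<^sup>2" using u0 by simp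
    finally have 1: "\<bar>conj_kernel d a - 1/a\<bar> \<le> 4 * e / u\<^sup>2" .
    have "1/a - 1/u = v / (a * u)" using a0 u0 by (simp add: field_simps a_def)
    hence "\<bar>1/a - 1/u\<bar> = \<bar>v\<bar> / (\<bar>a\<bar> * \<bar>u\<bar>)" by (simp add: abs_divide abs_mult)
    also have "\<dots> \<le> e / ((\<bar>u\<bar>/2) * \<bar>u\<bar>)" using v a u0 e by (intro frac_le mult_right_mono mult_pos_pos) auto
    also have "\<dots> = 2 * e / u\<^sup>2" by (simp add: power2_eq_square)
    finally have 2: "\<bar>1/a - 1/u\<bar> \<le> 2 * e / u\<^sup>2" .
    have "\<bar>conj_kernel e u - 1/u\<bar> \<le> e\<^sup>2 / \<bar>u\<bar>^3" by (rule inv[OF e u0])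
    also have "\<dots> = e * e / (\<bar>u\<bar> * u\<^sup>2)" by (simp add: u3 power2_eq_square[of e])
    also have "\<dots> \<le> e * \<bar>u\<bar> / (\<bar>u\<bar> * u\<^sup>2)" using u e by (intro divide_right_mono mult_left_mono) auto
    also have "\<dots> = e / u\<^sup>2" using u0 by simp
    finally have 3: "\<bar>conj_kernel e u - 1/u\<bar> \<le> e / u\<^sup>2" .
    have "\<bar>conj_kernel d a - conj_kernel e u\<bar> \<le> 4 * e / u\<^sup>2 + 2 * e / u\<^sup>2 + e / u\<^sup>2" using 1 2 3 by linarith
    also have "\<dots> = 7 * e / u\<^sup>2" by (simp flip: add_divide_distrib)
    finally show ?thesis by (simp add: a_def)
  qed
  have i: "integrable lborel (\<lambda>v. tent e v)" using integrable_tent[OF e, of 0] by simp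
  have "conj_kernel e u = (LBINT v. conj_kernel e u * tent e v)" using tent_integral[OF e, of 0] by simp
  hence "tent_conj d e u - conj_kernel e u = (LBINT v. conj_kernel d (u - v) * tent e v) - (LBINT v. conj_kernel e u * tent e v)"
    by (simp add: tent_conj_def)
  also have "\<dots> = (LBINT v. conj_kernel d (u - v) * tent e v - conj_kernel e u * tent e v)"
    by (rule Bochner_Integration.integral_diff[symmetric]) (use i integrable_conj_tent[OF d(1) e] in auto)
  finally have "\<bar>tent_conj d e u - conj_kernel e u\<bar> \<le> (LBINT v. \<bar>conj_kernel d (u - v) * tent e v - conj_kernel e u * tent e v\<bar>)"
    by (simp only: integral_abs_bound)
  also have "\<dots> \<le> (LBINT v. (7 * e / u\<^sup>2) * tent e v)"
  proof (rule integral_mono)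
    fix v
    have "\<bar>conj_kernel d (u - v) * tent e v - conj_kernel e u * tent e v\<bar> = \<bar>conj_kernel d (u - v) - conj_kernel e u\<bar> * tent e v"
      using tent_nonneg[OF e, of v] by (simp add: abs_mult flip: left_diff_distrib)
    also have "\<dots> \<le> (7 * e / u\<^sup>2) * tent e v"
    proof (cases "\<bar>v\<bar> \<le> e")
      case True
      thus ?thesis by (intro mult_right_mono key tent_nonneg e)
    next
      case False
      thus ?thesis using tent_zero[OF e, of v] by simp
    qed
    finally show "\<bar>conj_kernel d (u - v) * tent e v - conj_kernel e u * tent e v\<bar> \<le> (7 * e / u\<^sup>2) * tent e v" .
  qed (use i integrable_conj_tent[OF d(1) e] in auto)
  also have "\<dots> = 7 * e / u\<^sup>2" using tent_integral[OF e, of 0] by simp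
  finally show ?thesis .
qed

text \<open>Both regimes leave 7 over the larger scale: 7/e near 0, where e^2 + u^2 <= 5 e^2, and 7
  e/u^2 far away, where e^2 + u^2 <= 5 u^2. Hence 35, whatever d is.\<close>

lemma tent_conj_bound:
  assumes d: "d > 0" "d \<le> e"
  shows "\<bar>tent_conj d e u - conj_kernel e u\<bar> \<le> 35 * poisson_kernel e u"
proof -
  have e: "e > 0" using d by simp
  have s: "e\<^sup>2 + u\<^sup>2 > 0" using e by (simp add: add_pos_nonneg)
  show ?thesis
  proof (cases "\<bar>u\<bar> \<le> 2 * e")
    case True
    have "\<bar>u\<bar>\<^sup>2 \<le> (2 * e)\<^sup>2" using True by (intro power_mono) auto
    hence "e\<^sup>2 + u\<^sup>2 \<le> 5 * e\<^sup>2" by (simp add: power_mult_distrib)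
    hence "35 * e / (5 * e\<^sup>2) \<le> 35 * e / (e\<^sup>2 + u\<^sup>2)" using s e by (intro divide_left_mono) auto
    moreover have "35 * e / (5 * e\<^sup>2) = 7 / e" using e by (simp add: power2_eq_square)
    ultimately have "7 / e \<le> 35 * poisson_kernel e u" by (simp add: poisson_kernel_def)
    moreover have "\<bar>conj_kernel e u\<bar> \<le> 1 / e" by (rule conj_kernel_le[OF e])
    moreover have "6 / e + 1 / e = 7 / e" by (simp flip: add_divide_distrib)
    ultimately show ?thesis using tent_conj_near[OF d True] by linarith
  next
    case False
    have "(2 * e)\<^sup>2 \<le> \<bar>u\<bar>\<^sup>2" using False e by (intro power_mono) auto
    hence "4 * e\<^sup>2 \<le> u\<^sup>2" by (simp add: power_mult_distrib)
    hence "e\<^sup>2 + u\<^sup>2 \<le> 5 * u\<^sup>2" using zero_le_power2[of u] zero_le_power2[of e] by linarith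
    hence "35 * e / (5 * u\<^sup>2) \<le> 35 * e / (e\<^sup>2 + u\<^sup>2)" using s e by (intro divide_left_mono mult_pos_pos) auto
    moreover have "35 * e / (5 * u\<^sup>2) = 7 * e / u\<^sup>2" by simp
    ultimately show ?thesis using tent_conj_far[OF d, of u] False by (simp add: poisson_kernel_def)
  qed
qed

lemma tent_conj_measurable [measurable]: "tent_conj d e \<in> borel_measurable borel"
  unfolding tent_conj_def by measurable

lemma conj_poisson_tent_average:
  assumes f: "integrable lborel f" and d: "d > 0" "e > 0"
  shows "(LBINT s. conj_poisson f d s * of_real (tent e (s - t))) = (LBINT x. f x * of_real (tent_conj d e (x - t)))"
proof -
  have fm[measurable]: "f \<in> borel_measurable borel" using f by auto
  let ?G = "\<lambda>s x. f x * of_real (conj_kernel d (x - s)) * complex_of_real (tent e (s - t))"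
  have int: "integrable (lborel \<Otimes>\<^sub>M lborel) (\<lambda>(s, x). ?G s x)"
  proof (rule lborel_pair.Fubini_integrable)
    show "(\<lambda>(s, x). ?G s x) \<in> borel_measurable (lborel \<Otimes>\<^sub>M lborel)" by measurable
    have n: "(LBINT x. norm (?G s x)) = (LBINT x. norm (f x) * \<bar>conj_kernel d (x - s)\<bar>) * tent e (s - t)" for s
      using tent_nonneg[OF d(2)] by (simp add: norm_mult)
    have m: "(\<lambda>s. LBINT x. norm (f x) * \<bar>conj_kernel d (x - s)\<bar>) \<in> borel_measurable borel" by measurable
    have b: "\<bar>LBINT x. norm (f x) * \<bar>conj_kernel d (x - s)\<bar>\<bar> \<le> (LBINT x. norm (f x)) * (1/d)" for s
    proof -
      have "(LBINT x. norm (f x) * \<bar>conj_kernel d (x - s)\<bar>) \<le> (LBINT x. norm (f x) * (1/d))"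
      proof (rule integral_mono)
        show "integrable lborel (\<lambda>x. norm (f x) * \<bar>conj_kernel d (x - s)\<bar>)"
          by (rule integrable_mult_bounded[where B="1/d"]) (use f conj_kernel_le[OF d(1)] in auto)
        show "norm (f x) * \<bar>conj_kernel d (x - s)\<bar> \<le> norm (f x) * (1/d)" for x
          by (intro mult_left_mono conj_kernel_le d) auto
      qed (use f in auto)
      moreover have "0 \<le> (LBINT x. norm (f x) * \<bar>conj_kernel d (x - s)\<bar>)"
        by (intro Bochner_Integration.integral_nonneg) auto
      ultimately show ?thesis by simp
    qed
    have "integrable lborel (\<lambda>s. tent e (s - t) * (LBINT x. norm (f x) * \<bar>conj_kernel d (x - s)\<bar>))"
      by (rule integrable_mult_bounded[OF integrable_tent[OF d(2)]]) (use m b in auto)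
    thus "integrable lborel (\<lambda>s. LBINT x. norm (case (s, x) of (s, x) \<Rightarrow> ?G s x))"
      unfolding case_prod_conv n by (simp only: mult.commute)
    show "AE s in lborel. integrable lborel (\<lambda>x. case (s, x) of (s, x) \<Rightarrow> ?G s x)"
      using integrable_conj_kernel[OF f d(1)] by simp
  qed
  have "(LBINT s. conj_poisson f d s * of_real (tent e (s - t))) = (LBINT s. LBINT x. ?G s x)"
    unfolding conj_poisson_def by simp
  also have "\<dots> = (LBINT x. LBINT s. ?G s x)"
    using lborel_pair.Fubini_integral[OF int] by simp
  also have "\<dots> = (LBINT x. f x * of_real (tent_conj d e (x - t)))"
  proof (intro Bochner_Integration.integral_cong refl)
    fix x
    have "(LBINT s. ?G s x) = (LBINT s. f x * of_real (conj_kernel d (x - s) * tent e (s - t)))" by (simp add: mult.assoc)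
    also have "\<dots> = f x * of_real (LBINT s. conj_kernel d (x - s) * tent e (s - t))"
      by (simp only: integral_mult_right_zero integral_complex_of_real)
    also have "(LBINT s. conj_kernel d (x - s) * tent e (s - t)) = tent_conj d e (x - t)"
      unfolding tent_conj_def
      using lborel_integral_real_affine[of 1 "\<lambda>s. conj_kernel d (x - s) * tent e (s - t)" t] by (simp add: algebra_simps)
    finally show "(LBINT s. ?G s x) = f x * of_real (tent_conj d e (x - t))" .
  qed
  finally show ?thesis .
qed

lemma conj_poisson_tent_diff:
  assumes f: "integrable lborel f" "supp1 f" and d: "d > 0" "d \<le> e" and t: "\<bar>t\<bar> < 1"
  shows "norm ((LBINT s. conj_poisson f d s * of_real (tent e (s - t))) - conj_poisson f e t)
     \<le> 35 * (LBINT x:{t-2..t+2}. norm (f x - f t) * poisson_kernel e (x-t))"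
proof -
  have e: "e > 0" using d by simp
  have tb: "\<bar>tent_conj d e u\<bar> \<le> 36 / e" for u
    using tent_conj_bound[OF d, of u] conj_kernel_le[OF e, of u] poisson_kernel_le(2)[OF e, of u] by simp
  have i: "integrable lborel (\<lambda>x. f x * complex_of_real (tent_conj d e (x - t)))"
    by (rule integrable_mult_bounded[OF f(1), where B="36/e"]) (use tb in auto)
  have "(LBINT s. conj_poisson f d s * of_real (tent e (s - t))) - conj_poisson f e t
    = (LBINT x. f x * of_real (tent_conj d e (x - t)) - f x * of_real (conj_kernel e (x - t)))"
    unfolding conj_poisson_tent_average[OF f(1) d(1) e] conj_poisson_def[of f e]
    by (rule Bochner_Integration.integral_diff[symmetric, OF i integrable_conj_kernel[OF f(1) e]])
  also have "\<dots> = (LBINT x. f x * of_real (tent_conj d e (x - t) - conj_kernel e (x - t)))"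
    by (simp only: of_real_diff right_diff_distrib)
  finally have eq: "(LBINT s. conj_poisson f d s * of_real (tent e (s - t))) - conj_poisson f e t = (LBINT x. f x * of_real (tent_conj d e (x - t) - conj_kernel e (x - t)))" .
  show ?thesis unfolding eq
  proof (rule odd_kernel_bound[OF f t e])
    show "(\<lambda>u. tent_conj d e u - conj_kernel e u) \<in> borel_measurable borel" by measurable
    show "tent_conj d e (-u) - conj_kernel e (-u) = - (tent_conj d e u - conj_kernel e u)" for u
      by (simp add: tent_conj_minus)
    show "\<bar>tent_conj d e u - conj_kernel e u\<bar> \<le> 35 * poisson_kernel e u" for u
      by (rule tent_conj_bound[OF d])
  qed
qed

text \<open>The order of limits matters. With e fixed, d tends to 0 and L^1 convergence puts h
  inside the tent average; the comparison with the conjugate Poisson integral at e survives because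
  it is uniform in d. Then e tends to 0, where the Lebesgue points of f and of h are used.\<close>

lemma conj_poisson_pointwise:
  assumes f: "integrable lborel f" "supp1 f" and h: "integrable lborel h"
    and lim: "((\<lambda>e. LBINT t. norm (indicator {-1..1} t *\<^sub>R conj_poisson f e t - h t)) \<longlongrightarrow> 0) (at_right 0)"
    and t: "\<bar>t\<bar> < 1" and lp: "lebesgue_point f t" "lebesgue_point h t"
  shows "((\<lambda>e. conj_poisson f e t) \<longlongrightarrow> h t) (at_right 0)"
proof -
  let ?H = "\<lambda>e. LBINT s. h s * of_real (tent e (s - t))"
  let ?P = "\<lambda>e. LBINT x:{t-2..t+2}. norm (f x - f t) * poisson_kernel e (x-t)"
  let ?q = "\<lambda>d s. indicator {-1..1} s *\<^sub>R conj_poisson f d s"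
  have [measurable]: "h \<in> borel_measurable borel" using h by auto
  \<comment> \<open>The bound e < 1 - |t| keeps the support of the tent inside (-1,1), where h is
    the L^1 limit.\<close>
  have main: "norm (?H e - conj_poisson f e t) \<le> 35 * ?P e" if e: "0 < e" "e < 1 - \<bar>t\<bar>" for e
  proof -
    have qi: "integrable lborel (?q d)" if "d > 0" for d
      using conj_poisson_set_integrable[OF f that] unfolding set_integrable_def .
    have eq: "(LBINT s. conj_poisson f d s * of_real (tent e (s - t))) = (LBINT s. ?q d s * of_real (tent e (s - t)))" for d
    proof (intro Bochner_Integration.integral_cong refl)
      fix s
      show "conj_poisson f d s * of_real (tent e (s - t)) = ?q d s * of_real (tent e (s - t))"
        using tent_zero[OF e(1), of "s - t"] e by (cases "e \<le> \<bar>s - t\<bar>"; cases "s \<in> {-1..1}") auto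
    qed
    have bd: "norm ((LBINT s. ?q d s * of_real (tent e (s - t))) - ?H e) \<le> (LBINT s. norm (?q d s - h s)) * (1/e)" if d: "d > 0" for d
    proof -
      have i1: "integrable lborel (\<lambda>s. ?q d s * complex_of_real (tent e (s - t)))"
        by (rule integrable_mult_bounded[OF qi[OF d], where B="1/e"]) (use tent_le[OF e(1)] in auto)
      have i2: "integrable lborel (\<lambda>s. h s * complex_of_real (tent e (s - t)))"
        by (rule integrable_mult_bounded[OF h, where B="1/e"]) (use tent_le[OF e(1)] in auto)
      have "(LBINT s. ?q d s * of_real (tent e (s - t))) - ?H e = (LBINT s. ?q d s * of_real (tent e (s - t)) - h s * of_real (tent e (s - t)))"
        by (rule Bochner_Integration.integral_diff[symmetric, OF i1 i2])
      hence "norm ((LBINT s. ?q d s * of_real (tent e (s - t))) - ?H e) \<le> (LBINT s. norm (?q d s * of_real (tent e (s - t)) - h s * of_real (tent e (s - t))))"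
        by (simp only: integral_norm_bound)
      also have "\<dots> \<le> (LBINT s. norm (?q d s - h s) * (1/e))"
      proof (rule integral_mono)
        fix s
        have "norm (?q d s * of_real (tent e (s - t)) - h s * of_real (tent e (s - t))) = norm (?q d s - h s) * \<bar>tent e (s - t)\<bar>"
          by (simp only: norm_mult norm_of_real flip: left_diff_distrib)
        also have "\<dots> \<le> norm (?q d s - h s) * (1/e)" by (intro mult_left_mono tent_le e) auto
        finally show "norm (?q d s * of_real (tent e (s - t)) - h s * of_real (tent e (s - t))) \<le> norm (?q d s - h s) * (1/e)" .
      next
        show "integrable lborel (\<lambda>s. norm (?q d s * of_real (tent e (s - t)) - h s * of_real (tent e (s - t))))"
          using i1 i2 by (intro integrable_norm Bochner_Integration.integrable_diff)
        show "integrable lborel (\<lambda>s. norm (?q d s - h s) * (1/e))"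
          using qi[OF d] h by (intro integrable_mult_left integrable_norm Bochner_Integration.integrable_diff)
      qed
      finally show ?thesis by simp
    qed
    have "((\<lambda>d. (LBINT s. ?q d s * of_real (tent e (s - t))) - ?H e) \<longlongrightarrow> 0) (at_right 0)"
    proof (rule Lim_null_comparison)
      show "\<forall>\<^sub>F d in at_right 0. norm ((LBINT s. ?q d s * of_real (tent e (s - t))) - ?H e) \<le> (LBINT s. norm (?q d s - h s)) * (1/e)"
        using eventually_at_right_less[of 0] by eventually_elim (rule bd)
      show "((\<lambda>d. (LBINT s. norm (?q d s - h s)) * (1/e)) \<longlongrightarrow> 0) (at_right 0)"
        by (rule tendsto_mult_left_zero[OF lim])
    qed
    hence l: "((\<lambda>d. LBINT s. ?q d s * of_real (tent e (s - t))) \<longlongrightarrow> ?H e) (at_right 0)"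
      by (simp only: LIM_zero_iff)
    have "((\<lambda>d. norm ((LBINT s. ?q d s * of_real (tent e (s - t))) - conj_poisson f e t)) \<longlongrightarrow> norm (?H e - conj_poisson f e t)) (at_right 0)"
      by (intro tendsto_intros l)
    moreover have "eventually (\<lambda>d. d \<in> {0<..<e}) (at_right 0)" using e(1) by (rule eventually_at_right_real)
    hence "\<forall>\<^sub>F d in at_right 0. norm ((LBINT s. ?q d s * of_real (tent e (s - t))) - conj_poisson f e t) \<le> 35 * ?P e"
      by eventually_elim (unfold eq[symmetric], intro conj_poisson_tent_diff f t, auto)
    ultimately show ?thesis by (intro tendsto_upperbound) auto
  qed
  have "((\<lambda>e. ?H e - conj_poisson f e t) \<longlongrightarrow> 0) (at_right 0)"
  proof (rule Lim_null_comparison)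
    have "eventually (\<lambda>d. d \<in> {0<..<1-\<bar>t\<bar>}) (at_right 0)" using t by (intro eventually_at_right_real) auto
    thus "\<forall>\<^sub>F e in at_right 0. norm (?H e - conj_poisson f e t) \<le> 35 * ?P e"
      by eventually_elim (rule main; simp)
    show "((\<lambda>e. 35 * ?P e) \<longlongrightarrow> 0) (at_right 0)"
      by (rule tendsto_mult_right_zero[OF poisson_lebesgue_point[OF lp(1) f(1)]])
  qed
  from tendsto_diff[OF tent_average_tendsto[OF h lp(2)] this] show ?thesis by simp
qed

text \<open>The kernel is odd, so the operator is skew-adjoint. Fubini's theorem applies for fixed e
  because the kernel is bounded by 1/e and both densities are integrable.\<close>

lemma conj_poisson_pairing:
  assumes f: "integrable lborel f" "supp1 f" and g: "g \<in> borel_measurable borel" "supp1 g" "\<And>x. norm (g x) \<le> B"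
    and e: "e > 0"
  shows "(LBINT t. g t * conj_poisson f e t) = - (LBINT x. f x * conj_poisson g e x)"
proof -
  have [measurable]: "f \<in> borel_measurable borel" "g \<in> borel_measurable borel" using f g by auto
  have gi: "integrable lborel g"
  proof (rule Bochner_Integration.integrable_bound)
    show "integrable lborel (\<lambda>x. indicator {-1..1::real} x * B)" by (simp add: emeasure_lborel_Icc_eq)
    show "AE x in lborel. norm (g x) \<le> norm (indicator {-1..1} x * B)"
      using g(2,3) order_trans[OF g(3) abs_ge_self] by (intro AE_I2) (auto simp: indicator_def supp1_def)
  qed auto
  let ?G = "\<lambda>t x. g t * (f x * complex_of_real (conj_kernel e (x - t)))"
  have int: "integrable (lborel \<Otimes>\<^sub>M lborel) (\<lambda>(t, x). ?G t x)"
  proof (rule lborel_pair.Fubini_integrable)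
    show "(\<lambda>(s, x). ?G s x) \<in> borel_measurable (lborel \<Otimes>\<^sub>M lborel)" by measurable
    have n: "(LBINT x. norm (?G s x)) = norm (g s) * (LBINT x. norm (f x) * \<bar>conj_kernel e (x - s)\<bar>)" for s
      by (simp add: norm_mult)
    have m: "(\<lambda>s. LBINT x. norm (f x) * \<bar>conj_kernel e (x - s)\<bar>) \<in> borel_measurable borel" by measurable
    have b: "\<bar>LBINT x. norm (f x) * \<bar>conj_kernel e (x - s)\<bar>\<bar> \<le> (LBINT x. norm (f x)) * (1/e)" for s
    proof -
      have "(LBINT x. norm (f x) * \<bar>conj_kernel e (x - s)\<bar>) \<le> (LBINT x. norm (f x) * (1/e))"
      proof (rule integral_mono)
        show "integrable lborel (\<lambda>x. norm (f x) * \<bar>conj_kernel e (x - s)\<bar>)"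
          by (rule integrable_mult_bounded[where B="1/e"]) (use f conj_kernel_le[OF e] in auto)
        show "norm (f x) * \<bar>conj_kernel e (x - s)\<bar> \<le> norm (f x) * (1/e)" for x
          by (intro mult_left_mono conj_kernel_le e) auto
      qed (use f in auto)
      moreover have "0 \<le> (LBINT x. norm (f x) * \<bar>conj_kernel e (x - s)\<bar>)"
        by (intro Bochner_Integration.integral_nonneg) auto
      ultimately show ?thesis by simp
    qed
    have "integrable lborel (\<lambda>s. norm (g s) * (LBINT x. norm (f x) * \<bar>conj_kernel e (x - s)\<bar>))"
      by (rule integrable_mult_bounded[OF integrable_norm[OF gi]]) (use m b in auto)
    thus "integrable lborel (\<lambda>s. LBINT x. norm (case (s, x) of (s, x) \<Rightarrow> ?G s x))"
      by (simp add: n)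
    show "AE s in lborel. integrable lborel (\<lambda>x. case (s, x) of (s, x) \<Rightarrow> ?G s x)"
      using integrable_conj_kernel[OF f(1) e] by simp
  qed
  have "(LBINT t. g t * conj_poisson f e t) = (LBINT t. LBINT x. ?G t x)"
    unfolding conj_poisson_def by simp
  also have "\<dots> = (LBINT x. LBINT t. ?G t x)"
    using lborel_pair.Fubini_integral[OF int] by simp
  also have "\<dots> = (LBINT x. - (f x * conj_poisson g e x))"
  proof (intro Bochner_Integration.integral_cong refl)
    fix x
    have "?G t x = - (f x * (g t * complex_of_real (conj_kernel e (t - x))))" for t
      using conj_kernel_minus[of e "t - x"] by simp
    thus "(LBINT t. ?G t x) = - (f x * conj_poisson g e x)"
      unfolding conj_poisson_def by simp
  qed
  finally show ?thesis by simp
qed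

section \<open>Borel representatives and the principal value\<close>

lemma borel_representative:
  assumes "f \<in> borel_measurable leb"
  obtains f0 where "f0 \<in> borel_measurable borel" "supp1 f0" "AE x in leb. f0 x = f x"
proof -
  let ?F = "\<lambda>x. if x \<in> {-1<..<1} then f x else 0"
  have F: "?F \<in> borel_measurable (completion lborel)"
    using assms borel_measurable_if[of "{-1<..<1::real}" f] by (simp add: borel_measurable_if_I)
  obtain g1 where g1: "g1 \<in> borel_measurable lborel" "AE x in lborel. Re (?F x) = g1 x"
    using completion_ex_borel_measurable_real[of "\<lambda>x. Re (?F x)" lborel] F by auto
  obtain g2 where g2: "g2 \<in> borel_measurable lborel" "AE x in lborel. Im (?F x) = g2 x"
    using completion_ex_borel_measurable_real[of "\<lambda>x. Im (?F x)" lborel] F by auto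
  define g where "g x = complex_of_real (g1 x) + \<i> * of_real (g2 x)" for x
  have g: "g \<in> borel_measurable lborel" "AE x in lborel. ?F x = g x"
  proof -
    show "g \<in> borel_measurable lborel" using g1(1) g2(1) unfolding g_def by measurable
    show "AE x in lborel. ?F x = g x" using g1(2) g2(2) by eventually_elim (simp add: g_def complex_eq_iff)
  qed
  define f0 where "f0 x = (if x \<in> {-1<..<1} then g x else 0)" for x
  have "f0 \<in> borel_measurable borel" using g(1) unfolding f0_def by measurable
  moreover have "supp1 f0" by (auto simp: supp1_def f0_def)
  moreover have "AE x in lebesgue. x \<in> {-1<..<1} \<longrightarrow> f0 x = f x"
    using AE_completion[OF g(2)] by eventually_elim (auto simp: f0_def)
  hence "AE x in leb. f0 x = f x" by (subst AE_restrict_space_iff) auto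
  ultimately show ?thesis using that by blast
qed

lemma finite_hilbert_eq:
  assumes ae: "AE x in leb. f0 x = f x" and f0: "f0 \<in> borel_measurable borel" "supp1 f0" 
    and f: "f \<in> borel_measurable leb" and i: "integrable lborel f0" and t: "\<bar>t\<bar> < 1"
  shows "finite_hilbert f t = Lim (at_right 0) (\<lambda>e. 1 / (complex_of_real pi * \<i>) * truncated_hilbert f0 e t)"
proof -
  have ae': "AE x in lebesgue. x \<in> {-1<..<1} \<longrightarrow> f0 x = f x"
    using ae by (subst (asm) AE_restrict_space_iff) auto
  have fm: "(\<lambda>x. if x \<in> {-1<..<1} then f x else 0) \<in> borel_measurable lebesgue"
    using f borel_measurable_if[of "{-1<..<1::real}" f] by (simp add: borel_measurable_if_I)
  have eq: "((LINT x:{-1<..<t - e}|lebesgue. f x / complex_of_real (x - t)) +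
      (LINT x:{t + e<..<1}|lebesgue. f x / complex_of_real (x - t))) = truncated_hilbert f0 e t" if e: "e > 0" for e
  proof -
    let ?A = "{-1<..<t - e}" and ?B = "{t + e<..<1}"
    have conv: "(LINT x:A|lebesgue. f x / complex_of_real (x - t)) = (LBINT x. indicator A x *\<^sub>R (f0 x / of_real (x - t)))"
      if A: "A \<subseteq> {-1<..<1}" "A \<in> sets borel" for A
    proof -
      have "(LINT x:A|lebesgue. f x / complex_of_real (x - t)) = (LINT x|lebesgue. indicator A x *\<^sub>R ((if x \<in> {-1<..<1} then f x else 0) / of_real (x - t)))"
        unfolding set_lebesgue_integral_def using A by (intro Bochner_Integration.integral_cong refl) (auto simp: indicator_def)
      also have "\<dots> = (LINT x|lebesgue. indicator A x *\<^sub>R (f0 x / of_real (x - t)))"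
      proof (rule integral_cong_AE)
        show "AE x in lebesgue. indicator A x *\<^sub>R ((if x \<in> {-1<..<1} then f x else 0) / of_real (x - t)) = indicator A x *\<^sub>R (f0 x / of_real (x - t))"
          using ae' by eventually_elim (use A in \<open>auto simp: indicator_def\<close>)
        have [measurable]: "A \<in> sets lebesgue" "f0 \<in> borel_measurable lebesgue" 
          using A f0 by (auto simp: measurable_completion)
        have [measurable]: "(\<lambda>x. complex_of_real (x - t)) \<in> borel_measurable lebesgue"
          by (intro measurable_completion) auto
        note [measurable] = fm
        show "(\<lambda>x. indicator A x *\<^sub>R ((if x \<in> {-1<..<1} then f x else 0) / complex_of_real (x - t))) \<in> borel_measurable lebesgue"
          by measurable
        show "(\<lambda>x. indicator A x *\<^sub>R (f0 x / complex_of_real (x - t))) \<in> borel_measurable lebesgue"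
          by measurable
      qed
      also have "\<dots> = (LBINT x. indicator A x *\<^sub>R (f0 x / of_real (x - t)))"
        by (rule integral_completion) (use A f0 in measurable)
      finally show ?thesis .
    qed
    have int: "integrable lborel (\<lambda>x. indicator A x *\<^sub>R (f0 x / of_real (x - t)))"
      if A: "A \<in> sets borel" "\<And>x. x \<in> A \<Longrightarrow> e \<le> \<bar>x - t\<bar>" for A
    proof (rule Bochner_Integration.integrable_bound[where f="\<lambda>x. norm (f0 x) * (1/e)"])
      have "norm (indicator A x *\<^sub>R (f0 x / complex_of_real (x - t))) \<le> norm (f0 x) * (1/e)" for x
      proof (cases "x \<in> A")
        case True
        have "norm (f0 x) / \<bar>x - t\<bar> \<le> norm (f0 x) / e"
          using A(2)[OF True] e by (intro divide_left_mono) auto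
        thus ?thesis using True by (simp add: norm_divide flip: of_real_diff)
      qed (use e in auto)
      thus "AE x in lborel. norm (indicator A x *\<^sub>R (f0 x / complex_of_real (x - t))) \<le> norm (norm (f0 x) * (1/e))"
        using e by (intro AE_I2) auto
    qed (use i f0 A in auto)
    have "((LINT x:?A|lebesgue. f x / complex_of_real (x - t)) + (LINT x:?B|lebesgue. f x / complex_of_real (x - t)))
      = (LBINT x. indicator ?A x *\<^sub>R (f0 x / of_real (x - t))) + (LBINT x. indicator ?B x *\<^sub>R (f0 x / of_real (x - t)))"
      using t e by (subst (1 2) conv) auto
    also have "\<dots> = (LBINT x. indicator ?A x *\<^sub>R (f0 x / of_real (x - t)) + indicator ?B x *\<^sub>R (f0 x / of_real (x - t)))"
      by (rule Bochner_Integration.integral_add[symmetric, OF int int]) (use e in auto)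
    also have "\<dots> = truncated_hilbert f0 e t"
      unfolding truncated_hilbert_def
    proof (intro Bochner_Integration.integral_cong refl)
      fix x
      show "indicator ?A x *\<^sub>R (f0 x / of_real (x - t)) + indicator ?B x *\<^sub>R (f0 x / of_real (x - t)) = f0 x * of_real (of_bool (e < \<bar>x - t\<bar>) / (x - t))"
      proof (cases "\<bar>x\<bar> < 1")
        case True
        thus ?thesis using e t by (cases "e < \<bar>x - t\<bar>") (auto simp: indicator_def)
      next
        case False
        thus ?thesis using f0(2) by (simp add: supp1_def)
      qed
    qed
    finally show ?thesis .
  qed
  have ev: "\<forall>\<^sub>F e in at_right 0. 1 / (complex_of_real pi * \<i>) *
     ((LINT x:{-1<..<t - e}|lebesgue. f x / complex_of_real (x - t)) +
      (LINT x:{t + e<..<1}|lebesgue. f x / complex_of_real (x - t))) = 1 / (complex_of_real pi * \<i>) * truncated_hilbert f0 e t"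
    using eventually_at_right_less[of 0] by eventually_elim (simp only: eq)
  \<comment> \<open>\<open>Lim\<close> is a definite description of a limit point. Eventually equal
    functions have the same one, so the two sides agree even before convergence is known.\<close>
  show ?thesis unfolding finite_hilbert_def t2_space_class.Lim_def
    using tendsto_cong[OF ev] by simp
qed

lemma finite_hilbert_limit:
  assumes ae: "AE x in leb. f0 x = f x" and f0: "supp1 f0" 
    and f: "f \<in> borel_measurable leb" and i: "integrable lborel f0" and t: "\<bar>t\<bar> < 1"
    and lp: "lebesgue_point f0 t" and lim: "((\<lambda>e. conj_poisson f0 e t) \<longlongrightarrow> L) (at_right 0)"
  shows "finite_hilbert f t = L / (of_real pi * \<i>)"
proof -
  have f0m: "f0 \<in> borel_measurable borel" using i by auto
  have "((\<lambda>e. truncated_hilbert f0 e t) \<longlongrightarrow> L) (at_right 0)"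
    using tendsto_add[OF trunc_conj_poisson[OF i f0 lp t] lim] by simp
  hence "((\<lambda>e. 1 / (complex_of_real pi * \<i>) * truncated_hilbert f0 e t) \<longlongrightarrow> 1 / (of_real pi * \<i>) * L) (at_right 0)"
    by (intro tendsto_intros)
  hence "Lim (at_right 0) (\<lambda>e. 1 / (complex_of_real pi * \<i>) * truncated_hilbert f0 e t) = 1 / (of_real pi * \<i>) * L"
    by (intro tendsto_Lim) auto
  thus ?thesis using finite_hilbert_eq[OF ae f0m f0 f i t] by simp
qed

text \<open>For a density in L^r with 1 < r < 2 the principal value is, up to the factor 1/(pi i),
  the L^1 limit of the conjugate Poisson integrals. The L^1 convergence is exported along with it,
  as the later pairing is taken in the limit.\<close>

theorem finite_hilbert_AE:
  assumes ae: "AE x in leb. f0 x = f x" and f0: "supp1 f0" 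
    and f: "f \<in> borel_measurable leb" and i: "integrable lborel f0"
    and r: "1 < r" "r < 2" "integrable lborel (\<lambda>x. norm (f0 x) powr r)"
  obtains h where "integrable lborel h"
    "((\<lambda>e. LBINT t. norm (indicator {-1..1} t *\<^sub>R conj_poisson f0 e t - h t)) \<longlongrightarrow> 0) (at_right 0)"
    "AE t in leb. finite_hilbert f t = h t / (of_real pi * \<i>)"
proof -
  obtain h where h: "integrable lborel h"
    "((\<lambda>e. LBINT t. norm (indicator {-1..1} t *\<^sub>R conj_poisson f0 e t - h t)) \<longlongrightarrow> 0) (at_right 0)"
    using conj_poisson_L1_limit[OF i f0 r(3,1,2)] by blast
  have "AE t in lborel. \<bar>t\<bar> < 1 \<longrightarrow> finite_hilbert f t = h t / (of_real pi * \<i>)"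
    using AE_lebesgue_point[OF i] AE_lebesgue_point[OF h(1)]
  proof eventually_elim
    case (elim t)
    thus ?case using finite_hilbert_limit[OF ae f0 f i] conj_poisson_pointwise[OF i f0 h] by blast
  qed
  hence "AE t in leb. finite_hilbert f t = h t / (of_real pi * \<i>)"
    by (subst AE_restrict_space_iff) (auto dest!: AE_completion elim!: eventually_mono)
  thus ?thesis using that h by blast
qed

lemma isCont_lebesgue_point:
  assumes f: "integrable lborel f" and c: "isCont f t"
  shows "lebesgue_point f t"
  unfolding lebesgue_point_def
proof (intro allI impI)
  fix e :: real assume e: "e > 0"
  obtain d0 where d0: "d0 > 0" "\<And>x. \<bar>x - t\<bar> < d0 \<Longrightarrow> norm (f x - f t) < e/2"
    using c[unfolded continuous_at_eps_delta, rule_format, of "e/2"] e by (auto simp: dist_norm)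
  have "(LBINT x:{t-d..t+d}. norm (f x - f t)) \<le> e * d" if d: "0 < d" "d < d0" for d
  proof -
    have "(LBINT x:{t-d..t+d}. norm (f x - f t)) \<le> (LBINT x:{t-d..t+d}. e/2)"
    proof (rule set_integral_mono[OF set_integrable_norm[OF set_integrable_sub_const[OF f]]])
      show "set_integrable lborel {t-d..t+d} (\<lambda>x. e/2)" by (simp add: set_integrable_def emeasure_lborel_Icc_eq)
      show "norm (f x - f t) \<le> e/2" if "x \<in> {t-d..t+d}" for x
        using that d by (intro less_imp_le d0(2)) auto
    qed
    also have "\<dots> = e * d" using d by (simp add: set_lebesgue_integral_def)
    finally show ?thesis .
  qed
  thus "\<exists>d0>0. \<forall>d. 0 < d \<and> d < d0 \<longrightarrow> (LBINT x:{t-d..t+d}. norm (f x - f t)) \<le> e * d"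
    using d0(1) by blast
qed

section \<open>Jacobi functions\<close>

text \<open>The Jacobi weight (1 - x)^a (1 + x)^b with complex exponents, written with real
  logarithms so that no branch has to be chosen.\<close>

definition jacobi :: "complex \<Rightarrow> complex \<Rightarrow> real \<Rightarrow> complex" where
  "jacobi a b x = (if \<bar>x\<bar> < 1 then exp (a * of_real (ln (1 - x)) + b * of_real (ln (1 + x))) else 0)"

lemma jacobi_measurable [measurable]: "jacobi a b \<in> borel_measurable borel"
  unfolding jacobi_def by measurable

lemma jacobi_supp: "supp1 (jacobi a b)"
  by (simp add: supp1_def jacobi_def)

lemma norm_jacobi: "\<bar>x\<bar> < 1 \<Longrightarrow> norm (jacobi a b x) = (1 - x) powr Re a * (1 + x) powr Re b"
  by (auto simp: jacobi_def powr_def exp_add norm_mult abs_less_iff)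

lemma integrable_powr_near_one:
  fixes \<alpha> :: real
  assumes "\<alpha> > -1"
  shows "integrable lborel (\<lambda>x. indicator {-1<..<1} x * (1 - x) powr \<alpha>)"
    and "integrable lborel (\<lambda>x. indicator {-1<..<1} x * (1 + x) powr \<alpha>)"
proof -
  have "(\<lambda>x. x powr \<alpha>) integrable_on {0..2}"
    using has_integral_powr_from_0[OF assms, of 2] by auto
  hence "(\<lambda>x. x powr \<alpha>) absolutely_integrable_on {0..2}"
    by (intro nonnegative_absolutely_integrable_1) auto
  hence i: "integrable lborel (\<lambda>x. indicator {0..2} x * x powr \<alpha>)"
    unfolding set_integrable_def by (subst (asm) integrable_completion) auto
  have "integrable lborel (\<lambda>x. indicator {0..2} (1 - x) * (1 - x) powr \<alpha>)"
    using lborel_integrable_real_affine[OF i, of "-1" 1] by simp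
  thus "integrable lborel (\<lambda>x. indicator {-1<..<1} x * (1 - x) powr \<alpha>)"
    by (rule Bochner_Integration.integrable_bound) (auto simp: indicator_def)
  have "integrable lborel (\<lambda>x. indicator {0..2} (1 + x) * (1 + x) powr \<alpha>)"
    using lborel_integrable_real_affine[OF i, of 1 1] by simp
  thus "integrable lborel (\<lambda>x. indicator {-1<..<1} x * (1 + x) powr \<alpha>)"
    by (rule Bochner_Integration.integrable_bound) (auto simp: indicator_def)
qed

lemma powr_le_two_powr:
  fixes y \<beta> :: real
  assumes "1 \<le> y" "y \<le> 2"
  shows "y powr \<beta> \<le> 2 powr \<bar>\<beta>\<bar>"
proof -
  have "y powr \<beta> \<le> y powr \<bar>\<beta>\<bar>" using assms by (intro powr_mono) auto
  also have "\<dots> \<le> 2 powr \<bar>\<beta>\<bar>" using assms by (intro powr_mono2) auto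
  finally show ?thesis .
qed

lemma jacobi_norm_le:
  assumes x: "\<bar>x\<bar> < 1"
  shows "norm (jacobi a b x) \<le> 2 powr \<bar>Re b\<bar> * (1 - x) powr Re a + 2 powr \<bar>Re a\<bar> * (1 + x) powr Re b"
proof (cases "x \<ge> 0")
  case True
  have "norm (jacobi a b x) = (1 + x) powr Re b * (1 - x) powr Re a" by (simp add: norm_jacobi[OF x])
  also have "\<dots> \<le> 2 powr \<bar>Re b\<bar> * (1 - x) powr Re a"
    using True x by (intro mult_right_mono powr_le_two_powr) auto
  finally show ?thesis by (simp add: add_increasing2)
next
  case False
  have "norm (jacobi a b x) = (1 - x) powr Re a * (1 + x) powr Re b" by (simp add: norm_jacobi[OF x])
  also have "\<dots> \<le> 2 powr \<bar>Re a\<bar> * (1 + x) powr Re b"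
    using False x by (intro mult_right_mono powr_le_two_powr) auto
  finally show ?thesis by (simp add: add_increasing)
qed

lemma integrable_jacobi:
  assumes "Re a > -1" "Re b > -1"
  shows "integrable lborel (jacobi a b)"
proof (rule Bochner_Integration.integrable_bound)
  show "integrable lborel (\<lambda>x. 2 powr \<bar>Re b\<bar> * (indicator {-1<..<1} x * (1 - x) powr Re a) + 2 powr \<bar>Re a\<bar> * (indicator {-1<..<1} x * (1 + x) powr Re b))"
    using integrable_powr_near_one assms by (intro Bochner_Integration.integrable_add integrable_mult_right) auto
  have "norm (jacobi a b x) \<le> 2 powr \<bar>Re b\<bar> * (indicator {-1<..<1} x * (1 - x) powr Re a) + 2 powr \<bar>Re a\<bar> * (indicator {-1<..<1} x * (1 + x) powr Re b)" for x
  proof (cases "\<bar>x\<bar> < 1")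
    case True
    moreover have "x \<in> {-1<..<1}" using True by auto
    ultimately show ?thesis using jacobi_norm_le[of x a b] by simp
  qed (simp add: jacobi_def)
  thus "AE x in lborel. norm (jacobi a b x) \<le> norm (2 powr \<bar>Re b\<bar> * (indicator {-1<..<1} x * (1 - x) powr Re a) + 2 powr \<bar>Re a\<bar> * (indicator {-1<..<1} x * (1 + x) powr Re b))"
    by (intro AE_I2) (auto intro: order_trans[OF _ abs_ge_self])
qed auto

lemma norm_jacobi_powr: "norm (jacobi a b x) powr r = norm (jacobi (of_real r * a) (of_real r * b) x)"
proof (cases "\<bar>x\<bar> < 1")
  case True
  thus ?thesis by (simp add: norm_jacobi powr_mult powr_powr mult.commute)
qed (simp add: jacobi_def)

section \<open>The differential equation for Cauchy transforms of Jacobi functions\<close>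

lemma jacobi_has_derivative:
  assumes x: "\<bar>x\<bar> < 1"
  shows "(jacobi a b has_vector_derivative jacobi a b x * (b / of_real (1 + x) - a / of_real (1 - x))) (at x)"
proof -
  have p: "1 - x > 0" "1 + x > 0" using x by (auto simp: abs_less_iff)
  have l1: "((\<lambda>x. complex_of_real (ln (1 - x))) has_vector_derivative of_real (- (1 / (1 - x)))) (at x)"
    using p by (intro has_vector_derivative_of_real) (auto intro!: derivative_eq_intros)
  have l2: "((\<lambda>x. complex_of_real (ln (1 + x))) has_vector_derivative of_real (1 / (1 + x))) (at x)"
    using p by (intro has_vector_derivative_of_real) (auto intro!: derivative_eq_intros)
  have "((\<lambda>x. a * of_real (ln (1 - x)) + b * of_real (ln (1 + x))) has_vector_derivative (a * of_real (- (1 / (1 - x))) + b * of_real (1 / (1 + x)))) (at x)"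
    by (intro has_vector_derivative_add has_vector_derivative_mult_right l1 l2)
  hence "((exp \<circ> (\<lambda>x. a * of_real (ln (1 - x)) + b * of_real (ln (1 + x)))) has_vector_derivative (a * of_real (- (1 / (1 - x))) + b * of_real (1 / (1 + x))) * exp (a * of_real (ln (1 - x)) + b * of_real (ln (1 + x)))) (at x)"
    by (rule field_vector_diff_chain_at) (rule DERIV_exp)
  moreover have "(a * of_real (- (1 / (1 - x))) + b * of_real (1 / (1 + x))) * exp (a * of_real (ln (1 - x)) + b * of_real (ln (1 + x))) = jacobi a b x * (b / of_real (1 + x) - a / of_real (1 - x))"
    using x by (simp add: jacobi_def algebra_simps)
  ultimately have *: "((exp \<circ> (\<lambda>x. a * of_real (ln (1 - x)) + b * of_real (ln (1 + x)))) has_vector_derivative jacobi a b x * (b / of_real (1 + x) - a / of_real (1 - x))) (at x)"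
    by (simp only:)
  show ?thesis
    by (rule has_vector_derivative_transform_within_open[OF *, of "{-1<..<1}"]) (use x in \<open>auto simp: jacobi_def abs_less_iff\<close>)
qed

lemma jacobi_isCont: "\<bar>x\<bar> < 1 \<Longrightarrow> isCont (jacobi a b) x"
  using has_vector_derivative_continuous[OF jacobi_has_derivative] by simp

text \<open>The factor 1 - x^2 raises both exponents by 1, hence makes their real parts positive, so
  the product tends to 0 at both ends, where \<open>jacobi\<close> is 0 by definition.\<close>

lemma jacobi_boundary_continuous:
  assumes ab: "Re a > -1" "Re b > -1"
  shows "continuous_on {-1..1} (\<lambda>x. of_real (1 - x\<^sup>2) * jacobi a b x)"
proof -
  let ?g = "\<lambda>x. of_real (1 - x\<^sup>2) * jacobi a b x"
  let ?m = "\<lambda>x::real. \<bar>1 - x\<bar> powr (Re a + 1) * \<bar>1 + x\<bar> powr (Re b + 1)"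
  have le: "norm (?g x) \<le> ?m x" for x
  proof (cases "\<bar>x\<bar> < 1")
    case True
    have p: "1 - x > 0" "1 + x > 0" using True by (auto simp: abs_less_iff)
    have "1 - x\<^sup>2 = (1 - x) * (1 + x)" by (simp add: power2_eq_square algebra_simps)
    hence "norm (?g x) = ((1 - x) * (1 + x)) * ((1 - x) powr Re a * (1 + x) powr Re b)"
      using p norm_jacobi[OF True, of a b] by (simp add: norm_mult del: of_real_diff of_real_mult)
    also have "\<dots> = ?m x" using p by (simp add: powr_add)
    finally show ?thesis by simp
  qed (simp add: jacobi_def)
  have "continuous (at x within {-1..1}) ?g" if x: "x \<in> {-1..1}" for x
  proof (cases "\<bar>x\<bar> < 1")
    case True
    have "isCont ?g x" by (intro continuous_intros jacobi_isCont True)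
    thus ?thesis by (rule continuous_at_imp_continuous_at_within)
  next
    case False
    hence x1: "x = 1 \<or> x = -1" using x by auto
    have "isCont ?m x" using ab x1 by (intro continuous_intros) auto
    hence "(?m \<longlongrightarrow> ?m x) (at x within {-1..1})" by (meson continuous_at_imp_continuous_at_within continuous_within)
    moreover have "?m x = 0" using x1 by auto
    ultimately have "(?m \<longlongrightarrow> 0) (at x within {-1..1})" by simp
    hence "(?g \<longlongrightarrow> 0) (at x within {-1..1})"
      by (rule Lim_null_comparison[rotated]) (intro always_eventually allI le)
    thus ?thesis using False by (simp add: continuous_within jacobi_def)
  qed
  thus ?thesis by (simp add: continuous_on_eq_continuous_within)
qed

text \<open>The derivative of (1 - x^2) w(x) / (x - z) integrates to 0 over [-1,1], as the boundary
  values vanish. Pearson's identity (1 - x^2) w' = ((b - a) - (a + b) x) w turns that derivative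
  into a combination of w, w / (x - z) and w / (x - z)^2.\<close>

lemma jacobi_cauchy_ode:
  assumes ab: "Re a > -1" "Re b > -1" and z: "z \<notin> of_real ` {-1..1::real}"
  shows "(1 - z\<^sup>2) * (LBINT x. jacobi a b x / (of_real x - z)\<^sup>2) = 
     ((b - a) - (a + b) * z) * cauchy_transform (jacobi a b) z - (a + b + 1) * (LBINT x. jacobi a b x)"
proof -
  let ?w = "jacobi a b"
  obtain d where d: "d > 0" "\<And>y x. dist y z < d \<Longrightarrow> \<bar>x\<bar> \<le> 1 \<Longrightarrow> d \<le> norm (of_real x - y)"
    using cauchy_kernel_gap[OF z] by blast
  have dz: "d \<le> norm (of_real x - z)" if "\<bar>x\<bar> \<le> 1" for x using d that by auto
  have nz: "of_real x - z \<noteq> 0" if "\<bar>x\<bar> \<le> 1" for x using dz[OF that] d(1) by auto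
  note w = integrable_jacobi[OF ab] jacobi_supp[of a b]
  have i1: "integrable lborel (\<lambda>x. ?w x / (of_real x - z))"
    using integrable_cauchy_kernel(1)[OF w d(1) dz, of "\<lambda>_. 1" 1] by simp
  have i2: "integrable lborel (\<lambda>x. ?w x / (of_real x - z)\<^sup>2)"
  proof -
    have "norm (1 / (of_real x - z)) \<le> 1 / d" if "\<bar>x\<bar> \<le> 1" for x
      using dz[OF that] d(1) by (auto simp: norm_divide intro!: frac_le)
    from integrable_cauchy_kernel(1)[OF w d(1) dz _ this] show ?thesis by (simp add: power2_eq_square)
  qed
  let ?G = "\<lambda>x. of_real (1 - x\<^sup>2) * ?w x / (of_real x - z)"
  let ?g = "\<lambda>x. ((b - a) - (a + b) * z) * (?w x / (of_real x - z)) - (a + b + 1) * ?w x - (1 - z\<^sup>2) * (?w x / (of_real x - z)\<^sup>2)"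
  have gi: "integrable lborel ?g" using i1 i2 w by (intro Bochner_Integration.integrable_diff integrable_mult_right)
  have "(?g has_integral (?G 1 - ?G (-1))) {-1..1}"
  proof (rule fundamental_theorem_of_calculus_interior)
    show "continuous_on {-1..1} ?G"
    proof (rule continuous_on_divide[OF jacobi_boundary_continuous[OF ab]])
      show "\<forall>x\<in>{-1..1}. complex_of_real x - z \<noteq> 0" by (intro ballI nz) auto
    qed (intro continuous_intros)
    fix x :: real assume "x \<in> {-1<..<1}"
    hence x: "\<bar>x\<bar> < 1" by auto
    have p: "1 - complex_of_real x \<noteq> 0" "1 + complex_of_real x \<noteq> 0" and zx: "of_real x - z \<noteq> 0"
      using x nz[of x] by (auto simp: complex_eq_iff)
    have d1: "((\<lambda>x. complex_of_real (1 - x\<^sup>2)) has_vector_derivative of_real (- 2 * x)) (at x)"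
      by (intro has_vector_derivative_of_real) (auto intro!: derivative_eq_intros)
    have d2: "((\<lambda>x. 1 / (complex_of_real x - z)) has_vector_derivative (- 1 / (of_real x - z)\<^sup>2)) (at x)"
    proof -
      have "((\<lambda>y. 1 / (y - z)) has_field_derivative (- 1 / (of_real x - z)\<^sup>2)) (at (of_real x))"
        using zx by (auto intro!: derivative_eq_intros simp: power2_eq_square)
      moreover have "(of_real has_vector_derivative (1::complex)) (at x)"
        using has_vector_derivative_of_real[OF DERIV_ident] by simp
      ultimately show ?thesis using field_vector_diff_chain_at[of of_real 1 x "\<lambda>y. 1 / (y - z)"] by (simp add: o_def)
    qed
    have "((\<lambda>x. of_real (1 - x\<^sup>2) * ?w x * (1 / (of_real x - z))) has_vector_derivative
       (of_real (1 - x\<^sup>2) * ?w x * (- 1 / (of_real x - z)\<^sup>2) + (of_real (1 - x\<^sup>2) * (?w x * (b / of_real (1 + x) - a / of_real (1 - x))) + of_real (- 2 * x) * ?w x) * (1 / (of_real x - z)))) (at x)"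
      by (intro has_vector_derivative_mult d1 d2 jacobi_has_derivative x)
    moreover have "of_real (1 - x\<^sup>2) * W * (- 1 / (of_real x - z)\<^sup>2) + (of_real (1 - x\<^sup>2) * (W * (b / of_real (1 + x) - a / of_real (1 - x))) + of_real (- 2 * x) * W) * (1 / (of_real x - z))
        = ((b - a) - (a + b) * z) * (W / (of_real x - z)) - (a + b + 1) * W - (1 - z\<^sup>2) * (W / (of_real x - z)\<^sup>2)" for W
    proof -
      define X where "X = complex_of_real x"
      define Y where "Y = X - z"
      have Y: "Y \<noteq> 0" "z = X - Y" and X: "1 - X \<noteq> 0" "1 + X \<noteq> 0" using zx p by (auto simp: X_def Y_def)
      have f1: "(1 - X\<^sup>2) * (b / (1 + X) - a / (1 - X)) = b * (1 - X) - a * (1 + X)"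
      proof -
        have "P * Q * (b / Q - a / P) = b * P - a * Q" if "P \<noteq> 0" "Q \<noteq> 0" for P Q :: complex
          using that by (simp add: field_simps)
        from this[OF X] show ?thesis by (simp add: power2_eq_square algebra_simps)
      qed
      have comb: "A * W * (- 1 / Y\<^sup>2) + (A * (W * D) + (- 2 * X) * W) * (1 / Y) = W * (- A / Y\<^sup>2 + (A * D - 2 * X) / Y)" for A D
        by (simp add: algebra_simps add_divide_distrib diff_divide_distrib)
      have "(1 - X\<^sup>2) * W * (- 1 / Y\<^sup>2) + ((1 - X\<^sup>2) * (W * (b / (1 + X) - a / (1 - X))) + (- 2 * X) * W) * (1 / Y)
         = W * (- (1 - X\<^sup>2) / Y\<^sup>2 + ((1 - X\<^sup>2) * (b / (1 + X) - a / (1 - X)) - 2 * X) / Y)"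
        by (rule comb)
      also have "\<dots> = W * (- (1 - X\<^sup>2) / Y\<^sup>2 + (b * (1 - X) - a * (1 + X) - 2 * X) / Y)" by (simp only: f1)
      also have "\<dots> = ((b - a) - (a + b) * z) * (W / Y) - (a + b + 1) * W - (1 - z\<^sup>2) * (W / Y\<^sup>2)"
        unfolding Y(2) using Y(1) by (simp add: field_simps power2_eq_square)
      finally show ?thesis unfolding X_def Y_def by simp
    qed
    ultimately show "(?G has_vector_derivative ?g x) (at x)" by simp
  qed simp
  hence "integral {-1..1} ?g = 0" by (simp add: integral_unique)
  moreover have "(LBINT x:{-1..1}. ?g x) = integral {-1..1} ?g"
    by (rule set_borel_integral_eq_integral(2)) (use gi in \<open>simp add: set_integrable_def integrable_mult_indicator del: of_real_diff\<close>)
  moreover have "(LBINT x:{-1..1}. ?g x) = (LBINT x. ?g x)"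
    unfolding set_lebesgue_integral_def
    by (intro Bochner_Integration.integral_cong refl) (auto simp: indicator_def jacobi_def)
  ultimately have "(LBINT x. ?g x) = 0" by simp
  moreover have "(LBINT x. ?g x) = ((b - a) - (a + b) * z) * (LBINT x. ?w x / (of_real x - z)) - (a + b + 1) * (LBINT x. ?w x) - (1 - z\<^sup>2) * (LBINT x. ?w x / (of_real x - z)\<^sup>2)"
    using i1 i2 w by (simp del: times_divide_eq_right times_divide_eq_left)
  ultimately show ?thesis by (simp add: cauchy_transform_def)
qed

text \<open>With principal logarithms this is analytic off the real half-lines |x| >= 1 and
  continues \<open>jacobi a b\<close> from the interval (-1,1).\<close>

definition jacobi_ext :: "complex \<Rightarrow> complex \<Rightarrow> complex \<Rightarrow> complex" where
  "jacobi_ext a b z = exp (a * Ln (1 - z) + b * Ln (1 + z))"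

text \<open>After adding k the Cauchy transform solves the same homogeneous first-order equation as
  \<open>jacobi_ext\<close>, so their quotient is constant. The inhomogeneity (a + b + 1) times the
  mass is zero if a + b = -1; if a + b = 0 it equals the mass and is absorbed by k = mass / (2
  a).\<close>

lemma half_plane_const:
  assumes ab: "Re a > -1" "Re b > -1" and S: "convex S" "open S" "\<And>z. z \<in> S \<Longrightarrow> Im z \<noteq> 0"
    and k: "(a + b = 0 \<and> a \<noteq> 0 \<and> k = (LBINT x. jacobi a b x) / (2 * a)) \<or> (a + b = -1 \<and> k = 0)"
  shows "\<exists>C. \<forall>z\<in>S. cauchy_transform (jacobi a b) z + k = C * jacobi_ext a b z"
proof -
  let ?F = "cauchy_transform (jacobi a b)"
  let ?m = "LBINT x. jacobi a b x"
  define q where "q z = (?F z + k) * exp (- (a * Ln (1 - z) + b * Ln (1 + z)))" for z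
  have "(q has_field_derivative 0) (at z within S)" if z: "z \<in> S" for z
  proof -
    have nr: "1 - z \<notin> \<real>\<^sub>\<le>\<^sub>0" "1 + z \<notin> \<real>\<^sub>\<le>\<^sub>0" using S(3)[OF z] by (auto simp: complex_nonpos_Reals_iff)
    have n0: "1 - z \<noteq> 0" "1 + z \<noteq> 0" using S(3)[OF z] by (auto simp: complex_eq_iff)
    have z2: "1 - z\<^sup>2 \<noteq> 0"
    proof -
      have "1 - z\<^sup>2 = (1 - z) * (1 + z)" by (simp add: power2_eq_square algebra_simps)
      thus ?thesis using n0 by simp
    qed
    let ?D = "LBINT x. jacobi a b x / (of_real x - z)\<^sup>2"
    have F: "(?F has_field_derivative ?D) (at z)"
      by (rule cauchy_transform_has_derivative[OF integrable_jacobi[OF ab] jacobi_supp Im_nonzero_not_real[OF S(3)[OF z]]])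
    have ode: "(1 - z\<^sup>2) * ?D = ((b - a) - (a + b) * z) * (?F z + k)"
    proof -
      have "(1 - z\<^sup>2) * ?D = ((b - a) - (a + b) * z) * ?F z - (a + b + 1) * ?m"
        by (rule jacobi_cauchy_ode[OF ab Im_nonzero_not_real[OF S(3)[OF z]]])
      also have "(a + b + 1) * ?m = - (((b - a) - (a + b) * z) * k)"
        using k
      proof
        assume h: "a + b = 0 \<and> a \<noteq> 0 \<and> k = ?m / (2 * a)"
        hence "b = - a" by (simp add: add_eq_0_iff)
        thus ?thesis using h by simp
      next
        assume "a + b = -1 \<and> k = 0"
        thus ?thesis by simp
      qed
      finally show ?thesis by (simp add: algebra_simps)
    qed
    let ?L = "\<lambda>z. a * Ln (1 - z) + b * Ln (1 + z)"
    have L: "(?L has_field_derivative (b / (1 + z) - a / (1 - z))) (at z)"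
      using nr by (auto intro!: derivative_eq_intros simp: divide_inverse)
    have Lz: "(1 - z\<^sup>2) * (b / (1 + z) - a / (1 - z)) = (b - a) - (a + b) * z"
    proof -
      have "P * Q * (b / Q - a / P) = b * P - a * Q" if "P \<noteq> 0" "Q \<noteq> 0" for P Q :: complex
        using that by (simp add: field_simps)
      from this[OF n0] show ?thesis by (simp add: power2_eq_square algebra_simps)
    qed
    have "(1 - z\<^sup>2) * (?D - (?F z + k) * (b / (1 + z) - a / (1 - z))) = (1 - z\<^sup>2) * ?D - ((1 - z\<^sup>2) * (b / (1 + z) - a / (1 - z))) * (?F z + k)"
    proof -
      have "A * (D - F * G) = A * D - (A * G) * F" for A D F G :: complex by (simp add: algebra_simps)
      thus ?thesis .
    qed
    also have "\<dots> = 0" unfolding ode Lz by simp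
    finally have D: "?D = (?F z + k) * (b / (1 + z) - a / (1 - z))" using z2 by simp
    have "((\<lambda>z. (?F z + k) * exp (- ?L z)) has_field_derivative ((?F z + k) * (exp (- ?L z) * - (b / (1 + z) - a / (1 - z))) + (?D + 0) * exp (- ?L z))) (at z)"
      by (rule DERIV_mult'[OF DERIV_add[OF F DERIV_const] DERIV_fun_exp[OF DERIV_minus[OF L]]])
    moreover have "(?F z + k) * (exp (- ?L z) * - (b / (1 + z) - a / (1 - z))) + (?D + 0) * exp (- ?L z) = 0"
    proof -
      have "P * (E * - G) + (P * G + 0) * E = 0" for P E G :: complex by simp
      thus ?thesis unfolding D .
    qed
    ultimately have "(q has_field_derivative 0) (at z)" unfolding q_def by simp
    thus ?thesis by (rule has_field_derivative_at_within)
  qed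
  then obtain C where C: "\<And>z. z \<in> S \<Longrightarrow> q z = C"
    using has_field_derivative_zero_constant[OF S(1)] by metis
  have "?F z + k = C * jacobi_ext a b z" if "z \<in> S" for z
  proof -
    have e: "P * exp (- L) * exp L = P" for P L :: complex by (simp add: mult.assoc flip: exp_add)
    show ?thesis unfolding C[OF that, symmetric] q_def jacobi_ext_def e ..
  qed
  thus ?thesis by blast
qed

section \<open>Boundary values and connection constants\<close>

lemma jacobi_ext_tendsto_interval:
  assumes t: "\<bar>t\<bar> < 1"
  shows "((\<lambda>e. jacobi_ext a b (Complex t e)) \<longlongrightarrow> jacobi a b t) (at_right 0)"
    and "((\<lambda>e. jacobi_ext a b (Complex t (-e))) \<longlongrightarrow> jacobi a b t) (at_right 0)"
proof -
  have nr: "1 - complex_of_real t \<notin> \<real>\<^sub>\<le>\<^sub>0" "1 + complex_of_real t \<notin> \<real>\<^sub>\<le>\<^sub>0"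
    using t by (auto simp: complex_nonpos_Reals_iff)
  have c: "isCont (jacobi_ext a b) (of_real t)"
    unfolding jacobi_ext_def using nr by (intro continuous_intros) auto
  have "1 - t > 0" "1 + t > 0" using t by auto
  hence "Ln (1 - complex_of_real t) = of_real (ln (1 - t))" "Ln (1 + complex_of_real t) = of_real (ln (1 + t))"
    using Ln_of_real[of "1 - t"] Ln_of_real[of "1 + t"] by simp_all
  hence v: "jacobi_ext a b (of_real t) = jacobi a b t" using t by (simp add: jacobi_ext_def jacobi_def)
  have 1: "((\<lambda>e. Complex t e) \<longlongrightarrow> of_real t) (at_right 0)" "((\<lambda>e. Complex t (-e)) \<longlongrightarrow> of_real t) (at_right 0)"
    unfolding Complex_eq by (auto intro!: tendsto_eq_intros)
  show "((\<lambda>e. jacobi_ext a b (Complex t e)) \<longlongrightarrow> jacobi a b t) (at_right 0)"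
    "((\<lambda>e. jacobi_ext a b (Complex t (-e))) \<longlongrightarrow> jacobi a b t) (at_right 0)"
    using isCont_tendsto_compose[OF c 1(1)] isCont_tendsto_compose[OF c 1(2)] v by simp_all
qed

text \<open>As z approaches x > 1 from above, 1 - z reaches the cut of the logarithm from below, and
  its logarithm tends to ln (x - 1) - i pi; from the other side the sign flips. The two values
  differ by the factor exp (2 pi i a).\<close>

lemma jacobi_ext_tendsto_outside:
  assumes x: "x > 1"
  shows "((\<lambda>e. jacobi_ext a b (Complex x e)) \<longlongrightarrow> exp (- (\<i> * of_real pi * a)) * exp (a * of_real (ln (x - 1)) + b * of_real (ln (x + 1)))) (at_right 0)"
    and "((\<lambda>e. jacobi_ext a b (Complex x (-e))) \<longlongrightarrow> exp (\<i> * of_real pi * a) * exp (a * of_real (ln (x - 1)) + b * of_real (ln (x + 1)))) (at_right 0)"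
proof -
  have nr: "complex_of_real (x - 1) \<notin> \<real>\<^sub>\<le>\<^sub>0" "1 + complex_of_real x \<notin> \<real>\<^sub>\<le>\<^sub>0"
    using x by (auto simp: complex_nonpos_Reals_iff)
  have L: "Ln (complex_of_real (x - 1)) = of_real (ln (x - 1))" "Ln (1 + complex_of_real x) = of_real (ln (x + 1))"
    using Ln_of_real[of "x - 1"] Ln_of_real[of "x + 1"] x by (simp_all add: add.commute)
  have 1: "((\<lambda>e. Complex (x - 1) e) \<longlongrightarrow> of_real (x - 1)) (at_right 0)" "((\<lambda>e. Complex (x - 1) (-e)) \<longlongrightarrow> of_real (x - 1)) (at_right 0)"
    "((\<lambda>e. 1 + Complex x e) \<longlongrightarrow> 1 + of_real x) (at_right 0)" "((\<lambda>e. 1 + Complex x (-e)) \<longlongrightarrow> 1 + of_real x) (at_right 0)"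
    unfolding Complex_eq by (auto intro!: tendsto_eq_intros)
  have upper: "Ln (1 - Complex x e) = Ln (Complex (x - 1) e) - \<i> * of_real pi"
    and lower: "Ln (1 - Complex x (-e)) = Ln (Complex (x - 1) (-e)) + \<i> * of_real pi" if "e > 0" for e
  proof -
    have "1 - Complex x e = - Complex (x - 1) e" "1 - Complex x (-e) = - Complex (x - 1) (-e)" by (simp_all add: complex_eq_iff)
    moreover have "Complex (x - 1) e \<noteq> 0" "Complex (x - 1) (-e) \<noteq> 0" using x by (simp_all add: complex_eq_iff)
    ultimately show "Ln (1 - Complex x e) = Ln (Complex (x - 1) e) - \<i> * of_real pi" "Ln (1 - Complex x (-e)) = Ln (Complex (x - 1) (-e)) + \<i> * of_real pi"
      using Ln_minus[of "Complex (x - 1) e"] Ln_minus[of "Complex (x - 1) (-e)"] x that by simp_all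
  qed
  have "((\<lambda>e. exp (a * (Ln (Complex (x - 1) e) - \<i> * of_real pi) + b * Ln (1 + Complex x e))) \<longlongrightarrow> exp (a * (Ln (of_real (x - 1)) - \<i> * of_real pi) + b * Ln (1 + of_real x))) (at_right 0)"
    by (intro tendsto_intros 1 nr)
  moreover have "\<forall>\<^sub>F e in at_right 0. exp (a * (Ln (Complex (x - 1) e) - \<i> * of_real pi) + b * Ln (1 + Complex x e)) = jacobi_ext a b (Complex x e)"
    using eventually_at_right_less[of 0] by eventually_elim (simp only: jacobi_ext_def upper)
  ultimately have "((\<lambda>e. jacobi_ext a b (Complex x e)) \<longlongrightarrow> exp (a * (Ln (of_real (x - 1)) - \<i> * of_real pi) + b * Ln (1 + of_real x))) (at_right 0)"
    by (rule Lim_transform_eventually)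
  thus "((\<lambda>e. jacobi_ext a b (Complex x e)) \<longlongrightarrow> exp (- (\<i> * of_real pi * a)) * exp (a * of_real (ln (x - 1)) + b * of_real (ln (x + 1)))) (at_right 0)"
    unfolding L by (simp add: algebra_simps flip: exp_add)
  have "((\<lambda>e. exp (a * (Ln (Complex (x - 1) (-e)) + \<i> * of_real pi) + b * Ln (1 + Complex x (-e)))) \<longlongrightarrow> exp (a * (Ln (of_real (x - 1)) + \<i> * of_real pi) + b * Ln (1 + of_real x))) (at_right 0)"
    by (intro tendsto_intros 1 nr)
  moreover have "\<forall>\<^sub>F e in at_right 0. exp (a * (Ln (Complex (x - 1) (-e)) + \<i> * of_real pi) + b * Ln (1 + Complex x (-e))) = jacobi_ext a b (Complex x (-e))"
    using eventually_at_right_less[of 0] by eventually_elim (simp only: jacobi_ext_def lower)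
  ultimately have "((\<lambda>e. jacobi_ext a b (Complex x (-e))) \<longlongrightarrow> exp (a * (Ln (of_real (x - 1)) + \<i> * of_real pi) + b * Ln (1 + of_real x))) (at_right 0)"
    by (rule Lim_transform_eventually)
  thus "((\<lambda>e. jacobi_ext a b (Complex x (-e))) \<longlongrightarrow> exp (\<i> * of_real pi * a) * exp (a * of_real (ln (x - 1)) + b * of_real (ln (x + 1)))) (at_right 0)"
    unfolding L by (simp add: algebra_simps flip: exp_add)
qed

text \<open>Let P and C be the constants in the upper and lower half plane. The jump across (-1,1)
  gives P - C = 2 pi i, and continuity across x > 1 gives P = C exp (2 pi i a). If a + b = 0, then
  for x tending to infinity the transform vanishes and the power tends to 1, which identifies
  k.\<close>

lemma jacobi_cauchy_formula:
  assumes ab: "Re a > -1" "Re b > -1"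
    and k: "(a + b = 0 \<and> a \<noteq> 0 \<and> k = (LBINT x. jacobi a b x) / (2 * a)) \<or> (a + b = -1 \<and> k = 0)"
  obtains C where "C * (exp (2 * \<i> * of_real pi * a) - 1) = 2 * \<i> * of_real pi"
    "\<And>t e. e > 0 \<Longrightarrow> cauchy_transform (jacobi a b) (Complex t e) + k = C * exp (2 * \<i> * of_real pi * a) * jacobi_ext a b (Complex t e)"
    "\<And>t e. e > 0 \<Longrightarrow> cauchy_transform (jacobi a b) (Complex t (-e)) + k = C * jacobi_ext a b (Complex t (-e))"
    "a + b = 0 \<Longrightarrow> k = C * exp (\<i> * of_real pi * a)"
proof -
  let ?F = "cauchy_transform (jacobi a b)"
  note w = integrable_jacobi[OF ab] jacobi_supp[of a b]
  obtain P where P: "\<And>z. Im z > 0 \<Longrightarrow> ?F z + k = P * jacobi_ext a b z"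
    using half_plane_const[OF ab convex_halfspace_Im_gt[of 0] open_halfspace_Im_gt _ k] by auto
  obtain C where C: "\<And>z. Im z < 0 \<Longrightarrow> ?F z + k = C * jacobi_ext a b z"
    using half_plane_const[OF ab convex_halfspace_Im_lt[of 0] open_halfspace_Im_lt _ k] by auto
  \<comment> \<open>The jump is 2 i times the Poisson limit, that is 2 pi i times the density; it is
    read off at 0, where the Jacobi function is 1.\<close>
  have PC: "P - C = 2 * \<i> * of_real pi"
  proof -
    have lp: "lebesgue_point (jacobi a b) 0" by (rule isCont_lebesgue_point[OF w(1) jacobi_isCont]) simp
    have j0: "jacobi a b 0 = 1" by (simp add: jacobi_def)
    have "((\<lambda>e. 2 * \<i> * poisson (jacobi a b) e 0) \<longlongrightarrow> 2 * \<i> * (of_real pi * jacobi a b 0)) (at_right 0)"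
      by (intro tendsto_intros poisson_tendsto w lp) simp
    moreover have "\<forall>\<^sub>F e in at_right 0. 2 * \<i> * poisson (jacobi a b) e 0 = P * jacobi_ext a b (Complex 0 e) - C * jacobi_ext a b (Complex 0 (-e))"
      using eventually_at_right_less[of 0]
    proof eventually_elim
      case (elim e)
      have "P * jacobi_ext a b (Complex 0 e) - C * jacobi_ext a b (Complex 0 (-e)) = ?F (Complex 0 e) - ?F (Complex 0 (-e))"
        using P[of "Complex 0 e"] C[of "Complex 0 (-e)"] elim by (simp flip: P C)
      thus ?case unfolding cauchy_transform_upper[OF w(1) elim] by simp
    qed
    ultimately have "((\<lambda>e. P * jacobi_ext a b (Complex 0 e) - C * jacobi_ext a b (Complex 0 (-e))) \<longlongrightarrow> 2 * \<i> * (of_real pi * jacobi a b 0)) (at_right 0)"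
      by (rule Lim_transform_eventually)
    moreover have "((\<lambda>e. P * jacobi_ext a b (Complex 0 e) - C * jacobi_ext a b (Complex 0 (-e))) \<longlongrightarrow> P * jacobi a b 0 - C * jacobi a b 0) (at_right 0)"
      by (intro tendsto_intros jacobi_ext_tendsto_interval) auto
    ultimately have "2 * \<i> * (of_real pi * jacobi a b 0) = P * jacobi a b 0 - C * jacobi a b 0"
      by (rule tendsto_unique[rotated]) simp
    thus ?thesis using j0 by (simp add: algebra_simps)
  qed
  let ?R = "\<lambda>x. exp (a * of_real (ln (x - 1)) + b * of_real (ln (x + 1)))"
  have outside: "?F (of_real x) + k = P * (exp (- (\<i> * of_real pi * a)) * ?R x)" "?F (of_real x) + k = C * (exp (\<i> * of_real pi * a) * ?R x)"
    if x: "x > 1" for x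
  proof -
    have "complex_of_real x \<notin> of_real ` {-1..1::real}" using x by auto
    hence c: "isCont ?F (of_real x)" by (intro DERIV_isCont[OF cauchy_transform_has_derivative[OF w]])
    have 1: "((\<lambda>e. Complex x e) \<longlongrightarrow> of_real x) (at_right 0)" "((\<lambda>e. Complex x (-e)) \<longlongrightarrow> of_real x) (at_right 0)"
      unfolding Complex_eq by (auto intro!: tendsto_eq_intros)
    have "((\<lambda>e. ?F (Complex x e) + k) \<longlongrightarrow> ?F (of_real x) + k) (at_right 0)"
      by (intro tendsto_intros isCont_tendsto_compose[OF c] 1)
    moreover have "\<forall>\<^sub>F e in at_right 0. ?F (Complex x e) + k = P * jacobi_ext a b (Complex x e)"
      using eventually_at_right_less[of 0] by eventually_elim (simp add: P)
    ultimately have "((\<lambda>e. P * jacobi_ext a b (Complex x e)) \<longlongrightarrow> ?F (of_real x) + k) (at_right 0)"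
      by (rule Lim_transform_eventually)
    moreover have "((\<lambda>e. P * jacobi_ext a b (Complex x e)) \<longlongrightarrow> P * (exp (- (\<i> * of_real pi * a)) * ?R x)) (at_right 0)"
      by (intro tendsto_intros jacobi_ext_tendsto_outside x)
    ultimately show "?F (of_real x) + k = P * (exp (- (\<i> * of_real pi * a)) * ?R x)"
      by (rule tendsto_unique[rotated]) simp
    have "((\<lambda>e. ?F (Complex x (-e)) + k) \<longlongrightarrow> ?F (of_real x) + k) (at_right 0)"
      by (intro tendsto_intros isCont_tendsto_compose[OF c] 1)
    moreover have "\<forall>\<^sub>F e in at_right 0. ?F (Complex x (-e)) + k = C * jacobi_ext a b (Complex x (-e))"
      using eventually_at_right_less[of 0] by eventually_elim (simp add: C)
    ultimately have "((\<lambda>e. C * jacobi_ext a b (Complex x (-e))) \<longlongrightarrow> ?F (of_real x) + k) (at_right 0)"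
      by (rule Lim_transform_eventually)
    moreover have "((\<lambda>e. C * jacobi_ext a b (Complex x (-e))) \<longlongrightarrow> C * (exp (\<i> * of_real pi * a) * ?R x)) (at_right 0)"
      by (intro tendsto_intros jacobi_ext_tendsto_outside x)
    ultimately show "?F (of_real x) + k = C * (exp (\<i> * of_real pi * a) * ?R x)"
      by (rule tendsto_unique[rotated]) simp
  qed
  have PCq: "P = C * exp (2 * \<i> * of_real pi * a)"
  proof -
    let ?E = "exp (\<i> * of_real pi * a)"
    have "P * (exp (- (\<i> * of_real pi * a)) * ?R 2) = C * (?E * ?R 2)"
      using outside(1)[of 2, symmetric] outside(2)[of 2] by (simp only: one_less_numeral_iff semiring_norm)
    hence "(P * exp (- (\<i> * of_real pi * a))) * ?R 2 = (C * ?E) * ?R 2" by (simp only: mult.assoc)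
    hence "P * exp (- (\<i> * of_real pi * a)) = C * ?E" by (simp only: mult_right_cancel[OF exp_not_eq_zero])
    hence "P * exp (- (\<i> * of_real pi * a)) * ?E = C * ?E * ?E" by simp
    moreover have "exp (- (\<i> * of_real pi * a)) * ?E = 1" by (simp flip: exp_add)
    moreover have "?E * ?E = exp (2 * \<i> * of_real pi * a)" by (simp add: mult_ac flip: exp_add)
    ultimately show ?thesis by (simp only: mult.assoc mult_1_right)
  qed
  have kC: "k = C * exp (\<i> * of_real pi * a)" if ab0: "a + b = 0"
  proof -
    have b: "b = - a" using ab0 by (simp add: add_eq_0_iff)
    have "((\<lambda>x. ?F (of_real x) + k) \<longlongrightarrow> 0 + k) at_top"
    proof (intro tendsto_intros)
      show "((\<lambda>x::real. ?F (of_real x)) \<longlongrightarrow> 0) at_top"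
      proof (rule Lim_null_comparison)
        show "\<forall>\<^sub>F x::real in at_top. norm (?F (of_real x)) \<le> (LBINT x. norm (jacobi a b x)) / (x - 1)"
          using eventually_gt_at_top[of 1]
        proof eventually_elim
          case (elim x)
          thus ?case using cauchy_transform_bound[OF w, of "of_real x"] by simp
        qed
        have "((\<lambda>x::real. I / (x - 1)) \<longlongrightarrow> 0) at_top" for I :: real by real_asymp
        thus "((\<lambda>x. (LBINT x. norm (jacobi a b x)) / (x - 1)) \<longlongrightarrow> 0) at_top" .
      qed
    qed
    moreover have "\<forall>\<^sub>F x in at_top. ?F (of_real x) + k = C * (exp (\<i> * of_real pi * a) * exp (a * of_real (ln (x - 1) - ln (x + 1))))"
      using eventually_gt_at_top[of 1] 
    proof eventually_elim
      case (elim x)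
      show ?case unfolding outside(2)[OF elim] by (simp add: b right_diff_distrib)
    qed
    ultimately have "((\<lambda>x. C * (exp (\<i> * of_real pi * a) * exp (a * of_real (ln (x - 1) - ln (x + 1))))) \<longlongrightarrow> 0 + k) at_top"
      by (rule Lim_transform_eventually)
    moreover have "((\<lambda>x. C * (exp (\<i> * of_real pi * a) * exp (a * of_real (ln (x - 1) - ln (x + 1))))) \<longlongrightarrow> C * (exp (\<i> * of_real pi * a) * exp (a * of_real 0))) at_top"
    proof (intro tendsto_intros)
      show "((\<lambda>x::real. ln (x - 1) - ln (x + 1)) \<longlongrightarrow> 0) at_top" by real_asymp
    qed
    ultimately have "0 + k = C * (exp (\<i> * of_real pi * a) * exp (a * of_real 0))"
      by (rule tendsto_unique[rotated]) simp
    thus ?thesis by simp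
  qed
  show ?thesis
  proof (rule that[of C])
    show "C * (exp (2 * \<i> * of_real pi * a) - 1) = 2 * \<i> * of_real pi" using PC PCq by (simp add: algebra_simps)
  qed (use P C PCq kC in auto)
qed

lemma conj_poisson_jacobi_tendsto:
  assumes ab: "Re a > -1" "Re b > -1" and e: "\<And>e. e > 0 \<Longrightarrow> cauchy_transform (jacobi a b) (Complex t e) + k = C * q * jacobi_ext a b (Complex t e)"
    "\<And>e. e > 0 \<Longrightarrow> cauchy_transform (jacobi a b) (Complex t (-e)) + k = C * jacobi_ext a b (Complex t (-e))"
    and t: "\<bar>t\<bar> < 1"
  shows "((\<lambda>e. conj_poisson (jacobi a b) e t) \<longlongrightarrow> C * (q + 1) / 2 * jacobi a b t - k) (at_right 0)"
proof -
  have "((\<lambda>e. (C * q * jacobi_ext a b (Complex t e) + C * jacobi_ext a b (Complex t (-e))) / 2 - k) \<longlongrightarrow> (C * q * jacobi a b t + C * jacobi a b t) / 2 - k) (at_right 0)"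
    by (intro tendsto_intros jacobi_ext_tendsto_interval t) simp_all
  moreover have "\<forall>\<^sub>F e in at_right 0. (C * q * jacobi_ext a b (Complex t e) + C * jacobi_ext a b (Complex t (-e))) / 2 - k = conj_poisson (jacobi a b) e t"
    using eventually_at_right_less[of 0]
  proof eventually_elim
    case (elim e')
    show ?case unfolding conj_poisson_eq[OF integrable_jacobi[OF ab] elim] e(1)[OF elim, symmetric] e(2)[OF elim, symmetric]
      by (simp add: field_simps)
  qed
  ultimately have "((\<lambda>e. conj_poisson (jacobi a b) e t) \<longlongrightarrow> (C * q * jacobi a b t + C * jacobi a b t) / 2 - k) (at_right 0)"
    by (rule Lim_transform_eventually)
  thus ?thesis by (simp add: algebra_simps add_divide_distrib)
qed

lemma jacobi_in_L0: "jacobi a b \<in> borel_measurable leb"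
  by (intro measurable_restrict_space1 measurable_completion) simp

text \<open>The exponents sum to -1, so no constant is added. The conjugate Poisson limit is the
  mean of the two boundary values C q w and C w; inserting C = 2 pi i / (q - 1) and dividing by pi i
  leaves (q + 1) / (q - 1) times w.\<close>

lemma jacobi_eigenfunction:
  assumes c: "-1 < Re c" "Re c < 0" and t: "\<bar>t\<bar> < 1"
  defines "q \<equiv> exp (2 * \<i> * of_real pi * c)"
  shows "q \<noteq> 1" "finite_hilbert (jacobi c (- 1 - c)) t = (q + 1) / (q - 1) * jacobi c (- 1 - c) t"
proof -
  let ?w = "jacobi c (- 1 - c)"
  have ab: "Re c > -1" "Re (- 1 - c) > -1" using c by auto
  obtain C where C: "C * (q - 1) = 2 * \<i> * of_real pi"
    "\<And>t e. e > 0 \<Longrightarrow> cauchy_transform ?w (Complex t e) + 0 = C * q * jacobi_ext c (- 1 - c) (Complex t e)"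
    "\<And>t e. e > 0 \<Longrightarrow> cauchy_transform ?w (Complex t (-e)) + 0 = C * jacobi_ext c (- 1 - c) (Complex t (-e))"
    using jacobi_cauchy_formula[OF ab, of 0] unfolding q_def by auto
  show q: "q \<noteq> 1" using C(1) by auto
  have lp: "lebesgue_point ?w t" by (rule isCont_lebesgue_point[OF integrable_jacobi[OF ab] jacobi_isCont[OF t]])
  have "finite_hilbert ?w t = (C * (q + 1) / 2 * ?w t - 0) / (of_real pi * \<i>)"
    by (rule finite_hilbert_limit[OF _ jacobi_supp jacobi_in_L0 integrable_jacobi[OF ab] t lp conj_poisson_jacobi_tendsto[OF ab C(2,3) t]]) auto
  moreover have "C = 2 * \<i> * of_real pi / (q - 1)" using C(1) q by (simp add: field_simps)
  moreover have "(2 * I / d * Q / 2 * w - 0) / J = Q / d * w" if "I = J" "J \<noteq> 0" "d \<noteq> 0" for I J d Q w :: complex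
    using that by (simp add: field_simps)
  from this[of "\<i> * of_real pi" "of_real pi * \<i>" "q - 1"] have "(2 * (\<i> * of_real pi) / (q - 1) * (q + 1) / 2 * ?w t - 0) / (of_real pi * \<i>) = (q + 1) / (q - 1) * ?w t"
    using q by simp
  ultimately show "finite_hilbert ?w t = (q + 1) / (q - 1) * ?w t" by (simp only: mult.assoc)
qed

section \<open>The eigenvalue equation on the Fourier side\<close>

text \<open>The Fourier transform of f in the variable ln ((1 - x) / (1 + x)): the Jacobi function
  with exponents i s and -i s is the character of frequency s.\<close>

definition jacobi_fourier :: "(real \<Rightarrow> complex) \<Rightarrow> real \<Rightarrow> complex" where
  "jacobi_fourier f s = (LBINT x. f x * jacobi (\<i> * of_real s) (- (\<i> * of_real s)) x)"

lemma norm_jacobi_imaginary: "norm (jacobi (\<i> * of_real s) (- (\<i> * of_real s)) x) \<le> 1"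
  by (cases "\<bar>x\<bar> < 1") (auto simp: norm_jacobi jacobi_def abs_less_iff)

lemma integrable_jacobi_fourier:
  "integrable lborel f \<Longrightarrow> integrable lborel (\<lambda>x. f x * jacobi (\<i> * of_real s) (- (\<i> * of_real s)) x)"
  by (rule integrable_mult_bounded[where B=1]) (auto simp: norm_jacobi_imaginary)

lemma jacobi_fourier_0: "supp1 f \<Longrightarrow> jacobi_fourier f 0 = (LBINT x. f x)"
  unfolding jacobi_fourier_def
  by (intro Bochner_Integration.integral_cong refl) (auto simp: jacobi_def supp1_def)

text \<open>Imaginary exponents see only the arguments of 1 - z and 1 + z, which lie in [-pi,pi].
  The bound, uniform in t and e, provides the dominating function for the pairing.\<close>

lemma norm_jacobi_ext_imaginary: 
  assumes "e \<noteq> 0"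
  shows "norm (jacobi_ext (\<i> * of_real s) (- (\<i> * of_real s)) (Complex t e)) \<le> exp (\<bar>s\<bar> * (2 * pi))"
proof -
  have nz: "1 - Complex t e \<noteq> 0" "1 + Complex t e \<noteq> 0" using assms by (auto simp: complex_eq_iff)
  define A where "A = Im (Ln (1 - Complex t e))"
  define B where "B = Im (Ln (1 + Complex t e))"
  have AB: "\<bar>A\<bar> \<le> pi" "\<bar>B\<bar> \<le> pi"
    using Im_Ln_le_pi[OF nz(1)] mpi_less_Im_Ln[OF nz(1)] Im_Ln_le_pi[OF nz(2)] mpi_less_Im_Ln[OF nz(2)]
    by (auto simp: A_def B_def)
  have "norm (jacobi_ext (\<i> * of_real s) (- (\<i> * of_real s)) (Complex t e)) = exp (s * (B - A))"
    unfolding jacobi_ext_def by (simp add: A_def B_def algebra_simps)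
  also have "s * (B - A) \<le> \<bar>s\<bar> * \<bar>B - A\<bar>" unfolding abs_mult[symmetric] by (rule abs_ge_self)
  also have "\<bar>s\<bar> * \<bar>B - A\<bar> \<le> \<bar>s\<bar> * (2 * pi)" using AB by (intro mult_left_mono) auto
  finally show ?thesis by simp
qed

text \<open>On the functions \<open>((1 - x) / (1 + x))\<close> to an imaginary power the transform is diagonal up to a constant,
  so pairing with them turns the eigenvalue equation into an algebraic one for \<open>jacobi_fourier\<close>.\<close>

lemma jacobi_fourier_pairing:
  assumes f: "integrable lborel f" "supp1 f" and h: "integrable lborel h"
    and lim: "((\<lambda>e. LBINT t. norm (indicator {-1..1} t *\<^sub>R conj_poisson f e t - h t)) \<longlongrightarrow> 0) (at_right 0)"
    and s: "s \<noteq> 0"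
  shows "of_real (sinh (pi * s)) * jacobi_fourier h s = 
     \<i> * of_real pi * (of_real (cosh (pi * s)) * jacobi_fourier f s - jacobi_fourier f 0)"
proof -
  define a where "a = \<i> * complex_of_real s"
  let ?K = "jacobi a (- a)"
  have ab: "Re a > -1" "Re (- a) > -1" by (auto simp: a_def)
  have a0: "a \<noteq> 0" using s by (simp add: a_def)
  define k where "k = (LBINT x. ?K x) / (2 * a)"
  define q where "q = exp (2 * \<i> * of_real pi * a)"
  obtain C where C: "C * (q - 1) = 2 * \<i> * of_real pi"
    "\<And>t e. e > 0 \<Longrightarrow> cauchy_transform ?K (Complex t e) + k = C * q * jacobi_ext a (- a) (Complex t e)"
    "\<And>t e. e > 0 \<Longrightarrow> cauchy_transform ?K (Complex t (-e)) + k = C * jacobi_ext a (- a) (Complex t (-e))"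
    "k = C * exp (\<i> * of_real pi * a)"
    using jacobi_cauchy_formula[OF ab, of k] a0 unfolding q_def k_def by auto
  have [measurable]: "f \<in> borel_measurable borel" "h \<in> borel_measurable borel" using f h by auto
  have Kb: "norm (?K x) \<le> 1" for x unfolding a_def by (rule norm_jacobi_imaginary)
  let ?e = "\<lambda>n. 1 / real (Suc n)"
  have en: "filterlim ?e (at_right 0) sequentially"
    unfolding filterlim_at using lim_1_over_n[THEN LIMSEQ_Suc] by auto
  have pair: "(LBINT t. ?K t * conj_poisson f (?e n) t) = - (LBINT x. f x * conj_poisson ?K (?e n) x)" for n
    by (rule conj_poisson_pairing[OF f _ jacobi_supp Kb]) auto
  \<comment> \<open>On this side the test function is bounded by 1, so L^1 convergence of the
    conjugate Poisson integrals suffices.\<close>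
  have L: "(\<lambda>n. LBINT t. ?K t * conj_poisson f (?e n) t) \<longlonglongrightarrow> (LBINT t. ?K t * h t)"
  proof -
    have qi: "integrable lborel (\<lambda>t. indicator {-1..1} t *\<^sub>R conj_poisson f (?e n) t)" for n
      using conj_poisson_set_integrable[OF f, of "?e n"] unfolding set_integrable_def by simp
    have iK: "integrable lborel (\<lambda>t. ?K t * g t)" if "integrable lborel g" for g
      using integrable_mult_bounded[OF that, of ?K 1] Kb by (simp add: mult.commute)
    have "norm ((LBINT t. ?K t * conj_poisson f (?e n) t) - (LBINT t. ?K t * h t)) \<le> (LBINT t. norm (indicator {-1..1} t *\<^sub>R conj_poisson f (?e n) t - h t))" for n
    proof -
      have "(LBINT t. ?K t * conj_poisson f (?e n) t) = (LBINT t. ?K t * (indicator {-1..1} t *\<^sub>R conj_poisson f (?e n) t))"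
        by (intro Bochner_Integration.integral_cong refl) (auto simp: indicator_def jacobi_def)
      hence "(LBINT t. ?K t * conj_poisson f (?e n) t) - (LBINT t. ?K t * h t) = (LBINT t. ?K t * (indicator {-1..1} t *\<^sub>R conj_poisson f (?e n) t) - ?K t * h t)"
        using Bochner_Integration.integral_diff[OF iK[OF qi[of n]] iK[OF h]] by simp
      also have "\<dots> = (LBINT t. ?K t * (indicator {-1..1} t *\<^sub>R conj_poisson f (?e n) t - h t))"
        by (simp only: right_diff_distrib)
      also have "norm \<dots> \<le> (LBINT t. norm (?K t * (indicator {-1..1} t *\<^sub>R conj_poisson f (?e n) t - h t)))"
        by (rule integral_norm_bound)
      also have "\<dots> \<le> (LBINT t. norm (indicator {-1..1} t *\<^sub>R conj_poisson f (?e n) t - h t))"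
        using Kb by (intro integral_mono integrable_norm iK Bochner_Integration.integrable_diff qi h) (auto simp: norm_mult mult_left_le_one_le)
      finally show ?thesis .
    qed
    hence "(\<lambda>n. (LBINT t. ?K t * conj_poisson f (?e n) t) - (LBINT t. ?K t * h t)) \<longlonglongrightarrow> 0"
      by (intro Lim_null_comparison[OF _ filterlim_compose[OF lim en]]) auto
    thus ?thesis by (simp only: LIM_zero_iff)
  qed
  \<comment> \<open>On this side f is merely integrable, so the conjugate Poisson integrals of the
    test function must converge boundedly; their explicit formula provides the bound.\<close>
  have R: "(\<lambda>n. LBINT x. f x * conj_poisson ?K (?e n) x) \<longlonglongrightarrow> (LBINT x. f x * (C * (q + 1) / 2 * ?K x - k))"
  proof (rule integral_dominated_convergence[where w="\<lambda>x. norm (f x) * ((norm (C * q) + norm C) * exp (\<bar>s\<bar> * (2 * pi)) + norm k)"])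
    have [measurable]: "conj_poisson ?K (?e n) \<in> borel_measurable borel" for n
      using conj_poisson_measurable[OF integrable_jacobi[OF ab] jacobi_supp, of "?e n"] by simp
    show "(\<lambda>x. f x * conj_poisson ?K (?e n) x) \<in> borel_measurable lborel" for n by measurable
    show "(\<lambda>x. f x * (C * (q + 1) / 2 * ?K x - k)) \<in> borel_measurable lborel" by measurable
    show "integrable lborel (\<lambda>x. norm (f x) * ((norm (C * q) + norm C) * exp (\<bar>s\<bar> * (2 * pi)) + norm k))" using f by auto
    have "(\<lambda>n. f x * conj_poisson ?K (?e n) x) \<longlonglongrightarrow> f x * (C * (q + 1) / 2 * ?K x - k)" for x
    proof (cases "\<bar>x\<bar> < 1")
      case True
      show ?thesis by (intro tendsto_intros filterlim_compose[OF conj_poisson_jacobi_tendsto[OF ab C(2,3) True] en])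
    next
      case False
      thus ?thesis using f(2) by (simp add: supp1_def)
    qed
    thus "AE x in lborel. (\<lambda>n. f x * conj_poisson ?K (?e n) x) \<longlonglongrightarrow> f x * (C * (q + 1) / 2 * ?K x - k)" by simp
    have "norm (conj_poisson ?K e x) \<le> (norm (C * q) + norm C) * exp (\<bar>s\<bar> * (2 * pi)) + norm k" if e: "e > 0" for e x
    proof -
      let ?M = "exp (\<bar>s\<bar> * (2 * pi))"
      have E: "norm (jacobi_ext a (- a) (Complex x e)) \<le> ?M" "norm (jacobi_ext a (- a) (Complex x (-e))) \<le> ?M"
        unfolding a_def using norm_jacobi_ext_imaginary[of e s x] norm_jacobi_ext_imaginary[of "-e" s x] e by auto
      have "conj_poisson ?K e x = (C * q * jacobi_ext a (- a) (Complex x e) + C * jacobi_ext a (- a) (Complex x (-e))) / 2 - k"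
        unfolding conj_poisson_eq[OF integrable_jacobi[OF ab] e] C(2)[OF e, symmetric] C(3)[OF e, symmetric] by (simp add: field_simps)
      also have "norm \<dots> \<le> norm ((C * q * jacobi_ext a (- a) (Complex x e) + C * jacobi_ext a (- a) (Complex x (-e))) / 2) + norm k"
        by (rule norm_triangle_ineq4)
      also have "norm ((C * q * jacobi_ext a (- a) (Complex x e) + C * jacobi_ext a (- a) (Complex x (-e))) / 2) \<le> norm (C * q * jacobi_ext a (- a) (Complex x e)) + norm (C * jacobi_ext a (- a) (Complex x (-e)))"
        using norm_triangle_ineq[of "C * q * jacobi_ext a (- a) (Complex x e)" "C * jacobi_ext a (- a) (Complex x (-e))"]
          norm_ge_zero[of "C * q * jacobi_ext a (- a) (Complex x e)"] norm_ge_zero[of "C * jacobi_ext a (- a) (Complex x (-e))"]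
        unfolding norm_divide norm_numeral by linarith
      also have "\<dots> \<le> norm (C * q) * ?M + norm C * ?M"
        unfolding norm_mult[of "C * q"] norm_mult[of C "jacobi_ext _ _ _"] by (intro add_mono mult_left_mono E) auto
      finally show ?thesis by (simp add: distrib_right)
    qed
    thus "AE x in lborel. norm (f x * conj_poisson ?K (?e n) x) \<le> norm (f x) * ((norm (C * q) + norm C) * exp (\<bar>s\<bar> * (2 * pi)) + norm k)" for n
      unfolding norm_mult by (intro AE_I2 mult_left_mono) auto
  qed
  have fK: "integrable lborel (\<lambda>x. f x * ?K x)" unfolding a_def by (rule integrable_jacobi_fourier[OF f(1)])
  have "(LBINT t. ?K t * h t) = - (LBINT x. f x * (C * (q + 1) / 2 * ?K x - k))"
    using LIMSEQ_unique[OF L, unfolded pair, OF tendsto_minus[OF R]] by simp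
  also have "(LBINT x. f x * (C * (q + 1) / 2 * ?K x - k)) = (LBINT x. C * (q + 1) / 2 * (f x * ?K x) - k * f x)"
    by (intro Bochner_Integration.integral_cong refl) (simp add: algebra_simps)
  also have "\<dots> = C * (q + 1) / 2 * (LBINT x. f x * ?K x) - k * (LBINT x. f x)"
    using fK f(1) by (simp del: times_divide_eq_left)
  finally have jh: "jacobi_fourier h s = - (C * (q + 1) / 2 * jacobi_fourier f s - k * jacobi_fourier f 0)"
    unfolding jacobi_fourier_0[OF f(2)] unfolding jacobi_fourier_def a_def by (simp add: mult.commute)
  \<comment> \<open>With E = exp (pi s) one has exp (i pi a) = 1/E and q = 1/E^2, hence (E - 1/E) C
    = -2 pi i E. Multiplying by sinh clears the denominator of C.\<close>
  have "of_real (sinh (pi * s)) * (- (C * (q + 1) / 2 * A - k * B)) = \<i> * of_real pi * (of_real (cosh (pi * s)) * A - B)" for A B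
  proof -
    define E where "E = complex_of_real (exp (pi * s))"
    have E0: "E \<noteq> 0" by (simp add: E_def)
    have sh: "of_real (sinh (pi * s)) = (E - 1 / E) / 2" "of_real (cosh (pi * s)) = (E + 1 / E) / 2"
      by (simp_all only: E_def sinh_field_def cosh_field_def exp_minus inverse_eq_divide of_real_divide of_real_diff of_real_add of_real_1 of_real_numeral)
    have ex: "exp (\<i> * of_real pi * a) = 1 / E"
    proof -
      have "\<i> * of_real pi * a = of_real (- (pi * s))" by (simp add: a_def mult_ac)
      hence "exp (\<i> * of_real pi * a) = of_real (exp (- (pi * s)))" by (simp only: exp_of_real)
      thus ?thesis by (simp only: E_def exp_minus inverse_eq_divide of_real_divide of_real_1)
    qed
    have qE: "q = 1 / E\<^sup>2"
    proof -
      have "q = exp (\<i> * of_real pi * a) * exp (\<i> * of_real pi * a)" unfolding q_def by (simp add: mult_ac flip: exp_add)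
      thus ?thesis by (simp add: ex power2_eq_square)
    qed
    have 1: "(E - 1 / E) * C = - 2 * \<i> * of_real pi * E"
    proof -
      have "(E - 1 / E) * C = - E * (C * (q - 1))" using E0 by (simp add: qE field_simps power2_eq_square)
      thus ?thesis by (simp add: C(1))
    qed
    have "(E - 1 / E) / 2 * (- (C * (q + 1) / 2 * A - k * B)) = - ((E - 1 / E) * C) * ((q + 1) * A / 4 - (1 / E) * B / 2)"
    proof -
      have "D / 2 * (- (C * Q / 2 * A - C * X * B)) = - (D * C) * (Q * A / 4 - X * B / 2)" for D Q X
        by (simp add: algebra_simps)
      thus ?thesis unfolding C(4) ex .
    qed
    also have "\<dots> = \<i> * of_real pi * ((E + 1 / E) / 2 * A - B)"
    proof -
      define u where "u = 1 / E"
      have u: "E * u = 1" using E0 by (simp add: u_def)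
      have "1 / E\<^sup>2 = u * u" by (simp add: u_def power2_eq_square)
      hence "- (- 2 * I * P * E) * ((1 / E\<^sup>2 + 1) * A / 4 - (1 / E) * B / 2) = I * P * (((E * u) * u + E) / 2 * A - (E * u) * B)" for I P
        by (simp add: u_def[symmetric] algebra_simps add_divide_distrib diff_divide_distrib)
      thus ?thesis unfolding 1 qE unfolding u by (simp only: u_def mult_1 add.commute)
    qed
    finally show ?thesis unfolding sh .
  qed
  thus ?thesis unfolding jh .
qed

section \<open>Uniqueness for the Fourier side\<close>

lemma jacobi_imaginary_eq:
  "\<bar>x\<bar> < 1 \<Longrightarrow> jacobi (\<i> * of_real s) (- (\<i> * of_real s)) x = iexp (s * (ln (1 - x) - ln (1 + x)))"
  by (simp add: jacobi_def right_diff_distrib mult.assoc)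

text \<open>Levy's uniqueness theorem concerns probability laws, so g is split into its positive and
  negative part. Their masses agree by the equation at s = 0. If the mass m is positive, both are
  divided by m and transported to the line, where they have equal characteristic functions; if m =
  0, both parts vanish almost everywhere.\<close>

lemma jacobi_fourier_unique_real:
  fixes g :: "real \<Rightarrow> real"
  assumes g: "integrable lborel g" "\<And>x. 1 \<le> \<bar>x\<bar> \<Longrightarrow> g x = 0"
    and z: "\<And>s. jacobi_fourier (\<lambda>x. of_real (g x)) s = 0"
  shows "AE x in lborel. g x = 0"
proof -
  have [measurable]: "g \<in> borel_measurable borel" using g by auto
  define p where "p x = max 0 (g x)" for x
  define n where "n x = max 0 (- g x)" for x
  have gpn: "g x = p x - n x" for x by (auto simp: p_def n_def)
  have pn: "integrable lborel p" "integrable lborel n" "\<And>x. p x \<ge> 0" "\<And>x. n x \<ge> 0"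
    "\<And>x. 1 \<le> \<bar>x\<bar> \<Longrightarrow> p x = 0" "\<And>x. 1 \<le> \<bar>x\<bar> \<Longrightarrow> n x = 0"
    using g unfolding p_def[abs_def] n_def[abs_def] by auto
  have [measurable]: "p \<in> borel_measurable borel" unfolding p_def[abs_def] by measurable
  have [measurable]: "n \<in> borel_measurable borel" unfolding n_def[abs_def] by measurable
  let ?J = "\<lambda>s x. jacobi (\<i> * complex_of_real s) (- (\<i> * complex_of_real s)) x"
  have eqJ: "(LBINT x. of_real (p x) * ?J s x) = (LBINT x. of_real (n x) * ?J s x)" for s
  proof -
    have "(LBINT x. of_real (p x) * ?J s x - of_real (n x) * ?J s x) = 0"
      using z[of s] unfolding jacobi_fourier_def gpn by (simp add: left_diff_distrib)
    moreover have "(LBINT x. of_real (p x) * ?J s x - of_real (n x) * ?J s x) = (LBINT x. of_real (p x) * ?J s x) - (LBINT x. of_real (n x) * ?J s x)"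
      using pn by (intro Bochner_Integration.integral_diff integrable_jacobi_fourier) auto
    ultimately show ?thesis by simp
  qed
  define m where "m = (LBINT x. p x)"
  have mn: "(LBINT x. n x) = m"
  proof -
    have e: "(LBINT x. of_real (u x) * ?J 0 x) = complex_of_real (LBINT x. u x)" if "\<And>x. 1 \<le> \<bar>x\<bar> \<Longrightarrow> u x = 0" for u :: "real \<Rightarrow> real"
    proof -
      have "(LBINT x. of_real (u x) * ?J 0 x) = (LBINT x. complex_of_real (u x))"
        by (intro Bochner_Integration.integral_cong refl) (use that in \<open>auto simp: jacobi_def\<close>)
      thus ?thesis by simp
    qed
    have "complex_of_real (LBINT x. n x) = of_real m" using eqJ[of 0] e[OF pn(5)] e[OF pn(6)] by (simp add: m_def)
    thus ?thesis by (simp only: of_real_eq_iff)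
  qed
  have m0: "m \<ge> 0" unfolding m_def using pn by (intro Bochner_Integration.integral_nonneg) auto
  show ?thesis
  proof (cases "m = 0")
    case True
    have "AE x in lborel. p x = 0" "AE x in lborel. n x = 0"
      using integral_nonneg_eq_0_iff_AE[OF pn(1)] integral_nonneg_eq_0_iff_AE[OF pn(2)] pn(3,4) True mn by (auto simp: m_def)
    thus ?thesis by eventually_elim (simp add: gpn)
  next
    case False
    hence m: "m > 0" using m0 by simp
    define l where "l x = (if \<bar>x\<bar> < 1 then ln (1 - x) - ln (1 + x) else 0)" for x :: real
    have [measurable]: "l \<in> borel_measurable borel" unfolding l_def by measurable
    \<comment> \<open>The inverse of l on (-1,1): its push-forward recovers the original density
      from the law on the line.\<close>
    define \<tau> where "\<tau> u = (1 - exp u) / (1 + exp u)" for u :: real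
    have [measurable]: "\<tau> \<in> borel_measurable borel" unfolding \<tau>_def by measurable
    have \<tau>l: "\<tau> (l x) = x" if "\<bar>x\<bar> < 1" for x
    proof -
      have x: "1 - x > 0" "1 + x > 0" using that by auto
      have "exp (l x) = (1 - x) / (1 + x)" using that x by (simp add: l_def exp_diff)
      hence "1 - exp (l x) = 2 * x / (1 + x)" "1 + exp (l x) = 2 / (1 + x)"
        using x by (simp_all add: field_simps)
      thus ?thesis using x by (simp add: \<tau>_def)
    qed
    define D where "D u = density lborel (\<lambda>x. ennreal (u x / m))" for u :: "real \<Rightarrow> real"
    have main: "real_distribution (distr (D u) borel l)" "char (distr (D u) borel l) s = (LBINT x. of_real (u x) * ?J s x) / of_real m"
      "distr (distr (D u) borel l) borel \<tau> = D u"
      if u: "integrable lborel u" "\<And>x. u x \<ge> 0" "\<And>x. 1 \<le> \<bar>x\<bar> \<Longrightarrow> u x = 0" "(LBINT x. u x) = m" for u s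
    proof -
      have [measurable]: "u \<in> borel_measurable borel" using u by auto
      have sD[measurable_cong]: "sets (D u) = sets borel" by (simp add: D_def)
      have "emeasure (D u) (space (D u)) = (\<integral>\<^sup>+x. ennreal (u x / m) \<partial>lborel)"
        unfolding D_def by (subst emeasure_density) auto
      also have "\<dots> = ennreal (LBINT x. u x / m)"
        using u m by (intro nn_integral_eq_integral) auto
      also have "\<dots> = 1" using u(4) m by simp
      finally interpret P: prob_space "D u" by (intro prob_spaceI)
      have "prob_space (distr (D u) borel l)" by (rule P.prob_space_distr) (simp add: measurable_cong_sets[OF sD refl])
      thus "real_distribution (distr (D u) borel l)"
        by (simp add: real_distribution_def real_distribution_axioms_def)
      have "char (distr (D u) borel l) s = (LINT x|D u. iexp (s * l x))"
        unfolding char_def by (rule integral_distr) (auto simp: measurable_cong_sets[OF sD refl])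
      also have "\<dots> = (LBINT x. (u x / m) *\<^sub>R iexp (s * l x))"
        unfolding D_def using u m by (intro integral_density) auto
      also have "\<dots> = (LBINT x. of_real (u x) * ?J s x / of_real m)"
      proof (intro Bochner_Integration.integral_cong refl)
        fix x
        show "(u x / m) *\<^sub>R iexp (s * l x) = of_real (u x) * ?J s x / of_real m"
        proof (cases "\<bar>x\<bar> < 1")
          case True
          thus ?thesis unfolding jacobi_imaginary_eq[OF True] by (simp add: l_def scaleR_conv_of_real)
        next
          case False
          thus ?thesis using u(3)[of x] by simp
        qed
      qed
      finally show "char (distr (D u) borel l) s = (LBINT x. of_real (u x) * ?J s x) / of_real m" by simp
      have "distr (distr (D u) borel l) borel \<tau> = distr (D u) borel (\<tau> \<circ> l)"
        by (rule distr_distr) (auto simp: measurable_cong_sets[OF sD refl])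
      also have "\<dots> = distr (D u) borel (\<lambda>x. x)"
      proof (rule distr_cong_AE)
        have "AE x in lborel. 0 < ennreal (u x / m) \<longrightarrow> (\<tau> \<circ> l) x = x"
        proof (rule AE_I2, rule impI)
          fix x assume "0 < ennreal (u x / m)"
          hence "\<bar>x\<bar> < 1" using u(3)[of x] by (cases "\<bar>x\<bar> < 1") auto
          thus "(\<tau> \<circ> l) x = x" using \<tau>l by simp
        qed
        thus "AE x in D u. (\<tau> \<circ> l) x = x" unfolding D_def by (subst AE_density) auto
      qed (auto simp: measurable_cong_sets[OF sD refl])
      also have "\<dots> = D u" by (rule distr_id2) (simp add: sD)
      finally show "distr (distr (D u) borel l) borel \<tau> = D u" .
    qed
    note P = main[OF pn(1,3,5) m_def[symmetric]] and N = main[OF pn(2,4,6) mn]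
    have "char (distr (D p) borel l) s = char (distr (D n) borel l) s" for s
      using P(2)[of s] N(2)[of s] eqJ[of s] by simp
    hence ceq: "char (distr (D p) borel l) = char (distr (D n) borel l)" by (intro ext)
    have "distr (D p) borel l = distr (D n) borel l" by (rule Levy_uniqueness[OF P(1) N(1) ceq])
    hence "D p = D n" using P(3) N(3) by metis
    hence "AE x in lborel. ennreal (p x / m) = ennreal (n x / m)"
      unfolding D_def by (intro sigma_finite_measure.density_unique[OF lborel.sigma_finite_measure_axioms]) auto
    thus ?thesis
    proof eventually_elim
      case (elim x)
      hence "p x / m = n x / m" using pn(3,4)[of x] m by (subst (asm) ennreal_inj) auto
      thus ?case using m by (simp add: gpn)
    qed
  qed
qed

text \<open>Conjugating f conjugates the transform and flips s, so the transforms of the conjugate,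
  and with it of the real and imaginary parts, vanish too.\<close>

lemma jacobi_fourier_unique:
  assumes f: "integrable lborel f" "supp1 f" and z: "\<And>s. jacobi_fourier f s = 0"
  shows "AE x in lborel. f x = 0"
proof -
  let ?J = "\<lambda>s x. jacobi (\<i> * complex_of_real s) (- (\<i> * complex_of_real s)) x"
  have cJ: "cnj (?J s x) = ?J (- s) x" for s x by (simp add: jacobi_def exp_cnj)
  have c: "jacobi_fourier (\<lambda>x. cnj (f x)) s = 0" for s
  proof -
    have "jacobi_fourier (\<lambda>x. cnj (f x)) s = (LBINT x. cnj (f x * ?J (- s) x))"
      unfolding jacobi_fourier_def by (simp only: complex_cnj_mult cJ minus_minus)
    also have "\<dots> = cnj (jacobi_fourier f (- s))" unfolding jacobi_fourier_def by (rule Bochner_Integration.integral_cnj)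
    finally show ?thesis using z by simp
  qed
  have ci: "integrable lborel (\<lambda>x. cnj (f x))" using f(1) by simp
  have lin: "jacobi_fourier (\<lambda>x. \<alpha> * f x + \<beta> * cnj (f x)) s = 0" for \<alpha> \<beta> s
  proof -
    have "jacobi_fourier (\<lambda>x. \<alpha> * f x + \<beta> * cnj (f x)) s = (LBINT x. \<alpha> * (f x * ?J s x) + \<beta> * (cnj (f x) * ?J s x))"
      unfolding jacobi_fourier_def by (simp only: distrib_right mult.assoc)
    also have "\<dots> = \<alpha> * jacobi_fourier f s + \<beta> * jacobi_fourier (\<lambda>x. cnj (f x)) s"
      unfolding jacobi_fourier_def using integrable_jacobi_fourier[OF f(1), of s] integrable_jacobi_fourier[OF ci, of s] by simp
    finally show ?thesis using z c by simp
  qed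
  have "of_real (Re w) = 1/2 * w + 1/2 * cnj w" "of_real (Im w) = (- \<i>/2) * w + (\<i>/2) * cnj w" for w
    by (simp_all add: complex_eq_iff)
  hence "jacobi_fourier (\<lambda>x. of_real (Re (f x))) s = 0" "jacobi_fourier (\<lambda>x. of_real (Im (f x))) s = 0" for s
    by (simp_all only: lin)
  hence "AE x in lborel. Re (f x) = 0" "AE x in lborel. Im (f x) = 0"
    using f by (auto intro!: jacobi_fourier_unique_real simp: supp1_def)
  thus ?thesis by eventually_elim (simp add: complex_eq_iff)
qed

section \<open>The eigenvalue relation and its consequences\<close>

lemma jacobi_fourier_bound:
  assumes "integrable lborel f"
  shows "norm (jacobi_fourier f s) \<le> (LBINT x. norm (f x))"
proof -
  let ?J = "\<lambda>x. jacobi (\<i> * complex_of_real s) (- (\<i> * complex_of_real s)) x"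
  have "norm (jacobi_fourier f s) \<le> (LBINT x. norm (f x * ?J x))" unfolding jacobi_fourier_def by (rule integral_norm_bound)
  also have "\<dots> \<le> (LBINT x. norm (f x))"
    using assms by (intro integral_mono integrable_norm integrable_jacobi_fourier)
      (auto simp: norm_mult intro!: mult_left_le norm_jacobi_imaginary)
  finally show ?thesis .
qed

lemma jacobi_fourier_continuous:
  assumes f: "integrable lborel f" and X: "X \<longlonglongrightarrow> s"
  shows "(\<lambda>n. jacobi_fourier f (X n)) \<longlonglongrightarrow> jacobi_fourier f s"
  unfolding jacobi_fourier_def
proof (rule integral_dominated_convergence[where w="\<lambda>x. norm (f x)"])
  have "(\<lambda>n. jacobi (\<i> * of_real (X n)) (- (\<i> * of_real (X n))) x) \<longlonglongrightarrow> jacobi (\<i> * of_real s) (- (\<i> * of_real s)) x" for x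
    unfolding jacobi_def using X by (cases "\<bar>x\<bar> < 1") (auto intro!: tendsto_intros)
  thus "AE x in lborel. (\<lambda>n. f x * jacobi (\<i> * of_real (X n)) (- (\<i> * of_real (X n))) x) \<longlonglongrightarrow> f x * jacobi (\<i> * of_real s) (- (\<i> * of_real s)) x"
    by (intro AE_I2 tendsto_intros)
  show "AE x in lborel. norm (f x * jacobi (\<i> * of_real (X n)) (- (\<i> * of_real (X n))) x) \<le> norm (f x)" for n
    by (intro AE_I2) (auto simp: norm_mult intro!: mult_left_le norm_jacobi_imaginary)
qed (use f in auto)

text \<open>By the eigenvalue equation the L^1 limit of the conjugate Poisson integrals is i pi lam
  times f0. Inserting it into the pairing identity and cancelling i pi gives the relation for s
  other than 0; at s = 0 both sides coincide.\<close>

lemma eigen_fourier_relation: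
  assumes ae: "AE x in leb. f0 x = f x" and f0: "supp1 f0" 
    and f: "f \<in> borel_measurable leb" and i: "integrable lborel f0"
    and r: "1 < r" "r < 2" "integrable lborel (\<lambda>x. norm (f0 x) powr r)"
    and eig: "AE x in leb. finite_hilbert f x = lam * f x"
  shows "(of_real (cosh (pi * s)) - lam * of_real (sinh (pi * s))) * jacobi_fourier f0 s = jacobi_fourier f0 0"
proof (cases "s = 0")
  case False
  obtain h where h: "integrable lborel h"
    "((\<lambda>e. LBINT t. norm (indicator {-1..1} t *\<^sub>R conj_poisson f0 e t - h t)) \<longlongrightarrow> 0) (at_right 0)"
    "AE t in leb. finite_hilbert f t = h t / (of_real pi * \<i>)"
    using finite_hilbert_AE[OF ae f0 f i r] by blast
  have [measurable]: "h \<in> borel_measurable borel" "f0 \<in> borel_measurable borel" using h i by auto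
  have "AE x in leb. h x = (\<i> * of_real pi * lam) * f0 x"
    using h(3) eig ae by eventually_elim (simp add: field_simps)
  hence "AE x in lebesgue. \<bar>x\<bar> < 1 \<longrightarrow> h x = (\<i> * of_real pi * lam) * f0 x"
    by (subst (asm) AE_restrict_space_iff) (auto elim!: eventually_mono)
  hence hf: "AE x in lborel. \<bar>x\<bar> < 1 \<longrightarrow> h x = (\<i> * of_real pi * lam) * f0 x" by (simp only: AE_completion_iff)
  have "jacobi_fourier h s = (LBINT x. (\<i> * of_real pi * lam) * (f0 x * jacobi (\<i> * complex_of_real s) (- (\<i> * complex_of_real s)) x))"
    unfolding jacobi_fourier_def
  proof (rule integral_cong_AE)
    show "AE x in lborel. h x * jacobi (\<i> * complex_of_real s) (- (\<i> * complex_of_real s)) x = (\<i> * of_real pi * lam) * (f0 x * jacobi (\<i> * complex_of_real s) (- (\<i> * complex_of_real s)) x)"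
      using hf by eventually_elim (auto simp: jacobi_def)
  qed measurable
  hence jh: "jacobi_fourier h s = (\<i> * of_real pi * lam) * jacobi_fourier f0 s" by (simp add: jacobi_fourier_def)
  have "of_real (sinh (pi * s)) * ((\<i> * of_real pi * lam) * jacobi_fourier f0 s) = 
     \<i> * of_real pi * (of_real (cosh (pi * s)) * jacobi_fourier f0 s - jacobi_fourier f0 0)"
    using jacobi_fourier_pairing[OF i f0 h(1,2) False] unfolding jh .
  hence "(\<i> * of_real pi) * (lam * of_real (sinh (pi * s)) * jacobi_fourier f0 s) = (\<i> * of_real pi) * (of_real (cosh (pi * s)) * jacobi_fourier f0 s - jacobi_fourier f0 0)"
    by (simp only: mult_ac)
  hence "lam * of_real (sinh (pi * s)) * jacobi_fourier f0 s = of_real (cosh (pi * s)) * jacobi_fourier f0 s - jacobi_fourier f0 0"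
    by (subst (asm) mult_left_cancel) auto
  thus ?thesis by (simp add: algebra_simps)
qed simp

text \<open>The solution c of exp (2 pi i c) = -(1 + lam) / (1 - lam) with -1 < Re c < 0, for
  admissible lam. The shift by -1/2 produces the minus sign, so that the principal logarithm of the
  quotient itself can be used.\<close>

definition eigen_exponent :: "complex \<Rightarrow> complex" where
  "eigen_exponent lam = - 1 / 2 + Ln ((1 + lam) / (1 - lam)) / (2 * \<i> * of_real pi)"

lemma eigen_exponent:
  assumes "lam \<noteq> 1" "lam \<noteq> -1" "(1 + lam) / (1 - lam) \<notin> \<real>\<^sub>\<le>\<^sub>0"
  shows "Re (eigen_exponent lam) = - 1 / 2 + Arg ((1 + lam) / (1 - lam)) / (2 * pi)"
    and "-1 < Re (eigen_exponent lam)" "Re (eigen_exponent lam) < 0"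
    and "(exp (2 * \<i> * of_real pi * eigen_exponent lam) + 1) / (exp (2 * \<i> * of_real pi * eigen_exponent lam) - 1) = lam"
proof -
  define w where "w = (1 + lam) / (1 - lam)"
  have w0: "w \<noteq> 0" using assms by (auto simp: w_def add_eq_0_iff)
  show re: "Re (eigen_exponent lam) = - 1 / 2 + Arg ((1 + lam) / (1 - lam)) / (2 * pi)"
  proof -
    have "Ln w / (2 * \<i> * of_real pi) = (- \<i> * Ln w) / of_real (2 * pi)" by (simp add: field_simps)
    hence "Re (Ln w / (2 * \<i> * of_real pi)) = Im (Ln w) / (2 * pi)" by (simp only: Re_divide_of_real) simp
    thus ?thesis using w0 by (simp add: eigen_exponent_def w_def[symmetric] Arg_eq_Im_Ln)
  qed
  have "Im (Ln w) \<noteq> pi" using assms(3) w0 Im_Ln_eq_pi[of w] by (auto simp: w_def[symmetric] complex_nonpos_Reals_iff)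
  hence "- pi < Im (Ln w)" "Im (Ln w) < pi" using mpi_less_Im_Ln[OF w0] Im_Ln_le_pi[OF w0] by auto
  hence "- pi < Arg w" "Arg w < pi" using w0 by (simp_all add: Arg_eq_Im_Ln)
  thus "-1 < Re (eigen_exponent lam)" "Re (eigen_exponent lam) < 0"
    unfolding re w_def[symmetric] by (simp_all add: field_simps)
  have "2 * \<i> * of_real pi * eigen_exponent lam = - (\<i> * of_real pi) + Ln w"
    by (simp add: eigen_exponent_def w_def[symmetric] field_simps)
  hence q: "exp (2 * \<i> * of_real pi * eigen_exponent lam) = - w"
    using w0 by (simp add: exp_diff exp_pi_i')
  have "1 - lam \<noteq> 0" using assms by auto
  hence "w + 1 = 2 / (1 - lam)" "w - 1 = 2 * lam / (1 - lam)" by (simp_all add: w_def field_simps)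
  hence "(w - 1) / (w + 1) = lam" using \<open>1 - lam \<noteq> 0\<close> by simp
  moreover have "(- w + 1) / (- w - 1) = (w - 1) / (w + 1)"
  proof -
    have "(- w + 1) / (- w - 1) = (- (w - 1)) / (- (w + 1))" by simp
    thus ?thesis by (simp only: minus_divide_divide)
  qed
  ultimately show "(exp (2 * \<i> * of_real pi * eigen_exponent lam) + 1) / (exp (2 * \<i> * of_real pi * eigen_exponent lam) - 1) = lam"
    unfolding q by simp
qed

text \<open>Here m < 1 is the larger of the two singular exponents. Halfway between 1 and 1/m, r
  keeps r m < 1, and m >= 1/2 keeps r < 2.\<close>

lemma jacobi_powr_integrable:
  assumes c: "-1 < Re c" "Re c < 0"
  obtains r where "1 < r" "r < 2" "integrable lborel (\<lambda>x. norm (jacobi c (- 1 - c) x) powr r)"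
proof -
  define m where "m = max (- Re c) (1 + Re c)"
  have m: "1/2 \<le> m" "m < 1" using c by (auto simp: m_def max_def)
  define r where "r = (1 + 1/m) / 2"
  have r: "1 < r" "r < 2" using m by (auto simp: r_def field_simps)
  have rm: "r * m < 1" using m by (simp add: r_def field_simps)
  have "- Re c \<le> m" "1 + Re c \<le> m" by (simp_all add: m_def)
  hence "r * (- Re c) \<le> r * m" "r * (1 + Re c) \<le> r * m" using r by (simp_all only: mult_le_cancel_left_pos)
  hence "r * Re c > -1" "r * (- 1 - Re c) > -1" using rm by (auto simp: algebra_simps)
  hence "integrable lborel (jacobi (of_real r * c) (of_real r * (- 1 - c)))"
    by (intro integrable_jacobi) auto
  hence "integrable lborel (\<lambda>x. norm (jacobi (of_real r * c) (of_real r * (- 1 - c)) x))" by (rule integrable_norm)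
  hence "integrable lborel (\<lambda>x. norm (jacobi c (- 1 - c) x) powr r)" by (simp only: norm_jacobi_powr)
  thus ?thesis using that r by blast
qed

text \<open>A zero at s means lam = coth (pi s), and the map z -> (1 + z) / (1 - z) sends coth y to
  -exp (2 y).\<close>

lemma symbol_zero:
  assumes "of_real (cosh (pi * s)) - lam * of_real (sinh (pi * s)) = (0::complex)"
  shows "s \<noteq> 0" "(1 + lam) / (1 - lam) = of_real (- exp (2 * (pi * s)))"
proof -
  show s: "s \<noteq> 0" using assms by auto
  define E where "E = exp (pi * s)"
  have E: "E > 0" "E \<noteq> 1" using s by (auto simp: E_def)
  have sh: "sinh (pi * s) = (E - 1 / E) / 2" "cosh (pi * s) = (E + 1 / E) / 2"
    by (simp_all add: E_def sinh_field_def cosh_field_def exp_minus inverse_eq_divide)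
  have s0: "sinh (pi * s) \<noteq> 0" using s by simp
  have lam: "lam = of_real (cosh (pi * s) / sinh (pi * s))" using assms s0 by (simp add: field_simps)
  have sc: "sinh (pi * s) + cosh (pi * s) = E" "sinh (pi * s) - cosh (pi * s) = - (1 / E)" by (simp_all add: sh field_simps)
  have "1 + cosh (pi * s) / sinh (pi * s) = (sinh (pi * s) + cosh (pi * s)) / sinh (pi * s)" "1 - cosh (pi * s) / sinh (pi * s) = (sinh (pi * s) - cosh (pi * s)) / sinh (pi * s)"
    using s0 by (simp_all add: add_divide_distrib diff_divide_distrib)
  hence "1 + cosh (pi * s) / sinh (pi * s) = E / sinh (pi * s)" "1 - cosh (pi * s) / sinh (pi * s) = - (1 / E) / sinh (pi * s)"
    unfolding sc .
  hence "(1 + cosh (pi * s) / sinh (pi * s)) / (1 - cosh (pi * s) / sinh (pi * s)) = - (E * E)"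
    using s0 E by simp
  also have "E * E = exp (2 * (pi * s))" unfolding E_def by (simp flip: exp_add)
  finally have "(1 + cosh (pi * s) / sinh (pi * s)) / (1 - cosh (pi * s) / sinh (pi * s)) = - exp (2 * (pi * s))" .
  hence "complex_of_real ((1 + cosh (pi * s) / sinh (pi * s)) / (1 - cosh (pi * s) / sinh (pi * s))) = of_real (- exp (2 * (pi * s)))" by (simp only:)
  thus "(1 + lam) / (1 - lam) = of_real (- exp (2 * (pi * s)))" unfolding lam by (simp only: of_real_divide of_real_add of_real_diff of_real_1)
qed

text \<open>The transform of an integrable function is bounded by its L^1 norm, whereas a real
  exponential is unbounded.\<close>

lemma jacobi_fourier_zero_if_exp:
  assumes f: "integrable lborel f" and rel: "\<And>s. jacobi_fourier f s = of_real (exp (d * s)) * jacobi_fourier f 0" and d: "d \<noteq> 0"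
  shows "jacobi_fourier f 0 = 0"
proof (rule ccontr)
  assume nz: "jacobi_fourier f 0 \<noteq> 0"
  define B where "B = (LBINT x. norm (f x)) / norm (jacobi_fourier f 0)"
  have "exp (d * s) \<le> B" for s
    using jacobi_fourier_bound[OF f, of s] nz unfolding rel[of s] B_def by (simp add: norm_mult field_simps)
  from this[of "(\<bar>B\<bar> + 1) / d"] have "exp (\<bar>B\<bar> + 1) \<le> B" using d by simp
  moreover have "\<bar>B\<bar> + 1 < exp (\<bar>B\<bar> + 1)" using exp_ge_add_one_self[of "\<bar>B\<bar> + 1"] by simp
  ultimately show False by linarith
qed

text \<open>For lam = 1 or -1 the symbol is exp (-pi s) or exp (pi s), which forces exponential
  growth of the transform unless it is zero. If the quotient is a negative real, the symbol has
  exactly one real zero s; evaluating the relation there gives F 0 = 0, so the transform vanishes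
  away from s and, being continuous, at s.\<close>

lemma eigen_admissible:
  assumes f: "integrable lborel f" "supp1 f" and nz: "\<not> (AE x in lborel. f x = 0)"
    and rel: "\<And>s. (of_real (cosh (pi * s)) - lam * of_real (sinh (pi * s))) * jacobi_fourier f s = jacobi_fourier f 0"
  shows "lam \<noteq> 1" "lam \<noteq> -1" "(1 + lam) / (1 - lam) \<notin> \<real>\<^sub>\<le>\<^sub>0"
proof -
  have not0: "\<exists>s. jacobi_fourier f s \<noteq> 0" using jacobi_fourier_unique[OF f] nz by blast
  have cs: "cosh u - sinh u = exp (- u)" "cosh u + sinh u = exp u" for u :: real
    by (simp_all add: cosh_minus_sinh cosh_plus_sinh)
  show l1: "lam \<noteq> 1"
  proof
    assume l: "lam = 1"
    have r: "jacobi_fourier f s = of_real (exp (pi * s)) * jacobi_fourier f 0" for s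
    proof -
      have "of_real (exp (- (pi * s))) * jacobi_fourier f s = jacobi_fourier f 0"
        using rel[of s] by (simp only: l cs(1)[of "pi * s", symmetric] of_real_diff mult_1)
      note h = this
      have "exp (pi * s) * exp (- (pi * s)) = 1" by (simp flip: exp_add)
      hence "jacobi_fourier f s = of_real (exp (pi * s) * exp (- (pi * s))) * jacobi_fourier f s" by simp
      also have "\<dots> = of_real (exp (pi * s)) * (of_real (exp (- (pi * s))) * jacobi_fourier f s)" by (simp only: of_real_mult mult.assoc)
      finally show ?thesis unfolding h .
    qed
    have "jacobi_fourier f 0 = 0" by (rule jacobi_fourier_zero_if_exp[OF f(1) r]) simp
    hence "jacobi_fourier f s = 0" for s by (subst r) simp
    thus False using not0 by blast
  qed
  show l2: "lam \<noteq> -1"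
  proof
    assume l: "lam = -1"
    have r: "jacobi_fourier f s = of_real (exp ((- pi) * s)) * jacobi_fourier f 0" for s
    proof -
      have "of_real (exp (pi * s)) * jacobi_fourier f s = jacobi_fourier f 0"
        using rel[of s] by (simp only: l cs(2)[of "pi * s", symmetric] of_real_add mult_minus_left mult_1 diff_minus_eq_add)
      note h = this
      have "exp ((- pi) * s) * exp (pi * s) = 1" by (simp flip: exp_add)
      hence "jacobi_fourier f s = of_real (exp ((- pi) * s) * exp (pi * s)) * jacobi_fourier f s" by simp
      also have "\<dots> = of_real (exp ((- pi) * s)) * (of_real (exp (pi * s)) * jacobi_fourier f s)" by (simp only: of_real_mult mult.assoc)
      finally show ?thesis unfolding h .
    qed
    have "jacobi_fourier f 0 = 0" by (rule jacobi_fourier_zero_if_exp[OF f(1) r]) simp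
    hence "jacobi_fourier f s = 0" for s by (subst r) simp
    thus False using not0 by blast
  qed
  show "(1 + lam) / (1 - lam) \<notin> \<real>\<^sub>\<le>\<^sub>0"
  proof
    assume "(1 + lam) / (1 - lam) \<in> \<real>\<^sub>\<le>\<^sub>0"
    then obtain v where v: "(1 + lam) / (1 - lam) = of_real v" "v \<le> 0" by (auto elim: nonpos_Reals_cases)
    have n1: "1 - lam \<noteq> 0" "1 + lam \<noteq> 0" using l1 l2 by (auto simp: add_eq_0_iff)
    have v0: "v < 0" using v n1 by (cases "v = 0") auto
    have e1: "1 + lam = of_real v * (1 - lam)" using v n1 by (simp add: field_simps)
    have v1: "v \<noteq> -1" using e1 by auto
    define s where "s = ln (- v) / (2 * pi)"
    have ev: "- exp (2 * (pi * s)) = v" using v0 by (simp add: s_def)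
    have s0: "s \<noteq> 0" using ev v1 by auto
    have D0: "of_real (cosh (pi * s)) - lam * of_real (sinh (pi * s)) = (0::complex)"
    proof -
      define E where "E = complex_of_real (exp (pi * s))"
      have E: "E \<noteq> 0" by (simp add: E_def)
      have vE: "of_real v = - (E * E)" unfolding ev[symmetric] E_def by (simp flip: exp_add of_real_mult)
      have sh: "complex_of_real (sinh (pi * s)) = (E - 1 / E) / 2" "complex_of_real (cosh (pi * s)) = (E + 1 / E) / 2"
        by (simp_all only: E_def sinh_field_def cosh_field_def exp_minus inverse_eq_divide of_real_divide of_real_diff of_real_add of_real_1 of_real_numeral)
      have "lam * (E * E) - lam = E * E + 1" using e1 unfolding vE by (simp add: algebra_simps)
      hence "(E + 1 / E) / 2 - lam * ((E - 1 / E) / 2) = 0" using E by (simp add: field_simps)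
      thus ?thesis unfolding sh .
    qed
    have f0: "jacobi_fourier f 0 = 0" using rel[of s] D0 by simp
    have other: "jacobi_fourier f u = 0" if "u \<noteq> s" for u
    proof -
      have "of_real (cosh (pi * u)) - lam * of_real (sinh (pi * u)) \<noteq> (0::complex)"
      proof
        assume "of_real (cosh (pi * u)) - lam * of_real (sinh (pi * u)) = (0::complex)"
        from symbol_zero(2)[OF this] have "complex_of_real v = of_real (- exp (2 * (pi * u)))" unfolding v(1) .
        hence "v = - exp (2 * (pi * u))" by (simp only: of_real_eq_iff)
        hence "exp (2 * (pi * u)) = exp (2 * (pi * s))" using ev by simp
        thus False using that by simp
      qed
      thus ?thesis using rel[of u] f0 by simp
    qed
    \<comment> \<open>The zero of the symbol is approached through the points s + 1/(n+1), where the
      transform is already known to vanish.\<close>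
    have "jacobi_fourier f s = 0"
    proof -
      have X: "(\<lambda>n. s + 1 / real (Suc n)) \<longlonglongrightarrow> s + 0"
        by (intro tendsto_intros lim_1_over_n[THEN LIMSEQ_Suc])
      have "(\<lambda>n. jacobi_fourier f (s + 1 / real (Suc n))) \<longlonglongrightarrow> jacobi_fourier f s"
        using X by (intro jacobi_fourier_continuous f) simp
      moreover have "jacobi_fourier f (s + 1 / real (Suc n)) = 0" for n by (rule other) simp
      ultimately show ?thesis using LIMSEQ_unique[OF _ tendsto_const] by simp
    qed
    hence "jacobi_fourier f u = 0" for u using other by (cases "u = s") auto
    thus False using not0 by blast
  qed
qed

text \<open>Both f and the explicit Jacobi eigenfunction have a transform equal to a constant over
  the nonvanishing symbol. The combination A w - B f therefore has transform 0. The constant A of f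
  is not 0, as otherwise the transform of f, and f itself, would vanish.\<close>

lemma eigenfunction_unique:
  assumes f: "integrable lborel f" "supp1 f" and nz: "\<not> (AE x in lborel. f x = 0)"
    and rel: "\<And>s. (of_real (cosh (pi * s)) - lam * of_real (sinh (pi * s))) * jacobi_fourier f s = jacobi_fourier f 0"
  obtains k where "AE x in lborel. jacobi (eigen_exponent lam) (- 1 - eigen_exponent lam) x = k * f x"
proof -
  note adm = eigen_admissible[OF assms]
  define c where "c = eigen_exponent lam"
  let ?w = "jacobi c (- 1 - c)"
  note c = eigen_exponent(2,3)[OF adm, folded c_def]
  have w: "integrable lborel ?w" using c by (intro integrable_jacobi) auto
  obtain r where r: "1 < r" "r < 2" "integrable lborel (\<lambda>x. norm (?w x) powr r)"
    using jacobi_powr_integrable[OF c] by blast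
  have eig: "AE x in leb. finite_hilbert ?w x = lam * ?w x"
  proof (rule AE_I2)
    fix x assume "x \<in> space leb"
    hence "\<bar>x\<bar> < 1" by auto
    thus "finite_hilbert ?w x = lam * ?w x"
      using jacobi_eigenfunction(2)[OF c] eigen_exponent(4)[OF adm, folded c_def] by simp
  qed
  have relw: "(of_real (cosh (pi * s)) - lam * of_real (sinh (pi * s))) * jacobi_fourier ?w s = jacobi_fourier ?w 0" for s
    by (rule eigen_fourier_relation[OF _ jacobi_supp jacobi_in_L0 w r eig]) simp
  have D: "of_real (cosh (pi * s)) - lam * of_real (sinh (pi * s)) \<noteq> (0::complex)" for s
  proof
    assume "of_real (cosh (pi * s)) - lam * of_real (sinh (pi * s)) = (0::complex)"
    from symbol_zero(2)[OF this] have "(1 + lam) / (1 - lam) \<in> \<real>\<^sub>\<le>\<^sub>0" by (simp only: nonpos_Reals_of_real_iff) simp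
    thus False using adm by simp
  qed
  define A where "A = jacobi_fourier f 0"
  define B where "B = jacobi_fourier ?w 0"
  let ?g = "\<lambda>x. A * ?w x - B * f x"
  have gi: "integrable lborel ?g" using w f by auto
  have gs: "supp1 ?g" using f jacobi_supp[of c "- 1 - c"] by (auto simp: supp1_def)
  have "jacobi_fourier ?g s = 0" for s
  proof -
    have "jacobi_fourier ?g s = (LBINT x. A * (?w x * jacobi (\<i> * of_real s) (- (\<i> * of_real s)) x) - B * (f x * jacobi (\<i> * of_real s) (- (\<i> * of_real s)) x))"
      unfolding jacobi_fourier_def by (simp only: left_diff_distrib mult.assoc)
    also have "\<dots> = A * jacobi_fourier ?w s - B * jacobi_fourier f s"
      unfolding jacobi_fourier_def using integrable_jacobi_fourier[OF w, of s] integrable_jacobi_fourier[OF f(1), of s] by simp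
    finally have g: "jacobi_fourier ?g s = A * jacobi_fourier ?w s - B * jacobi_fourier f s" .
    let ?D = "of_real (cosh (pi * s)) - lam * of_real (sinh (pi * s)) :: complex"
    have "?D * (A * jacobi_fourier ?w s - B * jacobi_fourier f s) = A * (?D * jacobi_fourier ?w s) - B * (?D * jacobi_fourier f s)"
      by (simp only: right_diff_distrib mult.left_commute)
    also have "\<dots> = A * B - B * A" unfolding relw rel A_def B_def ..
    finally show ?thesis unfolding g using D[of s] by simp
  qed
  from jacobi_fourier_unique[OF gi gs this] have ae: "AE x in lborel. A * ?w x = B * f x" by simp
  have "A \<noteq> 0"
  proof
    assume A0: "A = 0"
    have "jacobi_fourier f s = 0" for s using rel[of s] D[of s] A0 by (simp add: A_def)
    thus False using jacobi_fourier_unique[OF f] nz by simp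
  qed
  hence "AE x in lborel. ?w x = B / A * f x" using ae by (auto simp: field_simps)
  thus ?thesis using that unfolding c_def by blast
qed

section \<open>Rearrangement invariant spaces\<close>

definition distribution :: "(real \<Rightarrow> complex) \<Rightarrow> real \<Rightarrow> ennreal" where
  "distribution f s = emeasure leb {x \<in> {-1<..<1}. s < norm (f x)}"

lemma space_leb [simp]: "space leb = {-1<..<1}"
  by simp

lemma finite_measure_leb: "finite_measure leb"
  by (rule finite_measureI) (simp add: emeasure_restrict_space)

lemma emeasure_leb: "A \<in> sets lebesgue \<Longrightarrow> A \<subseteq> {-1<..<1} \<Longrightarrow> emeasure leb A = emeasure lebesgue A"
  by (rule emeasure_restrict_space) auto

lemma sets_leb_iff: "A \<in> sets leb \<longleftrightarrow> A \<in> sets lebesgue \<and> A \<subseteq> {-1<..<1}"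
  by (subst sets_restrict_space_iff) auto

lemma superlevel_sets: "f \<in> L0 \<Longrightarrow> {x \<in> {-1<..<1}. s < norm (f x)} \<in> sets leb"
proof -
  assume "f \<in> L0"
  hence [measurable]: "f \<in> borel_measurable leb" by (simp add: L0_def)
  have "{x \<in> space leb. s < norm (f x)} \<in> sets leb" by measurable
  thus ?thesis by simp
qed

text \<open>Lets the axiom \<open>rearr\<close> be verified by comparing distribution functions at
  real thresholds; at the threshold \<open>top\<close> the level set is empty.\<close>

lemma decr_rearr_mono:
  assumes "\<And>s. s \<ge> 0 \<Longrightarrow> distribution g s \<le> distribution f s"
  shows "decr_rearr g t \<le> decr_rearr f t"
  unfolding decr_rearr_def
proof (rule Inf_superset_mono, rule subsetI, clarify)
  fix s assume s: "emeasure leb {x \<in> space leb. s < ennreal (norm (f x))} \<le> ennreal t"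
  show "emeasure leb {x \<in> space leb. s < ennreal (norm (g x))} \<le> ennreal t"
  proof (cases s)
    case (real r)
    have "{x \<in> space leb. s < ennreal (norm (h x))} = {x \<in> {-1<..<1}. r < norm (h x)}" for h :: "real \<Rightarrow> complex"
      using real by (auto simp: ennreal_less_iff)
    thus ?thesis using s assms[of r] real unfolding distribution_def by auto
  next
    case top
    thus ?thesis by simp
  qed
qed

section \<open>Indicator functions in an r.i. space\<close>

context ri_space
begin

lemma mem_L0: "f \<in> X \<Longrightarrow> f \<in> L0"
  using sub_L0 by auto

lemma distribution_mem:
  assumes "g \<in> L0" "f \<in> X" "\<And>s. s \<ge> 0 \<Longrightarrow> distribution g s \<le> distribution f s"
  shows "g \<in> X" "nrm g \<le> nrm f"
  using rearr[OF assms(1,2)] decr_rearr_mono[OF assms(3)] by blast+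

lemma dominated_mem:
  assumes g: "g \<in> L0" and f: "f \<in> X" and le: "AE x in leb. norm (g x) \<le> norm (f x)"
  shows "g \<in> X" "nrm g \<le> nrm f"
proof -
  have "distribution g s \<le> distribution f s" for s
    unfolding distribution_def
  proof (rule emeasure_mono_AE)
    show "AE x in leb. x \<in> {x \<in> {-1<..<1}. s < norm (g x)} \<longrightarrow> x \<in> {x \<in> {-1<..<1}. s < norm (f x)}"
      using le by eventually_elim auto
  qed (rule superlevel_sets[OF mem_L0[OF f]])
  thus "g \<in> X" "nrm g \<le> nrm f" using distribution_mem[OF g f] by auto
qed

lemma dominated_scaled_mem:
  assumes g: "g \<in> L0" and f: "f \<in> X" and C: "C \<ge> 0" and le: "AE x in leb. norm (g x) \<le> C * norm (f x)"
  shows "g \<in> X" "nrm g \<le> C * nrm f"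
proof -
  have 1: "(\<lambda>x. complex_of_real C * f x) \<in> X" by (rule scale_mem[OF f])
  have 2: "AE x in leb. norm (g x) \<le> norm (complex_of_real C * f x)" using le C by (simp add: norm_mult)
  show "g \<in> X" by (rule dominated_mem[OF g 1 2])
  show "nrm g \<le> C * nrm f" using dominated_mem(2)[OF g 1 2] nrm_scale[OF f, of "of_real C"] C by simp
qed

lemma zero_mem: "(\<lambda>x. 0) \<in> X" "nrm (\<lambda>x. 0) = 0"
proof -
  obtain f where f: "f \<in> X" using nonzero by blast
  show z: "(\<lambda>x. 0) \<in> X" using scale_mem[OF f, of 0] by simp
  show "nrm (\<lambda>x. 0) = 0" using nrm_eq_0_iff[OF z] by simp
qed

lemma sum_mem:
  assumes "finite I" "\<And>i. i \<in> I \<Longrightarrow> F i \<in> X"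
  shows "(\<lambda>x. \<Sum>i\<in>I. F i x) \<in> X \<and> nrm (\<lambda>x. \<Sum>i\<in>I. F i x) \<le> (\<Sum>i\<in>I. nrm (F i))"
  using assms
proof (induction I rule: finite_induct)
  case empty
  thus ?case by (simp add: zero_mem)
next
  case (insert i I)
  thus ?case using add_mem[of "F i" "\<lambda>x. \<Sum>i\<in>I. F i x"] nrm_triangle[of "F i" "\<lambda>x. \<Sum>i\<in>I. F i x"] by auto
qed

definition chi :: "real set \<Rightarrow> real \<Rightarrow> complex" where
  "chi A x = of_bool (x \<in> A)"

lemma chi_L0: "A \<in> sets lebesgue \<Longrightarrow> chi A \<in> L0"
proof -
  assume A: "A \<in> sets lebesgue"
  have "chi A = indicator A" by (auto simp: chi_def indicator_def fun_eq_iff)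
  moreover have "(indicator A :: real \<Rightarrow> complex) \<in> borel_measurable leb"
    by (intro measurable_restrict_space1 borel_measurable_indicator A)
  ultimately show ?thesis by (simp add: L0_def)
qed

lemma distribution_chi: "s \<ge> 0 \<Longrightarrow> distribution (chi A) s = (if s < 1 then emeasure leb (A \<inter> {-1<..<1}) else 0)"
proof -
  assume "s \<ge> 0"
  hence "{x \<in> {-1<..<1}. s < norm (chi A x)} = (if s < 1 then A \<inter> {-1<..<1} else {})"
    by (auto simp: chi_def)
  thus ?thesis by (simp add: distribution_def)
qed

lemma chi_mono:
  assumes "A \<in> sets lebesgue" "chi B \<in> X" "emeasure leb (A \<inter> {-1<..<1}) \<le> emeasure leb (B \<inter> {-1<..<1})"
  shows "chi A \<in> X" "nrm (chi A) \<le> nrm (chi B)"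
  using distribution_mem[OF chi_L0[OF assms(1)] assms(2)] assms(3) by (auto simp: distribution_chi)

text \<open>A nonzero member exceeds some 1/(n+1) on a set A of positive measure, so the indicator
  of A lies in X. Intervals of length at most |A| have indicators in X by rearrangement, and
  finitely many of them cover (-1,1).\<close>

lemma one_mem: "chi UNIV \<in> X" "nrm (chi UNIV) > 0"
proof -
  interpret finite_measure leb by (rule finite_measure_leb)
  obtain f where f: "f \<in> X" "\<not> (AE x in leb. f x = 0)" using nonzero by blast
  have fL: "f \<in> L0" by (rule mem_L0[OF f(1)])
  have "\<exists>n::nat. emeasure leb {x \<in> {-1<..<1}. 1 / real (Suc n) < norm (f x)} \<noteq> 0"
  proof (rule ccontr)
    assume "\<not> ?thesis"
    hence "{x \<in> {-1<..<1}. 1 / real (Suc n) < norm (f x)} \<in> null_sets leb" for n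
      using superlevel_sets[OF fL] by auto
    hence N: "(\<Union>n. {x \<in> {-1<..<1}. 1 / real (Suc n) < norm (f x)}) \<in> null_sets leb" by (intro null_sets_UN) auto
    have "AE x in leb. f x = 0"
    proof (rule AE_I'[OF N], rule subsetI)
      fix x assume "x \<in> {x \<in> space leb. f x \<noteq> 0}"
      hence x: "x \<in> {-1<..<1}" "norm (f x) > 0" by auto
      obtain n where "inverse (real (Suc n)) < norm (f x)" using reals_Archimedean[OF x(2)] by auto
      thus "x \<in> (\<Union>n. {x \<in> {-1<..<1}. 1 / real (Suc n) < norm (f x)})" using x by (auto simp: inverse_eq_divide)
    qed
    thus False using f by simp
  qed
  then obtain n :: nat where n: "emeasure leb {x \<in> {-1<..<1}. 1 / real (Suc n) < norm (f x)} \<noteq> 0" by blast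
  define A where "A = {x \<in> {-1<..<1}. 1 / real (Suc n) < norm (f x)}"
  have A: "A \<in> sets leb" unfolding A_def by (rule superlevel_sets[OF fL])
  hence A': "A \<in> sets lebesgue" "A \<subseteq> {-1<..<1}" by (simp_all add: sets_leb_iff)
  have cA: "chi A \<in> X"
  proof (rule dominated_scaled_mem[OF chi_L0[OF A'(1)] f(1), of "real (Suc n)"])
    show "AE x in leb. norm (chi A x) \<le> real (Suc n) * norm (f x)"
      by (rule AE_I2) (auto simp: chi_def A_def field_simps)
  qed simp
  have mA: "measure leb A > 0" using n unfolding A_def[symmetric] by (simp add: measure_def enn2real_positive_iff less_top[symmetric] zero_less_iff_neq_zero)
  obtain N :: nat where N: "N > 0" "2 / real N \<le> measure leb A"
  proof -
    obtain N where "2 / measure leb A < real N" using reals_Archimedean2 by blast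
    moreover from this have "N > 0" using mA by (cases N) (auto simp: not_less)
    ultimately show ?thesis using that mA by (simp add: field_simps)
  qed
  define J where "J j = {-1 + 2 * real j / real N <.. -1 + 2 * (real j + 1) / real N}" for j :: nat
  have cJ: "chi (J j) \<in> X" for j
  proof (rule chi_mono(1)[OF _ cA])
    show "J j \<in> sets lebesgue" by (simp add: J_def)
    have "emeasure leb (J j \<inter> {-1<..<1}) = emeasure lebesgue (J j \<inter> {-1<..<1})"
      by (intro emeasure_leb) (auto simp: J_def)
    also have "\<dots> \<le> emeasure lebesgue (J j)" by (intro emeasure_mono) (auto simp: J_def)
    also have "\<dots> = ennreal (2 / real N)"
      using N by (simp add: J_def add_divide_distrib distrib_left divide_right_mono)
    also have "\<dots> \<le> ennreal (measure leb A)" using N by (intro ennreal_leI)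
    also have "\<dots> = emeasure leb (A \<inter> {-1<..<1})" using A'(2) by (simp add: emeasure_eq_measure Int_absorb2)
    finally show "emeasure leb (J j \<inter> {-1<..<1}) \<le> emeasure leb (A \<inter> {-1<..<1})" .
  qed
  have s: "(\<lambda>x. \<Sum>j<N. chi (J j) x) \<in> X" using sum_mem[of "{..<N}" "\<lambda>j. chi (J j)"] cJ by auto
  show o: "chi UNIV \<in> X"
  proof (rule dominated_mem[OF chi_L0 s])
    have "norm (chi UNIV x) \<le> norm (\<Sum>j<N. chi (J j) x)" if x: "x \<in> {-1<..<1}" for x
    proof -
      define y where "y = (x + 1) * real N / 2"
      have y: "0 < y" "y < real N" using x N mult_strict_right_mono[of "x + 1" 2 "real N"] by (auto simp: y_def)
      define j where "j = nat (\<lceil>y\<rceil> - 1)"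
      have c: "1 \<le> \<lceil>y\<rceil>" "\<lceil>y\<rceil> \<le> int N" using y by (simp_all add: ceiling_le_iff)
      have j: "real j < y" "y \<le> real j + 1" "j < N" using c y ceiling_correct[of y] by (auto simp: j_def)
      have "x \<in> J j" using j N by (auto simp: J_def y_def field_simps)
      have "1 = Re (chi (J j) x)" using \<open>x \<in> J j\<close> by (simp add: chi_def)
      also have "\<dots> \<le> (\<Sum>j<N. Re (chi (J j) x))" using j by (intro member_le_sum) (auto simp: chi_def)
      also have "\<dots> = Re (\<Sum>j<N. chi (J j) x)" by simp
      also have "\<dots> \<le> norm (\<Sum>j<N. chi (J j) x)" by (rule complex_Re_le_cmod)
      finally show ?thesis by (simp add: chi_def)
    qed
    thus "AE x in leb. norm (chi UNIV x) \<le> norm (\<Sum>j<N. chi (J j) x)" by (intro AE_I2) simp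
  qed simp
  have "nrm (chi UNIV) \<noteq> 0"
  proof
    assume "nrm (chi UNIV) = 0"
    hence "AE x in leb. False" using nrm_eq_0_iff[OF o] by (auto simp: chi_def)
    hence "emeasure leb (space leb) = 0" unfolding ae_filter_eq_bot_iff[symmetric] trivial_limit_def .
    thus False by (simp add: emeasure_restrict_space)
  qed
  thus "nrm (chi UNIV) > 0" using nrm_nonneg[OF o] by simp
qed

lemma chi_mem: "A \<in> sets lebesgue \<Longrightarrow> chi A \<in> X"
proof (rule chi_mono(1)[OF _ one_mem(1)])
  assume A: "A \<in> sets lebesgue"
  show "emeasure leb (A \<inter> {-1<..<1}) \<le> emeasure leb (UNIV \<inter> {-1<..<1})"
    by (rule emeasure_mono) (auto simp: sets_leb_iff)
qed

end

section \<open>Dilations\<close>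

lemma sets_scaled_image:
  assumes "t \<noteq> 0" "A \<in> sets lebesgue"
  shows "(\<lambda>x::real. t * x) ` A \<in> sets lebesgue"
    and "emeasure lebesgue ((\<lambda>x::real. t * x) ` A) = ennreal \<bar>t\<bar> * emeasure lebesgue A"
proof -
  have "(\<lambda>x. t * x) ` A = ((*\<^sub>R) (1 / t)) -` A \<inter> space lebesgue"
    using assms(1) by (auto simp: image_iff intro!: bexI[of _ "_ / t"])
  also have "\<dots> \<in> sets lebesgue" by (rule measurable_sets[OF lebesgue_measurable_scaling assms(2)])
  finally show "(\<lambda>x. t * x) ` A \<in> sets lebesgue" .
  show "emeasure lebesgue ((\<lambda>x. t * x) ` A) = ennreal \<bar>t\<bar> * emeasure lebesgue A"
    using emeasure_lebesgue_affine[of t 0 A] by simp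
qed

text \<open>A value set without 0 sees only the part of the dilated function on [-t,t]. The closed
  cut-off in \<open>dilation\<close> also reads f at 1 and -1, where its values are arbitrary; that
  concerns only the points t and -t, a null set.\<close>

lemma dilation_preimage:
  assumes f: "f \<in> L0" and t: "t > 0" and V: "V \<in> sets borel" "0 \<notin> V"
  shows "{x \<in> {-1<..<1}. dilation (1 / t) f x \<in> V} \<in> sets leb"
    and "emeasure leb {x \<in> {-1<..<1}. dilation (1 / t) f x \<in> V} \<le> ennreal t * emeasure leb {x \<in> {-1<..<1}. f x \<in> V}"
proof -
  define A where "A = {x \<in> {-1<..<1}. f x \<in> V}"
  define S where "S = {x \<in> {-1<..<1}. dilation (1 / t) f x \<in> V}"
  have [measurable]: "f \<in> borel_measurable leb" using f by (simp add: L0_def)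
  have "{x \<in> space leb. f x \<in> V} \<in> sets leb" using V(1) by measurable
  hence A: "A \<in> sets lebesgue" "A \<subseteq> {-1<..<1}" by (auto simp: A_def sets_leb_iff)
  have S1: "S \<subseteq> (\<lambda>x. t * x) ` A \<union> (S \<inter> {t, -t})"
  proof
    fix x assume x: "x \<in> S"
    hence x1: "- 1 \<le> x / t" "x / t \<le> 1" "f (x / t) \<in> V" using V(2) by (auto simp: S_def dilation_def split: if_splits)
    show "x \<in> (\<lambda>x. t * x) ` A \<union> (S \<inter> {t, -t})"
    proof (cases "x = t \<or> x = - t")
      case False
      hence "x / t \<noteq> 1" "x / t \<noteq> -1" using t by (auto simp: field_simps)
      hence "x / t < 1" "- 1 < x / t" using x1(1,2) by linarith+
      hence "x / t \<in> A" using x1 by (simp add: A_def)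
      moreover have "x = t * (x / t)" using t by simp
      ultimately show ?thesis by blast
    qed (use x in auto)
  qed
  have S2: "(\<lambda>x. t * x) ` A \<inter> {-1<..<1} \<subseteq> S"
    using t by (auto simp: A_def S_def dilation_def)
  have "S \<subseteq> {-1<..<1}" by (auto simp: S_def)
  hence eq: "S = ((\<lambda>x. t * x) ` A \<inter> {-1<..<1}) \<union> (S \<inter> {t, -t})" using S1 S2 by blast
  have fin: "S \<inter> {t, -t} \<in> null_sets lebesgue"
    by (rule null_sets_completionI, rule finite_imp_null_set_lborel) auto
  have "(\<lambda>x. t * x) ` A \<inter> {-1<..<1} \<in> sets lebesgue"
    using sets_scaled_image(1)[of t A] A(1) t by (intro sets.Int) auto
  hence Sm: "S \<in> sets lebesgue" using null_setsD2[OF fin] by (subst eq) (rule sets.Un)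
  show "S \<in> sets leb" using Sm by (auto simp: sets_leb_iff S_def)
  have "emeasure leb S = emeasure lebesgue S" using Sm by (intro emeasure_leb) (auto simp: S_def)
  also have "\<dots> \<le> emeasure lebesgue ((\<lambda>x. t * x) ` A \<union> (S \<inter> {t, -t}))"
    using S1 sets_scaled_image(1)[of t A] A(1) t null_setsD2[OF fin] by (intro emeasure_mono sets.Un) auto
  also have "\<dots> = emeasure lebesgue ((\<lambda>x. t * x) ` A)"
    by (rule emeasure_Un_null_set[OF _ fin]) (use sets_scaled_image(1)[of t A] A(1) t in auto)
  also have "\<dots> = ennreal t * emeasure leb A"
    using sets_scaled_image(2)[of t A] A t by (simp add: emeasure_leb)
  finally show "emeasure leb S \<le> ennreal t * emeasure leb A" .
qed

text \<open>Of a set and its complement one omits 0, so \<open>dilation_preimage\<close> applies to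
  one of them.\<close>

lemma dilation_L0:
  assumes f: "f \<in> L0" and t: "t > 0"
  shows "dilation (1 / t) f \<in> L0"
  unfolding L0_def
proof (rule measurableI)
  fix V :: "complex set" assume V: "V \<in> sets borel"
  show "dilation (1 / t) f -` V \<inter> space leb \<in> sets leb"
  proof (cases "0 \<in> V")
    case False
    have "dilation (1 / t) f -` V \<inter> space leb = {x \<in> {-1<..<1}. dilation (1 / t) f x \<in> V}" by auto
    thus ?thesis using dilation_preimage(1)[OF f t V False] by simp
  next
    case True
    have "dilation (1 / t) f -` V \<inter> space leb = space leb - {x \<in> {-1<..<1}. dilation (1 / t) f x \<in> - V}" by auto
    moreover have "- V \<in> sets borel" using V by auto
    ultimately show ?thesis using dilation_preimage(1)[OF f t, of "- V"] True by (auto intro: sets.compl_sets)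
  qed
qed auto

text \<open>The cut points come from the intermediate value theorem for \<open>c \<mapsto> |A \<inter> (-1, c)|\<close>.\<close>

lemma split_set:
  assumes A: "A \<in> sets leb" and n: "n > (0::nat)"
  obtains P :: "nat \<Rightarrow> real set" where "\<And>j. P j \<in> sets leb" "\<And>j. P j \<subseteq> A"
    "A \<subseteq> (\<Union>j<n. P j)" "\<And>j. j < n \<Longrightarrow> emeasure leb (P j) = emeasure leb A / of_nat n"
proof -
  interpret finite_measure leb by (rule finite_measure_leb)
  have A1: "A \<subseteq> {-1<..<1}" using A by (simp add: sets_leb_iff)
  define m where "m c = measure leb (A \<inter> {..<c})" for c
  have sets: "A \<inter> {..<c} \<in> sets leb" "A \<inter> {c..<d} \<in> sets leb" for c d using A by (auto simp: sets_leb_iff)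
  have diff: "measure leb (A \<inter> {c..<d}) = m d - m c" if "c \<le> d" for c d
  proof -
    have "A \<inter> {c..<d} = A \<inter> {..<d} - A \<inter> {..<c}" by auto
    moreover have "A \<inter> {..<c} \<subseteq> A \<inter> {..<d}" using that by auto
    ultimately show ?thesis using sets finite_measure_Diff[of "A \<inter> {..<d}" "A \<inter> {..<c}"] by (simp add: m_def)
  qed
  have lip: "0 \<le> m d - m c \<and> m d - m c \<le> d - c" if "c \<le> d" for c d
  proof -
    have "emeasure leb (A \<inter> {c..<d}) = emeasure lebesgue (A \<inter> {c..<d})"
      using A by (intro emeasure_leb) (auto simp: sets_leb_iff)
    also have "\<dots> \<le> emeasure lebesgue {c..<d}" by (intro emeasure_mono) auto
    finally have "emeasure leb (A \<inter> {c..<d}) \<le> emeasure lebesgue {c..<d}" .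
    hence "ennreal (m d - m c) \<le> ennreal (d - c)" using that diff[OF that] by (simp add: emeasure_eq_measure)
    hence "m d - m c \<le> d - c" using that by simp
    thus ?thesis using diff[OF that] measure_nonneg[of leb "A \<inter> {c..<d}"] by simp
  qed
  have "1-lipschitz_on UNIV m"
  proof (rule lipschitz_onI)
    fix x y :: real
    show "dist (m x) (m y) \<le> 1 * dist x y"
      using lip[of x y] lip[of y x] by (cases "x \<le> y") (auto simp: dist_real_def)
  qed simp
  hence "continuous_on UNIV m" by (rule lipschitz_on_continuous_on)
  hence cont: "continuous_on {-1..1} m" by (rule continuous_on_subset) simp
  have e: "A \<inter> {..< -1} = {}" "A \<inter> {..<1} = A" using A1 by auto
  have m1: "m (-1) = 0" "m 1 = measure leb A" by (simp_all add: m_def e)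
  have "\<exists>c. (j = 0 \<longrightarrow> c = -1) \<and> (j = n \<longrightarrow> c = 1) \<and> m c = real j / real n * measure leb A" if "j \<le> n" for j
  proof -
    consider "j = 0" | "j = n" | "0 < j" "j < n" using \<open>j \<le> n\<close> by linarith
    thus ?thesis
    proof cases
      case 3
      have "real j / real n * measure leb A \<le> 1 * measure leb A"
        using \<open>j \<le> n\<close> n by (intro mult_right_mono) auto
      hence "m (-1) \<le> real j / real n * measure leb A" "real j / real n * measure leb A \<le> m 1"
        by (simp_all add: m1)
      then obtain c where "m c = real j / real n * measure leb A"
        using IVT'[of m "-1" _ 1, OF _ _ _ cont] by auto
      thus ?thesis using 3 by auto
    qed (use n m1 in auto)
  qed
  then obtain c where c: "j \<le> n \<Longrightarrow> (j = 0 \<longrightarrow> c j = -1) \<and> (j = n \<longrightarrow> c j = 1) \<and> m (c j) = real j / real n * measure leb A" for j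
    using choice[of "\<lambda>j c. j \<le> n \<longrightarrow> (j = 0 \<longrightarrow> c = -1) \<and> (j = n \<longrightarrow> c = 1) \<and> m c = real j / real n * measure leb A"] by auto
  have c0: "c 0 = -1" "c n = 1" using c[of 0] c[of n] by auto
  define P where "P j = A \<inter> {c j..<c (Suc j)}" for j
  show thesis
  proof
    show "P j \<in> sets leb" "P j \<subseteq> A" for j using sets by (auto simp: P_def)
    show "A \<subseteq> (\<Union>j<n. P j)"
    proof
      fix x assume x: "x \<in> A"
      have ex: "x < c n" using x A1 c0 by auto
      define k where "k = (LEAST k. x < c k)"
      have k: "x < c k" unfolding k_def by (rule LeastI[of "\<lambda>k. x < c k", OF ex])
      have "k \<le> n" unfolding k_def by (rule Least_le[of "\<lambda>k. x < c k", OF ex])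
      have "k \<noteq> 0" using k x A1 c0(1) by (intro notI) auto
      then obtain j where j: "k = Suc j" by (cases k) auto
      have "\<not> x < c j" using not_less_Least[of j "\<lambda>k. x < c k"] j by (simp add: k_def)
      hence "x \<in> P j" "j < n" using x k j \<open>k \<le> n\<close> by (auto simp: P_def)
      thus "x \<in> (\<Union>j<n. P j)" by blast
    qed
    show "emeasure leb (P j) = emeasure leb A / of_nat n" if j: "j < n" for j
    proof (cases "c j \<le> c (Suc j)")
      case True
      have "measure leb (P j) = m (c (Suc j)) - m (c j)" by (simp add: P_def diff[OF True])
      also have "\<dots> = measure leb A / real n" using c[of j] c[of "Suc j"] j n by (simp add: field_simps)
      finally show ?thesis using n by (simp add: emeasure_eq_measure divide_ennreal ennreal_of_nat_eq_real_of_nat)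
    next
      case False
      hence "0 \<le> m (c j) - m (c (Suc j))" using lip[of "c (Suc j)" "c j"] by simp
      also have "m (c j) - m (c (Suc j)) = - (measure leb A / real n)" using c[of j] c[of "Suc j"] j n by (simp add: field_simps)
      finally have "measure leb A = 0" using measure_nonneg[of leb A] n by (simp add: zero_le_divide_iff divide_le_0_iff order_antisym)
      moreover have "measure leb (P j) = 0" using False by (simp add: P_def)
      ultimately show ?thesis using n by (simp add: emeasure_eq_measure)
    qed
  qed
qed

lemma annulus_borel: "{z::complex. a \<le> norm z \<and> norm z < b} \<in> sets borel"
proof -
  have "{z::complex. a \<le> norm z \<and> norm z < b} = - ball 0 a \<inter> ball 0 b" by auto
  also have "\<dots> \<in> sets borel" by (intro sets.Int borel_comp borel_open open_ball)
  finally show ?thesis .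
qed

context ri_space
begin

text \<open>Cutting every dyadic level set of \<open>g\<close> into \<open>n\<close> pieces of equal measure decomposes \<open>g\<close> into \<open>n\<close>
  functions, each dominated in distribution by \<open>2 f\<close>.\<close>

lemma level_set_comparison:
  fixes \<Lambda> :: "int \<Rightarrow> complex set"
  defines "\<Lambda> \<equiv> \<lambda>k. {z. 2 powr real_of_int k \<le> norm z \<and> norm z < 2 powr real_of_int (k + 1)}"
  assumes g: "g \<in> L0" and f: "f \<in> X" and n: "n > (0::nat)"
    and le: "\<And>k. emeasure leb {x \<in> {-1<..<1}. g x \<in> \<Lambda> k} \<le> of_nat n * emeasure leb {x \<in> {-1<..<1}. f x \<in> \<Lambda> k}"
  shows "g \<in> X" "nrm g \<le> 2 * real n * nrm f"
proof -
  have fL: "f \<in> L0" by (rule mem_L0[OF f])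
  have \<Lambda>b: "\<Lambda> k \<in> sets borel" for k unfolding \<Lambda>_def by (rule annulus_borel)
  have lev: "{x \<in> {-1<..<1}. h x \<in> \<Lambda> k} \<in> sets leb" if "h \<in> L0" for h k
  proof -
    have [measurable]: "h \<in> borel_measurable leb" using that by (simp add: L0_def)
    have "{x \<in> space leb. h x \<in> \<Lambda> k} \<in> sets leb" using \<Lambda>b by measurable
    thus ?thesis by simp
  qed
  have disj: "k = l" if "z \<in> \<Lambda> k" "z \<in> \<Lambda> l" for z k l
  proof -
    have "2 powr real_of_int k < 2 powr real_of_int (l + 1)" "2 powr real_of_int l < 2 powr real_of_int (k + 1)"
      using that unfolding \<Lambda>_def mem_Collect_eq by (metis le_less_trans)+
    thus ?thesis by simp
  qed
  have ex: "\<exists>k. z \<in> \<Lambda> k" if "z \<noteq> 0" for z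
  proof
    have nz: "norm z > 0" using that by simp
    define u where "u = log 2 (norm z)"
    have zu: "norm z = 2 powr u" using nz by (simp add: u_def)
    show "z \<in> \<Lambda> \<lfloor>u\<rfloor>" using floor_correct[of u] zu by (simp add: \<Lambda>_def)
  qed
  define A where "A k = {x \<in> {-1<..<1}. f x \<in> \<Lambda> k}" for k
  define B where "B k = {x \<in> {-1<..<1}. g x \<in> \<Lambda> k}" for k
  have "\<exists>P :: nat \<Rightarrow> real set. (\<forall>j. P j \<in> sets leb) \<and> (\<forall>j. P j \<subseteq> B k) \<and> B k \<subseteq> (\<Union>j<n. P j)
     \<and> (\<forall>j<n. emeasure leb (P j) = emeasure leb (B k) / of_nat n)" (is "\<exists>P. ?Q k P") for k
  proof -
    obtain P where P: "\<And>j. P j \<in> sets leb" "\<And>j. P j \<subseteq> B k"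
      "B k \<subseteq> (\<Union>j<n. P j)" "\<And>j. j < n \<Longrightarrow> emeasure leb (P j) = emeasure leb (B k) / of_nat n"
      by (rule split_set[OF lev[OF g, of k] n, folded B_def]) blast
    show ?thesis by (intro exI[of _ P] conjI allI impI P)
  qed
  hence "\<forall>k. \<exists>P. ?Q k P" by blast
  then obtain P0 where P0: "\<forall>k. ?Q k (P0 k)" by (rule choice[THEN exE])
  then obtain P :: "int \<Rightarrow> nat \<Rightarrow> real set" where P:
    "\<And>k j. P k j \<in> sets leb" "\<And>k j. P k j \<subseteq> B k" "\<And>k. B k \<subseteq> (\<Union>j<n. P k j)"
    "\<And>k j. j < n \<Longrightarrow> emeasure leb (P k j) = emeasure leb (B k) / of_nat n"
    using P0 by (intro that[of P0]) blast+
  have PA: "emeasure leb (P k j) \<le> emeasure leb (A k)" if "j < n" for k j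
    unfolding P(4)[OF that] using le[of k] n unfolding A_def B_def
    by (intro divide_le_posI_ennreal) auto
  define H where "H j = (\<Union>k. P k j)" for j
  define G where "G j x = g x * chi (H j) x" for j x
  have H: "H j \<in> sets leb" for j unfolding H_def using P(1) by (intro sets.countable_UN') auto
  have GL: "G j \<in> L0" for j
  proof -
    have "chi (H j) \<in> L0" using H by (intro chi_L0) (simp add: sets_leb_iff)
    thus ?thesis using g unfolding L0_def G_def[abs_def] by (intro borel_measurable_times)
  qed
  have f2: "(\<lambda>x. 2 * f x) \<in> X" by (rule scale_mem[OF f])
  \<comment> \<open>A piece at level k has |g| < 2^(k+1) and is no larger than A k, where 2 |f| >=
    2^(k+1). The factor 2 absorbs the rounding to dyadic levels.\<close>
  have Gd: "distribution (G j) s \<le> distribution (\<lambda>x. 2 * f x) s" if j: "j < n" and s: "s \<ge> 0" for j s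
  proof -
    define I where "I = {k. s < 2 powr real_of_int (k + 1)}"
    have dA: "disjoint_family_on A I"
    proof (unfold disjoint_family_on_def, intro ballI impI)
      fix k l :: int assume "k \<noteq> l"
      thus "A k \<inter> A l = {}" using disj by (auto simp: A_def)
    qed
    have dP: "disjoint_family_on (\<lambda>k. P k j) I"
    proof (unfold disjoint_family_on_def, intro ballI impI)
      fix k l :: int assume "k \<noteq> l"
      hence "B k \<inter> B l = {}" using disj by (auto simp: B_def)
      thus "P k j \<inter> P l j = {}" using P(2)[of k j] P(2)[of l j] by blast
    qed
    have "{x \<in> {-1<..<1}. s < norm (G j x)} \<subseteq> (\<Union>k\<in>I. P k j)"
    proof clarify
      fix x assume x: "x \<in> {-1<..<1}" "s < norm (G j x)"
      hence "x \<in> H j" using s by (cases "x \<in> H j") (simp_all add: G_def chi_def)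
      then obtain k where k: "x \<in> P k j" by (auto simp: H_def)
      hence "g x \<in> \<Lambda> k" using P(2) by (auto simp: B_def)
      moreover have "s < norm (g x)" using x \<open>x \<in> H j\<close> by (simp add: G_def chi_def)
      ultimately have "k \<in> I" by (auto simp: I_def \<Lambda>_def)
      thus "x \<in> (\<Union>k\<in>I. P k j)" using k by blast
    qed
    hence "distribution (G j) s \<le> emeasure leb (\<Union>k\<in>I. P k j)"
      unfolding distribution_def by (rule emeasure_mono) (auto intro!: sets.countable_UN' P(1))
    also have "\<dots> = (\<integral>\<^sup>+k. emeasure leb (P k j) \<partial>count_space I)"
      by (rule emeasure_UN_countable[OF P(1) _ dP]) simp
    also have "\<dots> \<le> (\<integral>\<^sup>+k. emeasure leb (A k) \<partial>count_space I)"
      by (intro nn_integral_mono PA j)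
    also have "\<dots> = emeasure leb (\<Union>k\<in>I. A k)"
      by (rule emeasure_UN_countable[OF _ _ dA, symmetric]) (use lev[OF fL] in \<open>simp_all add: A_def\<close>)
    also have "\<dots> \<le> distribution (\<lambda>x. 2 * f x) s"
      unfolding distribution_def
    proof (rule emeasure_mono)
      show "(\<Union>k\<in>I. A k) \<subseteq> {x \<in> {-1<..<1}. s < norm (2 * f x)}"
      proof clarify
        fix k x assume k: "k \<in> I" "x \<in> A k"
        hence "2 powr real_of_int k \<le> norm (f x)" "x \<in> {-1<..<1}" by (auto simp: A_def \<Lambda>_def)
        moreover have "s < 2 * 2 powr real_of_int k" using k by (simp add: I_def powr_add)
        ultimately show "x \<in> {-1<..<1} \<and> s < norm (2 * f x)" by (simp add: norm_mult)
      qed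
    qed (rule superlevel_sets[OF mem_L0[OF f2]])
    finally show ?thesis .
  qed
  have GX: "G j \<in> X" "nrm (G j) \<le> 2 * nrm f" if "j < n" for j
    using distribution_mem[OF GL f2 Gd[OF that]] nrm_scale[OF f, of 2] by auto
  have S: "(\<lambda>x. \<Sum>j<n. of_real (norm (G j x))) \<in> X \<and> nrm (\<lambda>x. \<Sum>j<n. of_real (norm (G j x))) \<le> (\<Sum>j<n. nrm (\<lambda>x. of_real (norm (G j x))))"
  proof (rule sum_mem)
    fix j assume "j \<in> {..<n}"
    thus "(\<lambda>x. complex_of_real (norm (G j x))) \<in> X"
      using GL[of j] by (intro dominated_mem(1)[OF _ GX(1)[of j]]) (auto simp: L0_def)
  qed simp
  have Gn: "nrm (\<lambda>x. of_real (norm (G j x))) \<le> 2 * nrm f" if "j < n" for j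
  proof -
    have "nrm (\<lambda>x. of_real (norm (G j x))) \<le> nrm (G j)"
      using GL[of j] by (intro dominated_mem(2)[OF _ GX(1)[OF that]]) (auto simp: L0_def)
    thus ?thesis using GX(2)[OF that] by simp
  qed
  have dom: "norm (g x) \<le> norm (\<Sum>j<n. complex_of_real (norm (G j x)))" if x: "x \<in> {-1<..<1}" for x
  proof (cases "g x = 0")
    case False
    then obtain k where "x \<in> B k" using ex x by (auto simp: B_def)
    then obtain j where j: "j < n" "x \<in> P k j" using P(3)[of k] by auto
    have "norm (g x) = norm (G j x)" using j by (auto simp: G_def chi_def H_def)
    also have "\<dots> \<le> (\<Sum>j<n. norm (G j x))" using j by (intro member_le_sum) auto
    also have "\<dots> = norm (complex_of_real (\<Sum>j<n. norm (G j x)))" by (simp only: norm_of_real) (simp add: sum_nonneg)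
    also have "\<dots> = norm (\<Sum>j<n. complex_of_real (norm (G j x)))" by simp
    finally show ?thesis .
  qed simp
  have ae: "AE x in leb. norm (g x) \<le> norm (\<Sum>j<n. complex_of_real (norm (G j x)))"
    using dom by (intro AE_I2) simp
  show "g \<in> X" by (rule dominated_mem(1)[OF g conjunct1[OF S] ae])
  have "nrm g \<le> nrm (\<lambda>x. \<Sum>j<n. of_real (norm (G j x)))" by (rule dominated_mem(2)[OF g conjunct1[OF S] ae])
  also have "\<dots> \<le> (\<Sum>j<n. nrm (\<lambda>x. of_real (norm (G j x))))" using S by simp
  also have "\<dots> \<le> (\<Sum>j<n. 2 * nrm f)" using Gn by (intro sum_mono) auto
  finally show "nrm g \<le> 2 * real n * nrm f" by (simp add: mult.commute mult.left_commute)
qed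

text \<open>Dilation multiplies the measure of every level set that avoids 0 by at most t, and t <=
  n for an integer n; this is the hypothesis of \<open>level_set_comparison\<close>. The bound 2 n
  is crude, but finiteness is what gives \<open>op_norm\<close> a meaning.\<close>

lemma dilation_bounded:
  assumes t: "t > 0"
  obtains B where "\<And>f. f \<in> X \<Longrightarrow> dilation (1 / t) f \<in> X" "\<And>f. f \<in> X \<Longrightarrow> nrm (dilation (1 / t) f) \<le> B * nrm f"
proof -
  define n where "n = Suc (nat \<lceil>t\<rceil>)"
  have tn: "t \<le> real n" "n > 0" using t by (simp_all add: n_def) linarith
  note n0 = tn(2)
  have "dilation (1 / t) f \<in> X \<and> nrm (dilation (1 / t) f) \<le> 2 * real n * nrm f" if f: "f \<in> X" for f
  proof -
    have "emeasure leb {x \<in> {-1<..<1}. dilation (1 / t) f x \<in> {z. 2 powr real_of_int k \<le> norm z \<and> norm z < 2 powr real_of_int (k + 1)}}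
      \<le> of_nat n * emeasure leb {x \<in> {-1<..<1}. f x \<in> {z. 2 powr real_of_int k \<le> norm z \<and> norm z < 2 powr real_of_int (k + 1)}}" for k
    proof -
      have "{z::complex. 2 powr real_of_int k \<le> norm z \<and> norm z < 2 powr real_of_int (k + 1)} \<in> sets borel" by (rule annulus_borel)
      from dilation_preimage(2)[OF mem_L0[OF f] t this]
      have "emeasure leb {x \<in> {-1<..<1}. dilation (1 / t) f x \<in> {z. 2 powr real_of_int k \<le> norm z \<and> norm z < 2 powr real_of_int (k + 1)}}
        \<le> ennreal t * emeasure leb {x \<in> {-1<..<1}. f x \<in> {z. 2 powr real_of_int k \<le> norm z \<and> norm z < 2 powr real_of_int (k + 1)}}"
        by simp
      also have "\<dots> \<le> of_nat n * emeasure leb {x \<in> {-1<..<1}. f x \<in> {z. 2 powr real_of_int k \<le> norm z \<and> norm z < 2 powr real_of_int (k + 1)}}"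
        using tn by (intro mult_right_mono) (auto simp: ennreal_of_nat_eq_real_of_nat intro!: ennreal_leI)
      finally show ?thesis .
    qed
    from level_set_comparison[OF dilation_L0[OF mem_L0[OF f] t] f n0 this] show ?thesis by (rule conjI)
  qed
  thus thesis by (intro that[of "2 * real n"]) auto
qed

end

section \<open>Boyd indices and the weak-type estimate\<close>

lemma dilation_scale: "dilation t (\<lambda>x. c * f x) = (\<lambda>x. c * dilation t f x)"
  by (auto simp: dilation_def)

context ri_space
begin

text \<open>\<open>op_norm\<close> is a supremum of reals, so it acts as an operator norm only
  because \<open>dilation_bounded\<close> makes the set bounded above. Members of norm 0 are treated
  apart, as they cannot be normalised.\<close>

lemma op_norm_bound:
  assumes t: "t > 0"
  shows "f \<in> X \<Longrightarrow> nrm (dilation (1 / t) f) \<le> op_norm X nrm (dilation (1 / t)) * nrm f"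
    and "op_norm X nrm (dilation (1 / t)) \<ge> 0"
proof -
  obtain B where B: "\<And>f. f \<in> X \<Longrightarrow> dilation (1 / t) f \<in> X" "\<And>f. f \<in> X \<Longrightarrow> nrm (dilation (1 / t) f) \<le> B * nrm f"
    by (rule dilation_bounded[OF t]) blast
  have "bdd_above ((\<lambda>f. nrm (dilation (1 / t) f)) ` {f \<in> X. nrm f \<le> 1})"
  proof (rule bdd_aboveI2)
    fix f assume "f \<in> {f \<in> X. nrm f \<le> 1}"
    hence f: "f \<in> X" "nrm f \<le> 1" by auto
    have "nrm (dilation (1 / t) f) \<le> B * nrm f" by (rule B(2)[OF f(1)])
    also have "\<dots> \<le> \<bar>B\<bar> * nrm f" using nrm_nonneg[OF f(1)] by (intro mult_right_mono) auto
    also have "\<dots> \<le> \<bar>B\<bar> * 1" using f(2) by (intro mult_left_mono) auto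
    finally show "nrm (dilation (1 / t) f) \<le> \<bar>B\<bar>" by simp
  qed
  hence le: "nrm (dilation (1 / t) f) \<le> op_norm X nrm (dilation (1 / t))" if "f \<in> X" "nrm f \<le> 1" for f
    unfolding op_norm_def using that by (intro cSUP_upper) auto
  have "dilation (1 / t) (\<lambda>x. 0) = (\<lambda>x. 0)" by (auto simp: dilation_def)
  thus "op_norm X nrm (dilation (1 / t)) \<ge> 0" using le[OF zero_mem(1)] zero_mem(2) by simp
  show "nrm (dilation (1 / t) f) \<le> op_norm X nrm (dilation (1 / t)) * nrm f" if f: "f \<in> X"
  proof (cases "nrm f = 0")
    case True
    thus ?thesis using B(2)[OF f] by simp
  next
    case False
    hence p: "nrm f > 0" using nrm_nonneg[OF f] by simp
    define c where "c = complex_of_real (1 / nrm f)"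
    have c: "norm c = 1 / nrm f" unfolding c_def norm_of_real using p by simp
    have "nrm (dilation (1 / t) (\<lambda>x. c * f x)) \<le> op_norm X nrm (dilation (1 / t))"
      using nrm_scale[OF f, of c] p c by (intro le scale_mem[OF f]) simp
    moreover have "nrm (dilation (1 / t) (\<lambda>x. c * f x)) = nrm (dilation (1 / t) f) / nrm f"
      unfolding dilation_scale using nrm_scale[OF B(1)[OF f], of c] p c by simp
    ultimately have "nrm (dilation (1 / t) f) / nrm f \<le> op_norm X nrm (dilation (1 / t))" by simp
    thus ?thesis using p by (simp add: pos_divide_le_eq)
  qed
qed

text \<open>The fundamental function of X at measure 2 a, for 0 <= a <= 1.\<close>

definition phi :: "real \<Rightarrow> real" where
  "phi a = nrm (chi {-a<..<a})"

lemma phi_nonneg: "phi a \<ge> 0"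
  unfolding phi_def by (intro nrm_nonneg chi_mem) auto

lemma phi_mono: "a \<le> b \<Longrightarrow> phi a \<le> phi b"
  unfolding phi_def by (rule dominated_mem(2)) (auto intro!: chi_L0 chi_mem AE_I2 simp: chi_def)

text \<open>For a <= 1 the dilated indicator lives inside [-t,t], so the cut-off in
  \<open>dilation\<close> removes nothing.\<close>

lemma phi_dilation:
  assumes "t > 0" "a \<le> 1"
  shows "phi (t * a) \<le> op_norm X nrm (dilation (1 / t)) * phi a"
proof -
  have "dilation (1 / t) (chi {-a<..<a}) = chi {-(t * a)<..<t * a}"
  proof
    fix x
    have *: "- a < x / t \<longleftrightarrow> - (t * a) < x" "x / t < a \<longleftrightarrow> x < t * a" "- 1 \<le> x / t \<longleftrightarrow> - t \<le> x" "x / t \<le> 1 \<longleftrightarrow> x \<le> t"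
      using assms(1) by (auto simp: field_simps)
    have "t * a \<le> t" using assms by (simp add: mult_left_le)
    thus "dilation (1 / t) (chi {-a<..<a}) x = chi {-(t * a)<..<t * a} x"
      using * by (auto simp: dilation_def chi_def)
  qed
  thus ?thesis using op_norm_bound(1)[OF assms(1), of "chi {-a<..<a}"] chi_mem[of "{-a<..<a}"] by (simp add: phi_def)
qed

lemma phi_le_chi:
  assumes "A \<in> sets leb" "0 \<le> a" "a \<le> 1" "ennreal (2 * a) \<le> emeasure leb A"
  shows "phi a \<le> nrm (chi A)"
  unfolding phi_def
proof (rule chi_mono(2))
  have "emeasure leb ({-a<..<a} \<inter> {-1<..<1}) \<le> emeasure lebesgue {-a<..<a}"
    by (subst emeasure_leb) (auto intro!: emeasure_mono)
  also have "\<dots> = ennreal (2 * a)" using assms by simp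
  also have "\<dots> \<le> emeasure leb (A \<inter> {-1<..<1})" using assms by (simp add: sets_leb_iff Int_absorb2)
  finally show "emeasure leb ({-a<..<a} \<inter> {-1<..<1}) \<le> emeasure leb (A \<inter> {-1<..<1})" .
qed (use assms in \<open>auto simp: sets_leb_iff intro: chi_mem\<close>)

lemma phi_1_pos: "phi 1 > 0"
proof -
  have "nrm (chi UNIV) \<le> phi 1" unfolding phi_def by (rule chi_mono(2)) (auto intro: chi_mem)
  thus ?thesis using one_mem(2) by simp
qed

text \<open>An infimum below 1 yields a single t > 1 whose dilation norm is t^beta with beta < 1.
  Iterating this one dilation along the scales t^(-k) gives a power lower bound for
  \<open>phi\<close>; monotonicity fills the gaps between the scales.\<close>

lemma upper_boyd_phi:
  assumes "upper_boyd X nrm < 1"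
  obtains C b where "C > 0" "1/2 \<le> b" "b < 1" "\<And>a. 0 < a \<Longrightarrow> a \<le> 1 \<Longrightarrow> C * a powr b \<le> phi a"
proof -
  have "(\<lambda>t. ln (op_norm X nrm (dilation (1 / t))) / ln t) ` {1<..} \<noteq> {}" by simp
  from cInf_lessD[OF this assms[unfolded upper_boyd_def]]
  obtain t where t: "t > 1" and lt: "ln (op_norm X nrm (dilation (1 / t))) / ln t < 1" by blast
  define op where "op = op_norm X nrm (dilation (1 / t))"
  define \<beta> where "\<beta> = ln op / ln t"
  have t0: "t > 0" using t by simp
  have "phi 1 \<le> phi t" using t by (intro phi_mono) simp
  also have "\<dots> \<le> op * phi 1" using phi_dilation[OF t0, of 1] by (simp add: op_def)
  finally have op1: "op \<ge> 1" using phi_1_pos by simp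
  have \<beta>: "0 \<le> \<beta>" "\<beta> < 1" using op1 t lt by (auto simp: \<beta>_def op_def)
  have opt: "op = t powr \<beta>" using op1 t by (simp add: \<beta>_def powr_def)
  have iter: "phi 1 \<le> op ^ k * phi (1 / t ^ k)" for k
  proof (induction k)
    case (Suc k)
    have "phi (1 / t ^ k) = phi (t * (1 / t ^ Suc k))" using t by simp
    also have "\<dots> \<le> op * phi (1 / t ^ Suc k)" using phi_dilation[OF t0, of "1 / t ^ Suc k"] t
      unfolding op_def by (simp add: one_le_power divide_le_eq_1 one_le_power[of t "Suc k", simplified])
    finally have "op ^ k * phi (1 / t ^ k) \<le> op ^ k * (op * phi (1 / t ^ Suc k))" using op1 by (intro mult_left_mono) auto
    thus ?case using Suc by (simp add: algebra_simps)
  qed simp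
  define C where "C = phi 1 * t powr - \<beta>"
  show thesis
  proof
    show "C > 0" using phi_1_pos t by (simp add: C_def)
    \<comment> \<open>A larger exponent only weakens the bound for a <= 1. At least 1/2, it keeps
      the later weak-type exponent 1/b at most 2.\<close>
    show "1/2 \<le> max \<beta> (1/2)" "max \<beta> (1/2) < 1" using \<beta> by auto
    fix a :: real assume a: "0 < a" "a \<le> 1"
    \<comment> \<open>The first k with t^(-k) <= a. Overshooting by less than one step costs a
      factor t^beta, which is built into C.\<close>
    define k where "k = nat \<lceil>- log t a\<rceil>"
    have la: "- log t a \<ge> 0" using a t by (simp add: log_le_zero_cancel_iff)
    have k: "- log t a \<le> real k" "real k \<le> 1 - log t a" using la unfolding k_def by linarith+
    have "1 / t ^ k = t powr - real k" using t by (simp add: powr_minus powr_realpow inverse_eq_divide)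
    also have "\<dots> \<le> t powr log t a" using k t by (intro powr_mono) auto
    also have "\<dots> = a" using a t by simp
    finally have ka: "1 / t ^ k \<le> a" .
    have "op ^ k = t powr (\<beta> * real k)" unfolding opt using t by (simp add: powr_powr powr_realpow[symmetric])
    also have "\<dots> \<le> t powr (\<beta> + - \<beta> * log t a)"
      using t mult_left_mono[OF k(2) \<beta>(1)] by (intro powr_mono) (auto simp: algebra_simps)
    also have "\<dots> = t powr \<beta> * a powr - \<beta>"
    proof -
      have "t powr (- \<beta> * log t a) = (t powr log t a) powr - \<beta>" by (simp add: powr_powr mult.commute)
      thus ?thesis using a t by (simp only: powr_add) simp
    qed
    finally have opk: "op ^ k \<le> t powr \<beta> * a powr - \<beta>" .
    have "phi 1 \<le> op ^ k * phi (1 / t ^ k)" by (rule iter)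
    also have "\<dots> \<le> (t powr \<beta> * a powr - \<beta>) * phi a"
      by (intro mult_mono opk phi_mono ka phi_nonneg) simp
    finally have "phi 1 \<le> (t powr \<beta> * a powr - \<beta>) * phi a" .
    hence "C * a powr \<beta> \<le> phi a" using t a by (simp add: C_def powr_minus field_simps)
    moreover have "C * a powr max \<beta> (1/2) \<le> C * a powr \<beta>"
      using a \<open>C > 0\<close> by (intro mult_left_mono powr_mono') auto
    ultimately show "C * a powr max \<beta> (1/2) \<le> phi a" by linarith
  qed
qed

text \<open>Chebyshev's argument in X: s times the indicator of {|f| > s} is dominated by f, and the
  norm of that indicator is at least a constant times the b-th power of half its measure. Solving
  for the measure gives the exponent p = 1/b > 1.\<close>

lemma weak_type:
  assumes "upper_boyd X nrm < 1"
  obtains p where "1 < p" "p \<le> 2"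
    "\<And>f. f \<in> X \<Longrightarrow> \<exists>K\<ge>0. \<forall>s>0. distribution f s \<le> ennreal (K * s powr - p)"
proof -
  interpret finite_measure leb by (rule finite_measure_leb)
  obtain C b where C: "C > 0" and b: "1/2 \<le> b" "b < 1" and phi: "\<And>a. 0 < a \<Longrightarrow> a \<le> 1 \<Longrightarrow> C * a powr b \<le> phi a"
    by (rule upper_boyd_phi[OF assms]) blast
  show thesis
  proof
    show "1 < 1 / b" "1 / b \<le> 2" using b by (auto simp: field_simps)
    fix f assume f: "f \<in> X"
    have "distribution f s \<le> ennreal (2 * (nrm f / C) powr (1 / b) * s powr - (1 / b))" if s: "s > 0" for s
    proof -
      define A where "A = {x \<in> {-1<..<1}. s < norm (f x)}"
      have A: "A \<in> sets leb" unfolding A_def by (rule superlevel_sets[OF mem_L0[OF f]])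
      have AL: "chi A \<in> L0" using A by (intro chi_L0) (simp add: sets_leb_iff)
      define a where "a = measure leb A / 2"
      have D: "distribution f s = ennreal (2 * a)" unfolding distribution_def A_def[symmetric] by (simp add: emeasure_eq_measure a_def)
      have "measure leb A \<le> measure leb {-1<..<1}" using A by (intro finite_measure_mono) (auto simp: sets_leb_iff)
      also have "\<dots> = 2" by (simp add: measure_restrict_space)
      finally have a1: "0 \<le> a" "a \<le> 1" by (auto simp: a_def)
      show ?thesis
      proof (cases "a = 0")
        case False
        hence a: "0 < a" using a1 by simp
        have "C * a powr b \<le> phi a" by (rule phi[OF a a1(2)])
        also have "\<dots> \<le> nrm (chi A)" by (rule phi_le_chi[OF A a1]) (simp add: D[symmetric] distribution_def A_def)
        also have "\<dots> \<le> (1 / s) * nrm f"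
          by (rule dominated_scaled_mem(2)[OF AL f]) (use s in \<open>auto intro!: AE_I2 simp: chi_def A_def field_simps\<close>)
        finally have "C * a powr b \<le> C * (nrm f / C * (1 / s))" using C by simp
        hence "a powr b \<le> nrm f / C * (1 / s)" using C by (simp only: mult_le_cancel_left_pos)
        hence "(a powr b) powr (1 / b) \<le> (nrm f / C * (1 / s)) powr (1 / b)"
          using b by (intro powr_mono2) auto
        also have "(a powr b) powr (1 / b) = a" using a b by (simp add: powr_powr)
        also have "(nrm f / C * (1 / s)) powr (1 / b) = (nrm f / C) powr (1 / b) * s powr - (1 / b)"
          using s C nrm_nonneg[OF f] by (simp add: powr_mult powr_divide powr_minus_divide)
        finally show ?thesis unfolding D by (intro ennreal_leI) simp
      qed (simp add: D)
    qed
    moreover have "0 \<le> 2 * (nrm f / C) powr (1 / b)" by simp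
    ultimately show "\<exists>K\<ge>0. \<forall>s>0. distribution f s \<le> ennreal (K * s powr - (1 / b))" by blast
  qed
qed

end

text \<open>On the dyadic shell above 2^n the q-th power is at most 2^(q (n+1)) and the measure at
  most K 2^(-p n), a geometric series of ratio 2^(q-p) < 1. Where |f| <= 1 the finite measure of the
  interval suffices.\<close>

lemma weak_type_integrable:
  assumes f: "f \<in> L0" and K: "K \<ge> 0" and weak: "\<And>s. s > 0 \<Longrightarrow> distribution f s \<le> ennreal (K * s powr - p)"
    and q: "0 < q" "q < p"
  shows "integrable leb (\<lambda>x. norm (f x) powr q)"
proof -
  have [measurable]: "f \<in> borel_measurable leb" using f by (simp add: L0_def)
  define A where "A n = {x \<in> {-1<..<1}. 2 ^ n < norm (f x)}" for n :: nat
  have A: "A n \<in> sets leb" for n unfolding A_def by (rule superlevel_sets[OF f])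
  define r where "r = 2 powr (q - p)"
  have r: "0 \<le> r" "r < 1" using q by (auto simp: r_def powr_less_one)
  have dom: "ennreal (norm (f x) powr q) \<le> 1 + (\<Sum>n. ennreal (2 powr (q * (real n + 1))) * indicator (A n) x)" if x: "x \<in> {-1<..<1}" for x
  proof (cases "norm (f x) \<le> 1")
    case True
    hence "norm (f x) powr q \<le> 1" using q by (intro powr_le1) auto
    hence "ennreal (norm (f x) powr q) \<le> 1" by simp
    thus ?thesis by (rule order_trans) simp
  next
    case False
    define y where "y = norm (f x)"
    define u where "u = log 2 y"
    have y: "y > 1" using False by (simp add: y_def)
    have yu: "y = 2 powr u" and u: "u > 0" using y by (simp_all add: u_def)
    define n where "n = nat (\<lceil>u\<rceil> - 1)"
    have n: "real n < u" "u \<le> real n + 1" using u unfolding n_def by linarith+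
    have "2 ^ n < y" unfolding yu using n(1) by (simp add: powr_realpow[symmetric])
    hence xA: "x \<in> A n" using x by (simp add: A_def y_def)
    have "y powr q \<le> 2 powr (q * (real n + 1))" unfolding yu powr_powr using n(2) q by (simp add: mult.commute)
    hence "ennreal (y powr q) \<le> ennreal (2 powr (q * (real n + 1))) * indicator (A n) x" using xA by (simp add: ennreal_leI)
    also have "\<dots> \<le> (\<Sum>n. ennreal (2 powr (q * (real n + 1))) * indicator (A n) x)"
    proof -
      have "(\<Sum>n\<in>{n}. ennreal (2 powr (q * (real n + 1))) * indicator (A n) x)
        \<le> (\<Sum>n. ennreal (2 powr (q * (real n + 1))) * indicator (A n) x)"
        by (rule sum_le_suminf) auto
      thus ?thesis by (simp only: sum.insert_if finite.emptyI sum.empty add_0_right empty_iff if_False)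
    qed
    finally show ?thesis unfolding y_def by (rule order_trans) simp
  qed
  have "(\<integral>\<^sup>+x. ennreal (norm (f x) powr q) \<partial>leb) \<le> (\<integral>\<^sup>+x. 1 + (\<Sum>n. ennreal (2 powr (q * (real n + 1))) * indicator (A n) x) \<partial>leb)"
    using dom by (intro nn_integral_mono) simp
  also have "\<dots> = emeasure leb (space leb) + (\<Sum>n. ennreal (2 powr (q * (real n + 1))) * emeasure leb (A n))"
    using A by (simp add: nn_integral_add nn_integral_suminf nn_integral_cmult)
  also have "(\<Sum>n. ennreal (2 powr (q * (real n + 1))) * emeasure leb (A n)) \<le> (\<Sum>n. ennreal (2 powr q * K * r ^ n))"
  proof (intro suminf_le summableI)
    fix n
    have "ennreal (2 powr (q * (real n + 1))) * emeasure leb (A n) \<le> ennreal (2 powr (q * (real n + 1))) * ennreal (K * (2 ^ n) powr - p)"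
      using weak[of "2 ^ n"] by (intro mult_left_mono) (auto simp: A_def distribution_def)
    also have "\<dots> = ennreal (2 powr (q * (real n + 1)) * (K * (2 ^ n) powr - p))" using K by (simp add: ennreal_mult)
    also have "2 powr (q * (real n + 1)) * (K * (2 ^ n) powr - p) = 2 powr q * K * r ^ n"
    proof -
      have "r ^ n = 2 powr ((q - p) * real n)" by (simp add: r_def powr_powr powr_realpow[symmetric])
      moreover have "(2 ^ n) powr - p = (2::real) powr (- p * real n)" by (simp add: powr_powr powr_realpow[symmetric] mult.commute)
      moreover have "2 powr (q * (real n + 1)) * 2 powr (- p * real n) = 2 powr q * 2 powr ((q - p) * real n)"
        by (simp add: powr_add[symmetric] algebra_simps)
      ultimately show ?thesis by (simp add: mult.commute mult.left_commute)
    qed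
    finally show "ennreal (2 powr (q * (real n + 1))) * emeasure leb (A n) \<le> ennreal (2 powr q * K * r ^ n)" .
  qed
  also have "(\<Sum>n. ennreal (2 powr q * K * r ^ n)) < top"
    using r K by (intro less_top[THEN iffD1] ennreal_suminf_neq_top summable_mult summable_geometric) auto
  finally have fin: "(\<integral>\<^sup>+x. ennreal (norm (f x) powr q) \<partial>leb) < top"
    by (simp add: emeasure_restrict_space add_left_mono)
  show ?thesis
    by (rule integrableI_bounded) (use fin in auto)
qed

section \<open>Power functions and the index\<close>

definition pw :: "real \<Rightarrow> real \<Rightarrow> complex" where
  "pw a x = complex_of_real (\<bar>x\<bar> powr - a)"

lemma norm_pw [simp]: "norm (pw a x) = \<bar>x\<bar> powr - a"
  by (simp add: pw_def)

lemma pw_L0: "pw a \<in> L0"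
proof -
  have "pw a \<in> borel_measurable borel" unfolding pw_def[abs_def] by measurable
  hence "pw a \<in> borel_measurable lebesgue" by (intro measurable_completion) simp
  thus ?thesis unfolding L0_def by (rule measurable_restrict_space1)
qed

lemma less_powr_iff:
  fixes y s a :: real
  assumes "a > 0" "s > 0" "y > 0"
  shows "s < y powr - a \<longleftrightarrow> y < s powr (- 1 / a)"
proof -
  have "s < y powr - a \<longleftrightarrow> ln s < - a * ln y" using assms by (subst ln_less_cancel_iff[symmetric]) (auto simp: ln_powr)
  also have "\<dots> \<longleftrightarrow> ln y < - 1 / a * ln s" proof -
    have "ln y < - 1 / a * ln s \<longleftrightarrow> ln y < - ln s / a" by simp
    also have "\<dots> \<longleftrightarrow> ln y * a < - ln s" by (rule pos_less_divide_eq[OF assms(1)])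
    also have "\<dots> \<longleftrightarrow> ln s < - a * ln y" by (simp only: mult.commute mult_minus_left) linarith
    finally show ?thesis by (rule sym)
  qed
  also have "\<dots> \<longleftrightarrow> y < s powr (- 1 / a)" using assms by (subst (2) ln_less_cancel_iff[symmetric]) (auto simp: ln_powr)
  finally show ?thesis .
qed

text \<open>At x = 0 \<open>powr\<close> returns 0, so that point is missing from every level set.
  The threshold s = 0 is separate because \<open>powr\<close> with base 0 would yield measure 0 in
  place of 2.\<close>

lemma distribution_pw:
  assumes a: "a > 0" and s: "s \<ge> 0" and c: "c > 0"
  shows "distribution (\<lambda>x. of_real c * pw a x) s = (if s = 0 then 2 else ennreal (2 * min 1 ((s / c) powr (- 1 / a))))"
proof -
  define m where "m = (if s = 0 then 1 else min 1 ((s / c) powr (- 1 / a)))"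
  have m0: "0 \<le> m" by (simp add: m_def)
  have "{x \<in> {-1<..<1}. s < norm (of_real c * pw a x)} = {-m<..<m} - {0}"
  proof (rule set_eqI)
    fix x :: real
    show "x \<in> {x \<in> {-1<..<1}. s < norm (of_real c * pw a x)} \<longleftrightarrow> x \<in> {-m<..<m} - {0}"
    proof (cases "x = 0")
      case False
      have "s < norm (of_real c * pw a x) \<longleftrightarrow> s / c < \<bar>x\<bar> powr - a" using c by (simp add: norm_mult field_simps)
      also have "\<dots> \<longleftrightarrow> (s \<noteq> 0 \<longrightarrow> \<bar>x\<bar> < (s / c) powr (- 1 / a))"
      proof (cases "s = 0")
        case True
        thus ?thesis using False by simp
      next
        case s0: False
        have "s / c > 0" "\<bar>x\<bar> > 0" using s0 False s c by simp_all
        from less_powr_iff[OF a this] show ?thesis using s0 by (simp only: simp_thms)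
      qed
      finally show ?thesis using False by (auto simp: m_def)
    qed (use s in \<open>simp add: pw_def\<close>)
  qed
  hence "distribution (\<lambda>x. of_real c * pw a x) s = emeasure leb ({-m<..<m} - {0})" by (simp add: distribution_def)
  also have "\<dots> = emeasure lebesgue ({-m<..<m} - {0})" by (intro emeasure_leb) (auto simp: m_def)
  also have "\<dots> = emeasure lebesgue {-m<..<m}"   proof (rule emeasure_Diff_null_set)
    show "{0::real} \<in> null_sets lebesgue" by (rule null_sets_completionI, rule finite_imp_null_set_lborel) simp
  qed simp
  also have "\<dots> = ennreal (2 * m)" using m0 by simp
  finally show "distribution (\<lambda>x. of_real c * pw a x) s = (if s = 0 then 2 else ennreal (2 * min 1 ((s / c) powr (- 1 / a))))"
    by (simp add: m_def)
qed

lemma distribution_endpoint_power: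
  assumes \<sigma>: "\<sigma> = 1 \<or> \<sigma> = -1" and a: "a > 0" and s: "s \<ge> 0"
  shows "distribution (\<lambda>x. of_real ((1 + \<sigma> * x) powr - a)) s = (if s = 0 then 2 else ennreal (min 2 (s powr (- 1 / a))))"
proof -
  define m where "m = (if s = 0 then 2 else min 2 (s powr (- 1 / a)))"
  have m0: "0 \<le> m" "m \<le> 2" by (auto simp: m_def)
  have *: "s < norm (complex_of_real ((1 + \<sigma> * x) powr - a)) \<longleftrightarrow> 1 + \<sigma> * x < m" if "x \<in> {-1<..<1}" for x
  proof -
    have p: "0 < 1 + \<sigma> * x" "1 + \<sigma> * x < 2" using that \<sigma> by auto
    have "s < norm (complex_of_real ((1 + \<sigma> * x) powr - a)) \<longleftrightarrow> s < (1 + \<sigma> * x) powr - a" by simp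
    also have "\<dots> \<longleftrightarrow> (s \<noteq> 0 \<longrightarrow> 1 + \<sigma> * x < s powr (- 1 / a))"
      proof (cases "s = 0")
        case True
        thus ?thesis using p by simp
      next
        case False
        hence "s > 0" using s by simp
        from less_powr_iff[OF a this p(1)] show ?thesis using False by (simp only: simp_thms)
      qed
    finally show ?thesis using p by (auto simp: m_def)
  qed
  have "emeasure leb {x \<in> {-1<..<1}. s < norm (complex_of_real ((1 + \<sigma> * x) powr - a))} = emeasure leb {x \<in> {-1<..<1}. 1 + \<sigma> * x < m}"
    by (rule arg_cong[where f = "emeasure leb"]) (use * in blast)
  also have "\<dots> = ennreal m"
  proof (cases "\<sigma> = 1")
    case True
    have "{x \<in> {-1<..<1}. 1 + \<sigma> * x < m} = {-1<..<m - 1}" using True m0 by auto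
    moreover have "emeasure leb {-1<..<m - 1} = emeasure lebesgue {-1<..<m - 1}" using m0 by (intro emeasure_leb) auto
    ultimately show ?thesis using m0 by simp
  next
    case False
    hence "{x \<in> {-1<..<1}. 1 + \<sigma> * x < m} = {1 - m<..<1}" using \<sigma> m0 by auto
    moreover have "emeasure leb {1 - m<..<1} = emeasure lebesgue {1 - m<..<1}" using m0 by (intro emeasure_leb) auto
    ultimately show ?thesis using m0 by simp
  qed
  finally have "distribution (\<lambda>x. of_real ((1 + \<sigma> * x) powr - a)) s = ennreal m" unfolding distribution_def .
  thus ?thesis by (simp add: m_def)
qed

lemma endpoint_power_L0: "(\<lambda>x. complex_of_real ((1 + \<sigma> * x) powr - a)) \<in> L0"
proof -
  have "(\<lambda>x. complex_of_real ((1 + \<sigma> * x) powr - a)) \<in> borel_measurable borel" by measurable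
  hence "(\<lambda>x. complex_of_real ((1 + \<sigma> * x) powr - a)) \<in> borel_measurable lebesgue" by (intro measurable_completion) simp
  thus ?thesis unfolding L0_def by (rule measurable_restrict_space1)
qed

lemma pw_in_weak_Lp:
  assumes "p > 0"
  shows "pw (1 / p) \<in> weak_Lp p"
proof -
  define a where "a = 1 / p"
  have a: "a > 0" using assms by (simp add: a_def)
  have "decr_rearr (pw a) t \<le> ennreal (2 powr a * t powr - a)" if t: "t \<in> {0<..2}" for t
    unfolding decr_rearr_def
  proof (rule Inf_lower, rule CollectI)
    define s where "s = 2 powr a * t powr - a"
    have s: "s > 0" using t by (simp add: s_def)
    have "s = (t / 2) powr - a" using t by (simp add: s_def powr_divide powr_minus_divide)
    hence "s powr (- 1 / a) = t / 2" using t a by (simp add: powr_powr)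
    hence m: "2 * min 1 (s powr (- 1 / a)) \<le> t" by simp
    have "emeasure leb {x \<in> space leb. ennreal s < ennreal (norm (pw a x))} = distribution (pw a) s"
      unfolding distribution_def using s by (intro arg_cong2[where f = emeasure] refl) (auto simp: ennreal_less_iff)
    also have "\<dots> = ennreal (2 * min 1 (s powr (- 1 / a)))"
      using distribution_pw[of a s 1] a s by simp
    also have "\<dots> \<le> ennreal t" by (intro ennreal_leI m)
    finally show "emeasure leb {x \<in> space leb. ennreal (2 powr a * t powr - a) < ennreal (norm (pw a x))} \<le> ennreal t"
      by (simp add: s_def)
  qed
  moreover have "- 1 / p = - a" by (simp add: a_def)
  ultimately show ?thesis using pw_L0[of a] unfolding weak_Lp_def a_def[symmetric]
    by (intro CollectI conjI exI[of _ "2 powr a"] ballI) simp_all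
qed

lemma decr_rearr_pw_ge:
  assumes a: "a > 0" and c: "c > 0" and t: "0 < t" "t < 2"
  shows "ennreal (c * (t / 2) powr - a) \<le> decr_rearr (\<lambda>x. of_real c * pw a x) t"
  unfolding decr_rearr_def
proof (rule Inf_greatest, clarify, rule ccontr)
  fix s assume s: "emeasure leb {x \<in> space leb. s < ennreal (norm (of_real c * pw a x))} \<le> ennreal t"
    and "\<not> ennreal (c * (t / 2) powr - a) \<le> s"
  hence lt: "s < ennreal (c * (t / 2) powr - a)" by simp
  then obtain r where r: "s = ennreal r" "r \<ge> 0" by (cases s) auto
  have rc: "r < c * (t / 2) powr - a" using lt r c by (simp add: ennreal_less_iff)
  have "emeasure leb {x \<in> space leb. s < ennreal (norm (of_real c * pw a x))} = distribution (\<lambda>x. of_real c * pw a x) r"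
    unfolding distribution_def r(1) using r(2) by (intro arg_cong2[where f = emeasure] refl) (auto simp: ennreal_less_iff)
  hence D: "(if r = 0 then 2 else ennreal (2 * min 1 ((r / c) powr (- 1 / a)))) \<le> ennreal t"
    using s distribution_pw[OF a r(2) c] by simp
  show False
  proof (cases "r = 0")
    case True
    hence "ennreal 2 \<le> ennreal t" using D by simp
    thus False using t by simp
  next
    case False
    hence "r / c > 0" using r c by simp
    moreover have "r / c < (t / 2) powr - a" using rc c by (simp add: field_simps)
    ultimately have "t / 2 < (r / c) powr (- 1 / a)" using less_powr_iff[OF a, of "r / c" "t / 2"] t by simp
    moreover have "2 * min 1 ((r / c) powr (- 1 / a)) \<le> t" using D False t by simp
    ultimately show False using t by simp
  qed
qed

lemma decr_rearr_pw_0: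
  assumes a: "a > 0" and c: "c > 0"
  shows "decr_rearr (\<lambda>x. of_real c * pw a x) 0 = top"
proof -
  have all: "s = top" if s: "emeasure leb {x \<in> space leb. s < ennreal (norm (of_real c * pw a x))} \<le> ennreal 0" for s
  proof (cases s)
    case (real r)
    have "emeasure leb {x \<in> space leb. s < ennreal (norm (of_real c * pw a x))} = distribution (\<lambda>x. of_real c * pw a x) r"
      unfolding distribution_def real(2) using real(1) by (intro arg_cong2[where f = emeasure] refl) (auto simp: ennreal_less_iff)
    hence "distribution (\<lambda>x. of_real c * pw a x) r = 0" using s by simp
    moreover have "distribution (\<lambda>x. of_real c * pw a x) r \<noteq> 0"
    proof (cases "r = 0")
      case False
      hence "2 * min 1 ((r / c) powr (- 1 / a)) > 0" using c by simp
      thus ?thesis unfolding distribution_pw[OF a real(1) c] using False by (simp only: if_False ennreal_eq_0_iff not_le)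
    qed (use distribution_pw[OF a real(1) c] in simp)
    ultimately show ?thesis by simp
  qed
  have "top \<le> decr_rearr (\<lambda>x. of_real c * pw a x) 0"
    unfolding decr_rearr_def
  proof (rule Inf_greatest)
    fix s assume "s \<in> {s. emeasure leb {x \<in> space leb. s < ennreal (norm (of_real c * pw a x))} \<le> ennreal 0}"
    hence "s = top" by (intro all) (rule CollectD)
    thus "top \<le> s" by (simp only: order_refl)
  qed
  thus ?thesis by (simp only: top_unique)
qed

lemma decr_rearr_2: "decr_rearr f 2 = 0"
proof -
  have "emeasure leb {x \<in> space leb. 0 < ennreal (norm (f x))} \<le> emeasure leb (space leb)" by (rule emeasure_space)
  also have "\<dots> = ennreal 2" by (simp add: emeasure_restrict_space)
  finally have "decr_rearr f 2 \<le> 0" unfolding decr_rearr_def by (intro Inf_lower) simp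
  thus ?thesis by simp
qed

section \<open>Membership of power functions in X\<close>

context ri_space
begin

text \<open>A large multiple of the power function dominates in rearrangement. The ends of [0,2] are
  separate: at 0 the rearrangement of the power is infinite, and at 2 every rearrangement is
  0.\<close>

lemma weak_Lp_mem:
  assumes p: "p > 0" and X: "pw (1 / p) \<in> X" and f: "f \<in> weak_Lp p"
  shows "f \<in> X"
proof -
  define a where "a = 1 / p"
  have a: "a > 0" using p by (simp add: a_def)
  obtain M where M: "f \<in> L0" "\<And>t. t \<in> {0<..2} \<Longrightarrow> decr_rearr f t \<le> ennreal (M * t powr - a)"
  proof -
    from f obtain M where "f \<in> L0" "\<forall>t\<in>{0<..2}. decr_rearr f t \<le> ennreal (M * t powr (- 1 / p))"
      unfolding weak_Lp_def by blast
    moreover have "- 1 / p = - a" by (simp add: a_def)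
    ultimately show ?thesis by (intro that[of M]) (simp_all only:)
  qed
  define c where "c = max M 1"
  have c: "c > 0" "M \<le> c" by (auto simp: c_def)
  show "f \<in> X"
  proof (rule conjunct1[OF rearr[OF M(1) scale_mem[OF X, of "of_real c"]]])
    fix t :: real assume t: "t \<in> {0..2}"
    consider "t = 0" | "0 < t" "t < 2" | "t = 2" using t unfolding atLeastAtMost_iff by linarith
    hence "decr_rearr f t \<le> decr_rearr (\<lambda>x. of_real c * pw a x) t"
    proof cases
      case 1
      thus ?thesis using decr_rearr_pw_0[OF a c(1)] by simp
    next
      case 2
      have "decr_rearr f t \<le> ennreal (M * t powr - a)" using 2 by (intro M) auto
      also have "\<dots> \<le> ennreal (c * (t / 2) powr - a)"
      proof (rule ennreal_leI)
        have "M * t powr - a \<le> c * t powr - a" using c by (intro mult_right_mono) auto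
        also have "\<dots> \<le> c * (t / 2) powr - a" using c 2 a by (intro mult_left_mono powr_mono2') auto
        finally show "M * t powr - a \<le> c * (t / 2) powr - a" .
      qed
      also have "\<dots> \<le> decr_rearr (\<lambda>x. of_real c * pw a x) t" by (rule decr_rearr_pw_ge[OF a c(1) 2])
      finally show ?thesis .
    qed (simp add: decr_rearr_2)
    thus "decr_rearr f t \<le> decr_rearr (\<lambda>x. of_real c * pw (1 / p) x) t" by (simp add: a_def)
  qed
qed

lemma pw_mono:
  assumes "pw b \<in> X" "a \<le> b"
  shows "pw a \<in> X"
proof (rule dominated_mem(1)[OF pw_L0 assms(1)])
  have "\<bar>x\<bar> powr - a \<le> \<bar>x\<bar> powr - b" if "x \<in> {-1<..<1}" for x :: real
    using that assms(2) by (intro powr_mono') auto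
  thus "AE x in leb. norm (pw a x) \<le> norm (pw b x)" by (intro AE_I2) simp
qed

text \<open>Moving a two-sided singularity at 0 to one end halves the measure of the high level
  sets; up to a constant factor the distribution functions agree.\<close>

lemma endpoint_power_mem_iff:
  assumes \<sigma>: "\<sigma> = 1 \<or> \<sigma> = -1" and a: "a > 0"
  shows "(\<lambda>x. of_real ((1 + \<sigma> * x) powr - a)) \<in> X \<longleftrightarrow> pw a \<in> X"
proof
  assume pX: "pw a \<in> X"
  show "(\<lambda>x. of_real ((1 + \<sigma> * x) powr - a)) \<in> X"
  proof (rule distribution_mem(1)[OF endpoint_power_L0 pX])
    fix s :: real assume s: "s \<ge> 0"
    show "distribution (\<lambda>x. of_real ((1 + \<sigma> * x) powr - a)) s \<le> distribution (pw a) s"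
    proof (cases "s = 0")
      case False
      have "min 2 (s powr (- 1 / a)) \<le> 2 * min 1 (s powr (- 1 / a))" by (simp add: min_def)
      from ennreal_leI[OF this] show ?thesis
        using distribution_pw[OF a s, of 1] distribution_endpoint_power[OF \<sigma> a s] False by simp
    qed (use distribution_pw[OF a s, of 1] distribution_endpoint_power[OF \<sigma> a s] in simp)
  qed
next
  assume eX: "(\<lambda>x. of_real ((1 + \<sigma> * x) powr - a)) \<in> X"
  \<comment> \<open>Scaling by 2^(-a) replaces s^(-1/a) by half of it, which makes the two
    distribution functions equal.\<close>
  define b where "b = 2 powr - a"
  have b: "b > 0" by (simp add: b_def)
  have "(\<lambda>x. of_real b * pw a x) \<in> X"
  proof (rule distribution_mem(1)[OF _ eX])
    show "(\<lambda>x. of_real b * pw a x) \<in> L0" using pw_L0[of a] by (auto simp: L0_def)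
    fix s :: real assume s: "s \<ge> 0"
    have "2 * min 1 ((s / b) powr (- 1 / a)) \<le> min 2 (s powr (- 1 / a))" if "s > 0"
    proof -
      have "(s / b) powr (- 1 / a) = s powr (- 1 / a) / b powr (- 1 / a)" using that b by (simp add: powr_divide)
      also have "b powr (- 1 / a) = 2" using a by (simp add: b_def powr_powr)
      finally show ?thesis by simp
    qed
    hence "s \<noteq> 0 \<Longrightarrow> ennreal (2 * min 1 ((s / b) powr (- 1 / a))) \<le> ennreal (min 2 (s powr (- 1 / a)))"
      using s by (intro ennreal_leI) (simp only: order_less_le not_sym simp_thms)
    thus "distribution (\<lambda>x. of_real b * pw a x) s \<le> distribution (\<lambda>x. of_real ((1 + \<sigma> * x) powr - a)) s"
      unfolding distribution_pw[OF a s b] distribution_endpoint_power[OF \<sigma> a s]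
      by (cases "s = 0") (simp_all only: if_True if_False simp_thms order_refl)
  qed
  from scale_mem[OF this, of "of_real (1 / b)"] show "pw a \<in> X" using b by (simp add: pw_def[abs_def])
qed

text \<open>A positive supremum yields one t < 1 whose dilation norm is below 1, so the indicators
  of (-t^n, t^n) decay geometrically in norm. Weighting them by a slower geometric growth still
  gives bounded partial sums, which dominate truncations of a power of |x|.\<close>

lemma lower_boyd_pw:
  assumes "lower_boyd X nrm > 0"
  obtains a where "0 < a" "a < 1" "pw a \<in> X"
proof -
  have "(\<lambda>t. ln (op_norm X nrm (dilation (1 / t))) / ln t) ` {0<..<1} \<noteq> {}" by simp
  from less_cSupD[OF this assms[unfolded lower_boyd_def]]
  obtain t where t: "0 < t" "t < 1" and lt: "0 < ln (op_norm X nrm (dilation (1 / t))) / ln t" by auto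
  define op where "op = op_norm X nrm (dilation (1 / t))"
  have lnt: "ln t < 0" using t by simp
  have lop: "ln op < 0" using lt lnt by (simp add: op_def zero_less_divide_iff)
  have "op \<ge> 0" unfolding op_def by (rule op_norm_bound(2)[OF t(1)])
  hence op: "op > 0" using lop by (cases "op = 0") auto
  \<comment> \<open>Half the Boyd quotient at t makes t^(-a) times the dilation norm less than 1, so
    the weighted series converges; the minimum with 1/2 ensures a < 1.\<close>
  define a where "a = min (1/2) (ln op / ln t / 2)"
  have a: "0 < a" "a < 1" using lt by (auto simp: a_def op_def)
  define r where "r = t powr - a"
  have r0: "r > 0" using t by (simp add: r_def)
  have "ln (r * op) = - a * ln t + ln op" using t op r0 by (simp add: ln_mult r_def ln_powr)
  also have "\<dots> \<le> (- ln op / ln t / 2) * ln t + ln op"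
    using lnt by (intro add_right_mono mult_right_mono_neg) (auto simp: a_def)
  also have "\<dots> = ln op / 2" using lnt by simp
  also have "\<dots> < 0" using lop by simp
  finally have rop: "r * op < 1" using r0 op by (simp add: ln_less_zero_iff)
  have phi: "phi (t ^ n) \<le> op ^ n * phi 1" for n
  proof (induction n)
    case (Suc n)
    have "phi (t ^ Suc n) \<le> op * phi (t ^ n)"
      using phi_dilation[OF t(1), of "t ^ n"] t by (simp add: op_def power_le_one)
    also have "\<dots> \<le> op * (op ^ n * phi 1)" using Suc op by (intro mult_left_mono) auto
    finally show ?case by simp
  qed simp
  \<comment> \<open>The power cut off below t^(N+1). On the shell t^(n+1) <= |x| < t^n it is at most
    r^(n+1), one term of S; the cut-offs increase to the full power, so \<open>fatou\<close>
    applies.\<close>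
  define v where "v N x = \<bar>x\<bar> powr - a * of_bool (t ^ Suc N \<le> \<bar>x\<bar>)" for N x
  define S where "S N x = (\<Sum>n\<le>N. of_real (r ^ Suc n) * chi {-(t ^ n)<..<t ^ n} x)" for N x
  define C where "C = r * phi 1 / (1 - r * op)"
  have SX: "S N \<in> X \<and> nrm (S N) \<le> (\<Sum>n\<le>N. nrm (\<lambda>x. of_real (r ^ Suc n) * chi {-(t ^ n)<..<t ^ n} x))" for N
    unfolding S_def by (rule sum_mem) (simp, intro scale_mem chi_mem, simp)
  have "(\<Sum>n\<le>N. nrm (\<lambda>x. of_real (r ^ Suc n) * chi {-(t ^ n)<..<t ^ n} x)) \<le> C" for N
  proof -
    have "(\<Sum>n\<le>N. nrm (\<lambda>x. of_real (r ^ Suc n) * chi {-(t ^ n)<..<t ^ n} x)) = (\<Sum>n\<le>N. r ^ Suc n * phi (t ^ n))"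
      using r0 nrm_scale[OF chi_mem, of "{-(t ^ n)<..<t ^ n}" "of_real (r ^ Suc n)" for n]
      by (intro sum.cong refl) (simp add: phi_def norm_mult norm_power)
    also have "\<dots> \<le> (\<Sum>n\<le>N. r ^ Suc n * (op ^ n * phi 1))" using phi r0 by (intro sum_mono mult_left_mono) auto
    also have "\<dots> = r * phi 1 * (\<Sum>n\<le>N. (r * op) ^ n)" by (simp add: sum_distrib_left power_mult_distrib mult_ac)
    also have "(\<Sum>n\<le>N. (r * op) ^ n) \<le> (\<Sum>n. (r * op) ^ n)"
      using rop r0 op by (intro sum_le_suminf summable_geometric) auto
    also have "(\<Sum>n. (r * op) ^ n) = 1 / (1 - r * op)" using rop r0 op by (intro suminf_geometric) auto
    finally show ?thesis using r0 phi_nonneg[of 1] by (simp add: C_def mult_left_mono)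
  qed
  hence SC: "nrm (S N) \<le> C" for N using SX[of N] by (meson order_trans)
  have vL: "(\<lambda>x. complex_of_real (v N x)) \<in> L0" for N
  proof -
    have "(\<lambda>x. complex_of_real (v N x)) \<in> borel_measurable borel" unfolding v_def by measurable
    hence "(\<lambda>x. complex_of_real (v N x)) \<in> borel_measurable lebesgue" by (intro measurable_completion) simp
    thus ?thesis unfolding L0_def by (rule measurable_restrict_space1)
  qed
  have vS: "norm (complex_of_real (v N x)) \<le> norm (S N x)" if x: "x \<in> {-1<..<1}" for N x
  proof (cases "t ^ Suc N \<le> \<bar>x\<bar>")
    case True
    define n where "n = (LEAST n. t ^ Suc n \<le> \<bar>x\<bar>)"
    have n: "t ^ Suc n \<le> \<bar>x\<bar>" unfolding n_def by (rule LeastI[of "\<lambda>n. t ^ Suc n \<le> \<bar>x\<bar>", OF True])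
    have nN: "n \<le> N" unfolding n_def by (rule Least_le[of "\<lambda>n. t ^ Suc n \<le> \<bar>x\<bar>", OF True])
    have xn: "\<bar>x\<bar> < t ^ n"
    proof (cases n)
      case (Suc m)
      hence "\<not> t ^ Suc m \<le> \<bar>x\<bar>" unfolding n_def using not_less_Least[of m "\<lambda>n. t ^ Suc n \<le> \<bar>x\<bar>"] by linarith
      thus ?thesis using Suc by simp
    qed (use x in auto)
    have "v N x \<le> (t ^ Suc n) powr - a"
      using True n t a by (simp add: v_def powr_mono2')
    also have "\<dots> = r ^ Suc n * Re (chi {-(t ^ n)<..<t ^ n} x)"
      using xn t by (simp add: chi_def r_def powr_powr powr_realpow[symmetric] powr_mult mult.commute abs_less_iff)
    also have "\<dots> \<le> (\<Sum>n\<le>N. r ^ Suc n * Re (chi {-(t ^ n)<..<t ^ n} x))"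
      using nN r0 by (intro member_le_sum) (auto simp: chi_def)
    also have "\<dots> = Re (S N x)" by (simp add: S_def)
    also have "\<dots> \<le> norm (S N x)" by (rule complex_Re_le_cmod)
    finally show ?thesis unfolding norm_of_real by (subst abs_of_nonneg) (simp_all only: v_def zero_le_mult_iff powr_ge_zero of_bool_def split: if_split, simp_all)
  qed (simp add: v_def)
  have vX: "(\<lambda>x. complex_of_real (v N x)) \<in> X" "nrm (\<lambda>x. complex_of_real (v N x)) \<le> C" for N
    using dominated_mem[OF vL conjunct1[OF SX[of N]], of N] vS SC[of N] by (force intro: AE_I2)+
  have inc: "incseq (\<lambda>N. v N x)" for x
  proof (rule incseq_SucI)
    fix N
    have "t ^ Suc (Suc N) \<le> t ^ Suc N" using t by (intro power_decreasing) auto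
    thus "v N x \<le> v (Suc N) x" by (auto simp: v_def)
  qed
  have lim: "(\<lambda>N. v N x) \<longlonglongrightarrow> \<bar>x\<bar> powr - a" for x
  proof (cases "x = 0")
    case False
    have "(\<lambda>N. t ^ Suc N) \<longlonglongrightarrow> 0" using t by (intro LIMSEQ_Suc LIMSEQ_realpow_zero) auto
    from order_tendstoD(2)[OF this, of "\<bar>x\<bar>"] False have "eventually (\<lambda>N. v N x = \<bar>x\<bar> powr - a) sequentially"
      by (auto elim!: eventually_mono simp: v_def)
    thus ?thesis by (rule tendsto_eventually)
  qed (simp add: v_def)
  have "(\<lambda>x. complex_of_real (\<bar>x\<bar> powr - a)) \<in> X"
  proof (rule conjunct1[OF fatou[where v = v]])
    show "(\<lambda>x. complex_of_real (\<bar>x\<bar> powr - a)) \<in> L0" using pw_L0[of a] by (simp add: pw_def[abs_def])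
    show "AE x in leb. (\<forall>n. 0 \<le> v n x) \<and> incseq (\<lambda>n. v n x) \<and> (\<lambda>n. v n x) \<longlonglongrightarrow> \<bar>x\<bar> powr - a"
      using inc lim by (intro AE_I2) (simp add: v_def)
    show "bdd_above (range (\<lambda>n. nrm (\<lambda>x. complex_of_real (v n x))))" using vX(2) by (rule bdd_aboveI2)
  qed (rule vX)
  thus thesis using that[OF a] by (simp add: pw_def[abs_def])
qed

text \<open>The infimum runs over a nonempty set by \<open>lower_boyd_pw\<close>, and over values at
  least p0 > 1: for p < p0 the distribution of |x|^(-1/p) decays too slowly for the weak-type
  estimate. Domination of smaller powers by larger ones decides every exponent except 1 /
  \<open>p_index X\<close>, where attainment decides, since |x|^(-1/p) lies in its weak space and
  generates it.\<close>

lemma p_index_pw: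
  assumes "lower_boyd X nrm > 0" "upper_boyd X nrm < 1"
  shows "p_index X > 1"
    and "p_index_attained X \<longleftrightarrow> pw (1 / p_index X) \<in> X"
    and "0 < a \<Longrightarrow> a < 1 \<Longrightarrow> pw a \<in> X \<longleftrightarrow> a < 1 / p_index X \<or> (a = 1 / p_index X \<and> p_index_attained X)"
proof -
  define P where "P = {p. 1 < p \<and> pw (1 / p) \<in> X}"
  have idx: "p_index X = Inf P" by (simp add: p_index_def P_def pw_def[abs_def])
  obtain p0 where p0: "1 < p0" "p0 \<le> 2" and weak: "\<And>f. f \<in> X \<Longrightarrow> \<exists>K\<ge>0. \<forall>s>0. distribution f s \<le> ennreal (K * s powr - p0)"
    by (rule weak_type[OF assms(2)]) blast
  have lower: "p0 \<le> p" if p: "p \<in> P" for p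
  proof (rule ccontr)
    assume "\<not> p0 \<le> p"
    hence pp: "p < p0" by simp
    have p1: "p > 1" "pw (1 / p) \<in> X" using p by (auto simp: P_def)
    obtain K where K: "K \<ge> 0" "\<And>s. s > 0 \<Longrightarrow> distribution (pw (1 / p)) s \<le> ennreal (K * s powr - p0)"
      using weak[OF p1(2)] by blast
    have "s powr (p0 - p) \<le> K" if s: "s \<ge> 1" for s :: real
    proof -
      have "distribution (pw (1 / p)) s = ennreal (2 * min 1 (s powr - p))"
        using distribution_pw[of "1 / p" s 1] p1 s by simp
      moreover have "s powr - p \<le> 1" using s p1 by (simp add: powr_minus_divide ge_one_powr_ge_zero)
      ultimately have "ennreal (2 * s powr - p) \<le> ennreal (K * s powr - p0)" using K(2)[of s] s by simp
      hence "2 * s powr - p \<le> K * s powr - p0" using K(1) by (simp add: ennreal_le_iff)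
      hence "s powr - p \<le> K * s powr - p0" using powr_ge_zero[of s "- p"] by linarith
      hence "s powr - p * s powr p0 \<le> K * s powr - p0 * s powr p0" by (intro mult_right_mono) auto
      thus ?thesis using s by (simp add: powr_add[symmetric] powr_minus field_simps powr_diff)
    qed
    from this[of "(K + 1) powr (1 / (p0 - p))"] show False
      using K(1) pp by (simp add: powr_powr ge_one_powr_ge_zero)
  qed
  obtain a0 where a0: "0 < a0" "a0 < 1" "pw a0 \<in> X" by (rule lower_boyd_pw[OF assms(1)])
  have PI: "1 / a \<in> P" if "0 < a" "a < 1" "pw a \<in> X" for a using that by (simp add: P_def)
  have ne: "P \<noteq> {}" using PI[OF a0] by blast
  have bdd: "bdd_below P" using lower by (rule bdd_belowI)
  have "p0 \<le> Inf P" using lower by (intro cInf_greatest ne)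
  thus idx1: "p_index X > 1" using p0 by (simp add: idx)
  show att: "p_index_attained X \<longleftrightarrow> pw (1 / p_index X) \<in> X"
    using pw_in_weak_Lp[of "p_index X"] weak_Lp_mem[of "p_index X"] idx1 unfolding p_index_attained_def by auto
  assume a: "0 < a" "a < 1"
  show "pw a \<in> X \<longleftrightarrow> a < 1 / p_index X \<or> (a = 1 / p_index X \<and> p_index_attained X)"
  proof
    assume pX: "pw a \<in> X"
    have "p_index X \<le> 1 / a" unfolding idx by (rule cInf_lower[OF PI[OF a pX] bdd])
    hence "a \<le> 1 / p_index X" using a idx1 by (simp add: field_simps)
    thus "a < 1 / p_index X \<or> (a = 1 / p_index X \<and> p_index_attained X)" using pX att by (cases "a = 1 / p_index X") simp_all
  next
    assume "a < 1 / p_index X \<or> (a = 1 / p_index X \<and> p_index_attained X)"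
    thus "pw a \<in> X"
    proof
      assume "a < 1 / p_index X"
      hence "Inf P < 1 / a" using a idx1 by (simp add: idx[symmetric] field_simps)
      from cInf_lessD[OF ne this] obtain p where p: "p \<in> P" "p < 1 / a" by blast
      have "a \<le> 1 / p" using p a by (simp add: P_def field_simps)
      thus ?thesis using p pw_mono[of "1 / p" a] by (simp add: P_def)
    qed (use att in auto)
  qed
qed

end

section \<open>The point spectrum\<close>

lemma AE_leb_iff: "(AE x in leb. P x) \<longleftrightarrow> (AE x in lborel. \<bar>x\<bar> < 1 \<longrightarrow> P x)"
proof -
  have "(AE x in leb. P x) \<longleftrightarrow> (AE x in lebesgue. x \<in> {-1<..<1} \<longrightarrow> P x)"
    by (rule AE_restrict_space_iff) simp
  also have "\<dots> \<longleftrightarrow> (AE x in lborel. x \<in> {-1<..<1} \<longrightarrow> P x)" by (rule AE_completion_iff)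
  also have "(\<lambda>x::real. x \<in> {-1<..<1} \<longrightarrow> P x) = (\<lambda>x. \<bar>x\<bar> < 1 \<longrightarrow> P x)" by (intro ext) auto
  finally show ?thesis .
qed

lemma integrable_leb_iff:
  fixes f :: "real \<Rightarrow> 'b::{banach, second_countable_topology}"
  assumes "f \<in> borel_measurable borel" "\<And>x. 1 \<le> \<bar>x\<bar> \<Longrightarrow> f x = 0"
  shows "integrable leb f \<longleftrightarrow> integrable lborel f"
proof -
  have "integrable leb f \<longleftrightarrow> integrable lebesgue (\<lambda>x. indicator {-1<..<1} x *\<^sub>R f x)"
    by (rule integrable_restrict_space) simp
  also have "(\<lambda>x. indicator {-1<..<1} x *\<^sub>R f x) = f"
  proof
    fix x
    show "indicator {-1<..<1} x *\<^sub>R f x = f x"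
    proof (cases "\<bar>x\<bar> < 1")
      case True
      hence "x \<in> {-1<..<1}" by auto
      thus ?thesis by (simp only: indicator_simps scaleR_one)
    next
      case False
      hence "f x = 0" by (intro assms(2)) simp
      thus ?thesis by (simp only: scaleR_zero_right)
    qed
  qed
  also have "integrable lebesgue f \<longleftrightarrow> integrable lborel f"
    using assms(1) by (intro integrable_completion) simp
  finally show ?thesis .
qed

context ri_space
begin

text \<open>Both endpoint exponents lie in (-1,0), so either factor is at least 1/2 on (-1,1), and
  twice the product dominates the other factor. Conversely the product is dominated by a combination
  of the two factors. The stronger singularity decides.\<close>

lemma jacobi_mem_iff:
  assumes c: "-1 < Re c" "Re c < 0"
  shows "jacobi c (- 1 - c) \<in> X \<longleftrightarrow> pw (max (- Re c) (1 + Re c)) \<in> X"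
proof -
  define e1 where "e1 = (\<lambda>x. complex_of_real ((1 + (-1) * x) powr - (- Re c)))"
  define e2 where "e2 = (\<lambda>x. complex_of_real ((1 + 1 * x) powr - (1 + Re c)))"
  have e: "e1 \<in> X \<longleftrightarrow> pw (- Re c) \<in> X" "e2 \<in> X \<longleftrightarrow> pw (1 + Re c) \<in> X"
    unfolding e1_def e2_def using c by (intro endpoint_power_mem_iff; simp)+
  have eL: "e1 \<in> L0" "e2 \<in> L0" unfolding e1_def e2_def by (rule endpoint_power_L0)+
  have n: "norm (e1 x) = (1 - x) powr Re c" "norm (e2 x) = (1 + x) powr (- 1 - Re c)" for x
    by (simp_all add: e1_def e2_def)
  have jL: "jacobi c (- 1 - c) \<in> L0" unfolding L0_def by (rule jacobi_in_L0)
  have "jacobi c (- 1 - c) \<in> X \<longleftrightarrow> pw (- Re c) \<in> X \<and> pw (1 + Re c) \<in> X"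
  proof
    assume jX: "jacobi c (- 1 - c) \<in> X"
    have half: "1 / 2 \<le> u powr b" if "0 < u" "u < 2" "-1 < b" "b < 0" for u b :: real
    proof -
      have "(1::real) / 2 = 2 powr (-1)" by (simp add: powr_minus_divide)
      also have "\<dots> \<le> 2 powr b" using that by (intro powr_mono) auto
      also have "\<dots> \<le> u powr b" using that by (intro powr_mono2') auto
      finally show ?thesis .
    qed
    have "norm (e1 x) \<le> 2 * norm (jacobi c (- 1 - c) x)" "norm (e2 x) \<le> 2 * norm (jacobi c (- 1 - c) x)" if x: "x \<in> {-1<..<1}" for x
    proof -
      have j: "norm (jacobi c (- 1 - c) x) = (1 - x) powr Re c * (1 + x) powr (- 1 - Re c)"
        using x by (subst norm_jacobi) auto
      have "(1 - x) powr Re c * (1 / 2) \<le> (1 - x) powr Re c * (1 + x) powr (- 1 - Re c)"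
        using x c by (intro mult_left_mono half) auto
      thus "norm (e1 x) \<le> 2 * norm (jacobi c (- 1 - c) x)" unfolding j n by simp
      have "(1 / 2) * (1 + x) powr (- 1 - Re c) \<le> (1 - x) powr Re c * (1 + x) powr (- 1 - Re c)"
        using x c by (intro mult_right_mono half) auto
      thus "norm (e2 x) \<le> 2 * norm (jacobi c (- 1 - c) x)" unfolding j n by simp
    qed
    hence "AE x in leb. norm (e1 x) \<le> 2 * norm (jacobi c (- 1 - c) x)" "AE x in leb. norm (e2 x) \<le> 2 * norm (jacobi c (- 1 - c) x)"
      by (intro AE_I2; simp)+
    thus "pw (- Re c) \<in> X \<and> pw (1 + Re c) \<in> X"
      using dominated_scaled_mem(1)[OF eL(1) jX, of 2] dominated_scaled_mem(1)[OF eL(2) jX, of 2] e by simp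
  next
    assume "pw (- Re c) \<in> X \<and> pw (1 + Re c) \<in> X"
    hence eX: "e1 \<in> X" "e2 \<in> X" using e by auto
    define g where "g x = of_real (2 powr \<bar>Re (- 1 - c)\<bar>) * e1 x + of_real (2 powr \<bar>Re c\<bar>) * e2 x" for x
    have gX: "g \<in> X" unfolding g_def[abs_def] by (intro add_mem scale_mem eX)
    have "norm (jacobi c (- 1 - c) x) \<le> norm (g x)" if x: "x \<in> {-1<..<1}" for x
    proof -
      have "norm (jacobi c (- 1 - c) x) \<le> 2 powr \<bar>Re (- 1 - c)\<bar> * (1 - x) powr Re c + 2 powr \<bar>Re c\<bar> * (1 + x) powr Re (- 1 - c)"
        using x by (intro jacobi_norm_le) auto
      also have "\<dots> = Re (g x)" by (simp add: g_def e1_def e2_def)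
      also have "\<dots> \<le> norm (g x)" by (rule complex_Re_le_cmod)
      finally show ?thesis .
    qed
    hence "AE x in leb. norm (jacobi c (- 1 - c) x) \<le> norm (g x)" by (intro AE_I2) simp
    thus "jacobi c (- 1 - c) \<in> X" by (rule dominated_mem(1)[OF jL gX])
  qed
  also have "\<dots> \<longleftrightarrow> pw (max (- Re c) (1 + Re c)) \<in> X"
    using pw_mono[of "max (- Re c) (1 + Re c)" "- Re c"] pw_mono[of "max (- Re c) (1 + Re c)" "1 + Re c"]
    by (auto simp: max_def)
  finally show ?thesis .
qed

text \<open>A Borel representative of f lies in some L^r with 1 < r < 2, which opens the Fourier
  argument. The explicit eigenfunction is then a multiple of f and belongs to X together with
  it.\<close>

lemma eigenvalue_forward:
  assumes up: "upper_boyd X nrm < 1" and f: "f \<in> X" "\<not> (AE x in leb. f x = 0)"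
    and eig: "AE x in leb. finite_hilbert f x = lam * f x"
  shows "lam \<noteq> 1" "lam \<noteq> -1" "(1 + lam) / (1 - lam) \<notin> \<real>\<^sub>\<le>\<^sub>0"
    and "jacobi (eigen_exponent lam) (- 1 - eigen_exponent lam) \<in> X"
proof -
  have fm: "f \<in> borel_measurable leb" using mem_L0[OF f(1)] by (simp add: L0_def)
  obtain f0 where f0: "f0 \<in> borel_measurable borel" "supp1 f0" "AE x in leb. f0 x = f x"
    by (rule borel_representative[OF fm])
  have f0L: "f0 \<in> L0" unfolding L0_def using f0(1) by (intro measurable_restrict_space1 measurable_completion) simp
  have f0X: "f0 \<in> X" by (rule dominated_mem(1)[OF f0L f(1)]) (use f0(3) in \<open>auto elim: eventually_mono\<close>)
  obtain p where p: "1 < p" "p \<le> 2" "\<And>f. f \<in> X \<Longrightarrow> \<exists>K\<ge>0. \<forall>s>0. distribution f s \<le> ennreal (K * s powr - p)"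
    by (rule weak_type[OF up]) blast
  obtain K where K: "K \<ge> 0" "\<And>s. s > 0 \<Longrightarrow> distribution f0 s \<le> ennreal (K * s powr - p)"
    using p(3)[OF f0X] by blast
  have int: "integrable lborel (\<lambda>x. norm (f0 x) powr q)" if q: "0 < q" "q < p" for q
  proof -
    have "integrable leb (\<lambda>x. norm (f0 x) powr q)" by (rule weak_type_integrable[OF f0L K q])
    thus ?thesis by (subst (asm) integrable_leb_iff) (use f0 in \<open>auto simp: supp1_def\<close>)
  qed
  have i1: "integrable lborel f0"
    using int[of 1] p(1) f0(1) by (subst integrable_norm_iff[symmetric]) auto
  \<comment> \<open>Strictly between 1 and p, hence admissible for the integrability, and below 2
    because p <= 2.\<close>
  define r where "r = (1 + p) / 2"
  have r: "1 < r" "r < 2" "integrable lborel (\<lambda>x. norm (f0 x) powr r)" using p by (auto simp: r_def intro!: int)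
  have rel: "(of_real (cosh (pi * s)) - lam * of_real (sinh (pi * s))) * jacobi_fourier f0 s = jacobi_fourier f0 0" for s
    by (rule eigen_fourier_relation[OF f0(3,2) fm i1 r eig])
  have nz: "\<not> (AE x in lborel. f0 x = 0)"
  proof
    assume "AE x in lborel. f0 x = 0"
    hence "AE x in leb. f0 x = 0" unfolding AE_leb_iff by eventually_elim simp
    hence "AE x in leb. f x = 0" using f0(3) by eventually_elim simp
    thus False using f(2) by simp
  qed
  show "lam \<noteq> 1" "lam \<noteq> -1" "(1 + lam) / (1 - lam) \<notin> \<real>\<^sub>\<le>\<^sub>0"
    using eigen_admissible[OF i1 f0(2) nz rel] by simp_all
  obtain k where k: "AE x in lborel. jacobi (eigen_exponent lam) (- 1 - eigen_exponent lam) x = k * f0 x"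
    by (rule eigenfunction_unique[OF i1 f0(2) nz rel])
  have "AE x in leb. jacobi (eigen_exponent lam) (- 1 - eigen_exponent lam) x = k * f0 x"
    unfolding AE_leb_iff using k by eventually_elim simp
  hence "AE x in leb. norm (jacobi (eigen_exponent lam) (- 1 - eigen_exponent lam) x) \<le> norm (k * f0 x)"
    by eventually_elim simp
  thus "jacobi (eigen_exponent lam) (- 1 - eigen_exponent lam) \<in> X"
    by (intro dominated_mem(1)[OF _ scale_mem[OF f0X, of k]]) (auto simp: L0_def intro: jacobi_in_L0)
qed

text \<open>The singular exponents of the eigenfunction are 1/2 - v and 1/2 + v with v = Arg w / (2
  pi); the larger one is 1/2 + |v|.\<close>

lemma point_spectrum_iff:
  assumes "upper_boyd X nrm < 1"
  shows "lam \<in> point_spectrum X finite_hilbert \<longleftrightarrow>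
    lam \<noteq> 1 \<and> lam \<noteq> -1 \<and> (1 + lam) / (1 - lam) \<notin> \<real>\<^sub>\<le>\<^sub>0 \<and> pw (1 / 2 + \<bar>Arg ((1 + lam) / (1 - lam))\<bar> / (2 * pi)) \<in> X"
proof -
  define w where "w = (1 + lam) / (1 - lam)"
  define c where "c = eigen_exponent lam"
  have m: "max (- Re c) (1 + Re c) = 1 / 2 + \<bar>Arg w\<bar> / (2 * pi)" if "lam \<noteq> 1" "lam \<noteq> -1" "w \<notin> \<real>\<^sub>\<le>\<^sub>0"
  proof -
    have "Re c = - 1 / 2 + Arg w / (2 * pi)" using eigen_exponent(1)[of lam] that by (simp add: w_def c_def)
    moreover have "max (1 / 2 - v) (1 / 2 + v) = 1 / 2 + \<bar>v\<bar>" for v :: real by (auto simp: max_def abs_if)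
    from this[of "Arg w / (2 * pi)"] have "max (1 / 2 - Arg w / (2 * pi)) (1 / 2 + Arg w / (2 * pi)) = 1 / 2 + \<bar>Arg w\<bar> / (2 * pi)"
      by (simp add: abs_divide)
    ultimately show ?thesis by simp
  qed
  show ?thesis unfolding w_def[symmetric]
  proof
    assume "lam \<in> point_spectrum X finite_hilbert"
    then obtain f where f: "f \<in> X" "\<not> (AE x in leb. f x = 0)" "AE x in leb. finite_hilbert f x = lam * f x"
      by (auto simp: point_spectrum_def)
    note fw = eigenvalue_forward[OF assms f, folded c_def w_def]
    note ce = eigen_exponent(2,3)[OF fw(1-2) fw(3)[unfolded w_def], folded c_def]
    show "lam \<noteq> 1 \<and> lam \<noteq> -1 \<and> w \<notin> \<real>\<^sub>\<le>\<^sub>0 \<and> pw (1 / 2 + \<bar>Arg w\<bar> / (2 * pi)) \<in> X"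
      using fw jacobi_mem_iff[OF ce] m[OF fw(1-3)] by simp
  next
    assume *: "lam \<noteq> 1 \<and> lam \<noteq> -1 \<and> w \<notin> \<real>\<^sub>\<le>\<^sub>0 \<and> pw (1 / 2 + \<bar>Arg w\<bar> / (2 * pi)) \<in> X"
    hence l: "lam \<noteq> 1" "lam \<noteq> -1" "(1 + lam) / (1 - lam) \<notin> \<real>\<^sub>\<le>\<^sub>0" by (auto simp: w_def)
    note ce = eigen_exponent(2-4)[OF l, folded c_def]
    have X: "jacobi c (- 1 - c) \<in> X" using * jacobi_mem_iff[OF ce(1,2)] m l by (simp add: w_def)
    have "\<not> (AE x in leb. jacobi c (- 1 - c) x = 0)"
    proof
      assume "AE x in leb. jacobi c (- 1 - c) x = 0"
      moreover have "AE x in leb. jacobi c (- 1 - c) x \<noteq> 0" by (rule AE_I2) (auto simp: jacobi_def abs_less_iff)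
      ultimately have "AE x in leb. False" by eventually_elim simp
      hence "emeasure leb (space leb) = 0" unfolding ae_filter_eq_bot_iff[symmetric] trivial_limit_def .
      thus False by (simp add: emeasure_restrict_space)
    qed
    moreover have "AE x in leb. finite_hilbert (jacobi c (- 1 - c)) x = lam * jacobi c (- 1 - c) x"
    proof (rule AE_I2)
      fix x assume "x \<in> space leb"
      hence "\<bar>x\<bar> < 1" by auto
      from jacobi_eigenfunction(2)[OF ce(1,2) this] ce(3)
      show "finite_hilbert (jacobi c (- 1 - c)) x = lam * jacobi c (- 1 - c) x" by simp
    qed
    ultimately show "lam \<in> point_spectrum X finite_hilbert" using X unfolding point_spectrum_def by blast
  qed
qed

end

section \<open>The interior of \<open>R_set\<close> and the classification\<close>

lemma Arg_nonpos_Reals: "w \<in> \<real>\<^sub>\<le>\<^sub>0 \<Longrightarrow> w \<noteq> 0 \<Longrightarrow> Arg w = pi"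
  by (auto simp: Arg_eq_pi complex_nonpos_Reals_iff complex_eq_iff)

text \<open>Off the cut the argument is continuous, so the strict inequality defines an open set.
  Conversely, 1 and -1 are limits of real points with negative quotient, whose argument pi is too
  large, and a point with equality is moved out of the set by enlarging the argument of w.\<close>

lemma interior_R_set:
  assumes p: "1 < p" "p < 2"
  shows "interior (R_set p) =
    {z. z \<noteq> 1 \<and> z \<noteq> -1 \<and> (1 + z) / (1 - z) \<notin> \<real>\<^sub>\<le>\<^sub>0 \<and> \<bar>Arg ((1 + z) / (1 - z))\<bar> / (2 * pi) < 1 / p - 1 / 2}" (is "_ = ?U")
proof (rule antisym)
  define d where "d = 1 / p - 1 / 2"
  have d: "0 < d" "d < 1 / 2" "\<bar>1 / 2 - 1 / p\<bar> = d" using p by (auto simp: d_def field_simps abs_if)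
  have R: "z \<in> R_set p \<longleftrightarrow> z = 1 \<or> z = -1 \<or> \<bar>Arg ((1 + z) / (1 - z))\<bar> / (2 * pi) \<le> d" for z
    by (auto simp: R_set_def d)
  have neg: "(1 + z) / (1 - z) \<notin> \<real>\<^sub>\<le>\<^sub>0" if "z \<in> R_set p" "z \<noteq> 1" "z \<noteq> -1" for z
  proof
    assume w: "(1 + z) / (1 - z) \<in> \<real>\<^sub>\<le>\<^sub>0"
    have "(1 + z) / (1 - z) \<noteq> 0" using that by (auto simp: add_eq_0_iff)
    from Arg_nonpos_Reals[OF w this] show False using that d by (simp add: R)
  qed
  define V where "V = {w. w \<notin> \<real>\<^sub>\<le>\<^sub>0 \<and> \<bar>Arg w\<bar> / (2 * pi) < d}"
  have "open ((- \<real>\<^sub>\<le>\<^sub>0) \<inter> (\<lambda>w. \<bar>Arg w\<bar> / (2 * pi)) -` {..<d})"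
    by (intro continuous_open_preimage continuous_intros continuous_on_Arg open_Compl closed_nonpos_Reals_complex open_lessThan) auto
  also have "(- \<real>\<^sub>\<le>\<^sub>0) \<inter> (\<lambda>w. \<bar>Arg w\<bar> / (2 * pi)) -` {..<d} = V" by (auto simp: V_def)
  finally have V: "open V" .
  have "open ((- {1}) \<inter> (\<lambda>z. (1 + z) / (1 - z)) -` V)"
    by (intro continuous_open_preimage continuous_intros V) auto
  also have "(- {1}) \<inter> (\<lambda>z. (1 + z) / (1 - z)) -` V = ?U" by (auto simp: V_def d_def)
  finally have "open ?U" .
  thus "?U \<subseteq> interior (R_set p)" by (rule interior_maximal[rotated]) (auto simp: R d_def)
  show "interior (R_set p) \<subseteq> ?U"
  proof
    fix z assume z: "z \<in> interior (R_set p)"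
    then obtain e where e: "e > 0" "ball z e \<subseteq> R_set p" by (auto simp: mem_interior)
    have zR: "z \<in> R_set p" using z interior_subset by blast
    have real_neg: False if "(1 + of_real x) / (1 - of_real x) = complex_of_real y" "y \<le> 0" "x \<noteq> 1" "x \<noteq> -1"
      "complex_of_real x \<in> ball z e" for x y
    proof -
      have "complex_of_real x \<noteq> 1" "complex_of_real x \<noteq> -1" using that(3,4) of_real_eq_iff[of x "-1", where ?'a = complex] by simp_all
      from neg[OF subsetD[OF e(2) that(5)] this] show False unfolding that(1) using that(2) by simp
    qed
    \<comment> \<open>Real points just beyond 1 have a negative quotient, hence argument pi, and
      leave \<open>R_set p\<close> because d < 1/2.\<close>
    have z1: "z \<noteq> 1"
    proof
      assume z: "z = 1"
      have "1 + complex_of_real (1 + e / 2) = of_real (2 + e / 2)" "1 - complex_of_real (1 + e / 2) = of_real (- (e / 2))"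
        by simp_all
      hence q: "(1 + complex_of_real (1 + e / 2)) / (1 - of_real (1 + e / 2)) = of_real ((2 + e / 2) / (- (e / 2)))"
        by (simp only: of_real_divide)
      have n: "(2 + e / 2) / (- (e / 2)) \<le> 0" using e(1) by (intro divide_nonneg_neg) auto
      have "complex_of_real (1 + e / 2) \<in> ball z e" using e(1) by (simp add: z dist_norm)
      from real_neg[OF q n _ _ this] show False using e(1) by simp
    qed
    have z2: "z \<noteq> -1"
    proof
      assume z: "z = -1"
      have "1 + complex_of_real (- 1 - e / 2) = of_real (- (e / 2))" "1 - complex_of_real (- 1 - e / 2) = of_real (2 + e / 2)"
        by simp_all
      hence q: "(1 + complex_of_real (- 1 - e / 2)) / (1 - of_real (- 1 - e / 2)) = of_real ((- (e / 2)) / (2 + e / 2))"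
        by (simp only: of_real_divide)
      have n: "(- (e / 2)) / (2 + e / 2) \<le> 0" using e(1) by (intro divide_nonpos_pos) auto
      have "complex_of_real (- 1 - e / 2) \<in> ball z e" using e(1) by (simp add: z dist_norm)
      from real_neg[OF q n _ _ this] show False using e(1) by simp
    qed
    define w where "w = (1 + z) / (1 - z)"
    have w0: "w \<noteq> 0" using z1 z2 by (auto simp: w_def add_eq_0_iff)
    have wn: "w \<notin> \<real>\<^sub>\<le>\<^sub>0" unfolding w_def by (rule neg[OF zR z1 z2])
    have w1: "w \<noteq> -1" using wn by auto
    have le: "\<bar>Arg w\<bar> / (2 * pi) \<le> d" using zR z1 z2 by (simp add: R w_def)
    have "\<bar>Arg w\<bar> / (2 * pi) \<noteq> d"
    proof
      assume eq: "\<bar>Arg w\<bar> / (2 * pi) = d"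
      \<comment> \<open>The curve w^(1+s) passes through w at s = 0 and stretches its argument by 1
        + s; the next line transports it back to the z-plane by the inverse Moebius map.\<close>
      define u where "u s = exp (of_real (1 + s) * Ln w)" for s :: real
      define \<zeta> where "\<zeta> s = (u s - 1) / (u s + 1)" for s
      have u0: "u 0 = w" using w0 by (simp add: u_def)
      have "1 - z \<noteq> 0" using z1 by simp
      hence "w - 1 = 2 * z / (1 - z)" "w + 1 = 2 / (1 - z)" by (simp_all add: w_def field_simps)
      hence \<zeta>0: "\<zeta> 0 = z" using \<open>1 - z \<noteq> 0\<close> by (simp add: \<zeta>_def u0)
      have "isCont u 0" unfolding u_def by (intro continuous_intros)
      hence "isCont \<zeta> 0" unfolding \<zeta>_def using w1 u0 by (intro continuous_intros) (auto simp: add_eq_0_iff2)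
      hence "(\<zeta> \<longlongrightarrow> z) (at 0)" by (simp only: isCont_def \<zeta>0)
      hence "(\<zeta> \<longlongrightarrow> z) (at_right 0)" by (rule filterlim_mono[OF _ order_refl at_le]) simp
      hence "eventually (\<lambda>s. \<zeta> s \<in> ball z e) (at_right 0)"
        using e(1) by (intro topological_tendstoD) auto
      \<comment> \<open>This range keeps (1 + s) times the argument below pi, so the stretched value
        is still the principal argument.\<close>
      moreover have "eventually (\<lambda>s. s \<in> {0<..<1 / (2 * d) - 1}) (at_right 0)"
        using d by (intro eventually_at_right_real) (simp add: field_simps)
      ultimately have ev: "eventually (\<lambda>s. \<zeta> s \<in> ball z e \<and> s \<in> {0<..<1 / (2 * d) - 1}) (at_right 0)"
        by (rule eventually_conj)
      then obtain s where s: "\<zeta> s \<in> R_set p" "0 < s" "s < 1 / (2 * d) - 1"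
      proof -
        from eventually_happens'[OF trivial_limit_at_right_real ev]
        obtain s where "\<zeta> s \<in> ball z e" "s \<in> {0<..<1 / (2 * d) - 1}" by blast
        thus ?thesis using subsetD[OF e(2), of "\<zeta> s"] by (intro that[of s]) simp_all
      qed
      have A: "Arg w = Im (Ln w)" using w0 by (simp add: Arg_eq_Im_Ln)
      have Aw: "\<bar>Im (Ln w)\<bar> = 2 * pi * d" using eq by (simp add: A field_simps)
      have As: "\<bar>(1 + s) * Im (Ln w)\<bar> = (1 + s) * (2 * pi * d)" using s by (simp add: abs_mult Aw)
      also have "\<dots> < (1 / (2 * d)) * (2 * pi * d)" using s d by (intro mult_strict_right_mono) auto
      also have "\<dots> = pi" using d by simp
      finally have "\<bar>(1 + s) * Im (Ln w)\<bar> < pi" .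
      hence L: "Ln (u s) = of_real (1 + s) * Ln w" unfolding u_def by (intro Ln_exp) auto
      have us0: "u s \<noteq> 0" by (simp add: u_def)
      have Au: "Arg (u s) = (1 + s) * Im (Ln w)" using us0 L by (simp add: Arg_eq_Im_Ln)
      have "u s \<noteq> -1" using Au \<open>\<bar>(1 + s) * Im (Ln w)\<bar> < pi\<close> Arg_nonpos_Reals[of "-1"] by auto
      hence "u s + 1 \<noteq> 0" by (simp add: add_eq_0_iff2)
      hence a: "1 + \<zeta> s = 2 * u s / (u s + 1)" "1 - \<zeta> s = 2 / (u s + 1)" by (simp_all add: \<zeta>_def field_simps)
      have "\<zeta> s \<noteq> 1" "\<zeta> s \<noteq> -1" "(1 + \<zeta> s) / (1 - \<zeta> s) = u s" using a us0 \<open>u s + 1 \<noteq> 0\<close> by auto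
      hence "\<bar>Arg (u s)\<bar> / (2 * pi) \<le> d" using s(1) by (simp add: R)
      moreover have "\<bar>Arg (u s)\<bar> / (2 * pi) = d + s * d"
        unfolding Au As by (simp add: field_simps)
      moreover have "s * d > 0" using s(2) d(1) by simp
      ultimately show False by linarith
    qed
    thus "z \<in> ?U" using z1 z2 wn le by (simp add: w_def d_def)
  qed
qed

theorem proposition3p3:
  fixes X :: "(real \<Rightarrow> complex) set"
    and nrm :: "(real \<Rightarrow> complex) \<Rightarrow> real"
  assumes "ri_space X nrm"
    and "0 < lower_boyd X nrm"
    and "lower_boyd X nrm \<le> upper_boyd X nrm"
    and "upper_boyd X nrm < 1"
  shows "(p_index X > 2 \<or> (p_index X = 2 \<and> \<not> p_index_attained X) \<longrightarrow>
            point_spectrum X finite_hilbert = {}) \<and>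
         (p_index X \<le> 2 \<and> p_index_attained X \<longrightarrow>
            point_spectrum X finite_hilbert = R_set (p_index X) - {1, -1}) \<and>
         (p_index X < 2 \<and> \<not> p_index_attained X \<longrightarrow>
            point_spectrum X finite_hilbert = interior (R_set (p_index X)))"
proof -
  interpret ri_space X nrm by (rule assms(1))
  define p where "p = p_index X"
  note idx = p_index_pw[OF assms(2,4), folded p_def]
  define \<theta> where "\<theta> z = \<bar>Arg ((1 + z) / (1 - z))\<bar> / (2 * pi)" for z
  have \<theta>: "0 \<le> \<theta> z" "\<theta> z \<le> 1 / 2" for z
  proof -
    have "\<bar>Arg ((1 + z) / (1 - z))\<bar> \<le> pi"
      using mpi_less_Arg[of "(1 + z) / (1 - z)"] Arg_le_pi[of "(1 + z) / (1 - z)"] by linarith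
    thus "0 \<le> \<theta> z" "\<theta> z \<le> 1 / 2" by (simp_all add: \<theta>_def field_simps)
  qed
  have half: "\<theta> z = 1 / 2" if "z \<noteq> 1" "z \<noteq> -1" "(1 + z) / (1 - z) \<in> \<real>\<^sub>\<le>\<^sub>0" for z
  proof -
    have "(1 + z) / (1 - z) \<noteq> 0" using that by (auto simp: add_eq_0_iff)
    from Arg_nonpos_Reals[OF that(3) this] show ?thesis by (simp add: \<theta>_def)
  qed
  have lt: "\<theta> z < 1 / 2" if "(1 + z) / (1 - z) \<notin> \<real>\<^sub>\<le>\<^sub>0" for z
  proof -
    have "(1 + z) / (1 - z) \<noteq> 0" using that by auto
    hence "Arg ((1 + z) / (1 - z)) \<noteq> pi" using that by (auto simp: Arg_eq_pi complex_nonpos_Reals_iff)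
    hence "\<bar>Arg ((1 + z) / (1 - z))\<bar> < pi" using mpi_less_Arg[of "(1 + z) / (1 - z)"] Arg_le_pi[of "(1 + z) / (1 - z)"] by linarith
    thus ?thesis by (simp add: \<theta>_def field_simps)
  qed
  have spec: "z \<in> point_spectrum X finite_hilbert \<longleftrightarrow> z \<noteq> 1 \<and> z \<noteq> -1 \<and> (1 + z) / (1 - z) \<notin> \<real>\<^sub>\<le>\<^sub>0 \<and>
      (1 / 2 + \<theta> z < 1 / p \<or> (1 / 2 + \<theta> z = 1 / p \<and> p_index_attained X))" for z
    unfolding point_spectrum_iff[OF assms(4)] \<theta>_def[symmetric]
  proof (intro conj_cong refl)
    \<comment> \<open>Off the cut the angle is strictly below 1/2, so 1/2 + theta lies in (0,1),
      where \<open>idx\<close> decides membership.\<close>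
    assume "(1 + z) / (1 - z) \<notin> \<real>\<^sub>\<le>\<^sub>0"
    thus "pw (1 / 2 + \<theta> z) \<in> X \<longleftrightarrow> 1 / 2 + \<theta> z < 1 / p \<or> (1 / 2 + \<theta> z = 1 / p \<and> p_index_attained X)"
      using \<theta>(1)[of z] lt[of z] by (intro idx(3)) auto
  qed
  show ?thesis unfolding p_def[symmetric]
  proof (intro conjI impI)
    assume h: "p > 2 \<or> (p = 2 \<and> \<not> p_index_attained X)"
    have "z \<notin> point_spectrum X finite_hilbert" for z
    proof
      assume "z \<in> point_spectrum X finite_hilbert"
      hence z: "1 / 2 + \<theta> z < 1 / p \<or> (1 / 2 + \<theta> z = 1 / p \<and> p_index_attained X)" by (simp only: spec)
      show False
      proof (cases "p > 2")
        case True
        hence "1 / p < 1 / 2" by (simp add: field_simps)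
        thus False using z \<theta>(1)[of z] by linarith
      next
        case False
        hence "p = 2" "\<not> p_index_attained X" using h by auto
        thus False using z \<theta>(1)[of z] by simp
      qed
    qed
    thus "point_spectrum X finite_hilbert = {}" by blast
  next
    assume h: "p \<le> 2 \<and> p_index_attained X"
    have d: "\<bar>1 / 2 - 1 / p\<bar> = 1 / p - 1 / 2" "1 / p < 1" using h idx(1) by (auto simp: field_simps abs_if)
    have "z \<in> point_spectrum X finite_hilbert \<longleftrightarrow> z \<in> R_set p - {1, -1}" for z
    proof -
      have "z \<in> R_set p - {1, -1} \<longleftrightarrow> z \<noteq> 1 \<and> z \<noteq> -1 \<and> \<theta> z \<le> 1 / p - 1 / 2"
        unfolding R_set_def d \<theta>_def by simp blast
      \<comment> \<open>A quotient on the cut has angle 1/2, which is excluded here because 1/p <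
        1.\<close>
      moreover have "(1 + z) / (1 - z) \<notin> \<real>\<^sub>\<le>\<^sub>0" if "z \<noteq> 1" "z \<noteq> -1" "\<theta> z \<le> 1 / p - 1 / 2"
        using half[OF that(1,2)] that(3) d(2) by auto
      moreover have "1 / 2 + \<theta> z < 1 / p \<or> 1 / 2 + \<theta> z = 1 / p \<longleftrightarrow> \<theta> z \<le> 1 / p - 1 / 2" by linarith
      ultimately show ?thesis unfolding spec using h by blast
    qed
    thus "point_spectrum X finite_hilbert = R_set p - {1, -1}" by blast
  next
    assume h: "p < 2 \<and> \<not> p_index_attained X"
    have "z \<in> point_spectrum X finite_hilbert \<longleftrightarrow> z \<in> interior (R_set p)" for z
    proof -
      have "z \<in> interior (R_set p) \<longleftrightarrow> z \<noteq> 1 \<and> z \<noteq> -1 \<and> (1 + z) / (1 - z) \<notin> \<real>\<^sub>\<le>\<^sub>0 \<and> \<theta> z < 1 / p - 1 / 2"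
        using interior_R_set[of p] idx(1) h unfolding \<theta>_def by blast
      moreover have "1 / 2 + \<theta> z < 1 / p \<longleftrightarrow> \<theta> z < 1 / p - 1 / 2" by linarith
      ultimately show ?thesis unfolding spec using h by blast
    qed
    thus "point_spectrum X finite_hilbert = interior (R_set p)" by blast
  qed
qed

end
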